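(* Let $\mathbb{K}$ be an algebraically closed field of characteristic $0$, let $A=(a_{ij})_{i,j\in I}$ be a symmetrizable generalized Cartan matrix with relatively prime positive integers $d_i$ such that $d_ia_{ij}=d_ja_{ji}$, and let $\mathbf q=(q_{ij})_{i,j\in I}$ be a matrix of parameters in $\mathbb K^\times$ with $q_{ij}q_{ji}=q_{ii}^{a_{ij}}$ for all $i,j\in I$. Let $\hat{\mathbf q}=(\hat q_{ij})_{i,j\in I}$ be another matrix over $\mathbb K$ satisfying $$\hat q_{ii}=q_{ii},\qquad \hat q_{ij}\hat q_{ji}=q_{ij}q_{ji}\qquad\text{for all } i,j\in I.$$ Let $\Gamma\cong\mathbb Z^{2|I|}$ be the free abelian group generated by the group-like elements $\omega_i,\omega_i'$ ($i\in I$) of $U_{\mathbf q}(\mathfrak g_A)$, and fix any group bicharacter $\sigma:\Gamma\times\Gamma\to\mathbb K^\times$ with $$\sigma(\omega_i,\omega_j)\sigma^{-1}(\omega_j,\omega_i)=\hat q_{ij}q_{ij}^{-1},\quad \sigma(\omega_i',\omega_j')\sigma^{-1}(\omega_j',\omega_i')=\hat q_{ij}q_{ij}^{-1},\quad \sigma(\omega_i',\omega_j)\sigma^{-1}(\omega_j,\omega_i')=\hat q_{ji}^{-1}q_{ji}$$ for all $i,j\in I$. Inflate $\sigma$ to a bilinear form on $U_{\mathbf q}(\mathfrak g_A)$, still denoted $\sigma$, by extending it bilinearly to $U_{\mathbf q}(0)=\mathbb K\Gamma$ and setting it equal to $0$ on the other homogeneous basis elements, outside $U_{\mathbf q}(0)$;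 this inflation is a Hopf $2$-cocycle of $U_{\mathbf q}(\mathfrak g_A)$. Then there is an isomorphism of Hopf algebras $$U_{\hat{\mathbf q}}(\mathfrak g_A)\cong U_{\mathbf q}(\mathfrak g_A)^\sigma,$$ where $U_{\mathbf q}(\mathfrak g_A)^\sigma$ is the Hopf $2$-cocycle deformation of $U_{\mathbf q}(\mathfrak g_A)$ by $\sigma$. In particular, if there exists $q\in\mathbb K^\times$ with $q_{ii}=q^{2d_i}$ for all $i\in I$, then one can take $\hat q_{ij}=q^{d_ia_{ij}}$ for all $i,j\in I$, and $U_{\mathbf q}(\mathfrak g_A)^\sigma$ is then isomorphic to the one-parameter quantum group $U_{q,q^{-1}}(\mathfrak g_A)$ (an isomorphism which was previously known with another, different Hopf $2$-cocycle).
   Context: **Multi-parameter quantum group.** $I$ is the index set of $A$; the parameters satisfy $q_{ij}\in\mathbb K^\times$, $q_{ij}q_{ji}=q_{ii}^{a_{ij}}$, $q_{ii}\ne1$. Put $(n)_v=\frac{v^n-1}{v-1}$, $(n)_v!=(n)_v\cdots(1)_v$, $(0)_v!=1$, $\binom nk_v=\frac{(n)_v!}{(k)_v!(n-k)_v!}$ (an element of $\mathbb Z[v,v^{-1}]$). $U_{\mathbf q}=U_{\mathbf q}(\mathfrak g_A)$ is the unital $\mathbb K$-algebra generated by $e_i,f_i,\omega_i^{\pm1},\omega_i'^{\pm1}$ ($i\in I$) with relations: - all $\omega_i^{\pm1},\omega_j'^{\pm1}$ commute, $\omega_i\omega_i^{-1}=\omega_i'\omega_i'^{-1}=1$; - $\omega_ie_j\omega_i^{-1}=q_{ij}e_j$,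 $\omega_i'e_j\omega_i'^{-1}=q_{ji}^{-1}e_j$, $\omega_if_j\omega_i^{-1}=q_{ij}^{-1}f_j$, $\omega_i'f_j\omega_i'^{-1}=q_{ji}f_j$; - $e_if_j-f_je_i=\delta_{ij}\frac{q_{ii}}{q_{ii}-1}(\omega_i-\omega_i')$; - for $i\ne j$: $\sum_{k=0}^{1-a_{ij}}(-1)^k\binom{1-a_{ij}}k_{q_{ii}}q_{ii}^{k(k-1)/2}q_{ij}^ke_i^{1-a_{ij}-k}e_je_i^k=0$ and $\sum_{k=0}^{1-a_{ij}}(-1)^k\binom{1-a_{ij}}k_{q_{ii}}q_{ii}^{k(k-1)/2}q_{ij}^kf_i^kf_jf_i^{1-a_{ij}-k}=0$. It is a Hopf algebra with $\omega_i^{\pm1},\omega_i'^{\pm1}$ group-like, $\Delta(e_i)=e_i\otimes1+\omega_i\otimes e_i$, $\Delta(f_i)=1\otimes f_i+f_i\otimes\omega_i'$, $\varepsilon(e_i)=\varepsilon(f_i)=0$, $S(e_i)=-\omega_i^{-1}e_i$, $S(f_i)=-f_i\omega_i'^{-1}$. $U_{\hat{\mathbf q}}(\mathfrak g_A)$ is defined in the same way with $\hat q_{ij}$ in place of $q_{ij}$. $U_{q,q^{-1}}(\mathfrak g_A)$ denotes the multi-parameter quantum group with parameters $q^{d_ia_{ij}}$, $i,j\in I$. **Grading.** Let $U_{\mathbf q}^{\ge0}$ (resp. $U_{\mathbf q}^{\le0}$) be the subalgebra generated by $e_i,\omega_i^{\pm1}$ (resp. $f_i,\omega_i'^{\pm1}$),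 graded by $\deg e_i=\alpha_i$, $\deg f_i=-\alpha_i$, $\deg\omega_i=\deg\omega_i'=0$ (with $\alpha_i$ the simple roots), and let $\mathrm{ht}(\sum m_i\alpha_i)=\sum m_i$. As a coalgebra, $U_{\mathbf q}=\bigoplus_{k\ge0}U_{\mathbf q}(k)$ is graded with $U_{\mathbf q}(k)=\bigoplus(U_{\mathbf q}^{\le0})_{-\alpha}(U_{\mathbf q}^{\ge0})_{\beta}$, the sum over $\alpha,\beta\in\bigoplus_i\mathbb Z_{\ge0}\alpha_i$ with $\mathrm{ht}(\alpha)+\mathrm{ht}(\beta)=k$; $U_{\mathbf q}(0)$ is the subalgebra generated by all $\omega_i^{\pm1},\omega_i'^{\pm1}$. **Cocycle deformation.** A Hopf $2$-cocycle on a Hopf algebra $B$ is a convolution-invertible bilinear form $\sigma:B\otimes B\to\mathbb K$ with $\sigma(a_{(1)},b_{(1)})\sigma(a_{(2)}b_{(2)},c)=\sigma(b_{(1)},c_{(1)})\sigma(a,b_{(2)}c_{(2)})$ and $\sigma(a,1)=\sigma(1,a)=\varepsilon(a)$. $B^\sigma$ is the Hopf algebra with the same coalgebra structure as $B$ and multiplication $a\diamond b=\sigma(a_{(1)},b_{(1)})\,a_{(2)}b_{(2)}\,\sigma^{-1}(a_{(3)},b_{(3)})$, where $\sigma^{-1}$ is the convolution inverse.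
   Formalization: The inflation of an arbitrary such σ need not be a Hopf 2-cocycle; it is proved to be one exactly when σ takes equal values on ω_i and ω_i' in each argument, the isomorphisms are proved for all those σ, and such σ are shown to exist. The historical remark is left out. *)

theory Defs
  imports
    "HOL-Algebra.Algebra"
    "HOL-Computational_Algebra.Computational_Algebra"
begin

section \<open>Algebras over a field\<close>

text \<open>
  The ground field is a type of class \<^class>\<open>field\<close>; algebras and Hopf algebras are carrier-based
  records extending the module records of HOL-Algebra.  The following record lets the
  ground field act as the ring of scalars of a HOL-Algebra module.
\<close>

definition field_alg :: "('k::field, 'k) module" where
  "field_alg = \<lparr>carrier = UNIV, monoid.mult = (*), one = 1, ring.zero = 0, ring.add = (+), module.smult = (*)\<rparr>"

locale assoc_algebra = ring H + module field_alg H
  for H :: "('k::field, 'a, 'm) module_scheme" (structure) +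
  assumes smult_mult_left:
      "\<lbrakk>x \<in> carrier H; y \<in> carrier H\<rbrakk> \<Longrightarrow> (c \<odot> x) \<otimes> y = c \<odot> (x \<otimes> y)"
    and smult_mult_right:
      "\<lbrakk>x \<in> carrier H; y \<in> carrier H\<rbrakk> \<Longrightarrow> x \<otimes> (c \<odot> y) = c \<odot> (x \<otimes> y)"

definition opposite_alg :: "('k, 'a, 'm) module_scheme \<Rightarrow> ('k, 'a, 'm) module_scheme" where
  "opposite_alg H = H\<lparr>monoid.mult := (\<lambda>x y. y \<otimes>\<^bsub>H\<^esub> x)\<rparr>"

definition mspan :: "('k::field, 'a, 'm) module_scheme \<Rightarrow> 'a set \<Rightarrow> 'a set" where
  "mspan H S = \<Inter>{N. submodule N field_alg H \<and> S \<subseteq> N}"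

text \<open>The monoid algebra of \<open>G\<close>: formal finite linear combinations of elements of \<open>G\<close>.\<close>

definition monoid_alg :: "'g monoid \<Rightarrow> ('k::field, 'g \<Rightarrow>\<^sub>0 'k) module" where
  "monoid_alg G =
    \<lparr>carrier = {r. Poly_Mapping.keys r \<subseteq> carrier G},
     monoid.mult = (\<lambda>r s. \<Sum>x\<in>Poly_Mapping.keys r. \<Sum>y\<in>Poly_Mapping.keys s.
        Poly_Mapping.single (x \<otimes>\<^bsub>G\<^esub> y) (Poly_Mapping.lookup r x * Poly_Mapping.lookup s y)),
     one = Poly_Mapping.single \<one>\<^bsub>G\<^esub> 1,
     ring.zero = 0, ring.add = (+),
     module.smult = (\<lambda>c. Poly_Mapping.map ((*) c))\<rparr>"

definition linear_ext ::
    "('k::field, 'b, 'm) module_scheme \<Rightarrow> ('g \<Rightarrow> 'b) \<Rightarrow> ('g \<Rightarrow>\<^sub>0 'k) \<Rightarrow> 'b" where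
  "linear_ext M f r =
    (\<Oplus>\<^bsub>M\<^esub>x\<in>Poly_Mapping.keys r. Poly_Mapping.lookup r x \<odot>\<^bsub>M\<^esub> f x)"

text \<open>The quotient of an algebra by an ideal stable under scalars; its elements are cosets.\<close>

definition alg_quot :: "('k::field, 'a, 'm) module_scheme \<Rightarrow> 'a set \<Rightarrow> ('k, 'a set) module" where
  "alg_quot A N =
    \<lparr>carrier = carrier (A Quot N), monoid.mult = monoid.mult (A Quot N), one = one (A Quot N),
     ring.zero = ring.zero (A Quot N), ring.add = ring.add (A Quot N),
     module.smult = (\<lambda>c C. \<Union>x\<in>C. N +>\<^bsub>A\<^esub> (c \<odot>\<^bsub>A\<^esub> x))\<rparr>"

text \<open>The map induced on cosets by a map which is constant on each coset.\<close>

definition induced :: "('a \<Rightarrow> 'b) \<Rightarrow> 'a set \<Rightarrow> 'b" where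
  "induced f C = the_elem (f ` C)"

definition free_alg :: "('k::field, 'g list \<Rightarrow>\<^sub>0 'k) module" where
  "free_alg = monoid_alg \<lparr>carrier = UNIV, monoid.mult = (@), one = []\<rparr>"

text \<open>The algebra morphism from the free algebra to \<open>M\<close> extending \<open>g\<close>.\<close>

definition free_ext ::
    "('k::field, 'b, 'm) module_scheme \<Rightarrow> ('g \<Rightarrow> 'b) \<Rightarrow> ('g list \<Rightarrow>\<^sub>0 'k) \<Rightarrow> 'b" where
  "free_ext M g = linear_ext M (\<lambda>w. foldr (\<lambda>x y. g x \<otimes>\<^bsub>M\<^esub> y) w \<one>\<^bsub>M\<^esub>)"

section \<open>Tensor powers\<close>

text \<open>
  The tensor power \<open>H \<otimes> \<dots> \<otimes> H\<close> (\<open>n\<close> factors), with componentwise multiplication: formal linear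
  combinations of \<open>n\<close>-tuples (lists of length \<open>n\<close>) modulo the span of the multilinearity
  relations.  All tensor powers live in one type, so that no associativity isomorphisms occur.
\<close>

definition tuple_monoid :: "('k, 'a, 'm) module_scheme \<Rightarrow> nat \<Rightarrow> 'a list monoid" where
  "tuple_monoid H n =
    \<lparr>carrier = {xs. length xs = n \<and> set xs \<subseteq> carrier H},
     monoid.mult = map2 (\<lambda>x y. x \<otimes>\<^bsub>H\<^esub> y), one = replicate n \<one>\<^bsub>H\<^esub>\<rparr>"

definition multilinear_rels ::
    "('k::field, 'a, 'm) module_scheme \<Rightarrow> nat \<Rightarrow> ('a list \<Rightarrow>\<^sub>0 'k) set" where
  "multilinear_rels H n =
    {Poly_Mapping.single (xs @ (x \<oplus>\<^bsub>H\<^esub> y) # ys) 1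
       - Poly_Mapping.single (xs @ x # ys) 1 - Poly_Mapping.single (xs @ y # ys) 1 | xs x y ys.
       length xs + length ys + 1 = n \<and> set xs \<union> set ys \<union> {x, y} \<subseteq> carrier H} \<union>
    {Poly_Mapping.single (xs @ (c \<odot>\<^bsub>H\<^esub> x) # ys) 1 - Poly_Mapping.single (xs @ x # ys) c | xs c x ys.
       length xs + length ys + 1 = n \<and> set xs \<union> set ys \<union> {x} \<subseteq> carrier H}"

definition multilinear_ideal ::
    "('k::field, 'a, 'm) module_scheme \<Rightarrow> nat \<Rightarrow> ('a list \<Rightarrow>\<^sub>0 'k) set" where
  "multilinear_ideal H n = mspan (monoid_alg (tuple_monoid H n)) (multilinear_rels H n)"

definition tensor_power ::
    "('k::field, 'a, 'm) module_scheme \<Rightarrow> nat \<Rightarrow> ('k, ('a list \<Rightarrow>\<^sub>0 'k) set) module" where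
  "tensor_power H n = alg_quot (monoid_alg (tuple_monoid H n)) (multilinear_ideal H n)"

definition pure_tensor ::
    "('k::field, 'a, 'm) module_scheme \<Rightarrow> 'a list \<Rightarrow> ('a list \<Rightarrow>\<^sub>0 'k) set" where
  "pure_tensor H xs = multilinear_ideal H (length xs)
     +>\<^bsub>monoid_alg (tuple_monoid H (length xs))\<^esub> Poly_Mapping.single xs 1"

text \<open>The linear map on a tensor power induced by a multilinear map \<open>f\<close>.\<close>

definition tensor_lift ::
    "('k::field, 'b, 'm) module_scheme \<Rightarrow> ('a list \<Rightarrow> 'b) \<Rightarrow> ('a list \<Rightarrow>\<^sub>0 'k) set \<Rightarrow> 'b" where
  "tensor_lift M f = induced (linear_ext M f)"

section \<open>Hopf algebras\<close>

record (overloaded) ('k::zero, 'a) hopf = "('k, 'a) module" +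
  comult :: "'a \<Rightarrow> ('a list \<Rightarrow>\<^sub>0 'k) set"
  counit :: "'a \<Rightarrow> 'k"
  antipode :: "'a \<Rightarrow> 'a"

text \<open>
  Sweedler sums with values in \<open>M\<close>: \<open>sweedler H M f a\<close> is the sum of \<open>f a\<^sub>(\<^sub>1\<^sub>) a\<^sub>(\<^sub>2\<^sub>)\<close>, and
  \<open>sweedler3 H M f a\<close> is the sum of \<open>f a\<^sub>(\<^sub>1\<^sub>) a\<^sub>(\<^sub>2\<^sub>) a\<^sub>(\<^sub>3\<^sub>)\<close>, for multilinear \<open>f\<close>.
\<close>

definition sweedler :: "('k::field, 'a, 'm) hopf_scheme \<Rightarrow> ('k, 'b, 'n) module_scheme \<Rightarrow>
    ('a \<Rightarrow> 'a \<Rightarrow> 'b) \<Rightarrow> 'a \<Rightarrow> 'b" where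
  "sweedler H M f a = tensor_lift M (\<lambda>xs. f (xs ! 0) (xs ! 1)) (comult H a)"

definition sweedler3 :: "('k::field, 'a, 'm) hopf_scheme \<Rightarrow> ('k, 'b, 'n) module_scheme \<Rightarrow>
    ('a \<Rightarrow> 'a \<Rightarrow> 'a \<Rightarrow> 'b) \<Rightarrow> 'a \<Rightarrow> 'b" where
  "sweedler3 H M f a = sweedler H M (\<lambda>x a3. sweedler H M (\<lambda>a1 a2. f a1 a2 a3) x) a"

definition is_antipode :: "('k::field, 'a, 'm) hopf_scheme \<Rightarrow> ('a \<Rightarrow> 'a) \<Rightarrow> bool" where
  "is_antipode H S \<longleftrightarrow>
    S \<in> carrier H \<rightarrow> carrier H \<and>
    (\<forall>x\<in>carrier H. \<forall>y\<in>carrier H. S (x \<oplus>\<^bsub>H\<^esub> y) = S x \<oplus>\<^bsub>H\<^esub> S y) \<and>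
    (\<forall>c. \<forall>x\<in>carrier H. S (c \<odot>\<^bsub>H\<^esub> x) = c \<odot>\<^bsub>H\<^esub> S x) \<and>
    (\<forall>a\<in>carrier H. sweedler H H (\<lambda>x y. S x \<otimes>\<^bsub>H\<^esub> y) a = counit H a \<odot>\<^bsub>H\<^esub> \<one>\<^bsub>H\<^esub>) \<and>
    (\<forall>a\<in>carrier H. sweedler H H (\<lambda>x y. x \<otimes>\<^bsub>H\<^esub> S y) a = counit H a \<odot>\<^bsub>H\<^esub> \<one>\<^bsub>H\<^esub>)"

locale hopf_algebra = assoc_algebra H
  for H :: "('k::field, 'a, 'm) hopf_scheme" (structure) +
  assumes comult_ring_hom: "comult H \<in> ring_hom H (tensor_power H 2)"
    and comult_smult: "x \<in> carrier H \<Longrightarrow> comult H (c \<odot> x) = c \<odot>\<^bsub>tensor_power H 2\<^esub> comult H x"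
    and counit_ring_hom: "counit H \<in> ring_hom H field_alg"
    and counit_smult: "x \<in> carrier H \<Longrightarrow> counit H (c \<odot> x) = c * counit H x"
    and coassoc: "a \<in> carrier H \<Longrightarrow>
      sweedler H (tensor_power H 3)
        (\<lambda>x y. sweedler H (tensor_power H 3) (\<lambda>x1 x2. pure_tensor H [x1, x2, y]) x) a =
      sweedler H (tensor_power H 3)
        (\<lambda>x y. sweedler H (tensor_power H 3) (\<lambda>y1 y2. pure_tensor H [x, y1, y2]) y) a"
    and counit_left: "a \<in> carrier H \<Longrightarrow> sweedler H H (\<lambda>x y. counit H x \<odot> y) a = a"
    and counit_right: "a \<in> carrier H \<Longrightarrow> sweedler H H (\<lambda>x y. counit H y \<odot> x) a = a"
    and antipode: "is_antipode H (antipode H)"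

definition hopf_iso :: "('k::field, 'a, 'm) hopf_scheme \<Rightarrow> ('k, 'b, 'n) hopf_scheme \<Rightarrow> ('a \<Rightarrow> 'b) set" where
  "hopf_iso H G = {\<phi>. \<phi> \<in> ring_iso H G \<and>
    (\<forall>c. \<forall>x\<in>carrier H. \<phi> (c \<odot>\<^bsub>H\<^esub> x) = c \<odot>\<^bsub>G\<^esub> \<phi> x) \<and>
    (\<forall>x\<in>carrier H. comult G (\<phi> x) =
        sweedler H (tensor_power G 2) (\<lambda>x1 x2. pure_tensor G [\<phi> x1, \<phi> x2]) x) \<and>
    (\<forall>x\<in>carrier H. counit G (\<phi> x) = counit H x) \<and>
    (\<forall>x\<in>carrier H. antipode G (\<phi> x) = \<phi> (antipode H x))}"

definition hopf_isomorphic :: "('k::field, 'a, 'm) hopf_scheme \<Rightarrow> ('k, 'b, 'n) hopf_scheme \<Rightarrow> bool" where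
  "hopf_isomorphic H G \<longleftrightarrow> hopf_algebra H \<and> hopf_algebra G \<and> hopf_iso H G \<noteq> {}"

section \<open>Hopf 2-cocycles and cocycle deformations\<close>

definition bilinear_form :: "('k::field, 'a, 'm) module_scheme \<Rightarrow> ('a \<Rightarrow> 'a \<Rightarrow> 'k) \<Rightarrow> bool" where
  "bilinear_form H s \<longleftrightarrow>
    (\<forall>x\<in>carrier H. \<forall>y\<in>carrier H. \<forall>z\<in>carrier H.
      s (x \<oplus>\<^bsub>H\<^esub> y) z = s x z + s y z \<and> s z (x \<oplus>\<^bsub>H\<^esub> y) = s z x + s z y) \<and>
    (\<forall>c. \<forall>x\<in>carrier H. \<forall>y\<in>carrier H.
      s (c \<odot>\<^bsub>H\<^esub> x) y = c * s x y \<and> s x (c \<odot>\<^bsub>H\<^esub> y) = c * s x y)"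

definition convolution ::
    "('k::field, 'a, 'm) hopf_scheme \<Rightarrow> ('a \<Rightarrow> 'a \<Rightarrow> 'k) \<Rightarrow> ('a \<Rightarrow> 'a \<Rightarrow> 'k) \<Rightarrow> 'a \<Rightarrow> 'a \<Rightarrow> 'k" where
  "convolution H s t a b =
    sweedler H field_alg (\<lambda>a1 a2. sweedler H field_alg (\<lambda>b1 b2. s a1 b1 * t a2 b2) b) a"

definition convolution_inverse ::
    "('k::field, 'a, 'm) hopf_scheme \<Rightarrow> ('a \<Rightarrow> 'a \<Rightarrow> 'k) \<Rightarrow> ('a \<Rightarrow> 'a \<Rightarrow> 'k) \<Rightarrow> bool" where
  "convolution_inverse H s t \<longleftrightarrow> bilinear_form H t \<and>
    (\<forall>a\<in>carrier H. \<forall>b\<in>carrier H.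
      convolution H s t a b = counit H a * counit H b \<and>
      convolution H t s a b = counit H a * counit H b)"

locale hopf_2_cocycle = hopf_algebra H
  for H :: "('k::field, 'a, 'm) hopf_scheme" (structure) +
  fixes s :: "'a \<Rightarrow> 'a \<Rightarrow> 'k"
  assumes bilinear: "bilinear_form H s"
    and convolution_invertible: "\<exists>t. convolution_inverse H s t"
    and cocycle: "\<lbrakk>a \<in> carrier H; b \<in> carrier H; c \<in> carrier H\<rbrakk> \<Longrightarrow>
      sweedler H field_alg (\<lambda>a1 a2. sweedler H field_alg (\<lambda>b1 b2. s a1 b1 * s (a2 \<otimes> b2) c) b) a =
      sweedler H field_alg (\<lambda>b1 b2. sweedler H field_alg (\<lambda>c1 c2. s b1 c1 * s a (b2 \<otimes> c2)) c) b"
    and normalized: "a \<in> carrier H \<Longrightarrow> s a \<one> = counit H a \<and> s \<one> a = counit H a"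

text \<open>
  The convolution inverse is unique on the carrier, and so is the antipode of a Hopf algebra
  with prescribed algebra and coalgebra structure; \<open>SOME\<close> only fixes values off the carrier.
\<close>

definition deformed_mult :: "('k::field, 'a, 'm) hopf_scheme \<Rightarrow> ('a \<Rightarrow> 'a \<Rightarrow> 'k) \<Rightarrow> 'a \<Rightarrow> 'a \<Rightarrow> 'a" where
  "deformed_mult H s a b = (let t = (SOME t. convolution_inverse H s t) in
    sweedler3 H H (\<lambda>a1 a2 a3. sweedler3 H H (\<lambda>b1 b2 b3.
      (s a1 b1 * t a3 b3) \<odot>\<^bsub>H\<^esub> (a2 \<otimes>\<^bsub>H\<^esub> b2)) b) a)"

definition cocycle_deformation ::
    "('k::field, 'a, 'm) hopf_scheme \<Rightarrow> ('a \<Rightarrow> 'a \<Rightarrow> 'k) \<Rightarrow> ('k, 'a, 'm) hopf_scheme" where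
  "cocycle_deformation H s =
    (let B = H\<lparr>monoid.mult := deformed_mult H s\<rparr> in B\<lparr>antipode := (SOME S. is_antipode B S)\<rparr>)"

section \<open>Cartan matrices and Gaussian binomials\<close>

definition symmetrizable_GCM :: "('i::finite \<Rightarrow> 'i \<Rightarrow> int) \<Rightarrow> ('i \<Rightarrow> nat) \<Rightarrow> bool" where
  "symmetrizable_GCM A d \<longleftrightarrow>
    (\<forall>i. A i i = 2) \<and> (\<forall>i j. i \<noteq> j \<longrightarrow> A i j \<le> 0) \<and> (\<forall>i j. A i j = 0 \<longleftrightarrow> A j i = 0) \<and>
    (\<forall>i. d i > 0) \<and> Gcd (range d) = 1 \<and> (\<forall>i j. int (d i) * A i j = int (d j) * A j i)"

text \<open>
  Gaussian binomials are formed as polynomials in \<open>v\<close> by exact division, and only then evaluated: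
  the parameter may be a root of unity, where the quotient of evaluated factorials makes no sense.
\<close>

definition gauss_int :: "nat \<Rightarrow> int poly" where
  "gauss_int n = (monom 1 n - 1) div (monom 1 1 - 1)"

definition gauss_fact :: "nat \<Rightarrow> int poly" where
  "gauss_fact n = (\<Prod>m=1..n. gauss_int m)"

definition gauss_binomial :: "nat \<Rightarrow> nat \<Rightarrow> 'k::field \<Rightarrow> 'k" where
  "gauss_binomial n k v =
    poly (map_poly of_int (gauss_fact n div (gauss_fact k * gauss_fact (n - k)))) v"

section \<open>Multi-parameter quantum groups\<close>

text \<open>The generators \<open>e\<^sub>i\<close>, \<open>f\<^sub>i\<close>, \<open>\<omega>\<^sub>i\<close>, \<open>\<omega>\<^sub>i\<close> inverse, \<open>\<omega>'\<^sub>i\<close>, \<open>\<omega>'\<^sub>i\<close> inverse.\<close>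

datatype 'i qgen = Egen 'i | Fgen 'i | Om 'i | OmInv 'i | Om' 'i | OmInv' 'i

definition torus_gens :: "'i qgen set" where
  "torus_gens = range Om \<union> range OmInv \<union> range Om' \<union> range OmInv'"

abbreviation word_mono :: "'g list \<Rightarrow> 'k \<Rightarrow> ('g list \<Rightarrow>\<^sub>0 'k::field)" where
  "word_mono w c \<equiv> Poly_Mapping.single w c"

definition serre_coeff :: "('i \<Rightarrow> 'i \<Rightarrow> int) \<Rightarrow> ('i \<Rightarrow> 'i \<Rightarrow> 'k::field) \<Rightarrow> 'i \<Rightarrow> 'i \<Rightarrow> nat \<Rightarrow> 'k" where
  "serre_coeff A q i j k =
    (-1) ^ k * gauss_binomial (nat (1 - A i j)) k (q i i) * q i i ^ (k * (k - 1) div 2) * q i j ^ k"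

definition qgroup_rels ::
    "('i \<Rightarrow> 'i \<Rightarrow> int) \<Rightarrow> ('i \<Rightarrow> 'i \<Rightarrow> 'k::field) \<Rightarrow> ('i qgen list \<Rightarrow>\<^sub>0 'k) set" where
  "qgroup_rels A q =
    {word_mono [g, h] 1 - word_mono [h, g] 1 | g h. g \<in> torus_gens \<and> h \<in> torus_gens} \<union>
    {word_mono [Om i, OmInv i] 1 - word_mono [] 1 | i. True} \<union>
    {word_mono [Om' i, OmInv' i] 1 - word_mono [] 1 | i. True} \<union>
    {word_mono [Om i, Egen j, OmInv i] 1 - word_mono [Egen j] (q i j) | i j. True} \<union>
    {word_mono [Om' i, Egen j, OmInv' i] 1 - word_mono [Egen j] (inverse (q j i)) | i j. True} \<union>
    {word_mono [Om i, Fgen j, OmInv i] 1 - word_mono [Fgen j] (inverse (q i j)) | i j. True} \<union>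
    {word_mono [Om' i, Fgen j, OmInv' i] 1 - word_mono [Fgen j] (q j i) | i j. True} \<union>
    {word_mono [Egen i, Fgen j] 1 - word_mono [Fgen j, Egen i] 1
       - (if i = j then word_mono [Om i] (q i i / (q i i - 1)) - word_mono [Om' i] (q i i / (q i i - 1)) else 0)
       | i j. True} \<union>
    {(\<Sum>k\<le>nat (1 - A i j).
        word_mono (replicate (nat (1 - A i j) - k) (Egen i) @ [Egen j] @ replicate k (Egen i))
          (serre_coeff A q i j k)) | i j. i \<noteq> j} \<union>
    {(\<Sum>k\<le>nat (1 - A i j).
        word_mono (replicate k (Fgen i) @ [Fgen j] @ replicate (nat (1 - A i j) - k) (Fgen i))
          (serre_coeff A q i j k)) | i j. i \<noteq> j}"

definition qgroup_alg ::
    "('i \<Rightarrow> 'i \<Rightarrow> int) \<Rightarrow> ('i \<Rightarrow> 'i \<Rightarrow> 'k::field) \<Rightarrow> ('k, ('i qgen list \<Rightarrow>\<^sub>0 'k) set) module" where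
  "qgroup_alg A q = alg_quot free_alg (Idl\<^bsub>free_alg\<^esub> (qgroup_rels A q))"

definition word_class ::
    "('i \<Rightarrow> 'i \<Rightarrow> int) \<Rightarrow> ('i \<Rightarrow> 'i \<Rightarrow> 'k::field) \<Rightarrow> 'i qgen list \<Rightarrow> ('i qgen list \<Rightarrow>\<^sub>0 'k) set" where
  "word_class A q w = (Idl\<^bsub>free_alg\<^esub> (qgroup_rels A q)) +>\<^bsub>free_alg\<^esub> word_mono w 1"

fun comult_gen :: "('i \<Rightarrow> 'i \<Rightarrow> int) \<Rightarrow> ('i \<Rightarrow> 'i \<Rightarrow> 'k::field) \<Rightarrow> 'i qgen \<Rightarrow>
    (('i qgen list \<Rightarrow>\<^sub>0 'k) set list \<Rightarrow>\<^sub>0 'k) set" where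
  "comult_gen A q (Egen i) =
     pure_tensor (qgroup_alg A q) [word_class A q [Egen i], word_class A q []]
       \<oplus>\<^bsub>tensor_power (qgroup_alg A q) 2\<^esub>
     pure_tensor (qgroup_alg A q) [word_class A q [Om i], word_class A q [Egen i]]"
| "comult_gen A q (Fgen i) =
     pure_tensor (qgroup_alg A q) [word_class A q [], word_class A q [Fgen i]]
       \<oplus>\<^bsub>tensor_power (qgroup_alg A q) 2\<^esub>
     pure_tensor (qgroup_alg A q) [word_class A q [Fgen i], word_class A q [Om' i]]"
| "comult_gen A q g = pure_tensor (qgroup_alg A q) [word_class A q [g], word_class A q [g]]"

fun counit_gen :: "'i qgen \<Rightarrow> 'k::field" where
  "counit_gen (Egen i) = 0"
| "counit_gen (Fgen i) = 0"
| "counit_gen g = 1"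

fun antipode_gen :: "('i \<Rightarrow> 'i \<Rightarrow> int) \<Rightarrow> ('i \<Rightarrow> 'i \<Rightarrow> 'k::field) \<Rightarrow> 'i qgen \<Rightarrow> ('i qgen list \<Rightarrow>\<^sub>0 'k) set" where
  "antipode_gen A q (Egen i) = \<ominus>\<^bsub>qgroup_alg A q\<^esub> word_class A q [OmInv i, Egen i]"
| "antipode_gen A q (Fgen i) = \<ominus>\<^bsub>qgroup_alg A q\<^esub> word_class A q [Fgen i, OmInv' i]"
| "antipode_gen A q (Om i) = word_class A q [OmInv i]"
| "antipode_gen A q (OmInv i) = word_class A q [Om i]"
| "antipode_gen A q (Om' i) = word_class A q [OmInv' i]"
| "antipode_gen A q (OmInv' i) = word_class A q [Om' i]"

definition qgroup ::
    "('i \<Rightarrow> 'i \<Rightarrow> int) \<Rightarrow> ('i \<Rightarrow> 'i \<Rightarrow> 'k::field) \<Rightarrow> ('k, ('i qgen list \<Rightarrow>\<^sub>0 'k) set) hopf" where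
  "qgroup A q = module.extend (qgroup_alg A q) (hopf.fields
     (induced (free_ext (tensor_power (qgroup_alg A q) 2) (comult_gen A q)))
     (induced (free_ext field_alg counit_gen))
     (induced (free_ext (opposite_alg (qgroup_alg A q)) (antipode_gen A q))))"

text \<open>The parameters \<open>v\<close> to the power \<open>d\<^sub>i a\<^sub>i\<^sub>j\<close> of the one-parameter quantum group.\<close>

definition one_param :: "('i \<Rightarrow> 'i \<Rightarrow> int) \<Rightarrow> ('i \<Rightarrow> nat) \<Rightarrow> 'k::field \<Rightarrow> 'i \<Rightarrow> 'i \<Rightarrow> 'k" where
  "one_param A d v i j = v powi (int (d i) * A i j)"

section \<open>The grading, the torus and inflated bicharacters\<close>

text \<open>
  The homogeneous components of the subalgebras generated by \<open>e\<^sub>i\<close>, \<open>\<omega>\<^sub>i\<close> and inverses, resp. by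
  \<open>f\<^sub>i\<close>, \<open>\<omega>'\<^sub>i\<close> and inverses; \<open>\<beta>\<close> (resp. \<open>\<alpha>\<close>) gives the coefficients of the simple roots
  in the degree (resp. in minus the degree).
\<close>

definition pos_part :: "('i \<Rightarrow> 'i \<Rightarrow> int) \<Rightarrow> ('i \<Rightarrow> 'i \<Rightarrow> 'k::field) \<Rightarrow> ('i \<Rightarrow> nat) \<Rightarrow> ('i qgen list \<Rightarrow>\<^sub>0 'k) set set" where
  "pos_part A q \<beta> = mspan (qgroup_alg A q)
    {word_class A q w | w. w \<in> lists (range Egen \<union> range Om \<union> range OmInv) \<and>
                          (\<forall>i. count_list w (Egen i) = \<beta> i)}"

definition neg_part :: "('i \<Rightarrow> 'i \<Rightarrow> int) \<Rightarrow> ('i \<Rightarrow> 'i \<Rightarrow> 'k::field) \<Rightarrow> ('i \<Rightarrow> nat) \<Rightarrow> ('i qgen list \<Rightarrow>\<^sub>0 'k) set set" where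
  "neg_part A q \<alpha> = mspan (qgroup_alg A q)
    {word_class A q w | w. w \<in> lists (range Fgen \<union> range Om' \<union> range OmInv') \<and>
                          (\<forall>i. count_list w (Fgen i) = \<alpha> i)}"

definition graded_part :: "('i::finite \<Rightarrow> 'i \<Rightarrow> int) \<Rightarrow> ('i \<Rightarrow> 'i \<Rightarrow> 'k::field) \<Rightarrow> nat \<Rightarrow> ('i qgen list \<Rightarrow>\<^sub>0 'k) set set" where
  "graded_part A q k = mspan (qgroup_alg A q)
    {x \<otimes>\<^bsub>qgroup_alg A q\<^esub> y | x y \<alpha> \<beta>. x \<in> neg_part A q \<alpha> \<and> y \<in> pos_part A q \<beta> \<and>
       (\<Sum>i\<in>UNIV. \<alpha> i) + (\<Sum>i\<in>UNIV. \<beta> i) = k}"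

definition torus_group :: "('i \<Rightarrow> 'i \<Rightarrow> int) \<Rightarrow> ('i \<Rightarrow> 'i \<Rightarrow> 'k::field) \<Rightarrow> ('i qgen list \<Rightarrow>\<^sub>0 'k) set monoid" where
  "torus_group A q = subgroup_generated (units_of (qgroup_alg A q))
     (range (\<lambda>i. word_class A q [Om i]) \<union> range (\<lambda>i. word_class A q [Om' i]))"

definition bicharacter :: "('g, 'm) monoid_scheme \<Rightarrow> ('g \<Rightarrow> 'g \<Rightarrow> 'k::field) \<Rightarrow> bool" where
  "bicharacter G \<sigma> \<longleftrightarrow>
    (\<forall>g\<in>carrier G. \<sigma> g \<in> hom G (units_of field_alg)) \<and>
    (\<forall>h\<in>carrier G. (\<lambda>g. \<sigma> g h) \<in> hom G (units_of field_alg))"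

definition twisting_bicharacter :: "('i \<Rightarrow> 'i \<Rightarrow> int) \<Rightarrow> ('i \<Rightarrow> 'i \<Rightarrow> 'k::field) \<Rightarrow> ('i \<Rightarrow> 'i \<Rightarrow> 'k) \<Rightarrow>
    (('i qgen list \<Rightarrow>\<^sub>0 'k) set \<Rightarrow> ('i qgen list \<Rightarrow>\<^sub>0 'k) set \<Rightarrow> 'k) \<Rightarrow> bool" where
  "twisting_bicharacter A q qhat \<sigma> \<longleftrightarrow> bicharacter (torus_group A q) \<sigma> \<and>
    (let \<omega> = (\<lambda>i. word_class A q [Om i]); \<omega>' = (\<lambda>i. word_class A q [Om' i]) in
     \<forall>i j. \<sigma> (\<omega> i) (\<omega> j) * inverse (\<sigma> (\<omega> j) (\<omega> i)) = qhat i j * inverse (q i j) \<and>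
           \<sigma> (\<omega>' i) (\<omega>' j) * inverse (\<sigma> (\<omega>' j) (\<omega>' i)) = qhat i j * inverse (q i j) \<and>
           \<sigma> (\<omega>' i) (\<omega> j) * inverse (\<sigma> (\<omega> j) (\<omega>' i)) = inverse (qhat j i) * q j i)"

text \<open>\<open>s\<close> is the bilinear form on the whole quantum group obtained by inflating \<open>\<sigma>\<close>.\<close>

definition is_inflation :: "('i::finite \<Rightarrow> 'i \<Rightarrow> int) \<Rightarrow> ('i \<Rightarrow> 'i \<Rightarrow> 'k::field) \<Rightarrow>
    (('i qgen list \<Rightarrow>\<^sub>0 'k) set \<Rightarrow> ('i qgen list \<Rightarrow>\<^sub>0 'k) set \<Rightarrow> 'k) \<Rightarrow>
    (('i qgen list \<Rightarrow>\<^sub>0 'k) set \<Rightarrow> ('i qgen list \<Rightarrow>\<^sub>0 'k) set \<Rightarrow> 'k) \<Rightarrow> bool" where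
  "is_inflation A q \<sigma> s \<longleftrightarrow>
    bilinear_form (qgroup A q) s \<and>
    (\<forall>g\<in>carrier (torus_group A q). \<forall>h\<in>carrier (torus_group A q). s g h = \<sigma> g h) \<and>
    (\<forall>k\<ge>1. \<forall>x\<in>graded_part A q k. \<forall>y\<in>carrier (qgroup A q). s x y = 0 \<and> s y x = 0)"

text \<open>
  The bicharacter \<open>\<sigma>\<close> does not separate \<open>\<omega>\<^sub>i\<close> from \<open>\<omega>'\<^sub>i\<close>.  The cocycle identity of the inflation
  at \<open>(e\<^sub>i, f\<^sub>i, g)\<close> and at \<open>(g, e\<^sub>i, f\<^sub>i)\<close>, for \<open>g\<close> in the torus, amounts to exactly this, because
  \<open>e\<^sub>i f\<^sub>i\<close> has the component \<open>q\<^sub>i\<^sub>i / (q\<^sub>i\<^sub>i - 1) (\<omega>\<^sub>i - \<omega>'\<^sub>i)\<close> in degree 0.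
\<close>

definition balanced :: "('i \<Rightarrow> 'i \<Rightarrow> int) \<Rightarrow> ('i \<Rightarrow> 'i \<Rightarrow> 'k::field) \<Rightarrow>
    (('i qgen list \<Rightarrow>\<^sub>0 'k) set \<Rightarrow> ('i qgen list \<Rightarrow>\<^sub>0 'k) set \<Rightarrow> 'k) \<Rightarrow> bool" where
  "balanced A q \<sigma> \<longleftrightarrow> (\<forall>i. \<forall>g\<in>carrier (torus_group A q).
    \<sigma> (word_class A q [Om i]) g = \<sigma> (word_class A q [Om' i]) g \<and>
    \<sigma> g (word_class A q [Om i]) = \<sigma> g (word_class A q [Om' i]))"

end

theory Submission
  imports Defs "HOL-Library.Product_Plus"
begin

text \<open>
  A word in the generators has two degrees in the root lattice: those of its images under the left
  and right coactions of the group algebra of the root lattice, onto which the quantum group projects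
  by killing \<open>e\<^sub>i\<close> and \<open>f\<^sub>i\<close> and identifying \<open>\<omega>\<^sub>i\<close> with \<open>\<omega>'\<^sub>i\<close>.  The inflation of a balanced bicharacter is
  the pullback of a bicharacter \<open>z\<close> along this projection, hence a cocycle, and the deformed product
  of two words is their product times the value of \<open>z\<close> on the left degrees divided by its value on
  the right degrees.  Rescaling words therefore identifies the deformed product of the free algebra
  with concatenation, and it carries the ideal of relations for \<open>qhat\<close> onto the one for \<open>q\<close>, since all
  relations are homogeneous.  Conversely, the cocycle identity at \<open>e\<^sub>i, f\<^sub>i, g\<close> and \<open>g, e\<^sub>i, f\<^sub>i\<close> forces
  balance.  That the coproduct and the antipode respect the Serre relations is an identity for
  iterated \<open>q\<close>-commutators, and the torus and the inflations are separated from the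
  relations by a Harish-Chandra projection built from a universal Verma module.
\<close>


section \<open>Linear extension\<close>

text \<open>Carrier-based records and cosets are awkward to compute in, so each algebra is treated
  as the image of the free algebra on the letters under a linear map \<open>c\<close>, and every
  Hopf-algebraic statement becomes one about words and their splittings. The formulas for coproduct,
  counit and antipode on words do not depend on the parameters; hence two such Hopf algebras are
  isomorphic as soon as their maps from the free algebra have the same kernel. For the deformation
  that map is the rescaling followed by the quotient map, so that only ideals have to be compared,
  and the antipode, given in the deformation by a choice, is identified by uniqueness. Spanning by
  triangular words determines an inflation from its values on the torus; the Harish-Chandra
  projection supplies its existence and the freeness of the torus. The twisting conditions fix only
  the antisymmetric part of \<sigma>: multiplying \<sigma> by a symmetric bicharacter preserves them
  but may destroy balance, which is why the cocycle property is characterised rather than asserted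
  for every twisting bicharacter.\<close>

abbreviation sc :: "'k::field \<Rightarrow> ('g \<Rightarrow>\<^sub>0 'k) \<Rightarrow> ('g \<Rightarrow>\<^sub>0 'k)" where
  "sc c \<equiv> Poly_Mapping.map ((*) c)"

abbreviation "sgl \<equiv> Poly_Mapping.single"

lemma lookup_sc [simp]: "Poly_Mapping.lookup (sc c r) k = c * Poly_Mapping.lookup r k"
  by (simp add: Poly_Mapping.map.rep_eq when_def)

lemma sc_zero [simp]: "sc c 0 = 0"
  by (rule poly_mapping_eqI) simp

lemma keys_sc: "Poly_Mapping.keys (sc c r) \<subseteq> Poly_Mapping.keys r"
  by (auto simp: in_keys_iff)

lemma pm_expand: "r = (\<Sum>x\<in>Poly_Mapping.keys r. sgl x (Poly_Mapping.lookup r x))"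
  by (rule poly_mapping_eqI) (simp add: lookup_sum lookup_single when_def in_keys_iff)

text \<open>Only keys of \<open>r\<close> occur in the single case, so a support condition on
  \<open>r\<close> is available throughout the induction.\<close>

lemma pm_induct [case_names zero single add]:
  assumes "P 0" "\<And>x a. x \<in> Poly_Mapping.keys r \<Longrightarrow> P (sgl x a)" "\<And>s t. P s \<Longrightarrow> P t \<Longrightarrow> P (s + t)"
  shows "P (r :: 'g \<Rightarrow>\<^sub>0 'k::comm_monoid_add)"
proof -
  have "P (\<Sum>x\<in>K. sgl x (Poly_Mapping.lookup r x))" if "finite K" "K \<subseteq> Poly_Mapping.keys r" for K
    using that by (induction K) (auto intro: assms)
  from this[of "Poly_Mapping.keys r"] show ?thesis
    by (simp flip: pm_expand)
qed

lemma keys_add_subset: "Poly_Mapping.keys a \<subseteq> Y \<Longrightarrow> Poly_Mapping.keys b \<subseteq> Y \<Longrightarrow> Poly_Mapping.keys (a + b) \<subseteq> Y"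
  using Poly_Mapping.keys_add[of a b] by blast

text \<open>A vector space with the scalar action as a parameter, so that one theory of linear
  extension covers both finitely supported functions and the field itself.\<close>

locale scaling =
  fixes scl :: "'k::field \<Rightarrow> 'v::ab_group_add \<Rightarrow> 'v"
  assumes scl_left: "scl (a + b) v = scl a v + scl b v"
    and scl_right: "scl a (v + w) = scl a v + scl a w"
    and scl_mult: "scl (a * b) v = scl a (scl b v)"
    and scl_one [simp]: "scl 1 v = v"
begin

lemma scl_zero [simp]: "scl 0 v = 0" "scl a 0 = 0"
  using scl_left[of 0 0 v] scl_right[of a 0 0] by auto

lemma scl_sum: "scl a (sum f K) = (\<Sum>x\<in>K. scl a (f x))"
  by (induction K rule: infinite_finite_induct) (auto simp: scl_right)

lemma scl_minus: "scl (- 1) v = - v" "scl a (- v) = - scl a v"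
proof -
  show "scl (- 1) v = - v"
    using scl_left[of "-1" 1 v] by (simp add: eq_neg_iff_add_eq_0)
  show "scl a (- v) = - scl a v"
    using scl_right[of a "-v" v] by (simp add: eq_neg_iff_add_eq_0)
qed

definition lext :: "('g \<Rightarrow> 'v) \<Rightarrow> ('g \<Rightarrow>\<^sub>0 'k) \<Rightarrow> 'v" where
  "lext f r = (\<Sum>x\<in>Poly_Mapping.keys r. scl (Poly_Mapping.lookup r x) (f x))"

lemma lext_superset:
  assumes "finite K" "Poly_Mapping.keys r \<subseteq> K"
  shows "lext f r = (\<Sum>x\<in>K. scl (Poly_Mapping.lookup r x) (f x))"
  unfolding lext_def
  by (rule sum.mono_neutral_left) (use assms in \<open>auto simp: in_keys_iff\<close>)

lemma lext_zero [simp]: "lext f 0 = 0"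
  by (simp add: lext_def)

lemma lext_add: "lext f (r + s) = lext f r + lext f s"
proof -
  let ?K = "Poly_Mapping.keys r \<union> Poly_Mapping.keys s"
  have "lext f (r + s) = (\<Sum>x\<in>?K. scl (Poly_Mapping.lookup (r + s) x) (f x))"
    by (rule lext_superset) (use Poly_Mapping.keys_add[of r s] in auto)
  also have "\<dots> = lext f r + lext f s"
    by (simp add: lookup_add scl_left sum.distrib lext_superset[of ?K r] lext_superset[of ?K s])
  finally show ?thesis .
qed

lemma lext_sc: "lext f (sc c r) = scl c (lext f r)"
proof -
  have "lext f (sc c r) = (\<Sum>x\<in>Poly_Mapping.keys r. scl (Poly_Mapping.lookup (sc c r) x) (f x))"
    by (rule lext_superset) (auto simp: keys_sc)
  also have "\<dots> = scl c (lext f r)"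
    by (simp add: lext_def scl_sum scl_mult)
  finally show ?thesis .
qed

lemma lext_single [simp]: "lext f (sgl x a) = scl a (f x)"
  by (cases "a = 0") (auto simp: lext_def)

lemma lext_diff: "lext f (r - s) = lext f r - lext f s"
  using lext_add[of f "r - s" s] by (simp add: algebra_simps)

lemma lext_sum: "lext f (sum g K) = (\<Sum>x\<in>K. lext f (g x))"
  by (induction K rule: infinite_finite_induct) (auto simp: lext_add)

lemma lext_fun_add: "lext (\<lambda>x. f x + g x) r = lext f r + lext g r"
  by (simp add: lext_def scl_right sum.distrib)

lemma lext_fun_scl: "lext (\<lambda>x. scl c (f x)) r = scl c (lext f r)"
  by (simp add: lext_def scl_sum flip: scl_mult) (simp add: mult.commute)

lemma lext_cong: "(\<And>x. x \<in> Poly_Mapping.keys r \<Longrightarrow> f x = g x) \<Longrightarrow> lext f r = lext g r"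
  by (simp add: lext_def)

lemma lext_unique:
  assumes "\<And>x. h (sgl x 1) = f x" "\<And>r s. h (r + s) = h r + h s" "\<And>c r. h (sc c r) = scl c (h r)"
  shows "h r = lext f r"
proof (induction r rule: pm_induct)
  case zero
  show ?case using assms(3)[of 0 0] by simp
next
  case (single x a)
  have "sgl x a = sc a (sgl x 1)" by simp
  then show ?case by (metis assms(1,3) lext_sc lext_single scl_one)
next
  case (add s t)
  then show ?case by (simp add: assms lext_add)
qed

end

interpretation pm: scaling "sc :: 'k::field \<Rightarrow> ('g \<Rightarrow>\<^sub>0 'k) \<Rightarrow> _"
  by standard (auto intro!: poly_mapping_eqI simp: lookup_add algebra_simps)

interpretation fd: scaling "(*) :: 'k::field \<Rightarrow> 'k \<Rightarrow> 'k"
  by standard (auto simp: algebra_simps)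

lemma lext_comp:
  assumes "scaling s1" "scaling s2"
    and "\<And>r s. h (r + s) = h r + h s" "\<And>c r. h (s1 c r) = s2 c (h r)"
  shows "h (scaling.lext s1 f r) = scaling.lext s2 (\<lambda>x. h (f x)) r"
proof -
  interpret a: scaling s1 by fact
  interpret b: scaling s2 by fact
  show ?thesis
    by (rule b.lext_unique[of "\<lambda>r. h (a.lext f r)"]) (auto simp: assms a.lext_add a.lext_sc)
qed

lemma pm_lext_sgl [simp]: "pm.lext (\<lambda>x. sgl x 1) r = r"
  by (rule pm.lext_unique[of id, symmetric, simplified]) auto

lemma keys_lext: "(\<And>x. x \<in> Poly_Mapping.keys r \<Longrightarrow> Poly_Mapping.keys (f x) \<subseteq> Y) \<Longrightarrow> Poly_Mapping.keys (pm.lext f r) \<subseteq> Y"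
  unfolding pm.lext_def using keys_sum keys_sc by fastforce

section \<open>Modules presented as linear images\<close>

lemma field_alg_simps [simp]:
  "carrier field_alg = UNIV" "x \<otimes>\<^bsub>field_alg\<^esub> y = x * y" "\<one>\<^bsub>field_alg\<^esub> = 1"
  "\<zero>\<^bsub>field_alg\<^esub> = 0" "x \<oplus>\<^bsub>field_alg\<^esub> y = x + y" "x \<odot>\<^bsub>field_alg\<^esub> y = x * y"
  by (simp_all add: field_alg_def)

lemma cring_field_alg: "cring (field_alg :: ('k::field,'k) module)"
proof (rule cringI)
  show "abelian_group (field_alg :: ('k,'k) module)"
  proof (rule abelian_groupI)
    fix x :: 'k
    show "\<exists>y\<in>carrier field_alg. y \<oplus>\<^bsub>field_alg\<^esub> x = \<zero>\<^bsub>field_alg\<^esub>"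
      by (auto intro: exI[of _ "-x"])
  qed (auto simp: algebra_simps)
  show "comm_monoid (field_alg :: ('k,'k) module)"
    by (rule comm_monoidI) (auto simp: algebra_simps)
qed (auto simp: algebra_simps)

text \<open>The record module \<open>M\<close> is covered linearly by a subset \<open>S\<close> of a
  type-class group, where sums and scalars can be rewritten freely. A subset is taken because the
  carrier of a monoid algebra consists of the functions supported in the carrier of the
  monoid.\<close>

locale lin_image = scaling scl for scl :: "'k::field \<Rightarrow> 'v::ab_group_add \<Rightarrow> 'v" +
  fixes M :: "('k, 'b, 'm) module_scheme" (structure) and S :: "'v set" and p :: "'v \<Rightarrow> 'b"
  assumes S_zero [simp]: "0 \<in> S"
    and S_add [simp]: "x \<in> S \<Longrightarrow> y \<in> S \<Longrightarrow> x + y \<in> S"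
    and S_scl [simp]: "x \<in> S \<Longrightarrow> scl a x \<in> S"
    and carrier_eq: "carrier M = p ` S"
    and p_add: "x \<in> S \<Longrightarrow> y \<in> S \<Longrightarrow> p (x + y) = p x \<oplus> p y"
    and p_scl: "x \<in> S \<Longrightarrow> p (scl a x) = a \<odot> p x"
    and p_zero: "p 0 = \<zero>"
begin

lemma S_uminus [simp]: "x \<in> S \<Longrightarrow> - x \<in> S"
  using S_scl[of x "-1"] by (simp add: scl_minus)

lemma S_diff [simp]: "x \<in> S \<Longrightarrow> y \<in> S \<Longrightarrow> x - y \<in> S"
  using S_add[of x "-y"] by simp

lemma S_sum: "(\<And>x. x \<in> K \<Longrightarrow> f x \<in> S) \<Longrightarrow> sum f K \<in> S"
  by (induction K rule: infinite_finite_induct) auto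

lemma p_closed [simp]: "x \<in> S \<Longrightarrow> p x \<in> carrier M"
  by (simp add: carrier_eq)

lemma carrierE: assumes "a \<in> carrier M" obtains x where "x \<in> S" "a = p x"
  using assms by (auto simp: carrier_eq)

lemma abelian_group: "abelian_group M"
proof (rule abelian_groupI)
  fix x assume "x \<in> carrier M"
  then obtain v where v: "v \<in> S" "x = p v" by (rule carrierE)
  have "p (- v) \<oplus> x = p (- v + v)" using v p_add[of "-v" v] by simp
  then show "\<exists>y\<in>carrier M. y \<oplus> x = \<zero>" using v by (auto simp: p_zero intro!: bexI[of _ "p (-v)"])
qed (auto simp: carrier_eq add_ac simp flip: p_add p_zero)

lemma module: "module field_alg M"
  by (rule moduleI)
    (auto simp: cring_field_alg abelian_group carrier_eq scl_left scl_right scl_mult simp flip: p_add p_zero p_scl)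

sublocale mod: module field_alg M by (rule module)

lemma p_uminus: "x \<in> S \<Longrightarrow> p (- x) = \<ominus> p x"
proof -
  assume "x \<in> S"
  then have "p (- x) \<oplus> p x = \<zero>" by (simp flip: p_add p_zero)
  then show ?thesis using \<open>x \<in> S\<close> by (metis S_uminus p_closed mod.M.minus_equality)
qed

lemma p_diff: "x \<in> S \<Longrightarrow> y \<in> S \<Longrightarrow> p (x - y) = p x \<ominus> p y"
  using p_add[of x "-y"] by (simp add: p_uminus a_minus_def)

lemma p_sum: "(\<And>x. x \<in> K \<Longrightarrow> F x \<in> S) \<Longrightarrow> finite K \<Longrightarrow> p (sum F K) = (\<Oplus>x\<in>K. p (F x))"
proof (induction K rule: infinite_finite_induct)
  case (insert x K)
  then show ?case by (simp add: p_add S_sum mod.M.finsum_insert Pi_def)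
qed (auto simp: p_zero)

lemma lext_in_S: "(\<And>x. x \<in> Poly_Mapping.keys r \<Longrightarrow> F x \<in> S) \<Longrightarrow> lext F r \<in> S"
  by (simp add: lext_def S_sum)

lemma linear_ext_image:
  assumes "\<And>x. x \<in> Poly_Mapping.keys r \<Longrightarrow> F x \<in> S" "\<And>x. x \<in> Poly_Mapping.keys r \<Longrightarrow> f x = p (F x)"
  shows "linear_ext M f r = p (lext F r)"
proof -
  have "linear_ext M f r = (\<Oplus>x\<in>Poly_Mapping.keys r. p (scl (Poly_Mapping.lookup r x) (F x)))"
    unfolding linear_ext_def using assms
    by (intro mod.M.finsum_cong) (auto simp: p_scl simp_implies_def)
  then show ?thesis
    unfolding lext_def using assms by (subst p_sum) auto
qed

text \<open>The choice of preimages need not be linear in order to compute with it.\<close>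

definition pre :: "'b \<Rightarrow> 'v" where "pre b = (SOME x. x \<in> S \<and> p x = b)"

lemma pre: "b \<in> carrier M \<Longrightarrow> pre b \<in> S \<and> p (pre b) = b"
  unfolding pre_def by (rule someI_ex) (auto simp: carrier_eq)

lemma p_eqI:
  assumes "x \<in> S" "y \<in> S" "p (x - y) = \<zero>"
  shows "p x = p y"
proof -
  have "p x = p ((x - y) + y)" by simp
  also have "\<dots> = p (x - y) \<oplus> p y" using assms by (intro p_add) auto
  finally show ?thesis using assms by simp
qed

text \<open>Both sides equal \<open>linear_ext\<close> of the common images, so two families of
  lifts may be exchanged even when they differ by elements of the kernel.\<close>

lemma p_lext_cong:
  assumes "\<And>x. x \<in> Poly_Mapping.keys r \<Longrightarrow> F x \<in> S \<and> G x \<in> S \<and> p (F x) = p (G x)"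
  shows "p (lext F r) = p (lext G r)"
proof -
  have "p (lext F r) = linear_ext M (\<lambda>x. p (F x)) r"
    by (rule linear_ext_image[symmetric]) (use assms in auto)
  also have "\<dots> = p (lext G r)"
    by (rule linear_ext_image) (use assms in auto)
  finally show ?thesis .
qed

end

lemma lin_image_field: "lin_image ((*) :: 'k::field \<Rightarrow> _) field_alg UNIV id"
  by unfold_locales auto

locale alg_image = lin_image scl M S p
  for scl :: "'k::field \<Rightarrow> 'v::ab_group_add \<Rightarrow> 'v"
    and M :: "('k, 'b, 'm) module_scheme" (structure) and S p +
  fixes mu :: "'v \<Rightarrow> 'v \<Rightarrow> 'v" and u :: 'v
  assumes mu_closed [simp]: "x \<in> S \<Longrightarrow> y \<in> S \<Longrightarrow> mu x y \<in> S" and u_closed [simp]: "u \<in> S"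
    and p_mu: "x \<in> S \<Longrightarrow> y \<in> S \<Longrightarrow> p (mu x y) = p x \<otimes> p y" and p_u: "p u = \<one>"
    and mu_add: "x \<in> S \<Longrightarrow> y \<in> S \<Longrightarrow> z \<in> S \<Longrightarrow> mu (x + y) z = mu x z + mu y z"
      "x \<in> S \<Longrightarrow> y \<in> S \<Longrightarrow> z \<in> S \<Longrightarrow> mu z (x + y) = mu z x + mu z y"
    and mu_scl: "x \<in> S \<Longrightarrow> y \<in> S \<Longrightarrow> mu (scl a x) y = scl a (mu x y)"
      "x \<in> S \<Longrightarrow> y \<in> S \<Longrightarrow> mu x (scl a y) = scl a (mu x y)"
    and mu_assoc: "x \<in> S \<Longrightarrow> y \<in> S \<Longrightarrow> z \<in> S \<Longrightarrow> mu (mu x y) z = mu x (mu y z)"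
    and mu_unit: "x \<in> S \<Longrightarrow> mu u x = x" "x \<in> S \<Longrightarrow> mu x u = x"

begin

lemma assoc_algebra: "assoc_algebra M"
proof -
  have "Group.monoid M"
    by (rule Group.monoidI) (auto simp: carrier_eq p_mu[symmetric] p_u[symmetric] mu_assoc mu_unit)
  then have "ring M"
    by (intro ringI abelian_group)
      (auto simp: carrier_eq p_mu[symmetric] p_add[symmetric] mu_add)
  then show ?thesis
    by (intro assoc_algebra.intro module assoc_algebra_axioms.intro)
      (auto simp: carrier_eq p_mu[symmetric] p_scl[symmetric] mu_scl)
qed

sublocale alg: assoc_algebra M by (rule assoc_algebra)

end

section \<open>Monoid algebras and their quotients\<close>

definition mmul :: "'g monoid \<Rightarrow> ('g \<Rightarrow>\<^sub>0 'k::field) \<Rightarrow> ('g \<Rightarrow>\<^sub>0 'k) \<Rightarrow> ('g \<Rightarrow>\<^sub>0 'k)" where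
  "mmul G r s = pm.lext (\<lambda>x. pm.lext (\<lambda>y. sgl (x \<otimes>\<^bsub>G\<^esub> y) 1) s) r"

lemma monoid_alg_mult: "r \<otimes>\<^bsub>monoid_alg G\<^esub> s = mmul G r s"
  by (simp add: monoid_alg_def mmul_def pm.lext_def pm.scl_sum)

lemma monoid_alg_simps [simp]:
  "carrier (monoid_alg G) = {r. Poly_Mapping.keys r \<subseteq> carrier G}"
  "\<one>\<^bsub>monoid_alg G\<^esub> = sgl \<one>\<^bsub>G\<^esub> 1" "\<zero>\<^bsub>monoid_alg G\<^esub> = 0"
  "x \<oplus>\<^bsub>monoid_alg G\<^esub> y = x + y" "c \<odot>\<^bsub>monoid_alg G\<^esub> x = sc c x"
  by (simp_all add: monoid_alg_def)

lemma mmul_add: "mmul G (x + y) z = mmul G x z + mmul G y z" "mmul G z (x + y) = mmul G z x + mmul G z y"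
  by (simp_all add: mmul_def pm.lext_add pm.lext_fun_add)

lemma mmul_sc: "mmul G (sc c x) y = sc c (mmul G x y)" "mmul G x (sc c y) = sc c (mmul G x y)"
  by (simp_all add: mmul_def pm.lext_sc pm.lext_fun_scl)

lemma mmul_zero [simp]: "mmul G 0 x = 0" "mmul G x 0 = 0"
  by (simp_all add: mmul_def pm.lext_def)

lemma mmul_sgl: "mmul G (sgl x a) (sgl y b) = sgl (x \<otimes>\<^bsub>G\<^esub> y) (a * b)"
  by (simp add: mmul_def)

lemma mmul_assoc:
  assumes "Group.monoid G" "Poly_Mapping.keys x \<subseteq> carrier G" "Poly_Mapping.keys y \<subseteq> carrier G" "Poly_Mapping.keys z \<subseteq> carrier G"
  shows "mmul G (mmul G x y) z = mmul G x (mmul G y z)"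
proof (induction x rule: pm_induct)
  case (single a \<alpha>)
  show ?case
  proof (induction y rule: pm_induct)
    case (single b \<beta>)
    show ?case
    proof (induction z rule: pm_induct)
      case (single c \<gamma>)
      then show ?case
        using \<open>a \<in> _\<close> \<open>b \<in> _\<close> assms by (auto simp: mmul_sgl Group.monoid.m_assoc subset_iff mult.assoc)
    qed (simp_all add: mmul_add)
  qed (simp_all add: mmul_add)
qed (simp_all add: mmul_add)

lemma monoid_alg_image:
  assumes "Group.monoid G"
  shows "alg_image sc (monoid_alg G) {r. Poly_Mapping.keys r \<subseteq> carrier G} id (mmul G) (sgl \<one>\<^bsub>G\<^esub> (1::'k::field))"
proof -
  interpret G: Group.monoid G by fact
  have closed: "Poly_Mapping.keys (mmul G r s) \<subseteq> carrier G"
    if "Poly_Mapping.keys r \<subseteq> carrier G" "Poly_Mapping.keys s \<subseteq> carrier G" for r s :: "'a \<Rightarrow>\<^sub>0 'k"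
    unfolding mmul_def using that by (intro keys_lext) auto
  have unit: "mmul G (sgl \<one>\<^bsub>G\<^esub> 1) r = r \<and> mmul G r (sgl \<one>\<^bsub>G\<^esub> 1) = r" if "Poly_Mapping.keys r \<subseteq> carrier G" for r :: "'a \<Rightarrow>\<^sub>0 'k"
    by (induction r rule: pm_induct) (use that in \<open>auto simp: mmul_add mmul_sgl subset_iff\<close>)
  show ?thesis
    using keys_sc closed unit
    by unfold_locales
      (auto simp: keys_add_subset mmul_add mmul_sc monoid_alg_mult mmul_assoc assms dest: subsetD[OF keys_sc])
qed

locale quot_alg = Group.monoid G for G :: "'g monoid" (structure) +
  fixes N :: "('g \<Rightarrow>\<^sub>0 'k::field) set"
  assumes N_ideal: "ideal N (monoid_alg G)" and N_sc: "x \<in> N \<Longrightarrow> sc c x \<in> N"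
begin

definition cls :: "('g \<Rightarrow>\<^sub>0 'k) \<Rightarrow> ('g \<Rightarrow>\<^sub>0 'k) set" where "cls t = N +>\<^bsub>monoid_alg G\<^esub> t"

lemma cls_eq_iff:
  assumes "Poly_Mapping.keys x \<subseteq> carrier G" "Poly_Mapping.keys y \<subseteq> carrier G"
  shows "cls x = cls y \<longleftrightarrow> x - y \<in> N"
proof -
  interpret I: ideal N "monoid_alg G :: ('k, _) module" by (rule N_ideal)
  interpret A: alg_image sc "monoid_alg G :: ('k, _) module" "{r. Poly_Mapping.keys r \<subseteq> carrier G}" id "mmul G" "sgl \<one> (1::'k)"
    by (rule monoid_alg_image) (rule monoid_axioms)
  have "x - y = x \<ominus>\<^bsub>monoid_alg G\<^esub> y"
    using A.p_diff[of x y] assms by simp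
  then show ?thesis
    unfolding cls_def using I.quotient_eq_iff_same_a_r_cos[OF N_ideal, of x y] assms by auto
qed

lemma mem_cls:
  assumes "Poly_Mapping.keys x \<subseteq> carrier G" "y \<in> cls x"
  shows "Poly_Mapping.keys y \<subseteq> carrier G" "y - x \<in> N"
proof -
  interpret I: ideal N "monoid_alg G :: ('k, _) module" by (rule N_ideal)
  show y: "Poly_Mapping.keys y \<subseteq> carrier G"
    using assms I.a_r_coset_subset_G[of N x] I.a_subset by (auto simp: cls_def)
  have "cls x = cls y"
    unfolding cls_def
    by (rule I.a_repr_independence; (rule I.a_subgroup | use assms in \<open>simp add: cls_def\<close>))
  then show "y - x \<in> N"
    using assms y cls_eq_iff[of y x] by simp
qed

lemma self_mem_cls:
  assumes "Poly_Mapping.keys x \<subseteq> carrier G"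
  shows "x \<in> cls x"
proof -
  interpret I: ideal N "monoid_alg G :: ('k, _) module" by (rule N_ideal)
  show ?thesis using assms I.a_rcos_self[of x] by (simp add: cls_def)
qed

lemma induced_cls:
  assumes "Poly_Mapping.keys x \<subseteq> carrier G"
    and "\<And>y. Poly_Mapping.keys y \<subseteq> carrier G \<Longrightarrow> y - x \<in> N \<Longrightarrow> f y = f x"
  shows "induced f (cls x) = f x"
proof -
  have "f ` cls x = {f x}"
    using assms(2) mem_cls[OF assms(1)] self_mem_cls[OF assms(1)] by blast
  then show ?thesis by (simp add: induced_def)
qed

lemma quot_image: "alg_image sc (alg_quot (monoid_alg G) N) {r. Poly_Mapping.keys r \<subseteq> carrier G} cls (mmul G) (sgl \<one> 1)"
proof -
  interpret I: ideal N "monoid_alg G :: ('k, _) module" by (rule N_ideal)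
  interpret A: alg_image sc "monoid_alg G :: ('k, _) module" "{r. Poly_Mapping.keys r \<subseteq> carrier G}" id "mmul G" "sgl \<one> (1::'k)"
    by (rule monoid_alg_image) (rule monoid_axioms)
  have smult: "c \<odot>\<^bsub>alg_quot (monoid_alg G) N\<^esub> cls x = cls (sc c x)" if x: "Poly_Mapping.keys x \<subseteq> carrier G" for c x
  proof -
    have "cls (sc c y) = cls (sc c x)" if "y \<in> cls x" for y
    proof -
      have "sc c y - sc c x = sc c (y - x)"
        by (rule poly_mapping_eqI) (simp add: lookup_minus right_diff_distrib)
      then have "sc c y - sc c x \<in> N"
        using N_sc mem_cls(2)[OF x that] by simp
      then show ?thesis
        using x mem_cls(1)[OF x that] by (subst cls_eq_iff) (meson keys_sc order_trans)+
    qed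
    then have "(\<Union>y\<in>cls x. cls (sc c y)) = cls (sc c x)"
      using self_mem_cls[OF x] by blast
    then show ?thesis
      by (simp add: alg_quot_def cls_def)
  qed
  have carr: "carrier (alg_quot (monoid_alg G) N) = cls ` {r. Poly_Mapping.keys r \<subseteq> carrier G}"
    by (auto simp: alg_quot_def FactRing_def A_RCOSETS_def' cls_def)
  have add: "cls (x + y) = cls x \<oplus>\<^bsub>alg_quot (monoid_alg G) N\<^esub> cls y"
    if "Poly_Mapping.keys x \<subseteq> carrier G" "Poly_Mapping.keys y \<subseteq> carrier G" for x y
    using I.a_rcos_sum[of x y] that by (simp add: alg_quot_def FactRing_def cls_def)
  have mult: "cls (mmul G x y) = cls x \<otimes>\<^bsub>alg_quot (monoid_alg G) N\<^esub> cls y"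
    if "Poly_Mapping.keys x \<subseteq> carrier G" "Poly_Mapping.keys y \<subseteq> carrier G" for x y
    using I.rcoset_mult_add[of x y] that by (simp add: alg_quot_def FactRing_def cls_def monoid_alg_mult)
  have zero: "cls 0 = \<zero>\<^bsub>alg_quot (monoid_alg G) N\<^esub>"
    using I.a_coset_add_zero[of N] I.a_subset by (simp add: alg_quot_def FactRing_def cls_def)
  have one: "cls (sgl \<one> 1) = \<one>\<^bsub>alg_quot (monoid_alg G) N\<^esub>"
    by (simp add: alg_quot_def FactRing_def cls_def)
  note m = A.mu_add A.mu_scl A.mu_assoc A.mu_unit A.mu_closed A.u_closed A.S_add A.S_scl
  show ?thesis
    using m by unfold_locales (simp_all add: add mult zero one carr smult)
qed

end


section \<open>Tensor powers\<close>

lemma mspan_minimal: "submodule N field_alg M \<Longrightarrow> S \<subseteq> N \<Longrightarrow> mspan M S \<subseteq> N"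
  by (auto simp: mspan_def)

lemma mspan_superset: "S \<subseteq> mspan M S"
  by (auto simp: mspan_def)

lemma (in lin_image) submoduleI:
  assumes "N \<subseteq> carrier M" "\<zero> \<in> N" "\<And>x y. x \<in> N \<Longrightarrow> y \<in> N \<Longrightarrow> x \<oplus> y \<in> N" "\<And>a x. x \<in> N \<Longrightarrow> a \<odot> x \<in> N"
  shows "submodule N field_alg M"
proof (rule mod.submoduleI)
  fix a assume a: "a \<in> N"
  then obtain x where x: "x \<in> S" "a = p x"
    using assms(1) by (auto elim: carrierE)
  then have "\<ominus> a = (-1) \<odot> a"
    by (simp add: p_uminus[symmetric] p_scl[symmetric] scl_minus)
  then show "\<ominus> a \<in> N"
    using assms a by simp
qed (use assms in auto)

lemma (in lin_image) submoduleD: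
  assumes "submodule N field_alg M"
  shows "N \<subseteq> carrier M" "\<zero> \<in> N" "\<And>x y. x \<in> N \<Longrightarrow> y \<in> N \<Longrightarrow> x \<oplus> y \<in> N" "\<And>a x. x \<in> N \<Longrightarrow> a \<odot> x \<in> N"
proof -
  interpret submodule N field_alg M by fact
  show "N \<subseteq> carrier M" "\<zero> \<in> N" "\<And>x y. x \<in> N \<Longrightarrow> y \<in> N \<Longrightarrow> x \<oplus> y \<in> N" "\<And>a x. x \<in> N \<Longrightarrow> a \<odot> x \<in> N"
    using subset one_closed m_closed smult_closed by auto
qed

lemma (in lin_image) submodule_mspan:
  assumes "Y \<subseteq> carrier M"
  shows "submodule (mspan M Y) field_alg M"
proof -
  have "mspan M Y \<subseteq> carrier M"
    using assms by (intro mspan_minimal mod.carrier_is_submodule)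
  then show ?thesis
    by (rule submoduleI) (auto simp: mspan_def dest: submoduleD(2,3,4))
qed

lemma tuple_monoid_simps [simp]:
  "carrier (tuple_monoid H n) = {xs. length xs = n \<and> set xs \<subseteq> carrier H}"
  "xs \<otimes>\<^bsub>tuple_monoid H n\<^esub> ys = map2 (\<lambda>x y. x \<otimes>\<^bsub>H\<^esub> y) xs ys"
  "\<one>\<^bsub>tuple_monoid H n\<^esub> = replicate n \<one>\<^bsub>H\<^esub>"
  by (simp_all add: tuple_monoid_def)

lemma monoid_tuple_monoid:
  assumes "Group.monoid H"
  shows "Group.monoid (tuple_monoid H n)"
proof -
  interpret H: Group.monoid H by fact
  show ?thesis
  proof (rule Group.monoidI)
    fix x y assume "x \<in> carrier (tuple_monoid H n)" "y \<in> carrier (tuple_monoid H n)"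
    then show "x \<otimes>\<^bsub>tuple_monoid H n\<^esub> y \<in> carrier (tuple_monoid H n)"
      by (fastforce simp: set_zip subset_iff in_set_conv_nth)
  qed (auto intro!: nth_equalityI H.m_assoc simp: subset_iff)
qed

abbreviation tuples :: "('k::field, 'a, 'm) module_scheme \<Rightarrow> nat \<Rightarrow> ('a list \<Rightarrow>\<^sub>0 'k) set" where
  "tuples H n \<equiv> {t. Poly_Mapping.keys t \<subseteq> {xs. length xs = n \<and> set xs \<subseteq> carrier H}}"

context assoc_algebra
begin

lemma ring_H: "ring H" and monoid_H: "Group.monoid H"
  using assoc_algebra_axioms by (auto simp: assoc_algebra_def ring_def)

lemma distrib_H:
  assumes "x \<in> carrier H" "y \<in> carrier H" "z \<in> carrier H"
  shows "(x \<oplus> y) \<otimes> z = x \<otimes> z \<oplus> y \<otimes> z" "z \<otimes> (x \<oplus> y) = z \<otimes> x \<oplus> z \<otimes> y"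
  using assms by (simp_all add: ring.ring_simprules[OF ring_H])

lemma tuple_image: "alg_image sc (monoid_alg (tuple_monoid H n)) (tuples H n) id
    (mmul (tuple_monoid H n)) (sgl (replicate n \<one>) 1)"
  using monoid_alg_image[OF monoid_tuple_monoid[OF monoid_H, of n]] by simp

lemma multilinear_rels_subset: "multilinear_rels H n \<subseteq> tuples H n"
  by (auto simp: multilinear_rels_def dest!: subsetD[OF keys_diff] split: if_splits)

lemma multilinear_submodule: "submodule (multilinear_ideal H n) field_alg (monoid_alg (tuple_monoid H n))"
proof -
  interpret A: alg_image sc "monoid_alg (tuple_monoid H n)" "tuples H n" id "mmul (tuple_monoid H n)" "sgl (replicate n \<one>) 1"
    by (rule tuple_image)
  show ?thesis
    unfolding multilinear_ideal_def
    by (rule A.submodule_mspan) (use multilinear_rels_subset in auto)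
qed

text \<open>Multiplication of tuples is slotwise, so distributivity turns a relation in one slot
  into a relation of the same kind in that slot.\<close>

lemma multilinear_rels_mult:
  assumes r: "r \<in> multilinear_rels H n" and zs: "length zs = n" "set zs \<subseteq> carrier H"
  shows "mmul (tuple_monoid H n) (sgl zs 1) r \<in> multilinear_rels H n"
    and "mmul (tuple_monoid H n) r (sgl zs 1) \<in> multilinear_rels H n"
proof -
  \<comment> \<open>The factor \<open>zs\<close> is cut at the slot in which the relation
    lives.\<close>
  have split: "\<exists>zs1 z zs2. zs = zs1 @ z # zs2 \<and> length zs1 = l \<and> length zs2 = m" if "l + m + 1 = n" for l m
    using that zs id_take_nth_drop[of l zs] by (intro exI[of _ "take l zs"] exI[of _ "zs ! l"] exI[of _ "drop (Suc l) zs"]) auto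
  have map2: "set (map2 (\<lambda>x y. x \<otimes> y) xs ys) \<subseteq> carrier H" if "set xs \<subseteq> carrier H" "set ys \<subseteq> carrier H" for xs ys
    using that by (auto simp: subset_iff dest: set_zip_leftD set_zip_rightD)
  from r consider (add) xs x y ys where
      "r = sgl (xs @ (x \<oplus> y) # ys) 1 - sgl (xs @ x # ys) 1 - sgl (xs @ y # ys) 1"
      "length xs + length ys + 1 = n" "set xs \<union> set ys \<union> {x, y} \<subseteq> carrier H"
    | (smult) xs c x ys where "r = sgl (xs @ (c \<odot> x) # ys) 1 - sgl (xs @ x # ys) c"
      "length xs + length ys + 1 = n" "set xs \<union> set ys \<union> {x} \<subseteq> carrier H"
    unfolding multilinear_rels_def by auto
  then have "mmul (tuple_monoid H n) (sgl zs 1) r \<in> multilinear_rels H n \<and>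
    mmul (tuple_monoid H n) r (sgl zs 1) \<in> multilinear_rels H n"
  proof cases
    case add
    obtain zs1 z zs2 where z: "zs = zs1 @ z # zs2" "length zs1 = length xs" "length zs2 = length ys"
      using split[OF add(2)] by auto
    have "z \<in> carrier H" using zs z by auto
    have 1: "mmul (tuple_monoid H n) (sgl zs 1) r =
       sgl (map2 (\<otimes>) zs1 xs @ (z \<otimes> x \<oplus> z \<otimes> y) # map2 (\<otimes>) zs2 ys) 1 - sgl (map2 (\<otimes>) zs1 xs @ (z \<otimes> x) # map2 (\<otimes>) zs2 ys) 1
         - sgl (map2 (\<otimes>) zs1 xs @ (z \<otimes> y) # map2 (\<otimes>) zs2 ys) 1"
      using add z \<open>z \<in> _\<close>
      by (simp add: mmul_def pm.lext_diff distrib_H)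
    have 2: "mmul (tuple_monoid H n) r (sgl zs 1) =
       sgl (map2 (\<otimes>) xs zs1 @ (x \<otimes> z \<oplus> y \<otimes> z) # map2 (\<otimes>) ys zs2) 1 - sgl (map2 (\<otimes>) xs zs1 @ (x \<otimes> z) # map2 (\<otimes>) ys zs2) 1
         - sgl (map2 (\<otimes>) xs zs1 @ (y \<otimes> z) # map2 (\<otimes>) ys zs2) 1"
      using add z \<open>z \<in> _\<close>
      by (simp add: mmul_def pm.lext_diff distrib_H)
    have c: "set (map2 (\<otimes>) zs1 xs) \<subseteq> carrier H" "set (map2 (\<otimes>) zs2 ys) \<subseteq> carrier H"
      "set (map2 (\<otimes>) xs zs1) \<subseteq> carrier H" "set (map2 (\<otimes>) ys zs2) \<subseteq> carrier H"
      by (rule map2; use add zs z in auto)+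
    show ?thesis
      unfolding 1 2 multilinear_rels_def
      apply (intro conjI UnI1 CollectI)
      subgoal by (intro exI conjI, rule refl) (use c add zs z \<open>z \<in> _\<close> in auto)
      subgoal by (intro exI conjI, rule refl) (use c add zs z \<open>z \<in> _\<close> in auto)
      done
  next
    case smult
    obtain zs1 z zs2 where z: "zs = zs1 @ z # zs2" "length zs1 = length xs" "length zs2 = length ys"
      using split[OF smult(2)] by auto
    have "z \<in> carrier H" using zs z by auto
    have 1: "mmul (tuple_monoid H n) (sgl zs 1) r =
       sgl (map2 (\<otimes>) zs1 xs @ (c \<odot> (z \<otimes> x)) # map2 (\<otimes>) zs2 ys) 1 - sgl (map2 (\<otimes>) zs1 xs @ (z \<otimes> x) # map2 (\<otimes>) zs2 ys) c"
      using smult z \<open>z \<in> _\<close>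
      by (simp add: mmul_def pm.lext_diff smult_mult_right)
    have 2: "mmul (tuple_monoid H n) r (sgl zs 1) =
       sgl (map2 (\<otimes>) xs zs1 @ (c \<odot> (x \<otimes> z)) # map2 (\<otimes>) ys zs2) 1 - sgl (map2 (\<otimes>) xs zs1 @ (x \<otimes> z) # map2 (\<otimes>) ys zs2) c"
      using smult z \<open>z \<in> _\<close>
      by (simp add: mmul_def pm.lext_diff smult_mult_left)
    have c: "set (map2 (\<otimes>) zs1 xs) \<subseteq> carrier H" "set (map2 (\<otimes>) zs2 ys) \<subseteq> carrier H"
      "set (map2 (\<otimes>) xs zs1) \<subseteq> carrier H" "set (map2 (\<otimes>) ys zs2) \<subseteq> carrier H"
      by (rule map2; use smult zs z in auto)+
    show ?thesis
      unfolding 1 2 multilinear_rels_def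
      apply (intro conjI UnI2 CollectI)
      subgoal by (intro exI conjI, rule refl) (use c smult zs z \<open>z \<in> _\<close> in auto)
      subgoal by (intro exI conjI, rule refl) (use c smult zs z \<open>z \<in> _\<close> in auto)
      done
  qed
  then show "mmul (tuple_monoid H n) (sgl zs 1) r \<in> multilinear_rels H n"
    "mmul (tuple_monoid H n) r (sgl zs 1) \<in> multilinear_rels H n" by auto
qed

text \<open>By definition the relations span only a submodule; it is an ideal because the relations
  are stable under multiplication by tuples, and tuples span.\<close>

lemma tensor_quot: "quot_alg (tuple_monoid H n) (multilinear_ideal H n)"
proof -
  let ?G = "tuple_monoid H n" and ?N = "multilinear_ideal H n"
  interpret A: alg_image sc "monoid_alg ?G" "tuples H n" id "mmul ?G" "sgl (replicate n \<one>) 1"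
    by (rule tuple_image)
  note N = A.submoduleD[OF multilinear_submodule, simplified]
  have base: "mmul ?G x r \<in> ?N \<and> mmul ?G r x \<in> ?N"
    if r: "r \<in> multilinear_rels H n" and x: "x \<in> tuples H n" for r x
  proof (induction x rule: pm_induct)
    case zero
    show ?case using N by simp
  next
    case (single zs a)
    have eq: "sgl zs a = sc a (sgl zs 1)" by simp
    have "mmul ?G (sgl zs 1) r \<in> ?N" "mmul ?G r (sgl zs 1) \<in> ?N"
      unfolding multilinear_ideal_def
      by (rule subsetD[OF mspan_superset] multilinear_rels_mult[OF r]; use single x in auto)+
    then show ?case
      unfolding eq mmul_sc by (simp add: N(4))
  next
    case (add s t)
    then show ?case by (simp add: mmul_add N)
  qed
  \<comment> \<open>A submodule containing the relations, hence containing their span: this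
    transfers stability from the relations to \<open>?N\<close>.\<close>
  define T where "T = {t \<in> tuples H n. \<forall>x\<in>tuples H n. mmul ?G x t \<in> ?N \<and> mmul ?G t x \<in> ?N}"
  have "submodule T field_alg (monoid_alg ?G)"
    by (rule A.submoduleI)
      (use keys_sc in \<open>auto simp: T_def mmul_add mmul_sc N keys_add_subset dest: subsetD[OF keys_sc]\<close>)
  moreover have "multilinear_rels H n \<subseteq> T"
    using multilinear_rels_subset[of n] base unfolding T_def by blast
  ultimately have "?N \<subseteq> T"
    unfolding multilinear_ideal_def by (rule mspan_minimal)
  show ?thesis
  proof (intro quot_alg.intro quot_alg_axioms.intro)
    show "Group.monoid ?G" by (rule monoid_tuple_monoid) (rule monoid_H)
    show "ideal ?N (monoid_alg ?G)"
    proof (rule idealI, goal_cases)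
      case 1
      show ?case by (rule A.alg.ring_H)
    next
      case 2
      show ?case by (rule submodule.axioms(1)) (rule multilinear_submodule)
    qed (use \<open>?N \<subseteq> T\<close> in \<open>auto simp: T_def monoid_alg_mult\<close>)
  qed (rule N)
qed

end

definition tp :: "('k::field, 'a, 'm) module_scheme \<Rightarrow> nat \<Rightarrow> ('a list \<Rightarrow>\<^sub>0 'k) \<Rightarrow> ('a list \<Rightarrow>\<^sub>0 'k) set" where
  "tp H n t = multilinear_ideal H n +>\<^bsub>monoid_alg (tuple_monoid H n)\<^esub> t"

lemma pure_tensor_tp: "pure_tensor H xs = tp H (length xs) (sgl xs 1)"
  by (simp add: pure_tensor_def tp_def)

definition multilin :: "('k::field, 'a, 'm) module_scheme \<Rightarrow> nat \<Rightarrow> ('k, 'b, 'n) module_scheme \<Rightarrow> ('a list \<Rightarrow> 'b) \<Rightarrow> bool" where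
  "multilin H n M f \<longleftrightarrow>
    (\<forall>xs. length xs = n \<and> set xs \<subseteq> carrier H \<longrightarrow> f xs \<in> carrier M) \<and>
    (\<forall>xs x y ys. length xs + length ys + 1 = n \<and> set xs \<union> set ys \<union> {x, y} \<subseteq> carrier H \<longrightarrow>
      f (xs @ (x \<oplus>\<^bsub>H\<^esub> y) # ys) = f (xs @ x # ys) \<oplus>\<^bsub>M\<^esub> f (xs @ y # ys)) \<and>
    (\<forall>xs c x ys. length xs + length ys + 1 = n \<and> set xs \<union> set ys \<union> {x} \<subseteq> carrier H \<longrightarrow>
      f (xs @ (c \<odot>\<^bsub>H\<^esub> x) # ys) = c \<odot>\<^bsub>M\<^esub> f (xs @ x # ys))"

context assoc_algebra
begin

lemma tensor_image: "alg_image sc (tensor_power H n) (tuples H n) (tp H n)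
    (mmul (tuple_monoid H n)) (sgl (replicate n \<one>) 1)"
proof -
  interpret Q: quot_alg "tuple_monoid H n" "multilinear_ideal H n" by (rule tensor_quot)
  have "Q.cls = tp H n" by (auto simp: Q.cls_def tp_def)
  with Q.quot_image show ?thesis by (simp add: tensor_power_def)
qed

lemma tp_eq_iff: "x \<in> tuples H n \<Longrightarrow> y \<in> tuples H n \<Longrightarrow> tp H n x = tp H n y \<longleftrightarrow> x - y \<in> multilinear_ideal H n"
proof -
  interpret Q: quot_alg "tuple_monoid H n" "multilinear_ideal H n" by (rule tensor_quot)
  show "x \<in> tuples H n \<Longrightarrow> y \<in> tuples H n \<Longrightarrow> tp H n x = tp H n y \<longleftrightarrow> x - y \<in> multilinear_ideal H n"
    using Q.cls_eq_iff[of x y] by (simp add: Q.cls_def tp_def)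
qed

text \<open>Evaluates a lifted multilinear map on representatives. The chosen preimages of the
  values of \<open>f\<close> need not depend linearly on the arguments; only their images under
  \<open>p\<close> have to respect the relations.\<close>

lemma tensor_lift_tp:
  assumes "lin_image scl M S p" and f: "multilin H n M f" and t: "t \<in> tuples H n"
  shows "tensor_lift M f (tp H n t) = p (scaling.lext scl (\<lambda>xs. lin_image.pre S p (f xs)) t)"
proof -
  interpret L: lin_image scl M S p by fact
  interpret Q: quot_alg "tuple_monoid H n" "multilinear_ideal H n" by (rule tensor_quot)
  interpret A: alg_image sc "monoid_alg (tuple_monoid H n)" "tuples H n" id "mmul (tuple_monoid H n)" "sgl (replicate n \<one>) 1"
    by (rule tuple_image)
  define F where "F xs = L.pre (f xs)" for xs
  have F: "F xs \<in> S \<and> p (F xs) = f xs" if "length xs = n" "set xs \<subseteq> carrier H" for xs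
    unfolding F_def using that f by (intro L.pre) (auto simp: multilin_def)
  have lS [simp]: "L.lext F t \<in> S" if "Poly_Mapping.keys t \<subseteq> {xs. length xs = n \<and> set xs \<subseteq> carrier H}" for t
    using that F by (intro L.lext_in_S) auto
  have le: "linear_ext M f t = p (L.lext F t)" if "t \<in> tuples H n" for t
    using that F by (intro L.linear_ext_image) auto
  \<comment> \<open>The formal combinations killed by the extension of \<open>f\<close>. Containing
    the multilinearity relations, they contain the whole ideal.\<close>
  define T where "T = {t \<in> tuples H n. p (L.lext F t) = \<zero>\<^bsub>M\<^esub>}"
  have "submodule T field_alg (monoid_alg (tuple_monoid H n))"
    by (rule A.submoduleI)
      (use keys_sc in \<open>auto simp: T_def L.lext_add L.lext_sc L.p_add L.p_scl L.p_zero keys_add_subset dest: subsetD[OF keys_sc]\<close>)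
  moreover have "multilinear_rels H n \<subseteq> T"
  proof
    fix r assume r: "r \<in> multilinear_rels H n"
    then have "p (L.lext F r) = \<zero>\<^bsub>M\<^esub>"
      unfolding multilinear_rels_def
    proof (elim UnE CollectE exE conjE)
      fix xs x y ys
      assume *: "r = sgl (xs @ (x \<oplus> y) # ys) 1 - sgl (xs @ x # ys) 1 - sgl (xs @ y # ys) 1"
        "length xs + length ys + 1 = n" "set xs \<union> set ys \<union> {x, y} \<subseteq> carrier H"
      then have "p (F (xs @ (x \<oplus> y) # ys)) = p (F (xs @ x # ys)) \<oplus>\<^bsub>M\<^esub> p (F (xs @ y # ys))"
        using f F by (auto simp: multilin_def)
      also have "\<dots> = p (F (xs @ x # ys) + F (xs @ y # ys))"
        using * F by (subst L.p_add) auto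
      finally have "p (F (xs @ (x \<oplus> y) # ys) - (F (xs @ x # ys) + F (xs @ y # ys))) = \<zero>\<^bsub>M\<^esub>"
        using * F by (subst L.p_diff) (auto simp: L.mod.M.r_neg a_minus_def)
      moreover have "L.lext F r = F (xs @ (x \<oplus> y) # ys) - (F (xs @ x # ys) + F (xs @ y # ys))"
        by (simp add: *(1) L.lext_diff L.lext_add diff_diff_eq)
      ultimately show ?thesis by simp
    next
      fix xs c x ys
      assume *: "r = sgl (xs @ (c \<odot> x) # ys) 1 - sgl (xs @ x # ys) c"
        "length xs + length ys + 1 = n" "set xs \<union> set ys \<union> {x} \<subseteq> carrier H"
      then have "p (F (xs @ (c \<odot> x) # ys)) = c \<odot>\<^bsub>M\<^esub> p (F (xs @ x # ys))"
        using f F by (auto simp: multilin_def)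
      also have "\<dots> = p (scl c (F (xs @ x # ys)))"
        using * F by (subst L.p_scl) auto
      finally have "p (F (xs @ (c \<odot> x) # ys) - scl c (F (xs @ x # ys))) = \<zero>\<^bsub>M\<^esub>"
        using * F by (subst L.p_diff) (auto simp: L.mod.M.r_neg a_minus_def)
      moreover have "L.lext F r = F (xs @ (c \<odot> x) # ys) - scl c (F (xs @ x # ys))"
        by (simp add: *(1) L.lext_diff)
      ultimately show ?thesis by simp
    qed
    then show "r \<in> T"
      using multilinear_rels_subset r by (auto simp: T_def)
  qed
  ultimately have NT: "multilinear_ideal H n \<subseteq> T"
    unfolding multilinear_ideal_def by (rule mspan_minimal)
  have "induced (linear_ext M f) (Q.cls t) = linear_ext M f t"
  proof (rule Q.induced_cls)
    fix y assume y: "Poly_Mapping.keys y \<subseteq> carrier (tuple_monoid H n)" "y - t \<in> multilinear_ideal H n"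
    then have "p (L.lext F (y - t)) = \<zero>\<^bsub>M\<^esub>" using NT by (auto simp: T_def)
    then show "linear_ext M f y = linear_ext M f t"
      using y t by (auto simp: le L.lext_diff intro!: L.p_eqI)
  qed (use t in auto)
  then show ?thesis
    using le t unfolding F_def by (simp add: tensor_lift_def tp_def Q.cls_def)
qed

lemma tp_slot_add:
  assumes "length xs + length ys + 1 = n" "set xs \<union> set ys \<union> {x, y} \<subseteq> carrier H"
  shows "tp H n (sgl (xs @ (x \<oplus> y) # ys) a) = tp H n (sgl (xs @ x # ys) a + sgl (xs @ y # ys) a)"
proof -
  interpret T: alg_image sc "tensor_power H n" "tuples H n" "tp H n" "mmul (tuple_monoid H n)" "sgl (replicate n \<one>) 1"
    by (rule tensor_image)
  let ?r = "sgl (xs @ (x \<oplus> y) # ys) 1 - sgl (xs @ x # ys) 1 - sgl (xs @ y # ys) 1"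
  have "?r \<in> multilinear_rels H n"
    using assms unfolding multilinear_rels_def by blast
  then have "?r \<in> multilinear_ideal H n"
    by (simp add: multilinear_ideal_def subsetD[OF mspan_superset])
  then have 1: "tp H n (sgl (xs @ (x \<oplus> y) # ys) 1) = tp H n (sgl (xs @ x # ys) 1 + sgl (xs @ y # ys) 1)"
    using assms by (subst tp_eq_iff) (auto simp: diff_diff_eq dest!: subsetD[OF Poly_Mapping.keys_add] split: if_splits)
  have "tp H n (sc a (sgl (xs @ (x \<oplus> y) # ys) 1)) = tp H n (sc a (sgl (xs @ x # ys) 1 + sgl (xs @ y # ys) 1))"
    using assms by (subst (1 2) T.p_scl) (auto simp: 1 dest!: subsetD[OF Poly_Mapping.keys_add] split: if_splits)
  then show ?thesis by (simp add: pm.scl_right)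
qed

lemma tp_slot_smult:
  assumes "length xs + length ys + 1 = n" "set xs \<union> set ys \<union> {x} \<subseteq> carrier H"
  shows "tp H n (sgl (xs @ (c \<odot> x) # ys) a) = tp H n (sgl (xs @ x # ys) (a * c))"
proof -
  interpret T: alg_image sc "tensor_power H n" "tuples H n" "tp H n" "mmul (tuple_monoid H n)" "sgl (replicate n \<one>) 1"
    by (rule tensor_image)
  let ?r = "sgl (xs @ (c \<odot> x) # ys) 1 - sgl (xs @ x # ys) c"
  have "?r \<in> multilinear_rels H n"
    using assms unfolding multilinear_rels_def by blast
  then have "?r \<in> multilinear_ideal H n"
    by (simp add: multilinear_ideal_def subsetD[OF mspan_superset])
  then have 1: "tp H n (sgl (xs @ (c \<odot> x) # ys) 1) = tp H n (sgl (xs @ x # ys) c)"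
    using assms by (subst tp_eq_iff) auto
  have "tp H n (sc a (sgl (xs @ (c \<odot> x) # ys) 1)) = tp H n (sc a (sgl (xs @ x # ys) c))"
    using assms by (subst (1 2) T.p_scl) (auto simp: 1)
  then show ?thesis by simp
qed

end


section \<open>The free algebra\<close>

text \<open>With concatenation as addition of words, the convolution product of finitely supported
  functions is the product of the free algebra, and the ring rules of the type class become
  available.\<close>

instantiation list :: (type) monoid_add
begin

definition zero_list :: "'a list" where [simp]: "zero_list = []"
definition plus_list :: "'a list \<Rightarrow> 'a list \<Rightarrow> 'a list" where [simp]: "plus_list = (@)"

instance by standard auto

end

lemma sgl_Nil [simp]: "sgl [] (1::'k::field) = 1"
  using single_one by (metis zero_list_def)

lemma sc_mult_left [simp]: "sc a x * y = sc a (x * (y :: 'g::monoid_add \<Rightarrow>\<^sub>0 'k::field))"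
  by (simp add: mult_map_scale_conv_mult mult.assoc)

lemma sc_mult_right [simp]: "x * sc a y = sc a (x * (y :: 'g::monoid_add \<Rightarrow>\<^sub>0 'k::field))"
proof (induction x rule: pm_induct)
  case (single w b)
  show ?case
    by (induction y rule: pm_induct) (simp_all add: mult_single pm.scl_right distrib_left mult.left_commute)
qed (simp_all add: distrib_right pm.scl_right)

lemma pm_lext_mult:
  assumes "\<And>u v. f (u + v) = f u * f v"
  shows "pm.lext f (x * y) = pm.lext f x * (pm.lext f y :: 'h::monoid_add \<Rightarrow>\<^sub>0 'k::field)"
proof (induction x rule: pm_induct)
  case (single w b)
  show ?case
    by (induction y rule: pm_induct) (simp_all add: mult_single assms pm.lext_add distrib_left mult.commute flip: pm.scl_mult)
qed (simp_all add: distrib_right pm.lext_add)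

abbreviation wrd :: "'g list \<Rightarrow> 'g list \<Rightarrow>\<^sub>0 'k::field" where "wrd w \<equiv> sgl w 1"

lemma wrd_mult: "wrd u * wrd v = wrd (u @ v)"
  by (simp add: mult_single)

lemma word_induct [case_names single add sc]:
  assumes "\<And>w. P (wrd w)" "\<And>s t. P s \<Longrightarrow> P t \<Longrightarrow> P (s + t)" "\<And>a s. P s \<Longrightarrow> P (sc a s)"
  shows "P (x :: 'g list \<Rightarrow>\<^sub>0 'k::field)"
proof (induction x rule: pm_induct)
  case zero
  show ?case using assms(3)[OF assms(1), of 0] by simp
next
  case (single w a)
  show ?case using assms(3)[OF assms(1), of a w] by simp
qed (rule assms(2))

section \<open>Sweedler splittings of words\<close>

text \<open>
  The coproduct of a word in the generators is a sum of tensors of words which does not depend on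
  the parameters: \<open>spl w f\<close> is the sum of \<open>f u v\<close> over these tensors \<open>u \<otimes> v\<close>.
\<close>

fun gspl :: "'i qgen \<Rightarrow> ('i qgen list \<Rightarrow> 'i qgen list \<Rightarrow> 'v::comm_monoid_add) \<Rightarrow> 'v" where
  "gspl (Egen i) f = f [Egen i] [] + f [Om i] [Egen i]"
| "gspl (Fgen i) f = f [] [Fgen i] + f [Fgen i] [Om' i]"
| "gspl g f = f [g] [g]"

primrec spl :: "'i qgen list \<Rightarrow> ('i qgen list \<Rightarrow> 'i qgen list \<Rightarrow> 'v::comm_monoid_add) \<Rightarrow> 'v" where
  "spl [] f = f [] []"
| "spl (x # w) f = gspl x (\<lambda>a b. spl w (\<lambda>u v. f (a @ u) (b @ v)))"

lemma gspl_add: "gspl x (\<lambda>a b. f a b + g a b) = gspl x f + gspl x g"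
  by (cases x) (auto simp: add_ac)

lemma spl_add: "spl w (\<lambda>a b. f a b + g a b) = spl w f + spl w g"
  by (induction w arbitrary: f g) (auto simp: gspl_add)

lemma gspl_hom: "(\<And>x y. h (x + y) = h x + h y) \<Longrightarrow> h (gspl x f) = gspl x (\<lambda>a b. h (f a b))"
  by (cases x) auto

lemma spl_hom: "(\<And>x y. h (x + y) = h x + h y) \<Longrightarrow> h (spl w f) = spl w (\<lambda>a b. h (f a b))"
  by (induction w arbitrary: f) (auto simp: gspl_hom)

lemma spl_zero [simp]: "spl w (\<lambda>u v. 0) = 0"
proof (induction w)
  case (Cons x w)
  then show ?case by (cases x) auto
qed simp

lemma spl_gspl: "spl w (\<lambda>u v. gspl x (\<lambda>a b. f a b u v)) = gspl x (\<lambda>a b. spl w (\<lambda>u v. f a b u v))"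
  by (cases x) (simp_all add: spl_add)

lemma spl_append: "spl (w @ w') f = spl w (\<lambda>u v. spl w' (\<lambda>u' v'. f (u @ u') (v @ v')))"
  by (induction w arbitrary: f) auto

text \<open>Induction reduces this to one letter, where \<open>Egen\<close> and \<open>Fgen\<close>
  each give the same three tensors in either order of splitting.\<close>

lemma spl_coassoc: "spl w (\<lambda>u v. spl u (\<lambda>u1 u2. f u1 u2 v)) = spl w (\<lambda>u v. spl v (\<lambda>v1 v2. f u v1 v2))"
proof (induction w arbitrary: f)
  case (Cons x w)
  show ?case by (cases x) (simp_all add: spl_add Cons add_ac)
qed simp

definition eps :: "'i qgen list \<Rightarrow> 'k::field" where
  "eps w = prod_list (map counit_gen w)"

lemma eps_simps [simp]: "eps [] = 1" "eps (x # w) = counit_gen x * eps w" "eps (u @ v) = eps u * eps v"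
  by (simp_all add: eps_def)

text \<open>
  The torus degrees of the left and right coactions along the projection to the group algebra of
  the root lattice which kills \<open>e\<^sub>i\<close>, \<open>f\<^sub>i\<close> and identifies \<open>\<omega>\<^sub>i\<close> with \<open>\<omega>'\<^sub>i\<close>.
\<close>

fun gl :: "'i qgen \<Rightarrow> 'i \<Rightarrow>\<^sub>0 int" where
  "gl (Egen i) = sgl i 1" | "gl (Fgen i) = 0" | "gl (Om i) = sgl i 1" | "gl (Om' i) = sgl i 1"
| "gl (OmInv i) = sgl i (-1)" | "gl (OmInv' i) = sgl i (-1)"

fun gr :: "'i qgen \<Rightarrow> 'i \<Rightarrow>\<^sub>0 int" where
  "gr (Egen i) = 0" | "gr (Fgen i) = sgl i 1" | "gr (Om i) = sgl i 1" | "gr (Om' i) = sgl i 1"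
| "gr (OmInv i) = sgl i (-1)" | "gr (OmInv' i) = sgl i (-1)"

definition "ld w = sum_list (map gl w)"
definition "rd w = sum_list (map gr w)"

lemma ld_simps [simp]: "ld [] = 0" "ld (x # w) = gl x + ld w" "ld (u @ v) = ld u + ld v"
  by (simp_all add: ld_def)

lemma rd_simps [simp]: "rd [] = 0" "rd (x # w) = gr x + rd w" "rd (u @ v) = rd u + rd v"
  by (simp_all add: rd_def)

context scaling
begin

lemma spl_scl: "spl w (\<lambda>u v. scl a (f u v)) = scl a (spl w f)"
  by (rule spl_hom[symmetric]) (rule scl_right)

text \<open>The counit keeps only tensors whose left leg is a torus word. Exactly one splitting of
  \<open>w\<close> survives, with right leg \<open>w\<close> and a left leg of degree
  \<open>ld w\<close>; this is how the left coaction enters.\<close>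

lemma spl_eps_left: "spl w (\<lambda>u v. scl (eps u * h (ld u)) (f v)) = scl (h (ld w)) (f w)"
proof (induction w arbitrary: h f)
  case (Cons x w)
  show ?case
    using Cons[of "\<lambda>d. h (gl x + d)" "\<lambda>v. f (x # v)"] by (cases x) auto
qed simp

lemma spl_eps_right: "spl w (\<lambda>u v. scl (eps v * h (rd v)) (f u)) = scl (h (rd w)) (f w)"
proof (induction w arbitrary: h f)
  case (Cons x w)
  show ?case
    using Cons[of "\<lambda>d. h (gr x + d)" "\<lambda>v. f (x # v)"] by (cases x) auto
qed simp

end

lemma spl_eps_wrd:
  "spl w (\<lambda>u v. sc (eps u) (wrd v)) = wrd w" "spl w (\<lambda>u v. sc (eps v) (wrd u)) = wrd w"
  using pm.spl_eps_left[of w "\<lambda>_. 1" wrd] pm.spl_eps_right[of w "\<lambda>_. 1" wrd] by (simp_all del: map_single)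

fun ag :: "'i qgen \<Rightarrow> 'i qgen list \<Rightarrow>\<^sub>0 'k::field" where
  "ag (Egen i) = - wrd [OmInv i, Egen i]"
| "ag (Fgen i) = - wrd [Fgen i, OmInv' i]"
| "ag (Om i) = wrd [OmInv i]" | "ag (OmInv i) = wrd [Om i]"
| "ag (Om' i) = wrd [OmInv' i]" | "ag (OmInv' i) = wrd [Om' i]"

primrec antw :: "'i qgen list \<Rightarrow> 'i qgen list \<Rightarrow>\<^sub>0 'k::field" where
  "antw [] = 1" | "antw (x # w) = antw w * ag x"

abbreviation "anti \<equiv> pm.lext antw"

lemma antw_append [simp]: "antw (u @ v) = antw v * antw u"
  by (induction u) (auto simp: mult.assoc)

lemma anti_mult: "anti (x * y) = anti y * anti x"
proof (induction x rule: word_induct)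
  case (single w)
  show ?case
    by (induction y rule: word_induct)
      (simp_all add: wrd_mult distrib_left distrib_right pm.lext_add pm.lext_sc)
qed (simp_all add: distrib_left distrib_right pm.lext_add pm.lext_sc)

section \<open>Bilinear and trilinear maps\<close>

definition bilin :: "('k::field, 'a, 'm) module_scheme \<Rightarrow> ('k, 'b, 'n) module_scheme \<Rightarrow> ('a \<Rightarrow> 'a \<Rightarrow> 'b) \<Rightarrow> bool" where
  "bilin H M f \<longleftrightarrow> (\<forall>x\<in>carrier H. \<forall>y\<in>carrier H. f x y \<in> carrier M) \<and>
    (\<forall>x\<in>carrier H. \<forall>y\<in>carrier H. \<forall>z\<in>carrier H.
      f (x \<oplus>\<^bsub>H\<^esub> y) z = f x z \<oplus>\<^bsub>M\<^esub> f y z \<and> f z (x \<oplus>\<^bsub>H\<^esub> y) = f z x \<oplus>\<^bsub>M\<^esub> f z y) \<and>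
    (\<forall>c. \<forall>x\<in>carrier H. \<forall>y\<in>carrier H. f (c \<odot>\<^bsub>H\<^esub> x) y = c \<odot>\<^bsub>M\<^esub> f x y \<and> f x (c \<odot>\<^bsub>H\<^esub> y) = c \<odot>\<^bsub>M\<^esub> f x y)"

definition trilin :: "('k::field, 'a, 'm) module_scheme \<Rightarrow> ('k, 'b, 'n) module_scheme \<Rightarrow> ('a \<Rightarrow> 'a \<Rightarrow> 'a \<Rightarrow> 'b) \<Rightarrow> bool" where
  "trilin H M f \<longleftrightarrow> (\<forall>x\<in>carrier H. bilin H M (f x) \<and> bilin H M (\<lambda>y z. f y z x))"

lemma bilin_multilin:
  assumes "bilin H M f"
  shows "multilin H 2 M (\<lambda>xs. f (xs ! 0) (xs ! 1))"
proof -
  have cases: "(xs = [] \<and> (\<exists>b. ys = [b])) \<or> (ys = [] \<and> (\<exists>b. xs = [b]))"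
    if "length xs + length ys + 1 = 2" for xs ys :: "'a list"
    using that by (cases xs; cases ys) auto
  show ?thesis
    unfolding multilin_def
  proof (intro conjI allI impI, goal_cases)
    case (1 xs)
    then show ?case
      using assms unfolding bilin_def by (auto simp: subset_iff)
  next
    case (2 xs x y ys)
    then show ?case
      using cases[of xs ys] assms unfolding bilin_def by auto
  next
    case (3 xs c x ys)
    then show ?case
      using cases[of xs ys] assms unfolding bilin_def by auto
  qed
qed

lemma (in lin_image) p_gspl_cong:
  assumes "\<And>u v. f u v \<in> S \<and> g u v \<in> S \<and> p (f u v) = p (g u v)"
  shows "gspl x f \<in> S \<and> gspl x g \<in> S \<and> p (gspl x f) = p (gspl x g)"
  by (cases x) (simp_all add: assms p_add)

lemma (in lin_image) p_spl_cong:
  assumes "\<And>u v. f u v \<in> S \<and> g u v \<in> S \<and> p (f u v) = p (g u v)"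
  shows "spl w f \<in> S \<and> spl w g \<in> S \<and> p (spl w f) = p (spl w g)"
  using assms
proof (induction w arbitrary: f g)
  case (Cons x w)
  have *: "spl w (\<lambda>u v. f (a @ u) (b @ v)) \<in> S \<and> spl w (\<lambda>u v. g (a @ u) (b @ v)) \<in> S \<and>
     p (spl w (\<lambda>u v. f (a @ u) (b @ v))) = p (spl w (\<lambda>u v. g (a @ u) (b @ v)))" for a b
    by (rule Cons.IH) (rule Cons.prems)
  then show ?case unfolding spl.simps by (rule p_gspl_cong)
qed auto

section \<open>Hopf algebras presented by words\<close>

text \<open>The kernel of \<open>c\<close> is left open: the locale serves for the quantum group,
  for the quotient by the non-Serre relations alone, and for the deformation. The inverse laws of
  the torus letters are what makes the antipode identities hold on words.\<close>

locale word_algebra =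
  fixes H :: "('k::field, 'b, 'm) module_scheme" (structure) and c :: "('i qgen list \<Rightarrow>\<^sub>0 'k) \<Rightarrow> 'b"
  assumes carrier_c: "carrier H = range c"
    and c_add: "c (x + y) = c x \<oplus> c y" and c_sc: "c (sc a x) = a \<odot> c x" and c_zero: "c 0 = \<zero>"
    and c_mult: "c (x * y) = c x \<otimes> c y" and c_one: "c 1 = \<one>"
    and c_inv: "c (wrd [Om i, OmInv i]) = c 1" "c (wrd [OmInv i, Om i]) = c 1"
      "c (wrd [Om' i, OmInv' i]) = c 1" "c (wrd [OmInv' i, Om' i]) = c 1"
begin

sublocale alg_image sc H UNIV c "(*)" 1
  by unfold_locales (auto simp: carrier_c c_add c_sc c_zero c_mult c_one distrib_left distrib_right mult.assoc)

lemma tensor_image_H: "alg_image sc (tensor_power H n) (tuples H n) (tp H n)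
    (mmul (tuple_monoid H n)) (sgl (replicate n \<one>) 1)"
  by (rule alg.tensor_image)

definition dt :: "('i qgen list \<Rightarrow>\<^sub>0 'k) \<Rightarrow> 'b list \<Rightarrow>\<^sub>0 'k" where
  "dt = pm.lext (\<lambda>w. spl w (\<lambda>u v. sgl [c (wrd u), c (wrd v)] 1))"

lemma dt_wrd: "dt (wrd w) = spl w (\<lambda>u v. sgl [c (wrd u), c (wrd v)] 1)"
  by (simp add: dt_def)

lemma dt_closed [simp]: "dt x \<in> tuples H 2"
proof -
  interpret T: alg_image sc "tensor_power H 2" "tuples H 2" "tp H 2" "mmul (tuple_monoid H 2)" "sgl (replicate 2 \<one>) 1"
    by (rule tensor_image_H)
  have "spl w (\<lambda>u v. sgl [c (wrd u), c (wrd v)] 1) \<in> tuples H 2" for w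
    by (rule conjunct1[OF T.p_spl_cong]) (auto simp: carrier_c)
  then have "Poly_Mapping.keys (spl w (\<lambda>u v. sgl [c (wrd u), c (wrd v)] (1::'k))) \<subseteq> {xs. length xs = 2 \<and> set xs \<subseteq> carrier H}" for w
    by simp
  then show ?thesis
    unfolding dt_def by (intro CollectI keys_lext)
qed

lemma dt_mult: "dt (x * y) = mmul (tuple_monoid H 2) (dt x) (dt y)"
proof (induction x rule: word_induct)
  case (single w)
  show ?case
  proof (induction y rule: word_induct)
    case (single w')
    show ?case
      unfolding wrd_mult dt_wrd spl_append
      apply (subst spl_hom[of "\<lambda>x. mmul _ x _"], rule mmul_add)
      apply (subst spl_hom[of "mmul _ _"], rule mmul_add)
      apply (simp add: mmul_sgl c_mult flip: wrd_mult)
      done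
  qed (simp_all add: dt_def distrib_left pm.lext_add pm.lext_sc mmul_add mmul_sc)
qed (simp_all add: dt_def distrib_right pm.lext_add pm.lext_sc mmul_add mmul_sc)

lemma c_cong_mult: "c x = c y \<Longrightarrow> c (u * x * v) = c (u * y * v)"
  by (simp add: c_mult)

lemma anti_inverse_gen:
  "c (gspl x (\<lambda>a b. antw a * wrd b)) = c (sc (counit_gen x) 1)"
  "c (gspl x (\<lambda>a b. wrd a * antw b)) = c (sc (counit_gen x) 1)"
proof -
  have F: "c (wrd [Fgen i, OmInv' i, Om' i]) = c (wrd [Fgen i])" for i
    using c_cong_mult[OF c_inv(4), of "wrd [Fgen i]" i 1] by (simp add: wrd_mult)
  have E: "c (wrd [Om i, OmInv i, Egen i]) = c (wrd [Egen i])" for i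
    using c_cong_mult[OF c_inv(1), of 1 i "wrd [Egen i]"] by (simp add: wrd_mult)
  show "c (gspl x (\<lambda>a b. antw a * wrd b)) = c (sc (counit_gen x) 1)"
    using F by (cases x) (simp_all add: wrd_mult c_inv p_diff c_zero mod.M.r_neg a_minus_def)
  show "c (gspl x (\<lambda>a b. wrd a * antw b)) = c (sc (counit_gen x) 1)"
    using E by (cases x) (simp_all add: wrd_mult c_inv p_diff c_zero mod.M.r_neg a_minus_def)
qed

lemma c_spl_cong: "(\<And>u v. c (f u v) = c (g u v)) \<Longrightarrow> c (spl w f) = c (spl w g)"
  using p_spl_cong[of f g w] by simp

lemma c_gspl_cong: "(\<And>u v. c (f u v) = c (g u v)) \<Longrightarrow> c (gspl w f) = c (gspl w g)"
  using p_gspl_cong[of f g w] by simp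

lemma anti_inverse_wrd:
  "c (spl w (\<lambda>u v. antw u * wrd v)) = c (sc (eps w) 1)"
  "c (spl w (\<lambda>u v. wrd u * antw v)) = c (sc (eps w) 1)"
proof (induction w)
  case (Cons x w)
  \<comment> \<open>With the antipode on the left leg the letter \<open>x\<close> is split
    innermost, between the legs of \<open>w\<close>, so its sum is moved inside and collapsed by the
    identity for letters.\<close>
  have "spl (x # w) (\<lambda>u v. antw u * wrd v) = gspl x (\<lambda>a b. spl w (\<lambda>u v. antw u * (antw a * wrd b) * wrd v))"
    by (simp add: mult.assoc wrd_mult)
  also have "\<dots> = spl w (\<lambda>u v. antw u * gspl x (\<lambda>a b. antw a * wrd b) * wrd v)"
  proof -
    have *: "antw u * gspl x F * wrd v = gspl x (\<lambda>a b. antw u * F a b * wrd v)" for F u v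
      by (rule gspl_hom[of "\<lambda>z. antw u * z * wrd v"]) (simp add: distrib_left distrib_right)
    show ?thesis by (simp only: * spl_gspl)
  qed
  finally have "c (spl (x # w) (\<lambda>u v. antw u * wrd v)) = c (spl w (\<lambda>u v. antw u * gspl x (\<lambda>a b. antw a * wrd b) * wrd v))"
    by (rule arg_cong)
  also have "\<dots> = c (spl w (\<lambda>u v. antw u * sc (counit_gen x) 1 * wrd v))"
    by (intro c_spl_cong c_cong_mult anti_inverse_gen)
  also have "\<dots> = c (sc (counit_gen x) (spl w (\<lambda>u v. antw u * wrd v)))"
    by (simp add: pm.spl_scl)
  also have "\<dots> = c (sc (eps (x # w)) 1)"
    unfolding c_sc Cons by (simp add: pm.scl_mult flip: c_sc)
  finally show "c (spl (x # w) (\<lambda>u v. antw u * wrd v)) = c (sc (eps (x # w)) 1)" .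
  \<comment> \<open>With the antipode on the right leg the splitting of \<open>x\<close> is
    outermost, so the induction hypothesis is applied inside it instead.\<close>
  have "spl (x # w) (\<lambda>u v. wrd u * antw v) = gspl x (\<lambda>a b. spl w (\<lambda>u v. wrd a * (wrd u * antw v) * antw b))"
    by (simp add: mult.assoc flip: wrd_mult)
  also have "\<dots> = gspl x (\<lambda>a b. wrd a * spl w (\<lambda>u v. wrd u * antw v) * antw b)"
    by (subst spl_hom[of "\<lambda>z. wrd _ * z * antw _"]) (simp_all add: distrib_left distrib_right)
  finally have "c (spl (x # w) (\<lambda>u v. wrd u * antw v)) = c (gspl x (\<lambda>a b. wrd a * spl w (\<lambda>u v. wrd u * antw v) * antw b))"
    by (rule arg_cong)
  also have "\<dots> = c (gspl x (\<lambda>a b. wrd a * sc (eps w) 1 * antw b))"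
    by (intro c_gspl_cong c_cong_mult Cons)
  also have "gspl x (\<lambda>a b. wrd a * sc (eps w) 1 * antw b) = sc (eps w) (gspl x (\<lambda>a b. wrd a * antw b) :: 'i qgen list \<Rightarrow>\<^sub>0 'k)"
  proof -
    have "(\<lambda>a b. wrd a * sc (eps w) 1 * antw b) = (\<lambda>a b. sc (eps w) (wrd a * antw b :: 'i qgen list \<Rightarrow>\<^sub>0 'k))"
      by (simp del: map_single)
    then show ?thesis
      by (simp only: gspl_hom[of "sc (eps w)", OF pm.scl_right])
  qed
  also have "c \<dots> = c (sc (eps (x # w)) 1)"
    unfolding c_sc anti_inverse_gen by (simp add: mult.commute flip: c_sc pm.scl_mult)
  finally show "c (spl (x # w) (\<lambda>u v. wrd u * antw v)) = c (sc (eps (x # w)) 1)" .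
qed simp_all

lemma c_eq_iff: "c x = c y \<longleftrightarrow> c (x - y) = \<zero>"
  using p_eqI[of x y] by (auto simp: p_diff mod.M.r_neg a_minus_def)

end

text \<open>\<open>comult_c\<close> says that the coproduct is the class of the parameter-free
  splitting of words; \<open>anti_ker\<close> says that the antipode of the free algebra descends to
  \<open>H\<close>.\<close>

locale word_bialgebra = word_algebra H c
  for H :: "('k::field, 'b, 'm) hopf_scheme" (structure) and c :: "('i qgen list \<Rightarrow>\<^sub>0 'k) \<Rightarrow> 'b" +
  assumes comult_c: "comult H (c x) = tp H 2 (pm.lext (\<lambda>w. spl w (\<lambda>u v. sgl [c (wrd u), c (wrd v)] 1)) x)"
    and counit_c: "counit H (c x) = fd.lext eps x"
    and anti_ker: "c x = \<zero> \<Longrightarrow> c (anti x) = \<zero>"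
begin

context
  fixes scl :: "'k \<Rightarrow> 'v::ab_group_add \<Rightarrow> 'v" and M :: "('k, 'e, 'n) module_scheme" and T and p
  assumes M: "lin_image scl M T p"
begin

interpretation L: lin_image scl M T p by (rule M)

text \<open>Replaces a Sweedler sum by a sum over splittings of words. \<open>F\<close> may be any
  family of lifts of the values of \<open>f\<close>, which later allows explicit formulas in place
  of chosen preimages.\<close>

lemma sweedler_c:
  assumes f: "bilin H M f" and F: "\<And>u v. F u v \<in> T \<and> f (c (wrd u)) (c (wrd v)) = p (F u v)"
  shows "sweedler H M f (c x) = p (L.lext (\<lambda>w. spl w F) x)"
proof -
  let ?G = "\<lambda>xs. L.pre (f (xs ! 0) (xs ! 1))"
  have "sweedler H M f (c x) = p (L.lext ?G (dt x))"
    unfolding sweedler_def comult_c dt_def[symmetric]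
    by (rule alg.tensor_lift_tp[OF M bilin_multilin[OF f] dt_closed])
  also have "L.lext ?G (dt x) = L.lext (\<lambda>w. spl w (\<lambda>u v. L.pre (f (c (wrd u)) (c (wrd v))))) x"
  proof -
    have "L.lext ?G (dt x) = L.lext (\<lambda>w. L.lext ?G (spl w (\<lambda>u v. sgl [c (wrd u), c (wrd v)] 1))) x"
      unfolding dt_def
      by (rule lext_comp[OF pm.scaling_axioms L.scaling_axioms]) (simp_all add: L.lext_add L.lext_sc)
    then show ?thesis
      by (simp only: spl_hom[of "L.lext ?G", OF L.lext_add] L.lext_single L.scl_one) simp
  qed
  also have "p \<dots> = p (L.lext (\<lambda>w. spl w F) x)"
  proof (rule L.p_lext_cong, rule L.p_spl_cong)
    fix u v
    have "f (c (wrd u)) (c (wrd v)) \<in> carrier M"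
      using F[of u v] by simp
    then show "L.pre (f (c (wrd u)) (c (wrd v))) \<in> T \<and> F u v \<in> T \<and> p (L.pre (f (c (wrd u)) (c (wrd v)))) = p (F u v)"
      using F[of u v] L.pre by simp
  qed
  finally show ?thesis .
qed

lemma bilin_pre: "bilin H M f \<Longrightarrow> L.pre (f (c x) (c y)) \<in> T \<and> f (c x) (c y) = p (L.pre (f (c x) (c y)))"
  using L.pre[of "f (c x) (c y)"] by (simp add: bilin_def)

lemma spl_closed: "(\<And>u v. F u v \<in> T) \<Longrightarrow> spl w F \<in> T"
  using L.p_spl_cong[of F F] by blast

lemma sweedler_linear:
  assumes f: "bilin H M f" and "a \<in> carrier H" "b \<in> carrier H"
  shows "sweedler H M f a \<in> carrier M" "sweedler H M f (a \<oplus> b) = sweedler H M f a \<oplus>\<^bsub>M\<^esub> sweedler H M f b"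
    "sweedler H M f (r \<odot> a) = r \<odot>\<^bsub>M\<^esub> sweedler H M f a"
proof -
  define F where "F = (\<lambda>u v. L.pre (f (c (wrd u)) (c (wrd v))))"
  have F: "F u v \<in> T \<and> f (c (wrd u)) (c (wrd v)) = p (F u v)" for u v
    unfolding F_def by (rule bilin_pre) (rule f)
  note s = sweedler_c[OF f F]
  have [simp]: "L.lext (\<lambda>w. spl w F) x \<in> T" for x
    by (rule L.lext_in_S) (use F in \<open>auto intro: spl_closed\<close>)
  obtain x y where "a = c x" "b = c y" using assms by (auto simp: carrier_c)
  then show "sweedler H M f a \<in> carrier M" "sweedler H M f (a \<oplus> b) = sweedler H M f a \<oplus>\<^bsub>M\<^esub> sweedler H M f b"
    "sweedler H M f (r \<odot> a) = r \<odot>\<^bsub>M\<^esub> sweedler H M f a"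
    by (simp_all add: s L.lext_add L.lext_sc L.p_add L.p_scl flip: c_add c_sc)
qed

lemma sweedler_fun_linear:
  assumes f: "bilin H M f" and g: "bilin H M g" and h: "bilin H M h" and a: "a \<in> carrier H"
  shows "(\<And>x y. x \<in> carrier H \<Longrightarrow> y \<in> carrier H \<Longrightarrow> h x y = f x y \<oplus>\<^bsub>M\<^esub> g x y) \<Longrightarrow>
      sweedler H M h a = sweedler H M f a \<oplus>\<^bsub>M\<^esub> sweedler H M g a"
    and "(\<And>x y. x \<in> carrier H \<Longrightarrow> y \<in> carrier H \<Longrightarrow> h x y = r \<odot>\<^bsub>M\<^esub> f x y) \<Longrightarrow>
      sweedler H M h a = r \<odot>\<^bsub>M\<^esub> sweedler H M f a"
proof -
  define F where "F = (\<lambda>u v. L.pre (f (c (wrd u)) (c (wrd v))))"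
  define G where "G = (\<lambda>u v. L.pre (g (c (wrd u)) (c (wrd v))))"
  have F: "F u v \<in> T \<and> f (c (wrd u)) (c (wrd v)) = p (F u v)" for u v
    unfolding F_def by (rule bilin_pre) (rule f)
  have G: "G u v \<in> T \<and> g (c (wrd u)) (c (wrd v)) = p (G u v)" for u v
    unfolding G_def by (rule bilin_pre) (rule g)
  have [simp]: "L.lext (\<lambda>w. spl w F) x \<in> T" "L.lext (\<lambda>w. spl w G) x \<in> T" for x
    by (rule L.lext_in_S; use F G in \<open>auto intro: spl_closed\<close>)+
  obtain x where x: "a = c x" using a by (auto simp: carrier_c)
  {
    assume *: "\<And>x y. x \<in> carrier H \<Longrightarrow> y \<in> carrier H \<Longrightarrow> h x y = f x y \<oplus>\<^bsub>M\<^esub> g x y"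
    have "sweedler H M h (c x) = p (L.lext (\<lambda>w. spl w (\<lambda>u v. F u v + G u v)) x)"
      by (rule sweedler_c[OF h]) (use F G in \<open>simp add: * L.p_add\<close>)
    then show "sweedler H M h a = sweedler H M f a \<oplus>\<^bsub>M\<^esub> sweedler H M g a"
      by (simp add: x sweedler_c[OF f F] sweedler_c[OF g G] spl_add L.lext_fun_add L.p_add)
  }
  {
    assume *: "\<And>x y. x \<in> carrier H \<Longrightarrow> y \<in> carrier H \<Longrightarrow> h x y = r \<odot>\<^bsub>M\<^esub> f x y"
    have "sweedler H M h (c x) = p (L.lext (\<lambda>w. spl w (\<lambda>u v. scl r (F u v))) x)"
      by (rule sweedler_c[OF h]) (use F in \<open>simp add: * L.p_scl\<close>)
    then show "sweedler H M h a = r \<odot>\<^bsub>M\<^esub> sweedler H M f a"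
      by (simp add: x sweedler_c[OF f F] L.spl_scl L.lext_fun_scl L.p_scl)
  }
qed

text \<open>An iterated Sweedler sum can be evaluated by \<open>sweedler_c\<close> only once its
  inner sum is known to be bilinear in the remaining arguments.\<close>

lemma trilin_sweedler:
  assumes f: "trilin H M f"
  shows "bilin H M (\<lambda>x z. sweedler H M (\<lambda>x1 x2. f x1 x2 z) x)"
    and "bilin H M (\<lambda>x y. sweedler H M (\<lambda>y1 y2. f x y1 y2) y)"
proof -
  have b: "bilin H M (f x)" "bilin H M (\<lambda>y z. f y z x)" if "x \<in> carrier H" for x
    using f that by (auto simp: trilin_def)
  have e: "f x y (z \<oplus> z') = f x y z \<oplus>\<^bsub>M\<^esub> f x y z'" "f (z \<oplus> z') x y = f z x y \<oplus>\<^bsub>M\<^esub> f z' x y"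
    "f x y (r \<odot> z) = r \<odot>\<^bsub>M\<^esub> f x y z" "f (r \<odot> z) x y = r \<odot>\<^bsub>M\<^esub> f z x y"
    if "x \<in> carrier H" "y \<in> carrier H" "z \<in> carrier H" "z' \<in> carrier H" for x y z z' r
    using b[of x] b[of y] that by (auto simp: bilin_def)
  have cl: "r \<odot> x \<in> carrier H" "x \<oplus> y \<in> carrier H" if "x \<in> carrier H" "y \<in> carrier H" for x y r
    using that by (auto simp: carrier_c simp flip: c_add c_sc)
  show "bilin H M (\<lambda>x z. sweedler H M (\<lambda>x1 x2. f x1 x2 z) x)"
    unfolding bilin_def
    by (intro conjI ballI allI;
        (rule sweedler_linear[OF b(2)] | rule sweedler_fun_linear(1)[OF b(2) b(2) b(2)] | rule sweedler_fun_linear(2)[OF b(2) b(2) b(2)]);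
        (assumption | rule cl | simp add: e))
  show "bilin H M (\<lambda>x y. sweedler H M (\<lambda>y1 y2. f x y1 y2) y)"
    unfolding bilin_def
    by (intro conjI ballI allI;
        (rule sweedler_linear[OF b(1)] | rule sweedler_fun_linear(1)[OF b(1) b(1) b(1)] | rule sweedler_fun_linear(2)[OF b(1) b(1) b(1)]);
        (assumption | rule cl | simp add: e))
qed

lemma sweedler3_c:
  assumes f: "trilin H M f"
    and F: "\<And>u v w. F u v w \<in> T \<and> f (c (wrd u)) (c (wrd v)) (c (wrd w)) = p (F u v w)"
  shows "sweedler H M (\<lambda>x z. sweedler H M (\<lambda>x1 x2. f x1 x2 z) x) (c x) =
      p (L.lext (\<lambda>w. spl w (\<lambda>u v. spl u (\<lambda>u1 u2. F u1 u2 v))) x)"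
    and "sweedler H M (\<lambda>x y. sweedler H M (\<lambda>y1 y2. f x y1 y2) y) (c x) =
      p (L.lext (\<lambda>w. spl w (\<lambda>u v. spl v (\<lambda>v1 v2. F u v1 v2))) x)"
proof -
  have b: "bilin H M (f (c x))" "bilin H M (\<lambda>y z. f y z (c x))" for x
    using f by (auto simp: trilin_def)
  show "sweedler H M (\<lambda>x z. sweedler H M (\<lambda>x1 x2. f x1 x2 z) x) (c x) =
      p (L.lext (\<lambda>w. spl w (\<lambda>u v. spl u (\<lambda>u1 u2. F u1 u2 v))) x)"
    by (rule sweedler_c[OF trilin_sweedler(1)[OF f]])
      (use sweedler_c[OF b(2) F] F in \<open>auto intro: spl_closed\<close>)
  show "sweedler H M (\<lambda>x y. sweedler H M (\<lambda>y1 y2. f x y1 y2) y) (c x) =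
      p (L.lext (\<lambda>w. spl w (\<lambda>u v. spl v (\<lambda>v1 v2. F u v1 v2))) x)"
    by (rule sweedler_c[OF trilin_sweedler(2)[OF f]])
      (use sweedler_c[OF b(1) F] F in \<open>auto intro: spl_closed\<close>)
qed

end

lemma bilin_H:
  assumes "\<And>x y. T (c x) (c y) = c (F x y)" "\<And>x y z. F (x + y) z = F x z + F y z" "\<And>x y z. F z (x + y) = F z x + F z y"
    "\<And>a x y. F (sc a x) y = sc a (F x y)" "\<And>a x y. F x (sc a y) = sc a (F x y)"
  shows "bilin H H T"
  unfolding bilin_def using assms by (auto simp: carrier_c simp flip: c_add c_sc)

lemma lext_eps_one: "c (pm.lext (\<lambda>w. sc (eps w) 1) x) = counit H (c x) \<odot> \<one>"
proof -
  have "sc (fd.lext eps x) (1 :: 'i qgen list \<Rightarrow>\<^sub>0 'k) = pm.lext (\<lambda>w. sc (eps w) 1) x"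
    by (rule lext_comp[OF fd.scaling_axioms pm.scaling_axioms, of "\<lambda>a. sc a 1"])
      (simp_all add: pm.scl_left pm.scl_mult)
  then show ?thesis by (simp add: counit_c flip: c_sc c_one)
qed

lemma lin_image_H: "lin_image sc H UNIV c"
  by (rule lin_image_axioms)

lemma is_antipode_anti:
  assumes S: "\<And>x. S (c x) = c (anti x)"
  shows "is_antipode H S"
proof -
  have 1: "bilin H H (\<lambda>x y. S x \<otimes> y)"
    by (rule bilin_H[where F = "\<lambda>x y. anti x * y"])
      (simp_all add: S c_mult pm.lext_add pm.lext_sc distrib_left distrib_right)
  have 2: "bilin H H (\<lambda>x y. x \<otimes> S y)"
    by (rule bilin_H[where F = "\<lambda>x y. x * anti y"])
      (simp_all add: S c_mult pm.lext_add pm.lext_sc distrib_left distrib_right)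
  have a: "sweedler H H (\<lambda>x y. S x \<otimes> y) (c x) = counit H (c x) \<odot> \<one>" for x
  proof -
    have "sweedler H H (\<lambda>x y. S x \<otimes> y) (c x) = c (pm.lext (\<lambda>w. spl w (\<lambda>u v. antw u * wrd v)) x)"
      by (rule sweedler_c[OF lin_image_H 1]) (simp add: S c_mult)
    also have "\<dots> = c (pm.lext (\<lambda>w. sc (eps w) 1) x)"
      by (rule p_lext_cong) (simp add: anti_inverse_wrd)
    finally show ?thesis by (simp add: lext_eps_one)
  qed
  have b: "sweedler H H (\<lambda>x y. x \<otimes> S y) (c x) = counit H (c x) \<odot> \<one>" for x
  proof -
    have "sweedler H H (\<lambda>x y. x \<otimes> S y) (c x) = c (pm.lext (\<lambda>w. spl w (\<lambda>u v. wrd u * antw v)) x)"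
      by (rule sweedler_c[OF lin_image_H 2]) (simp add: S c_mult)
    also have "\<dots> = c (pm.lext (\<lambda>w. sc (eps w) 1) x)"
      by (rule p_lext_cong) (simp add: anti_inverse_wrd)
    finally show ?thesis by (simp add: lext_eps_one)
  qed
  show ?thesis
    unfolding is_antipode_def using a b
    by (auto simp: carrier_c S pm.lext_add pm.lext_sc simp flip: c_add c_sc)
qed

lemma anti_cong: "c x = c y \<Longrightarrow> c (anti x) = c (anti y)"
proof -
  assume "c x = c y"
  then show ?thesis
    using anti_ker[of "x - y"] by (simp add: c_eq_iff[of x] c_eq_iff[of "anti x"] pm.lext_diff)
qed

text \<open>The deformation takes its antipode by choice; existence makes that choice satisfy its
  specification.\<close>

lemma ex_antipode: "\<exists>S. is_antipode H S"
proof
  show "is_antipode H (\<lambda>a. c (anti (pre a)))"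
    by (intro is_antipode_anti anti_cong) (simp add: pre)
qed

text \<open>The usual convolution argument
  \<open>S = S * (id * anti) = (S * id) * anti = anti\<close>, carried out on words.\<close>

lemma antipode_unique:
  assumes S: "is_antipode H S"
  shows "S (c x) = c (anti x)"
proof -
  have S_closed: "S a \<in> carrier H" if "a \<in> carrier H" for a
    using S that by (auto simp: is_antipode_def)
  define s where "s x = pre (S (c x))" for x
  have s: "c (s x) = S (c x)" for x
    unfolding s_def using pre[OF S_closed] by (simp add: carrier_c)
  have lin: "S (c (x + y)) = S (c x) \<oplus> S (c y)" "S (c (sc a x)) = a \<odot> S (c x)" for x y a
    using S by (auto simp: is_antipode_def carrier_c c_add c_sc)
  have "bilin H H (\<lambda>x y. S x \<otimes> y)"
    unfolding bilin_def
  proof (intro conjI ballI allI; elim carrierE)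
    fix a x y z x' y' z' assume [simp]: "x = c x'" "y = c y'" "z = c z'"
    show "S x \<otimes> y \<in> carrier H" by (simp add: carrier_c s[symmetric] flip: c_mult)
    show "S (x \<oplus> y) \<otimes> z = S x \<otimes> z \<oplus> S y \<otimes> z" "S z \<otimes> (x \<oplus> y) = S z \<otimes> x \<oplus> S z \<otimes> y"
      by (simp_all add: lin flip: c_add) (simp_all add: distrib_left distrib_right flip: s c_add c_mult)
    show "S (a \<odot> x) \<otimes> y = a \<odot> (S x \<otimes> y)" "S x \<otimes> (a \<odot> y) = a \<odot> (S x \<otimes> y)"
      by (simp_all add: lin flip: c_sc) (simp_all flip: s c_sc c_mult)
  qed
  then have left: "c (spl w (\<lambda>u v. s (wrd u) * wrd v)) = c (sc (eps w) 1)" for w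
  proof -
    assume b: "bilin H H (\<lambda>x y. S x \<otimes> y)"
    have "sweedler H H (\<lambda>x y. S x \<otimes> y) (c (wrd w)) = c (pm.lext (\<lambda>w. spl w (\<lambda>u v. s (wrd u) * wrd v)) (wrd w))"
      by (rule sweedler_c[OF lin_image_H b]) (simp add: s c_mult)
    moreover have "sweedler H H (\<lambda>x y. S x \<otimes> y) (c (wrd w)) = counit H (c (wrd w)) \<odot> \<one>"
      using S by (simp add: is_antipode_def carrier_c)
    ultimately show ?thesis by (simp add: lext_eps_one[symmetric])
  qed
  have wrd: "S (c (wrd w)) = c (antw w)" for w
  proof -
    \<comment> \<open>The triple convolution: collapsing its last two factors gives
      \<open>S\<close>, collapsing its first two gives \<open>antw\<close>.\<close>
    let ?F = "\<lambda>u v1 v2. s (wrd u) * wrd v1 * antw v2"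
    have "c (spl w (\<lambda>u v. spl v (?F u))) = c (spl w (\<lambda>u v. sc (eps v) (s (wrd u))))"
    proof (rule c_spl_cong)
      fix u v
      have "c (spl v (?F u)) = c (s (wrd u) * spl v (\<lambda>v1 v2. wrd v1 * antw v2))"
        by (subst spl_hom[of "\<lambda>z. s (wrd u) * z"]) (simp_all add: distrib_left mult.assoc)
      also have "\<dots> = c (s (wrd u) * sc (eps v) 1)"
        by (simp only: c_mult anti_inverse_wrd)
      finally show "c (spl v (?F u)) = c (sc (eps v) (s (wrd u)))" by simp
    qed
    also have "\<dots> = c (s (wrd w))"
      by (simp add: pm.spl_eps_right[where h = "\<lambda>_. 1", simplified])
    finally have 1: "c (spl w (\<lambda>u v. spl v (?F u))) = S (c (wrd w))" by (simp add: s)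
    have "c (spl w (\<lambda>u v. spl u (\<lambda>u1 u2. ?F u1 u2 v))) = c (spl w (\<lambda>u v. sc (eps u) (antw v)))"
    proof (rule c_spl_cong)
      fix u v
      have "c (spl u (\<lambda>u1 u2. ?F u1 u2 v)) = c (spl u (\<lambda>v1 v2. s (wrd v1) * wrd v2) * antw v)"
        by (subst spl_hom[of "\<lambda>z. z * antw v"]) (simp_all add: distrib_right)
      also have "\<dots> = c (sc (eps u) 1 * antw v)"
        by (simp only: c_mult left)
      finally show "c (spl u (\<lambda>u1 u2. ?F u1 u2 v)) = c (sc (eps u) (antw v))" by simp
    qed
    also have "\<dots> = c (antw w)"
      by (simp add: pm.spl_eps_left[where h = "\<lambda>_. 1", simplified])
    finally show ?thesis using 1 by (simp add: spl_coassoc)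
  qed
  show ?thesis
    by (induction x rule: word_induct)
      (simp_all add: wrd lin pm.lext_add pm.lext_sc, simp_all add: c_add c_sc)
qed

end

locale word_hopf = word_bialgebra H c
  for H :: "('k::field, 'b, 'm) hopf_scheme" (structure) and c :: "('i qgen list \<Rightarrow>\<^sub>0 'k) \<Rightarrow> 'b" +
  assumes antipode_H: "is_antipode H (antipode H)"
begin

lemma pure_trilin: "trilin H (tensor_power H 3) (\<lambda>x y z. pure_tensor H [x, y, z])"
proof -
  interpret T: alg_image sc "tensor_power H 3" "tuples H 3" "tp H 3" "mmul (tuple_monoid H 3)" "sgl (replicate 3 \<one>) 1"
    by (rule tensor_image_H)
  have p: "pure_tensor H [x, y, z] = tp H 3 (sgl [x, y, z] 1)" for x y z
    by (simp add: pure_tensor_tp numeral_3_eq_3)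
  have add: "tp H 3 (sgl (xs @ (x \<oplus> y) # ys) 1) = tp H 3 (sgl (xs @ x # ys) 1) \<oplus>\<^bsub>tensor_power H 3\<^esub> tp H 3 (sgl (xs @ y # ys) 1)"
    if "length xs + length ys + 1 = 3" "set xs \<union> set ys \<union> {x, y} \<subseteq> carrier H" for xs ys x y
    using that by (subst alg.tp_slot_add) (auto intro!: T.p_add)
  have smult: "tp H 3 (sgl (xs @ (r \<odot> x) # ys) 1) = r \<odot>\<^bsub>tensor_power H 3\<^esub> tp H 3 (sgl (xs @ x # ys) 1)"
    if "length xs + length ys + 1 = 3" "set xs \<union> set ys \<union> {x} \<subseteq> carrier H" for xs ys x r
    using that alg.tp_slot_smult[OF that, of r 1] T.p_scl[of "sgl (xs @ x # ys) 1" r] by auto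
  note a = add[of "[]" "[_, _]"] add[of "[_]" "[_]"] add[of "[_, _]" "[]"]
  note m = smult[of "[]" "[_, _]"] smult[of "[_]" "[_]"] smult[of "[_, _]" "[]"]
  have cl: "tp H 3 (sgl [x, y, z] 1) \<in> carrier (tensor_power H 3)"
    if "x \<in> carrier H" "y \<in> carrier H" "z \<in> carrier H" for x y z
    using that by (intro T.p_closed) auto
  show ?thesis
    unfolding trilin_def bilin_def p using a m cl by simp
qed

lemma comult_ring_hom_H: "comult H \<in> ring_hom H (tensor_power H 2)"
proof -
  interpret T: alg_image sc "tensor_power H 2" "tuples H 2" "tp H 2" "mmul (tuple_monoid H 2)" "sgl (replicate 2 \<one>) 1"
    by (rule tensor_image_H)
  have cm: "comult H (c x) = tp H 2 (dt x)" for x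
    by (simp add: comult_c dt_def)
  show ?thesis
  proof (rule ring_hom_memI; (elim carrierE)?; (simp only: cm c_mult[symmetric] c_add[symmetric] c_one[symmetric])?)
    show "tp H 2 (dt x) \<in> carrier (tensor_power H 2)" for x
      by (rule T.p_closed) (rule dt_closed)
    show "tp H 2 (dt (x * y)) = tp H 2 (dt x) \<otimes>\<^bsub>tensor_power H 2\<^esub> tp H 2 (dt y)" for x y
      unfolding dt_mult by (rule T.p_mu) (rule dt_closed)+
    show "tp H 2 (dt (x + y)) = tp H 2 (dt x) \<oplus>\<^bsub>tensor_power H 2\<^esub> tp H 2 (dt y)" for x y
      unfolding dt_def pm.lext_add unfolding dt_def[symmetric] by (rule T.p_add) (rule dt_closed)+
    have "dt 1 = sgl (replicate 2 \<one>) 1"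
      unfolding sgl_Nil[symmetric] dt_wrd by (simp add: c_one numeral_2_eq_2)
    then show "tp H 2 (dt 1) = \<one>\<^bsub>tensor_power H 2\<^esub>"
      by (simp only: T.p_u)
  qed
qed

lemma fd_lext_eps_mult: "fd.lext eps (x * y) = fd.lext eps x * fd.lext eps y"
proof (induction x rule: word_induct)
  case (single w)
  show ?case
    by (induction y rule: word_induct)
      (simp_all add: wrd_mult distrib_left fd.lext_add fd.lext_sc mult.left_commute)
qed (simp_all add: distrib_right fd.lext_add fd.lext_sc)

theorem hopf_algebra_H: "hopf_algebra H"
proof (intro hopf_algebra.intro hopf_algebra_axioms.intro)
  interpret T2: alg_image sc "tensor_power H 2" "tuples H 2" "tp H 2" "mmul (tuple_monoid H 2)" "sgl (replicate 2 \<one>) 1"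
    by (rule tensor_image_H)
  interpret T3: alg_image sc "tensor_power H 3" "tuples H 3" "tp H 3" "mmul (tuple_monoid H 3)" "sgl (replicate 3 \<one>) 1"
    by (rule tensor_image_H)
  show "assoc_algebra H" by (rule assoc_algebra)
  show "comult H \<in> ring_hom H (tensor_power H 2)" by (rule comult_ring_hom_H)
  show "counit H \<in> ring_hom H field_alg"
    by (rule ring_hom_memI; (elim carrierE)?)
      (auto simp: counit_c fd_lext_eps_mult fd.lext_add simp flip: c_mult c_add c_one sgl_Nil)
  show "is_antipode H (antipode H)" by (rule antipode_H)
  fix a r assume "a \<in> carrier H"
  then obtain x where x: "a = c x" by (auto simp: carrier_c)
  show "comult H (r \<odot> a) = r \<odot>\<^bsub>tensor_power H 2\<^esub> comult H a"
    using T2.p_scl[OF dt_closed] by (simp add: x comult_c pm.lext_sc dt_def flip: c_sc)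
  show "counit H (r \<odot> a) = r * counit H a"
    by (simp add: x counit_c fd.lext_sc flip: c_sc)
  let ?F = "\<lambda>u v w. sgl [c (wrd u), c (wrd v), c (wrd w)] (1::'k)"
  have F: "?F u v w \<in> tuples H 3 \<and> pure_tensor H [c (wrd u), c (wrd v), c (wrd w)] = tp H 3 (?F u v w)" for u v w
    by (auto simp: pure_tensor_tp carrier_c numeral_3_eq_3)
  show "sweedler H (tensor_power H 3) (\<lambda>x y. sweedler H (tensor_power H 3) (\<lambda>x1 x2. pure_tensor H [x1, x2, y]) x) a =
      sweedler H (tensor_power H 3) (\<lambda>x y. sweedler H (tensor_power H 3) (\<lambda>y1 y2. pure_tensor H [x, y1, y2]) y) a"
    unfolding x
    by (subst sweedler3_c(1)[OF T3.lin_image_axioms pure_trilin F], subst sweedler3_c(2)[OF T3.lin_image_axioms pure_trilin F])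
      (simp add: spl_coassoc)
  have b1: "bilin H H (\<lambda>x y. counit H x \<odot> y)" and b2: "bilin H H (\<lambda>x y. counit H y \<odot> x)"
    by (rule bilin_H[where F = "\<lambda>x y. sc (fd.lext eps x) y"] bilin_H[where F = "\<lambda>x y. sc (fd.lext eps y) x"];
      simp add: counit_c c_sc fd.lext_add fd.lext_sc pm.scl_left pm.scl_right mult.commute flip: pm.scl_mult)+
  show "sweedler H H (\<lambda>x y. counit H x \<odot> y) a = a"
    unfolding x
    by (subst sweedler_c[OF lin_image_H b1, where F = "\<lambda>u v. sc (eps u) (wrd v)"])
      (simp_all add: counit_c c_sc spl_eps_wrd del: map_single)
  show "sweedler H H (\<lambda>x y. counit H y \<odot> x) a = a"
    unfolding x
    by (subst sweedler_c[OF lin_image_H b2, where F = "\<lambda>u v. sc (eps v) (wrd u)"])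
      (simp_all add: counit_c c_sc spl_eps_wrd del: map_single)
qed

end

text \<open>Equal kernels make \<open>c x \<mapsto> c' x\<close> a well-defined bijection. It
  respects the coproducts because both come from the same splittings, and the antipodes because each
  is forced to be the image of \<open>anti\<close>.\<close>

lemma word_hopf_iso:
  assumes "word_hopf H c" "word_hopf G c'"
    and ker: "\<And>x. c x = \<zero>\<^bsub>H\<^esub> \<longleftrightarrow> c' x = \<zero>\<^bsub>G\<^esub>"
  shows "hopf_isomorphic H G"
proof -
  interpret H: word_hopf H c by fact
  interpret G: word_hopf G c' by fact
  interpret T: alg_image sc "tensor_power G 2" "tuples G 2" "tp G 2" "mmul (tuple_monoid G 2)" "sgl (replicate 2 \<one>\<^bsub>G\<^esub>) 1"
    by (rule G.tensor_image_H)
  have eq: "c x = c y \<longleftrightarrow> c' x = c' y" for x y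
    by (simp add: H.c_eq_iff[of x y] G.c_eq_iff[of x y] ker)
  define \<phi> where "\<phi> a = c' (H.pre a)" for a
  have \<phi>: "\<phi> (c x) = c' x" for x
    unfolding \<phi>_def using H.pre[of "c x"] by (simp add: eq[symmetric])
  have b: "bilin H (tensor_power G 2) (\<lambda>x1 x2. pure_tensor G [\<phi> x1, \<phi> x2])"
  proof -
    have p: "pure_tensor G [x, y] = tp G 2 (sgl [x, y] 1)" for x y
      by (simp add: pure_tensor_tp numeral_2_eq_2)
    have cl: "tp G 2 (sgl [x, y] 1) \<in> carrier (tensor_power G 2)" if "x \<in> carrier G" "y \<in> carrier G" for x y
      using that by (intro T.p_closed) auto
    have add: "tp G 2 (sgl (xs @ (x \<oplus>\<^bsub>G\<^esub> y) # ys) 1) = tp G 2 (sgl (xs @ x # ys) 1) \<oplus>\<^bsub>tensor_power G 2\<^esub> tp G 2 (sgl (xs @ y # ys) 1)"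
      if "length xs + length ys + 1 = 2" "set xs \<union> set ys \<union> {x, y} \<subseteq> carrier G" for xs ys x y
      using that by (subst G.alg.tp_slot_add) (auto intro!: T.p_add)
    have smult: "tp G 2 (sgl (xs @ (r \<odot>\<^bsub>G\<^esub> x) # ys) 1) = r \<odot>\<^bsub>tensor_power G 2\<^esub> tp G 2 (sgl (xs @ x # ys) 1)"
      if "length xs + length ys + 1 = 2" "set xs \<union> set ys \<union> {x} \<subseteq> carrier G" for xs ys x r
      using that G.alg.tp_slot_smult[OF that, of r 1] T.p_scl[of "sgl (xs @ x # ys) 1" r] by auto
    note a = add[of "[]" "[_]"] add[of "[_]" "[]"]
    note m = smult[of "[]" "[_]"] smult[of "[_]" "[]"]
    show ?thesis
      unfolding bilin_def p
      using a m cl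
      by (auto simp: H.carrier_c \<phi> G.c_add G.c_sc simp flip: H.c_add H.c_sc)
  qed
  have "comult G (\<phi> (c x)) = sweedler H (tensor_power G 2) (\<lambda>x1 x2. pure_tensor G [\<phi> x1, \<phi> x2]) (c x)" for x
    by (subst H.sweedler_c[OF T.lin_image_axioms b, where F = "\<lambda>u v. sgl [c' (wrd u), c' (wrd v)] 1"])
      (auto simp: \<phi> G.comult_c pure_tensor_tp numeral_2_eq_2 G.carrier_c)
  moreover have "\<phi> \<in> ring_iso H G"
  proof (rule ring_iso_memI)
    have "inj_on \<phi> (carrier H)"
      by (auto simp: inj_on_def H.carrier_c \<phi> eq)
    moreover have "\<phi> ` carrier H = carrier G"
      by (auto simp: H.carrier_c G.carrier_c \<phi> image_image)
    ultimately show "bij_betw \<phi> (carrier H) (carrier G)" by (simp add: bij_betw_def)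
  qed (auto simp: H.carrier_c \<phi> G.c_mult G.c_add G.c_one simp flip: H.c_mult H.c_add H.c_one)
  moreover have "antipode G (\<phi> (c x)) = \<phi> (antipode H (c x))" for x
    using H.antipode_unique[OF H.antipode_H] G.antipode_unique[OF G.antipode_H] by (simp add: \<phi>)
  ultimately have "\<phi> \<in> hopf_iso H G"
    unfolding hopf_iso_def
    by (auto simp: H.carrier_c \<phi> G.c_sc H.counit_c G.counit_c simp flip: H.c_sc)
  then show ?thesis
    using H.hopf_algebra_H G.hopf_algebra_H by (auto simp: hopf_isomorphic_def)
qed


section \<open>Gaussian binomials\<close>

text \<open>Gaussian binomials by the Pascal rule: free of division, and zero for
  \<open>k > n\<close>, so that sums can be extended by a vanishing boundary term.\<close>

fun qbin :: "nat \<Rightarrow> nat \<Rightarrow> int poly" where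
  "qbin n 0 = 1"
| "qbin 0 (Suc k) = 0"
| "qbin (Suc n) (Suc k) = qbin n (Suc k) + monom 1 (n - k) * qbin n k"

lemma qbin_eq_0: "n < k \<Longrightarrow> qbin n k = 0"
proof (induction n k rule: qbin.induct)
  case (3 n k)
  then show ?case by (cases "n < k") auto
qed auto

lemma qbin_diag [simp]: "qbin n n = 1"
  by (induction n) (auto simp: qbin_eq_0)

lemma gauss_int_mult: "gauss_int n * (monom 1 1 - 1) = monom 1 n - 1"
proof -
  have "monom 1 n - 1 = (monom 1 1 - 1) * (\<Sum>i<n. monom 1 1 ^ i :: int poly)"
    using power_diff_1_eq[of "monom 1 1 :: int poly" n] by (simp add: monom_power)
  then show ?thesis
    unfolding gauss_int_def by (metis dvd_div_mult_self dvd_triv_left)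
qed

lemma monom_minus_one_nonzero: "monom 1 1 - 1 \<noteq> (0 :: int poly)"
  by (simp add: monom_altdef one_pCons)

lemma gauss_int_nonzero: "n > 0 \<Longrightarrow> gauss_int n \<noteq> 0"
  using gauss_int_mult[of n] by (auto simp: monom_eq_1_iff)

lemma gauss_int_split: "gauss_int (m + k) = gauss_int m + monom 1 m * gauss_int k"
proof -
  have "gauss_int (m + k) * (monom 1 1 - 1) = (gauss_int m + monom 1 m * gauss_int k) * (monom 1 1 - 1)"
    by (simp only: distrib_right mult.assoc gauss_int_mult) (simp add: right_diff_distrib mult_monom)
  then show ?thesis using monom_minus_one_nonzero mult_right_cancel by blast
qed

lemma gauss_fact_Suc: "gauss_fact (Suc n) = gauss_fact n * gauss_int (Suc n)"
  by (simp add: gauss_fact_def mult.commute)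

lemma gauss_fact_0 [simp]: "gauss_fact 0 = 1"
  by (simp add: gauss_fact_def)

lemma gauss_fact_nonzero: "gauss_fact n \<noteq> 0"
  by (simp add: gauss_fact_def gauss_int_nonzero)

text \<open>After clearing factorials both Pascal summands are multiples of
  \<open>gauss_fact n\<close>, and the multipliers add up to \<open>gauss_int (Suc n)\<close> by
  \<open>gauss_int_split\<close>.\<close>

lemma qbin_fact: "k \<le> n \<Longrightarrow> qbin n k * (gauss_fact k * gauss_fact (n - k)) = gauss_fact n"
proof (induction n k rule: qbin.induct)
  case (3 n k)
  show ?case
  proof (cases "k = n")
    case False
    with 3 have "k < n" by simp
    then obtain m where m: "n = Suc (k + m)" using less_imp_Suc_add by blast
    have 1: "qbin n (Suc k) * (gauss_fact (Suc k) * gauss_fact m) = gauss_fact n"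
      and 2: "qbin n k * (gauss_fact k * gauss_fact (Suc m)) = gauss_fact n"
      using 3 m by (auto simp: Suc_diff_le)
    have "qbin (Suc n) (Suc k) * (gauss_fact (Suc k) * gauss_fact (Suc m)) =
       qbin n (Suc k) * (gauss_fact (Suc k) * gauss_fact m) * gauss_int (Suc m) +
       monom 1 (Suc m) * gauss_int (Suc k) * (qbin n k * (gauss_fact k * gauss_fact (Suc m)))"
      by (simp add: m gauss_fact_Suc algebra_simps)
    also have "\<dots> = gauss_fact n * (gauss_int (Suc m) + monom 1 (Suc m) * gauss_int (Suc k))"
      unfolding 1 2 by (simp add: algebra_simps)
    also have "\<dots> = gauss_fact (Suc n)"
      using gauss_int_split[of "Suc m" "Suc k"] by (simp add: gauss_fact_Suc m add.commute)
    finally show ?thesis using m by (simp add: Suc_diff_le)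
  qed (simp add: qbin_eq_0)
qed auto

text \<open>The mirror image of the defining Pascal rule, obtained by cancelling factorials; the two
  rules are used together in \<open>qcom_add_general\<close>.\<close>

lemma qbin_Suc': "qbin (Suc n) (Suc k) = monom 1 (Suc k) * qbin n (Suc k) + qbin n k"
proof (cases "k < n")
  case True
  then obtain m where m: "n = Suc (k + m)" using less_imp_Suc_add by blast
  have 1: "qbin n (Suc k) * (gauss_fact (Suc k) * gauss_fact m) = gauss_fact n"
    and 2: "qbin n k * (gauss_fact k * gauss_fact (Suc m)) = gauss_fact n"
    using qbin_fact[of "Suc k" n] qbin_fact[of k n] m by (auto simp: Suc_diff_le)
  have "(monom 1 (Suc k) * qbin n (Suc k) + qbin n k) * (gauss_fact (Suc k) * gauss_fact (Suc m)) =
     monom 1 (Suc k) * gauss_int (Suc m) * (qbin n (Suc k) * (gauss_fact (Suc k) * gauss_fact m)) +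
     gauss_int (Suc k) * (qbin n k * (gauss_fact k * gauss_fact (Suc m)))"
    by (simp add: gauss_fact_Suc algebra_simps)
  also have "\<dots> = gauss_fact n * (gauss_int (Suc k) + monom 1 (Suc k) * gauss_int (Suc m))"
    unfolding 1 2 by (simp add: algebra_simps)
  also have "\<dots> = gauss_fact (Suc n)"
    using gauss_int_split[of "Suc k" "Suc m"] by (simp add: gauss_fact_Suc m add.commute)
  also have "\<dots> = qbin (Suc n) (Suc k) * (gauss_fact (Suc k) * gauss_fact (Suc m))"
    using qbin_fact[of "Suc k" "Suc n"] m by (simp add: Suc_diff_le)
  finally show ?thesis
    using gauss_fact_nonzero[of "Suc k"] gauss_fact_nonzero[of "Suc m"] by simp
next
  case False
  then show ?thesis by (cases "k = n") (auto simp: qbin_eq_0)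
qed

definition gb :: "'k::field \<Rightarrow> nat \<Rightarrow> nat \<Rightarrow> 'k" where
  "gb v n k = poly (map_poly of_int (qbin n k)) v"

lemma map_poly_of_int_add: "map_poly of_int (p + q) = map_poly of_int p + (map_poly of_int q :: 'k::field poly)"
  by (rule poly_eqI) (simp add: coeff_map_poly)

lemma map_poly_of_int_monom_mult: "map_poly of_int (monom 1 j * p) = monom 1 j * (map_poly of_int p :: 'k::field poly)"
  by (rule poly_eqI) (simp add: coeff_map_poly coeff_monom_mult)

lemma gb_simps [simp]: "gb v n 0 = 1" "gb v 0 (Suc k) = 0" "gb v n n = 1"
  by (simp_all add: gb_def)

lemma gb_eq_0: "n < k \<Longrightarrow> gb v n k = 0"
  by (simp add: gb_def qbin_eq_0)

lemma gb_Suc: "gb v (Suc n) (Suc k) = gb v n (Suc k) + v ^ (n - k) * gb v n k"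
  by (simp add: gb_def map_poly_of_int_add map_poly_of_int_monom_mult poly_monom)

lemma gb_Suc': "gb v (Suc n) (Suc k) = v ^ Suc k * gb v n (Suc k) + gb v n k"
  unfolding gb_def qbin_Suc' by (simp add: map_poly_of_int_add map_poly_of_int_monom_mult poly_monom)

lemma gauss_binomial_gb: "k \<le> n \<Longrightarrow> gauss_binomial n k v = gb v n k"
proof -
  assume "k \<le> n"
  then have "gauss_fact n div (gauss_fact k * gauss_fact (n - k)) = qbin n k"
    using qbin_fact[of k n] gauss_fact_nonzero[of k] gauss_fact_nonzero[of "n - k"]
    by (metis mult_eq_0_iff nonzero_mult_div_cancel_right)
  then show ?thesis by (simp add: gauss_binomial_def gb_def)
qed

section \<open>Iterated \<open>q\<close>-commutators modulo an ideal\<close>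

text \<open>
  The multiplication is a parameter, because the Serre relation in the \<open>f\<^sub>i\<close> is the one in the
  \<open>e\<^sub>i\<close> for the opposite multiplication.
\<close>

locale cong_alg = scaling scl for scl :: "'k::field \<Rightarrow> 'v::ab_group_add \<Rightarrow> 'v" +
  fixes mul :: "'v \<Rightarrow> 'v \<Rightarrow> 'v" (infixl "\<star>" 70) and I :: "'v set"
  assumes mul_assoc: "(x \<star> y) \<star> z = x \<star> (y \<star> z)"
    and mul_add: "(x + y) \<star> z = x \<star> z + y \<star> z" "z \<star> (x + y) = z \<star> x + z \<star> y"
    and mul_scl: "scl a x \<star> y = scl a (x \<star> y)" "x \<star> scl a y = scl a (x \<star> y)"
    and I_zero [simp]: "0 \<in> I"
    and I_add: "x \<in> I \<Longrightarrow> y \<in> I \<Longrightarrow> x + y \<in> I"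
    and I_scl: "x \<in> I \<Longrightarrow> scl a x \<in> I"
    and I_mul: "x \<in> I \<Longrightarrow> u \<star> x \<in> I" "x \<in> I \<Longrightarrow> x \<star> u \<in> I"
begin

definition cg :: "'v \<Rightarrow> 'v \<Rightarrow> bool" (infix "\<doteq>" 50) where "x \<doteq> y \<longleftrightarrow> x - y \<in> I"

lemma I_uminus: "x \<in> I \<Longrightarrow> - x \<in> I"
  using I_scl[of x "-1"] by (simp add: scl_minus)

lemma mul_zero [simp]: "0 \<star> x = 0" "x \<star> 0 = 0"
  using mul_add(1)[of 0 0 x] mul_add(2)[of x 0 0] by auto

lemma mul_minus: "(- x) \<star> y = - (x \<star> y)" "x \<star> (- y) = - (x \<star> y)"
  using mul_scl(1)[of "-1" x y] mul_scl(2)[of x "-1" y] by (simp_all add: scl_minus)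

lemma mul_diff: "(x - y) \<star> z = x \<star> z - y \<star> z" "z \<star> (x - y) = z \<star> x - z \<star> y"
  using mul_add(1)[of x "-y" z] mul_add(2)[of z x "-y"] by (simp_all add: mul_minus)

lemma scl_diff: "scl a (x - y) = scl a x - scl a y" "scl (a - b) x = scl a x - scl b x"
  using scl_right[of a x "-y"] scl_left[of a "-b" x] scl_mult[of "-1" b x] by (simp_all add: scl_minus)

lemma mul_sum: "x \<star> sum f K = (\<Sum>i\<in>K. x \<star> f i)" "sum f K \<star> x = (\<Sum>i\<in>K. f i \<star> x)"
  by (induction K rule: infinite_finite_induct) (auto simp: mul_add)

lemma cg_refl [simp, intro!]: "x \<doteq> x"
  by (simp add: cg_def)

lemma cg_sym: "x \<doteq> y \<Longrightarrow> y \<doteq> x"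
  using I_uminus[of "x - y"] by (simp add: cg_def)

lemma cg_trans [trans]: "x \<doteq> y \<Longrightarrow> y \<doteq> z \<Longrightarrow> x \<doteq> z"
  using I_add[of "x - y" "y - z"] by (simp add: cg_def)

lemma cg_eq_trans [trans]: "x \<doteq> y \<Longrightarrow> y = z \<Longrightarrow> x \<doteq> z" "x = y \<Longrightarrow> y \<doteq> z \<Longrightarrow> x \<doteq> z"
  by auto

lemma cg_add: "x \<doteq> x' \<Longrightarrow> y \<doteq> y' \<Longrightarrow> x + y \<doteq> x' + y'"
  using I_add[of "x - x'" "y - y'"] by (simp add: cg_def algebra_simps)

lemma cg_scl: "x \<doteq> x' \<Longrightarrow> scl a x \<doteq> scl a x'"
  using I_scl[of "x - x'" a] by (simp add: cg_def scl_diff)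

lemma cg_minus: "x \<doteq> x' \<Longrightarrow> - x \<doteq> - x'"
  using cg_scl[of x x' "-1"] by (simp add: scl_minus)

lemma cg_diff: "x \<doteq> x' \<Longrightarrow> y \<doteq> y' \<Longrightarrow> x - y \<doteq> x' - y'"
  using cg_add[OF _ cg_minus, of x x' y y'] by simp

lemma cg_mul_left: "x \<doteq> x' \<Longrightarrow> u \<star> x \<doteq> u \<star> x'" and cg_mul_right: "x \<doteq> x' \<Longrightarrow> x \<star> u \<doteq> x' \<star> u"
  using I_mul(1)[of "x - x'" u] I_mul(2)[of "x - x'" u] by (simp_all add: cg_def mul_diff)

lemma cg_mul: "x \<doteq> x' \<Longrightarrow> y \<doteq> y' \<Longrightarrow> x \<star> y \<doteq> x' \<star> y'"
  by (blast intro: cg_trans cg_mul_left cg_mul_right)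

lemma cg_sum: "(\<And>i. i \<in> K \<Longrightarrow> f i \<doteq> g i) \<Longrightarrow> sum f K \<doteq> sum g K"
  by (induction K rule: infinite_finite_induct) (auto intro: cg_add)

text \<open>For \<open>x = e\<^sub>i\<close>, \<open>y = e\<^sub>j\<close> and the parameters
  \<open>q i i\<close>, \<open>q i j\<close> this is the braided adjoint action of
  \<open>e\<^sub>i\<close> iterated on \<open>e\<^sub>j\<close>; its value at
  \<open>1 - A i j\<close> is the Serre element.\<close>

primrec qcom :: "'k \<Rightarrow> 'k \<Rightarrow> 'v \<Rightarrow> 'v \<Rightarrow> nat \<Rightarrow> 'v" where
  "qcom q p x y 0 = y"
| "qcom q p x y (Suc m) = x \<star> qcom q p x y m - scl (q ^ m * p) (qcom q p x y m \<star> x)"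

abbreviation lp :: "'v \<Rightarrow> nat \<Rightarrow> 'v \<Rightarrow> 'v" where "lp x k \<equiv> ((\<star>) x ^^ k)"
abbreviation rp :: "'v \<Rightarrow> nat \<Rightarrow> 'v \<Rightarrow> 'v" where "rp x k \<equiv> ((\<lambda>y. y \<star> x) ^^ k)"

lemma lp_scl: "lp x k (scl a y) = scl a (lp x k y)"
  by (induction k) (auto simp: mul_scl)

lemma lp_diff: "lp x k (y - z) = lp x k y - lp x k z"
  by (induction k) (auto simp: mul_diff)

lemma lp_mul: "lp x k (y \<star> z) = lp x k y \<star> z"
  by (induction k) (auto simp: mul_assoc)

lemma lp_cong: "y \<doteq> y' \<Longrightarrow> lp x k y \<doteq> lp x k y'"
  by (induction k) (auto intro: cg_mul_left)

lemma lp_swap: "lp x k (x \<star> y) = x \<star> lp x k y"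
  by (induction k) auto

text \<open>Left and right multiplication by \<open>x\<close> commute, so \<open>qcom\<close>
  applies the product of the operators \<open>L - q\<^sup>m p R\<close> to \<open>y\<close>. The
  formula is the q-binomial expansion of that product, which is the form in which the Serre
  relations are given.\<close>

lemma qcom_expand:
  "qcom q p x y n = (\<Sum>k\<le>n. scl ((-1) ^ k * gb q n k * q ^ (k * (k - 1) div 2) * p ^ k) (lp x (n - k) (rp x k y)))"
proof (induction n)
  case (Suc n)
  let ?c = "\<lambda>n k. (-1) ^ k * gb q n k * q ^ (k * (k - 1) div 2) * p ^ k"
  \<comment> \<open>The first Pascal rule; the exponent \<open>k * (k - 1) div 2\<close> grows by
    \<open>k\<close> when \<open>k\<close> is increased by one.\<close>
  have c: "?c (Suc n) (Suc k) = ?c n (Suc k) - q ^ n * p * ?c n k" if "k \<le> n" for k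
  proof -
    have "Suc k * (Suc k - 1) div 2 = k + k * (k - 1) div 2"
    proof -
      have "even (k * (k - 1))" by (cases k) auto
      then show ?thesis by (cases k) (auto elim!: evenE simp: algebra_simps)
    qed
    moreover have "q ^ n = q ^ (n - k) * q ^ k" using that by (simp flip: power_add)
    ultimately show ?thesis by (simp add: gb_Suc power_add algebra_simps)
  qed
  have r: "lp x (n - k) (rp x k y) \<star> x = lp x (n - k) (rp x (Suc k) y)" for k
    by (simp add: lp_mul)
  have l: "x \<star> lp x (n - k) z = lp x (Suc n - k) z" if "k \<le> n" for k z
    using that by (simp add: Suc_diff_le)
  have "qcom q p x y (Suc n) = (\<Sum>k\<le>n. scl (?c n k) (lp x (Suc n - k) (rp x k y))) -
     (\<Sum>k\<le>n. scl (q ^ n * p * ?c n k) (lp x (n - k) (rp x (Suc k) y)))"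
    by (simp add: Suc mul_sum mul_scl scl_sum scl_mult r del: funpow.simps)
      (simp add: l del: funpow.simps)
  also have "(\<Sum>k\<le>n. scl (?c n k) (lp x (Suc n - k) (rp x k y))) =
     scl (?c n 0) (lp x (Suc n) y) + (\<Sum>k\<le>n. scl (?c n (Suc k)) (lp x (n - k) (rp x (Suc k) y)))"
  proof -
    have "(\<Sum>k\<le>n. scl (?c n k) (lp x (Suc n - k) (rp x k y))) = (\<Sum>k\<le>Suc n. scl (?c n k) (lp x (Suc n - k) (rp x k y)))"
      by (simp add: gb_eq_0 del: funpow.simps)
    then show ?thesis by (simp add: sum.atMost_Suc_shift del: funpow.simps sum.atMost_Suc)
  qed
  also have "\<dots> - (\<Sum>k\<le>n. scl (q ^ n * p * ?c n k) (lp x (n - k) (rp x (Suc k) y))) =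
     scl (?c n 0) (lp x (Suc n) y) + (\<Sum>k\<le>n. scl (?c (Suc n) (Suc k)) (lp x (n - k) (rp x (Suc k) y)))"
    unfolding add_diff_eq[symmetric] sum_subtractf[symmetric] scl_diff(2)[symmetric]
    by (intro arg_cong2[of _ _ _ _ "(+)"] refl sum.cong) (simp only: c atMost_iff)
  also have "\<dots> = (\<Sum>k\<le>Suc n. scl (?c (Suc n) k) (lp x (Suc n - k) (rp x k y)))"
    by (simp add: sum.atMost_Suc_shift del: funpow.simps sum.atMost_Suc)
  finally show ?case .
qed simp

text \<open>Every monomial of the iterated commutator contains \<open>m\<close> copies of
  \<open>a\<close> and one \<open>c\<close>, so \<open>b\<close> picks up the same scalar from all
  of them.\<close>

lemma qcom_left_commute:
  assumes ba: "b \<star> a \<doteq> scl q (a \<star> b)" and bc: "b \<star> c \<doteq> scl p (c \<star> b)"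
  shows "b \<star> qcom q p a c m \<doteq> scl (q ^ m * p) (qcom q p a c m \<star> b)"
proof (induction m)
  case 0
  show ?case using bc by simp
next
  case (Suc m)
  let ?D = "qcom q p a c m" and ?r = "q ^ m * p"
  have 1: "b \<star> (a \<star> ?D) \<doteq> scl (q * ?r) (a \<star> ?D \<star> b)"
  proof -
    have "b \<star> (a \<star> ?D) \<doteq> scl q (a \<star> b) \<star> ?D"
      using cg_mul_right[OF ba, of ?D] by (simp add: mul_assoc)
    also have "\<dots> = scl q (a \<star> (b \<star> ?D))" by (simp add: mul_scl mul_assoc)
    also have "\<dots> \<doteq> scl q (a \<star> scl ?r (?D \<star> b))" by (intro cg_scl cg_mul_left Suc)
    also have "\<dots> = scl (q * ?r) (a \<star> ?D \<star> b)" by (simp add: mul_scl mul_assoc scl_mult)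
    finally show ?thesis .
  qed
  have 2: "b \<star> (?D \<star> a) \<doteq> scl (q * ?r) (?D \<star> a \<star> b)"
  proof -
    have "b \<star> (?D \<star> a) \<doteq> scl ?r (?D \<star> b) \<star> a"
      using cg_mul_right[OF Suc, of a] by (simp add: mul_assoc)
    also have "\<dots> = scl ?r (?D \<star> (b \<star> a))" by (simp add: mul_scl mul_assoc)
    also have "\<dots> \<doteq> scl ?r (?D \<star> scl q (a \<star> b))" by (intro cg_scl cg_mul_left ba)
    also have "\<dots> = scl (q * ?r) (?D \<star> a \<star> b)" by (simp add: mul_scl mul_assoc mult.commute flip: scl_mult)
    finally show ?thesis .
  qed
  have "b \<star> qcom q p a c (Suc m) \<doteq> scl (q * ?r) (a \<star> ?D \<star> b) - scl ?r (scl (q * ?r) (?D \<star> a \<star> b))"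
    by (simp add: mul_diff mul_scl) (intro cg_diff 1 cg_scl 2)
  also have "\<dots> = scl (q ^ Suc m * p) (qcom q p a c (Suc m) \<star> b)"
    by (simp add: mul_diff mul_scl scl_diff mult_ac flip: scl_mult)
  finally show ?case .
qed

lemma qcom_right_commute:
  assumes ba: "b \<star> a \<doteq> scl q (a \<star> b)" and da: "d \<star> a \<doteq> scl s (a \<star> d)"
  shows "qcom q p b d m \<star> a \<doteq> scl (q ^ m * s) (a \<star> qcom q p b d m)"
proof (induction m)
  case 0
  show ?case using da by simp
next
  case (Suc m)
  let ?D = "qcom q p b d m" and ?r = "q ^ m * s"
  have 1: "b \<star> ?D \<star> a \<doteq> scl (q * ?r) (a \<star> (b \<star> ?D))"
  proof -
    have "b \<star> ?D \<star> a \<doteq> b \<star> scl ?r (a \<star> ?D)"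
      using cg_mul_left[OF Suc, of b] by (simp add: mul_assoc)
    also have "\<dots> = scl ?r (b \<star> a \<star> ?D)" by (simp add: mul_scl mul_assoc)
    also have "\<dots> \<doteq> scl ?r (scl q (a \<star> b) \<star> ?D)" by (intro cg_scl cg_mul_right ba)
    also have "\<dots> = scl (q * ?r) (a \<star> (b \<star> ?D))" by (simp add: mul_scl mul_assoc mult.commute flip: scl_mult)
    finally show ?thesis .
  qed
  have 2: "?D \<star> b \<star> a \<doteq> scl (q * ?r) (a \<star> (?D \<star> b))"
  proof -
    have "?D \<star> b \<star> a \<doteq> ?D \<star> scl q (a \<star> b)"
      using cg_mul_left[OF ba, of ?D] by (simp add: mul_assoc)
    also have "\<dots> = scl q (?D \<star> a \<star> b)" by (simp add: mul_scl mul_assoc)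
    also have "\<dots> \<doteq> scl q (scl ?r (a \<star> ?D) \<star> b)" by (intro cg_scl cg_mul_right Suc)
    also have "\<dots> = scl (q * ?r) (a \<star> (?D \<star> b))" by (simp add: mul_scl mul_assoc scl_mult)
    finally show ?thesis .
  qed
  have "qcom q p b d (Suc m) \<star> a \<doteq> scl (q * ?r) (a \<star> (b \<star> ?D)) - scl (q ^ m * p) (scl (q * ?r) (a \<star> (?D \<star> b)))"
    by (simp add: mul_diff mul_scl) (intro cg_diff 1 cg_scl 2)
  also have "\<dots> = scl (q ^ Suc m * s) (a \<star> qcom q p b d (Suc m))"
    by (simp add: mul_diff mul_scl scl_diff mult_ac flip: scl_mult)
  finally show ?case .
qed

lemma lp_commute:
  assumes ba: "b \<star> a \<doteq> scl q (a \<star> b)"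
  shows "b \<star> lp a k x \<doteq> scl (q ^ k) (lp a k (b \<star> x))"
proof (induction k)
  case (Suc k)
  have "b \<star> lp a (Suc k) x \<doteq> scl q (a \<star> b) \<star> lp a k x"
    using cg_mul_right[OF ba, of "lp a k x"] by (simp add: mul_assoc)
  also have "\<dots> = scl q (a \<star> (b \<star> lp a k x))" by (simp add: mul_scl mul_assoc)
  also have "\<dots> \<doteq> scl q (a \<star> scl (q ^ k) (lp a k (b \<star> x)))" by (intro cg_scl cg_mul_left Suc)
  also have "\<dots> = scl (q ^ Suc k) (lp a (Suc k) (b \<star> x))" by (simp add: mul_scl scl_mult)
  finally show ?case .
qed simp

text \<open>
  The coefficient of \<open>a\<^sup>m\<^sup>-\<^sup>r D\<^sub>r(b, d)\<close> in \<open>D\<^sub>m(a + b, c + d)\<close> contains all factors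
  \<open>1 - q\<^sup>l p s\<close> with \<open>r \<le> l < m\<close>.
\<close>

lemma qcom_add_general:
  assumes ba: "b \<star> a \<doteq> scl q (a \<star> b)" and bc: "b \<star> c \<doteq> scl p (c \<star> b)" and da: "d \<star> a \<doteq> scl s (a \<star> d)"
  shows "qcom q p (a + b) (c + d) m \<doteq> qcom q p a c m +
    (\<Sum>r\<le>m. scl (gb q m r * (\<Prod>l=r..<m. 1 - q ^ l * (p * s))) (lp a (m - r) (qcom q p b d r)))"
proof (induction m)
  case (Suc m)
  let ?D = "qcom q p b d" and ?E = "qcom q p a c" and ?w = "q ^ m * p"
  let ?C = "\<lambda>m r. gb q m r * (\<Prod>l=r..<m. 1 - q ^ l * (p * s))"
  let ?T = "\<lambda>m r. lp a (m - r) (?D r)"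
  have E: "(a + b) \<star> ?E m - scl ?w (?E m \<star> (a + b)) \<doteq> ?E (Suc m)"
  proof -
    have "(a + b) \<star> ?E m - scl ?w (?E m \<star> (a + b)) = ?E (Suc m) + (b \<star> ?E m - scl ?w (?E m \<star> b))"
      by (simp add: mul_add scl_right)
    also have "\<dots> \<doteq> ?E (Suc m) + 0"
      by (intro cg_add cg_refl) (use qcom_left_commute[OF ba bc, of m] in \<open>simp add: cg_def\<close>)
    finally show ?thesis by simp
  qed
  \<comment> \<open>The term \<open>r\<close> contributes to the terms \<open>r\<close> and
    \<open>r + 1\<close> of the next stage: the former through \<open>a\<close>, with the defect of
    q-commutation, the latter through \<open>b\<close>, which is first moved past the powers of
    \<open>a\<close>.\<close>
  have T: "(a + b) \<star> ?T m r - scl ?w (?T m r \<star> (a + b)) \<doteq>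
      scl (1 - q ^ (m + r) * (p * s)) (?T (Suc m) r) + scl (q ^ (m - r)) (?T (Suc m) (Suc r))" if "r \<le> m" for r
  proof -
    let ?k = "m - r"
    have m: "q ^ m = q ^ ?k * q ^ r" using that by (simp flip: power_add)
    have 1: "?T m r \<star> a \<doteq> scl (q ^ r * s) (?T (Suc m) r)"
    proof -
      have "?T m r \<star> a = lp a ?k (?D r \<star> a)" by (simp add: lp_mul)
      also have "\<dots> \<doteq> lp a ?k (scl (q ^ r * s) (a \<star> ?D r))"
        by (intro lp_cong qcom_right_commute ba da)
      also have "\<dots> = scl (q ^ r * s) (?T (Suc m) r)"
        using that by (simp add: lp_scl lp_swap Suc_diff_le)
      finally show ?thesis .
    qed
    have 2: "b \<star> ?T m r \<doteq> scl (q ^ ?k) (lp a ?k (b \<star> ?D r))"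
      by (rule lp_commute) (rule ba)
    have "(a + b) \<star> ?T m r - scl ?w (?T m r \<star> (a + b)) =
        ?T (Suc m) r + b \<star> ?T m r - scl ?w (?T m r \<star> a) - scl ?w (lp a ?k (?D r \<star> b))"
      using that by (simp add: mul_add scl_right lp_mul Suc_diff_le algebra_simps)
    also have "\<dots> \<doteq> ?T (Suc m) r + scl (q ^ ?k) (lp a ?k (b \<star> ?D r)) - scl ?w (scl (q ^ r * s) (?T (Suc m) r)) - scl ?w (lp a ?k (?D r \<star> b))"
      by (intro cg_diff cg_add cg_refl cg_scl 1 2)
    also have "\<dots> = scl (1 - q ^ (m + r) * (p * s)) (?T (Suc m) r) + scl (q ^ ?k) (?T (Suc m) (Suc r))"
      by (simp add: scl_diff lp_diff lp_scl power_add mult_ac m flip: scl_mult)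
    finally show ?thesis .
  qed
  have "qcom q p (a + b) (c + d) (Suc m) \<doteq>
      (a + b) \<star> (?E m + (\<Sum>r\<le>m. scl (?C m r) (?T m r))) - scl ?w ((?E m + (\<Sum>r\<le>m. scl (?C m r) (?T m r))) \<star> (a + b))"
    unfolding qcom.simps by (intro cg_diff cg_scl cg_mul_left cg_mul_right Suc)
  also have "\<dots> = ((a + b) \<star> ?E m - scl ?w (?E m \<star> (a + b))) +
      (\<Sum>r\<le>m. scl (?C m r) ((a + b) \<star> ?T m r - scl ?w (?T m r \<star> (a + b))))"
  proof -
    have e: "(a + b) \<star> (x + y) - scl ?w ((x + y) \<star> (a + b)) =
        ((a + b) \<star> x - scl ?w (x \<star> (a + b))) + ((a + b) \<star> y - scl ?w (y \<star> (a + b)))" for x y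
      by (simp add: mul_add scl_right algebra_simps)
    have "(\<Sum>r\<le>m. scl (?C m r) ((a + b) \<star> ?T m r - scl ?w (?T m r \<star> (a + b)))) =
        (\<Sum>r\<le>m. (a + b) \<star> scl (?C m r) (?T m r)) - (\<Sum>r\<le>m. scl ?w (scl (?C m r) (?T m r) \<star> (a + b)))"
      unfolding sum_subtractf[symmetric]
      by (intro sum.cong refl) (simp only: mul_scl scl_diff mult.commute flip: scl_mult)
    then show ?thesis
      unfolding e mul_sum scl_sum by simp
  qed
  also have "\<dots> \<doteq> ?E (Suc m) + (\<Sum>r\<le>m. scl (?C m r)
      (scl (1 - q ^ (m + r) * (p * s)) (?T (Suc m) r) + scl (q ^ (m - r)) (?T (Suc m) (Suc r))))"
    by (intro cg_add E cg_sum cg_scl T) simp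
  also have "(\<Sum>r\<le>m. scl (?C m r) (scl (1 - q ^ (m + r) * (p * s)) (?T (Suc m) r) + scl (q ^ (m - r)) (?T (Suc m) (Suc r)))) =
      (\<Sum>r\<le>m. scl (?C m r * (1 - q ^ (m + r) * (p * s))) (?T (Suc m) r)) +
      (\<Sum>r\<le>m. scl (?C m r * q ^ (m - r)) (?T (Suc m) (Suc r)))"
    by (simp only: scl_right scl_mult sum.distrib)
  also have "(\<Sum>r\<le>m. scl (?C m r * (1 - q ^ (m + r) * (p * s))) (?T (Suc m) r)) =
      (\<Sum>r\<le>Suc m. scl (?C m r * (1 - q ^ (m + r) * (p * s))) (?T (Suc m) r))"
    by (simp add: gb_eq_0)
  also have "\<dots> + (\<Sum>r\<le>m. scl (?C m r * q ^ (m - r)) (?T (Suc m) (Suc r))) =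
      scl (?C m 0 * (1 - q ^ m * (p * s))) (?T (Suc m) 0) +
      (\<Sum>r\<le>m. scl (?C m (Suc r) * (1 - q ^ (m + Suc r) * (p * s)) + ?C m r * q ^ (m - r)) (?T (Suc m) (Suc r)))"
    by (simp only: sum.atMost_Suc_shift scl_left sum.distrib add.assoc add_0_right)
  also have "\<dots> = (\<Sum>r\<le>Suc m. scl (?C (Suc m) r) (?T (Suc m) r))"
  proof -
    \<comment> \<open>The common factor \<open>P\<close> is split off; then the part without
      \<open>p * s\<close> and the part with it are combined by one Pascal rule each.\<close>
    have "?C m (Suc r) * (1 - q ^ (m + Suc r) * (p * s)) + ?C m r * q ^ (m - r) = ?C (Suc m) (Suc r)" if "r \<le> m" for r
    proof (cases "r = m")
      case False
      with that have "r < m" by simp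
      define P where "P = (\<Prod>l=Suc r..<m. 1 - q ^ l * (p * s))"
      have P: "(\<Prod>l=r..<m. 1 - q ^ l * (p * s)) = (1 - q ^ r * (p * s)) * P"
        "(\<Prod>l=Suc r..<Suc m. 1 - q ^ l * (p * s)) = P * (1 - q ^ m * (p * s))"
        using \<open>r < m\<close> by (simp_all add: P_def prod.atLeast_Suc_lessThan)
      have m: "q ^ m = q ^ (m - r) * q ^ r" using that by (simp flip: power_add)
      have "gb q m (Suc r) * (1 - q ^ (m + Suc r) * (p * s)) + gb q m r * ((1 - q ^ r * (p * s)) * q ^ (m - r)) =
        (gb q m (Suc r) + q ^ (m - r) * gb q m r) - q ^ m * (p * s) * (q ^ Suc r * gb q m (Suc r) + gb q m r)"
        unfolding power_add power_Suc m by (simp add: algebra_simps)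
      also have "\<dots> = gb q (Suc m) (Suc r) * (1 - q ^ m * (p * s))"
        unfolding gb_Suc[symmetric] gb_Suc'[symmetric] by (simp add: algebra_simps)
      finally have "P * (gb q m (Suc r) * (1 - q ^ (m + Suc r) * (p * s)) + gb q m r * ((1 - q ^ r * (p * s)) * q ^ (m - r))) =
         P * (gb q (Suc m) (Suc r) * (1 - q ^ m * (p * s)))" by simp
      then show ?thesis
        unfolding P P_def[symmetric] by (simp add: algebra_simps)
    qed (simp add: gb_eq_0)
    then show ?thesis
      by (simp only: sum.atMost_Suc_shift) (simp add: prod.atLeastLessThan_Suc)
  qed
  finally show ?case by (simp only: add.assoc)
qed (simp add: cg_def)

text \<open>Every coefficient with \<open>r < n\<close> contains the factor for
  \<open>l = n - 1\<close>, which the hypothesis makes zero; only \<open>r = n\<close>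
  remains.\<close>

lemma qcom_add:
  assumes "b \<star> a \<doteq> scl q (a \<star> b)" "b \<star> c \<doteq> scl p (c \<star> b)" "d \<star> a \<doteq> scl s (a \<star> d)"
    and n: "n > 0" "q ^ (n - 1) * (p * s) = 1"
  shows "qcom q p (a + b) (c + d) n \<doteq> qcom q p a c n + qcom q p b d n"
proof -
  have P: "(\<Prod>l=r..<n. 1 - q ^ l * (p * s)) = 0" if "r < n" for r
    by (rule prod_zero) (use n that in \<open>auto intro!: bexI[of _ "n - 1"]\<close>)
  then have "(\<Sum>r\<le>n. scl (gb q n r * (\<Prod>l=r..<n. 1 - q ^ l * (p * s))) (lp a (n - r) (qcom q p b d r))) =
      (\<Sum>r\<le>n. if r = n then qcom q p b d n else 0)"
    by (intro sum.cong refl) (simp add: P)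
  then show ?thesis
    using qcom_add_general[OF assms(1-3), of n] by simp
qed

end


section \<open>Commutators of iterated q-commutators with another element\<close>

context cong_alg
begin

lemma commutator_step:
  "g \<star> (x \<star> y - scl c (y \<star> x)) - (x \<star> y - scl c (y \<star> x)) \<star> g =
    x \<star> (g \<star> y - y \<star> g) + (g \<star> x - x \<star> g) \<star> y - scl c ((g \<star> y - y \<star> g) \<star> x) - scl c (y \<star> (g \<star> x - x \<star> g))"
  by (simp add: mul_diff mul_scl scl_diff mul_assoc)

lemma qcom_commute:
  assumes "g \<star> x \<doteq> x \<star> g" "g \<star> y \<doteq> y \<star> g"
  shows "g \<star> qcom q p x y m \<doteq> qcom q p x y m \<star> g"
proof (induction m)
  case (Suc m)
  let ?D = "qcom q p x y m"
  have "g \<star> qcom q p x y (Suc m) - qcom q p x y (Suc m) \<star> g \<doteq> x \<star> 0 + 0 \<star> ?D - scl (q ^ m * p) (0 \<star> x) - scl (q ^ m * p) (?D \<star> 0)"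
    unfolding qcom.simps commutator_step
    by (intro cg_add cg_diff cg_scl cg_mul_left cg_mul_right) (use Suc assms in \<open>simp_all add: cg_def\<close>)
  then show ?case by (simp add: cg_def)
qed (use assms in simp)

text \<open>Here \<open>g\<close> stands for the opposite generator with the index of
  \<open>x\<close>. Its commutator with an iterate is a multiple of \<open>u'\<close> times the
  preceding iterate, and the multiple vanishes at stage \<open>n\<close> because
  \<open>q ^ n * (p * s) = q\<close>.\<close>

lemma qcom_commutator_diag:
  assumes gx: "g \<star> x \<doteq> x \<star> g + scl \<kappa> (u' - u)" and gy: "g \<star> y \<doteq> y \<star> g"
    and ux: "u \<star> x \<doteq> scl q (x \<star> u)" and uy: "u \<star> y \<doteq> scl p (y \<star> u)"
    and xu': "x \<star> u' \<doteq> scl q (u' \<star> x)" and yu': "y \<star> u' \<doteq> scl s (u' \<star> y)"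
    and n: "n > 0" "q ^ (n - 1) * (p * s) = 1" "q \<noteq> 0" "q \<noteq> 1"
  shows "g \<star> qcom q p x y n \<doteq> qcom q p x y n \<star> g"
proof -
  let ?D = "qcom q p x y"
  \<comment> \<open>The multiple solves the recursion
    \<open>a' = q * a + \<kappa> * (1 - q ^ (2 * m) * (p * s))\<close>; its closed form is stated
    with the denominator \<open>(q - 1) * q\<close> cleared. At \<open>m = 0\<close> it is zero, so
    the truncated \<open>m - 1\<close> does no harm.\<close>
  have "\<exists>a. (q - 1) * q * a = \<kappa> * (q ^ m - 1) * (q - q ^ m * (p * s)) \<and>
      g \<star> ?D m - ?D m \<star> g \<doteq> scl a (u' \<star> ?D (m - 1))" for m
  proof (induction m)
    case 0
    show ?case using gy by (auto intro!: exI[of _ 0] simp: cg_def)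
  next
    case (Suc m)
    let ?c = "q ^ m * p"
    obtain a where a: "(q - 1) * q * a = \<kappa> * (q ^ m - 1) * (q - q ^ m * (p * s))"
      "g \<star> ?D m - ?D m \<star> g \<doteq> scl a (u' \<star> ?D (m - 1))"
      using Suc by blast
    have gx': "g \<star> x - x \<star> g \<doteq> scl \<kappa> (u' - u)"
      using gx by (simp add: cg_def diff_diff_eq)
    have 1: "x \<star> scl a (u' \<star> ?D (m - 1)) - scl ?c (scl a (u' \<star> ?D (m - 1)) \<star> x) \<doteq> scl (q * a) (u' \<star> ?D m)"
    proof (cases m)
      case 0
      then have "a = 0" using a n by simp
      then show ?thesis by simp
    next
      case (Suc l)
      have "x \<star> (u' \<star> ?D l) \<doteq> scl q (u' \<star> x \<star> ?D l)"
        using cg_mul_right[OF xu', of "?D l"] by (simp add: mul_assoc mul_scl)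
      then have "x \<star> scl a (u' \<star> ?D (m - 1)) - scl ?c (scl a (u' \<star> ?D (m - 1)) \<star> x) \<doteq>
          scl a (scl q (u' \<star> x \<star> ?D l)) - scl ?c (scl a (u' \<star> ?D l \<star> x))"
        unfolding Suc diff_Suc_1 mul_scl by (intro cg_diff cg_scl cg_refl)
      also have "\<dots> = scl (q * a) (u' \<star> ?D m)"
        by (simp add: Suc mul_diff mul_scl scl_diff mul_assoc mult_ac flip: scl_mult)
      finally show ?thesis .
    qed
    \<comment> \<open>The two terms containing \<open>u\<close> cancel, as \<open>u\<close> commutes
      with the iterate up to exactly the scalar \<open>?c\<close>; only \<open>u'\<close> is
      left.\<close>
    have 2: "scl \<kappa> (u' - u) \<star> ?D m - scl ?c (?D m \<star> scl \<kappa> (u' - u)) \<doteq> scl (\<kappa> * (1 - q ^ m * q ^ m * (p * s))) (u' \<star> ?D m)"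
    proof -
      have "scl \<kappa> (u' - u) \<star> ?D m - scl ?c (?D m \<star> scl \<kappa> (u' - u)) =
          scl \<kappa> (u' \<star> ?D m - u \<star> ?D m - scl ?c (?D m \<star> u') + scl ?c (?D m \<star> u))"
        by (simp add: mul_diff mul_scl scl_diff scl_right mult.commute flip: scl_mult)
      also have "\<dots> \<doteq> scl \<kappa> (u' \<star> ?D m - scl ?c (?D m \<star> u) - scl ?c (scl (q ^ m * s) (u' \<star> ?D m)) + scl ?c (?D m \<star> u))"
        by (intro cg_scl cg_add cg_diff cg_refl qcom_left_commute qcom_right_commute ux uy xu' yu')
      also have "\<dots> = scl (\<kappa> * (1 - q ^ m * q ^ m * (p * s))) (u' \<star> ?D m)"
        by (simp add: scl_diff scl_mult[of \<kappa>]) (simp add: mult_ac flip: scl_mult)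
      finally show ?thesis .
    qed
    have "g \<star> ?D (Suc m) - ?D (Suc m) \<star> g \<doteq>
        x \<star> scl a (u' \<star> ?D (m - 1)) + scl \<kappa> (u' - u) \<star> ?D m - scl ?c (scl a (u' \<star> ?D (m - 1)) \<star> x) - scl ?c (?D m \<star> scl \<kappa> (u' - u))"
      unfolding qcom.simps commutator_step
      by (intro cg_add cg_diff cg_scl cg_mul_left cg_mul_right a gx')
    also have "\<dots> = (x \<star> scl a (u' \<star> ?D (m - 1)) - scl ?c (scl a (u' \<star> ?D (m - 1)) \<star> x)) +
       (scl \<kappa> (u' - u) \<star> ?D m - scl ?c (?D m \<star> scl \<kappa> (u' - u)))"
      by simp
    also have "\<dots> \<doteq> scl (q * a) (u' \<star> ?D m) + scl (\<kappa> * (1 - q ^ m * q ^ m * (p * s))) (u' \<star> ?D m)"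
      by (intro cg_add 1 2)
    also have "\<dots> = scl (q * a + \<kappa> * (1 - q ^ m * q ^ m * (p * s))) (u' \<star> ?D (Suc m - 1))"
      by (simp add: scl_left)
    finally have 3: "g \<star> ?D (Suc m) - ?D (Suc m) \<star> g \<doteq> scl (q * a + \<kappa> * (1 - q ^ m * q ^ m * (p * s))) (u' \<star> ?D (Suc m - 1))" .
    have "(q - 1) * q * (q * a + \<kappa> * (1 - q ^ m * q ^ m * (p * s))) =
        q * ((q - 1) * q * a) + (q - 1) * q * (\<kappa> * (1 - q ^ m * q ^ m * (p * s)))"
      by (simp only: distrib_left mult_ac)
    also have "\<dots> = \<kappa> * (q ^ Suc m - 1) * (q - q ^ Suc m * (p * s))"
      unfolding a(1) by (simp add: algebra_simps)
    finally show ?case using 3 by blast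
  qed
  from this[of n] obtain a where a: "(q - 1) * q * a = \<kappa> * (q ^ n - 1) * (q - q ^ n * (p * s))"
    "g \<star> ?D n - ?D n \<star> g \<doteq> scl a (u' \<star> ?D (n - 1))" by blast
  have "q ^ n * (p * s) = q"
    using n by (cases n) (auto simp: mult.assoc)
  then have "a = 0" using a(1) n by simp
  then show ?thesis using a by (simp add: cg_def)
qed

text \<open>Now \<open>g\<close> fails to commute with \<open>y\<close> only. The \<open>w'\<close>
  part dies at the first step, and the \<open>w\<close> part becomes \<open>x\<^sup>m w\<close>
  times a product whose factor for \<open>l = n - 1\<close> is zero.\<close>

lemma qcom_commutator_off:
  assumes gx: "g \<star> x \<doteq> x \<star> g" and gy: "g \<star> y \<doteq> y \<star> g + scl \<kappa> (w' - w)"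
    and wx: "w \<star> x \<doteq> scl s (x \<star> w)" and xw': "x \<star> w' \<doteq> scl p (w' \<star> x)"
    and n: "n > 0" "q ^ (n - 1) * (p * s) = 1"
  shows "g \<star> qcom q p x y n \<doteq> qcom q p x y n \<star> g"
proof -
  let ?D = "qcom q p x y"
  let ?y = "\<lambda>m. - \<kappa> * (\<Prod>l<m. 1 - q ^ l * (p * s))"
  let ?R = "\<lambda>m. scl (?y m) (lp x m w) + (if m = 0 then scl \<kappa> w' else 0)"
  have *: "g \<star> ?D m - ?D m \<star> g \<doteq> ?R m" for m
  proof (induction m)
    case 0
    show ?case
    proof -
      have "scl (- \<kappa>) w = - scl \<kappa> w"
        using scl_left[of \<kappa> "-\<kappa>" w] by (simp add: eq_neg_iff_add_eq_0 add.commute)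
      then show ?thesis using gy by (simp add: cg_def scl_diff diff_diff_eq)
    qed
  next
    case (Suc m)
    let ?c = "q ^ m * p"
    have r: "lp x m w \<star> x \<doteq> scl s (x \<star> lp x m w)"
    proof -
      have "lp x m w \<star> x = lp x m (w \<star> x)" by (simp only: lp_mul)
      also have "\<dots> \<doteq> lp x m (scl s (x \<star> w))" by (rule lp_cong) (rule wx)
      also have "\<dots> = scl s (x \<star> lp x m w)" by (simp only: lp_scl lp_swap)
      finally show ?thesis .
    qed
    have w': "x \<star> (if m = 0 then scl \<kappa> w' else 0) - scl ?c ((if m = 0 then scl \<kappa> w' else 0) \<star> x) \<doteq> 0"
    proof (cases "m = 0")
      case True
      have "scl \<kappa> (x \<star> w' - scl p (w' \<star> x)) \<doteq> scl \<kappa> 0"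
        by (intro cg_scl) (use xw' in \<open>simp add: cg_def\<close>)
      then show ?thesis
        using True by (simp add: mul_scl scl_diff mult.commute flip: scl_mult)
    qed simp
    have "g \<star> ?D (Suc m) - ?D (Suc m) \<star> g \<doteq> x \<star> ?R m + 0 \<star> ?D m - scl ?c (?R m \<star> x) - scl ?c (?D m \<star> 0)"
      unfolding qcom.simps commutator_step
      by (intro cg_add cg_diff cg_scl cg_mul_left cg_mul_right Suc) (use gx in \<open>simp_all add: cg_def\<close>)
    also have "\<dots> = scl (?y m) (x \<star> lp x m w) - scl ?c (scl (?y m) (lp x m w \<star> x)) +
        (x \<star> (if m = 0 then scl \<kappa> w' else 0) - scl ?c ((if m = 0 then scl \<kappa> w' else 0) \<star> x))"
      by (simp add: mul_add mul_scl scl_right)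
    also have "\<dots> \<doteq> scl (?y m) (x \<star> lp x m w) - scl ?c (scl (?y m) (scl s (x \<star> lp x m w))) + 0"
      by (intro cg_add cg_diff cg_scl cg_refl r w')
    also have "\<dots> = scl (?y m - ?c * (?y m * s)) (x \<star> lp x m w)"
      by (simp only: scl_diff scl_mult add_0_right)
    also have "?y m - ?c * (?y m * s) = ?y (Suc m)"
      by (simp add: algebra_simps)
    finally show ?case by simp
  qed
  have P: "(\<Prod>l<n. 1 - q ^ l * (p * s)) = 0"
    by (rule prod_zero) (use n in \<open>auto intro!: bexI[of _ "n - 1"]\<close>)
  show ?thesis using *[of n] n unfolding P by (simp add: cg_def)
qed

text \<open>Meant for \<open>h = \<omega>\<^sub>i \<otimes> 1\<close> and
  \<open>x = 1 \<otimes> e\<^sub>i\<close> in the tensor square: first legs commute with second legs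
  and can be collected in front.\<close>

lemma qcom_torus_factor:
  assumes hx: "h \<star> x \<doteq> x \<star> h" and hy: "h \<star> y \<doteq> y \<star> h" and kx: "k \<star> x \<doteq> x \<star> k" and kh: "k \<star> h \<doteq> h \<star> k"
  shows "qcom q p (h \<star> x) (k \<star> y) m \<doteq> lp h m k \<star> qcom q p x y m"
proof (induction m)
  case (Suc m)
  let ?D = "qcom q p x y m" and ?G = "lp h m k" and ?c = "q ^ m * p"
  have com: "lp h l k \<star> z \<doteq> z \<star> lp h l k" if "h \<star> z \<doteq> z \<star> h" "k \<star> z \<doteq> z \<star> k" for z l
  proof (induction l)
    case (Suc l)
    have "lp h (Suc l) k \<star> z = h \<star> (lp h l k \<star> z)" by (simp add: mul_assoc)
    also have "\<dots> \<doteq> h \<star> (z \<star> lp h l k)" by (intro cg_mul_left Suc)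
    also have "\<dots> = h \<star> z \<star> lp h l k" by (simp add: mul_assoc)
    also have "\<dots> \<doteq> z \<star> h \<star> lp h l k" by (intro cg_mul_right that)
    finally show ?case by (simp add: mul_assoc)
  qed (simp add: that)
  have 1: "h \<star> x \<star> (?G \<star> ?D) \<doteq> h \<star> ?G \<star> (x \<star> ?D)"
  proof -
    have "h \<star> (x \<star> ?G) \<star> ?D \<doteq> h \<star> (?G \<star> x) \<star> ?D"
      by (intro cg_mul_right cg_mul_left cg_sym[OF com] hx kx)
    then show ?thesis by (simp add: mul_assoc)
  qed
  have 2: "?G \<star> ?D \<star> (h \<star> x) \<doteq> h \<star> ?G \<star> (?D \<star> x)"
  proof -
    have "?G \<star> ?D \<star> (h \<star> x) = ?G \<star> (?D \<star> h) \<star> x" by (simp add: mul_assoc)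
    also have "\<dots> \<doteq> ?G \<star> (h \<star> ?D) \<star> x"
      by (intro cg_mul_right cg_mul_left cg_sym[OF qcom_commute] hx hy)
    also have "\<dots> = ?G \<star> h \<star> (?D \<star> x)" by (simp add: mul_assoc)
    also have "\<dots> \<doteq> h \<star> ?G \<star> (?D \<star> x)"
      by (intro cg_mul_right com kh cg_refl)
    finally show ?thesis .
  qed
  have "qcom q p (h \<star> x) (k \<star> y) (Suc m) \<doteq> h \<star> x \<star> (?G \<star> ?D) - scl ?c (?G \<star> ?D \<star> (h \<star> x))"
    unfolding qcom.simps by (intro cg_diff cg_scl cg_mul_left cg_mul_right Suc)
  also have "\<dots> \<doteq> h \<star> ?G \<star> (x \<star> ?D) - scl ?c (h \<star> ?G \<star> (?D \<star> x))"
    by (intro cg_diff cg_scl 1 2)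
  also have "\<dots> = lp h (Suc m) k \<star> qcom q p x y (Suc m)"
    by (simp add: mul_diff mul_scl)
  finally show ?case .
qed simp

end

section \<open>Two-sided ideals of a ring\<close>

text \<open>The arbitrary factor \<open>u\<close> already supplies negatives and scalar multiples,
  so that closure under addition yields the two-sided ideal.\<close>

inductive_set ideal_of :: "'a::ring_1 set \<Rightarrow> 'a set" for R where
  zero: "0 \<in> ideal_of R"
| gen: "r \<in> R \<Longrightarrow> u * r * v \<in> ideal_of R"
| add: "x \<in> ideal_of R \<Longrightarrow> y \<in> ideal_of R \<Longrightarrow> x + y \<in> ideal_of R"

lemma ideal_of_base: "r \<in> R \<Longrightarrow> r \<in> ideal_of R"
  using ideal_of.gen[of r R 1 1] by simp

lemma ideal_of_mult: "x \<in> ideal_of R \<Longrightarrow> u * x * v \<in> ideal_of R"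
proof (induction rule: ideal_of.induct)
  case (gen r u' v')
  have "u * (u' * r * v') * v = (u * u') * r * (v' * v)" by (simp add: mult.assoc)
  then show ?case using ideal_of.gen[OF gen, of "u * u'" "v' * v"] by simp
qed (auto simp: distrib_left distrib_right intro: ideal_of.intros)

lemma ideal_of_mult_left: "x \<in> ideal_of R \<Longrightarrow> u * x \<in> ideal_of R"
  and ideal_of_mult_right: "x \<in> ideal_of R \<Longrightarrow> x * u \<in> ideal_of R"
  using ideal_of_mult[of x R u 1] ideal_of_mult[of x R 1 u] by simp_all

lemma ideal_of_hom:
  assumes "x \<in> ideal_of R" "\<And>x y. h (x + y) = h x + h y" "\<And>x y. h (x * y) = h x * h y"
    "\<And>r. r \<in> R \<Longrightarrow> h r \<in> ideal_of S"
  shows "h x \<in> ideal_of S"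
  using assms(1)
proof (induction rule: ideal_of.induct)
  case zero
  show ?case using assms(2)[of 0 0] by (simp add: ideal_of.zero)
qed (auto simp: assms intro: ideal_of_mult ideal_of.add)

lemma ideal_of_mono: "R \<subseteq> S \<Longrightarrow> ideal_of R \<subseteq> ideal_of S"
proof
  fix x assume "R \<subseteq> S" "x \<in> ideal_of R"
  then show "x \<in> ideal_of S"
    using ideal_of_hom[of x R id S] ideal_of_base by auto
qed

lemma ideal_of_sc: "x \<in> ideal_of R \<Longrightarrow> sc a x \<in> ideal_of (R :: ('g::monoid_add \<Rightarrow>\<^sub>0 'k::field) set)"
  by (simp add: mult_map_scale_conv_mult ideal_of_mult_left)

lemma cong_alg_ideal_of:
  "cong_alg sc (*) (ideal_of (R :: ('g::monoid_add \<Rightarrow>\<^sub>0 'k::field) set))"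
  by unfold_locales
    (auto simp: mult.assoc distrib_left distrib_right intro: ideal_of.intros ideal_of_sc ideal_of_mult_left ideal_of_mult_right)

lemma cong_alg_ideal_of_op:
  "cong_alg sc (\<lambda>x y. y * x) (ideal_of (R :: ('g::monoid_add \<Rightarrow>\<^sub>0 'k::field) set))"
  by unfold_locales
    (auto simp: mult.assoc distrib_left distrib_right intro: ideal_of.intros ideal_of_sc ideal_of_mult_left ideal_of_mult_right)

section \<open>Relations of the quantum group\<close>

text \<open>All relations except those of Serre. The Serre elements are studied modulo these, so
  that statements about them are not made trivial by the Serre relations themselves.\<close>

inductive_set rels0 :: "('i \<Rightarrow> 'i \<Rightarrow> 'k::field) \<Rightarrow> ('i qgen list \<Rightarrow>\<^sub>0 'k) set" for q where
  torus: "g \<in> torus_gens \<Longrightarrow> h \<in> torus_gens \<Longrightarrow> wrd [g, h] - wrd [h, g] \<in> rels0 q"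
| om_inv: "wrd [Om i, OmInv i] - wrd [] \<in> rels0 q"
| om'_inv: "wrd [Om' i, OmInv' i] - wrd [] \<in> rels0 q"
| om_e: "wrd [Om i, Egen j, OmInv i] - sgl [Egen j] (q i j) \<in> rels0 q"
| om'_e: "wrd [Om' i, Egen j, OmInv' i] - sgl [Egen j] (inverse (q j i)) \<in> rels0 q"
| om_f: "wrd [Om i, Fgen j, OmInv i] - sgl [Fgen j] (inverse (q i j)) \<in> rels0 q"
| om'_f: "wrd [Om' i, Fgen j, OmInv' i] - sgl [Fgen j] (q j i) \<in> rels0 q"
| ef: "wrd [Egen i, Fgen j] - wrd [Fgen j, Egen i]
       - (if i = j then sgl [Om i] (q i i / (q i i - 1)) - sgl [Om' i] (q i i / (q i i - 1)) else 0) \<in> rels0 q"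

lemma rels0_eq: "rels0 q =
    {wrd [g, h] - wrd [h, g] | g h. g \<in> torus_gens \<and> h \<in> torus_gens} \<union>
    {wrd [Om i, OmInv i] - wrd [] | i. True} \<union>
    {wrd [Om' i, OmInv' i] - wrd [] | i. True} \<union>
    {wrd [Om i, Egen j, OmInv i] - sgl [Egen j] (q i j) | i j. True} \<union>
    {wrd [Om' i, Egen j, OmInv' i] - sgl [Egen j] (inverse (q j i)) | i j. True} \<union>
    {wrd [Om i, Fgen j, OmInv i] - sgl [Fgen j] (inverse (q i j)) | i j. True} \<union>
    {wrd [Om' i, Fgen j, OmInv' i] - sgl [Fgen j] (q j i) | i j. True} \<union>
    {wrd [Egen i, Fgen j] - wrd [Fgen j, Egen i]
       - (if i = j then sgl [Om i] (q i i / (q i i - 1)) - sgl [Om' i] (q i i / (q i i - 1)) else 0)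
       | i j. True}" (is "_ = ?R")
proof (intro equalityI subsetI)
  fix r show "r \<in> ?R" if "r \<in> rels0 q"
    using that by cases blast+
  show "r \<in> rels0 q" if "r \<in> ?R"
    using that by (elim UnE CollectE exE conjE) (simp_all only: rels0.intros)
qed

definition serreE where
  "serreE A q i j = (\<Sum>k\<le>nat (1 - A i j).
        sgl (replicate (nat (1 - A i j) - k) (Egen i) @ [Egen j] @ replicate k (Egen i)) (serre_coeff A q i j k))"

definition serreF where
  "serreF A q i j = (\<Sum>k\<le>nat (1 - A i j).
        sgl (replicate k (Fgen i) @ [Fgen j] @ replicate (nat (1 - A i j) - k) (Fgen i)) (serre_coeff A q i j k))"

lemma qgroup_rels_eq: "qgroup_rels A q = rels0 q \<union> {serreE A q i j | i j. i \<noteq> j} \<union> {serreF A q i j | i j. i \<noteq> j}"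
  by (simp only: qgroup_rels_def rels0_eq serreE_def serreF_def)

fun tinv :: "'i qgen \<Rightarrow> 'i qgen" where
  "tinv (Om i) = OmInv i" | "tinv (OmInv i) = Om i" | "tinv (Om' i) = OmInv' i" | "tinv (OmInv' i) = Om' i"
| "tinv g = g"

text \<open>\<open>tw q g x\<close> is the scalar in \<open>g x = tw q g x \<cdot> x g\<close> for a torus generator \<open>g\<close>.\<close>

fun tw :: "('i \<Rightarrow> 'i \<Rightarrow> 'k::field) \<Rightarrow> 'i qgen \<Rightarrow> 'i qgen \<Rightarrow> 'k" where
  "tw q (Om i) (Egen j) = q i j" | "tw q (OmInv i) (Egen j) = inverse (q i j)"
| "tw q (Om' i) (Egen j) = inverse (q j i)" | "tw q (OmInv' i) (Egen j) = q j i"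
| "tw q (Om i) (Fgen j) = inverse (q i j)" | "tw q (OmInv i) (Fgen j) = q i j"
| "tw q (Om' i) (Fgen j) = q j i" | "tw q (OmInv' i) (Fgen j) = inverse (q j i)"
| "tw q g x = 1"

lemma torus_gens_iff [simp]: "Om i \<in> torus_gens" "OmInv i \<in> torus_gens" "Om' i \<in> torus_gens" "OmInv' i \<in> torus_gens"
  "Egen i \<notin> torus_gens" "Fgen i \<notin> torus_gens"
  by (auto simp: torus_gens_def)

lemma torus_genE:
  assumes "g \<in> torus_gens"
  obtains i where "g = Om i" | i where "g = OmInv i" | i where "g = Om' i" | i where "g = OmInv' i"
  using assms by (cases g) auto

locale qparam =
  fixes q :: "'i \<Rightarrow> 'i \<Rightarrow> 'k::field"
  assumes q_nonzero [simp]: "q i j \<noteq> 0" and q_diag: "q i i \<noteq> 1"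
begin

sublocale F: cong_alg sc "(*)" "ideal_of (rels0 q)"
  by (rule cong_alg_ideal_of)

sublocale Fop: cong_alg sc "\<lambda>x y. y * x" "ideal_of (rels0 q)"
  by (rule cong_alg_ideal_of_op)

abbreviation eqv (infix "\<doteq>" 50) where "x \<doteq> y \<equiv> F.cg x y"

lemma rel_eqv: "x - y \<in> rels0 q \<Longrightarrow> x \<doteq> y"
  by (simp add: F.cg_def ideal_of_base)

lemma torus_comm0: "g \<in> torus_gens \<Longrightarrow> h \<in> torus_gens \<Longrightarrow> wrd [g] * wrd [h] \<doteq> wrd [h] * wrd [g]"
  by (simp add: wrd_mult rel_eqv rels0.torus)

lemma torus_inv_mult: "g \<in> torus_gens \<Longrightarrow> wrd [g] * wrd [tinv g] \<doteq> 1"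
proof -
  have 1: "wrd [Om i] * wrd [OmInv i] \<doteq> 1" for i
    unfolding sgl_Nil[symmetric] by (simp only: wrd_mult append.simps) (rule rel_eqv, rule rels0.intros)
  have 2: "wrd [Om' i] * wrd [OmInv' i] \<doteq> 1" for i
    unfolding sgl_Nil[symmetric] by (simp only: wrd_mult append.simps) (rule rel_eqv, rule rels0.intros)
  have 3: "wrd [OmInv i] * wrd [Om i] \<doteq> 1" "wrd [OmInv' i] * wrd [Om' i] \<doteq> 1" for i
    by (rule F.cg_trans[OF torus_comm0]; simp add: 1 2)+
  assume "g \<in> torus_gens"
  then show ?thesis using 1 2 3 by (cases g) auto
qed

lemma tinv_simps [simp]: "tinv (tinv g) = g" "tinv g \<in> torus_gens \<longleftrightarrow> g \<in> torus_gens"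
  by (cases g; simp)+

lemma tw_nonzero [simp]: "tw q g x \<noteq> 0"
  by (cases g; cases x) auto

lemma tw_tinv: "g \<in> torus_gens \<Longrightarrow> tw q (tinv g) x = inverse (tw q g x)"
  by (cases g; cases x) auto

lemma conj_to_comm:
  assumes g: "g \<in> torus_gens" and r: "wrd [g] * x * wrd [tinv g] \<doteq> sc r x" "r \<noteq> 0"
  shows "wrd [g] * x \<doteq> sc r (x * wrd [g])" "wrd [tinv g] * x \<doteq> sc (inverse r) (x * wrd [tinv g])"
proof -
  have "wrd [g] * x = wrd [g] * x * 1" by simp
  also have "\<dots> \<doteq> wrd [g] * x * (wrd [tinv g] * wrd [g])"
    by (rule F.cg_mul_left, rule F.cg_sym) (use torus_inv_mult[of "tinv g"] g in simp)
  also have "\<dots> = (wrd [g] * x * wrd [tinv g]) * wrd [g]" by (simp add: mult.assoc)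
  also have "\<dots> \<doteq> sc r x * wrd [g]" by (intro F.cg_mul_right r)
  finally show "wrd [g] * x \<doteq> sc r (x * wrd [g])" by simp
  have "x * wrd [tinv g] = 1 * (x * wrd [tinv g])" by simp
  also have "\<dots> \<doteq> wrd [tinv g] * wrd [g] * (x * wrd [tinv g])"
    by (rule F.cg_mul_right, rule F.cg_sym) (use torus_inv_mult[of "tinv g"] g in simp)
  also have "\<dots> = wrd [tinv g] * (wrd [g] * x * wrd [tinv g])" by (simp add: mult.assoc)
  also have "\<dots> \<doteq> wrd [tinv g] * sc r x" by (intro F.cg_mul_left r)
  finally have "sc (inverse r) (x * wrd [tinv g]) \<doteq> sc (inverse r) (wrd [tinv g] * sc r x)" by (rule F.cg_scl)
  also have "\<dots> = wrd [tinv g] * x" using r by (simp flip: pm.scl_mult)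
  finally show "wrd [tinv g] * x \<doteq> sc (inverse r) (x * wrd [tinv g])" by (rule F.cg_sym)
qed

lemma torus_comm:
  assumes g: "g \<in> torus_gens"
  shows "wrd [g] * wrd [x] \<doteq> sc (tw q g x) (wrd [x] * wrd [g])"
proof -
  have *: "wrd [g] * wrd [x] * wrd [tinv g] \<doteq> sc (tw q g x) (wrd [x])"
    if "g = Om i \<or> g = Om' i" "x = Egen j \<or> x = Fgen j" for g x i j
    by (simp add: wrd_mult, rule rel_eqv) (use that in \<open>auto intro: rels0.intros\<close>)
  show ?thesis
  proof (cases "x \<in> torus_gens")
    case True
    then have "tw q g x = 1" using g by (cases g; cases x) auto
    then show ?thesis using torus_comm0[OF g True] by simp
  next
    case False
    then obtain j where x: "x = Egen j \<or> x = Fgen j" by (cases x) auto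
    from g show ?thesis
    proof (cases rule: torus_genE)
      case (1 i) then show ?thesis using conj_to_comm(1)[OF g *[OF _ x]] by simp
    next
      case (3 i) then show ?thesis using conj_to_comm(1)[OF g *[OF _ x]] by simp
    next
      case (2 i)
      then show ?thesis using conj_to_comm(2)[of "Om i", OF _ *[OF _ x]] tw_tinv[of "Om i" x] by simp
    next
      case (4 i)
      then show ?thesis using conj_to_comm(2)[of "Om' i", OF _ *[OF _ x]] tw_tinv[of "Om' i" x] by simp
    qed
  qed
qed

lemma torus_comm':
  assumes g: "g \<in> torus_gens"
  shows "wrd [x] * wrd [g] \<doteq> sc (inverse (tw q g x)) (wrd [g] * wrd [x])"
  using F.cg_scl[OF F.cg_sym[OF torus_comm[OF g, of x]], of "inverse (tw q g x)"]
  by (simp flip: pm.scl_mult)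

definition "kap i = q i i / (q i i - 1)"

lemma ef_comm: "wrd [Egen i] * wrd [Fgen j] \<doteq> wrd [Fgen j] * wrd [Egen i] +
    (if i = j then sc (kap i) (wrd [Om i] - wrd [Om' i]) else 0)"
proof -
  have e: "wrd [Egen i] * wrd [Fgen j] - (wrd [Fgen j] * wrd [Egen i] + (if i = j then sc (kap i) (wrd [Om i] - wrd [Om' i]) else 0)) =
     wrd [Egen i, Fgen j] - wrd [Fgen j, Egen i]
       - (if i = j then sgl [Om i] (q i i / (q i i - 1)) - sgl [Om' i] (q i i / (q i i - 1)) else 0)"
    by (simp add: wrd_mult kap_def F.scl_diff diff_diff_eq)
  show ?thesis
    by (rule rel_eqv, unfold e) (rule rels0.ef)
qed

end


section \<open>Quotients of the free algebra\<close>

abbreviation "wmon \<equiv> \<lparr>carrier = UNIV, monoid.mult = (@), one = []\<rparr>"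

lemma mmul_wmon: "mmul wmon x y = x * y"
proof (induction x rule: word_induct)
  case (single w)
  show ?case
    by (induction y rule: word_induct) (simp_all add: mmul_sgl wrd_mult mmul_add mmul_sc distrib_left)
qed (simp_all add: mmul_add mmul_sc distrib_right)

lemma wmon_monoid: "Group.monoid wmon"
  by (rule Group.monoidI) auto

lemma free_alg_simps: "carrier free_alg = UNIV" "x \<otimes>\<^bsub>free_alg\<^esub> y = x * y" "x \<oplus>\<^bsub>free_alg\<^esub> y = x + y" "\<zero>\<^bsub>free_alg\<^esub> = 0"
  "c \<odot>\<^bsub>free_alg\<^esub> x = sc c x" "\<one>\<^bsub>free_alg\<^esub> = 1"
  by (simp_all add: free_alg_def monoid_alg_mult mmul_wmon)

lemma free_alg_image: "alg_image sc free_alg UNIV id (*) (1 :: 'g list \<Rightarrow>\<^sub>0 'k::field)"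
  by unfold_locales (simp_all add: free_alg_simps distrib_left distrib_right mult.assoc)

lemma ideal_ideal_of: "ideal (ideal_of R) (free_alg :: ('k::field, 'g list \<Rightarrow>\<^sub>0 'k) module)"
proof -
  interpret A: alg_image sc "free_alg :: ('k, 'g list \<Rightarrow>\<^sub>0 'k) module" UNIV id "(*)" 1
    by (rule free_alg_image)
  have "submodule (ideal_of R) field_alg free_alg"
    by (rule A.submoduleI) (auto simp: free_alg_simps intro: ideal_of.intros ideal_of_sc)
  then show ?thesis
    by (intro idealI A.alg.ring_H submodule.axioms(1))
      (auto simp: free_alg_simps intro: ideal_of_mult_left ideal_of_mult_right)
qed

lemma genideal_eq: "Idl\<^bsub>free_alg\<^esub> R = ideal_of (R :: ('g list \<Rightarrow>\<^sub>0 'k::field) set)"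
proof
  show "Idl\<^bsub>free_alg\<^esub> R \<subseteq> ideal_of R"
    unfolding genideal_def by (rule Inter_lower) (auto simp: ideal_ideal_of ideal_of_base)
  show "ideal_of R \<subseteq> Idl\<^bsub>free_alg\<^esub> R"
    unfolding genideal_def
  proof (intro subsetI InterI, elim CollectE conjE)
    fix x N assume "x \<in> ideal_of R" "ideal N free_alg" "R \<subseteq> N"
    interpret N: ideal N "free_alg :: ('k, 'g list \<Rightarrow>\<^sub>0 'k) module" by fact
    from \<open>x \<in> ideal_of R\<close> show "x \<in> N"
    proof (induction rule: ideal_of.induct)
      case zero
      show ?case using additive_subgroup.zero_closed[OF N.additive_subgroup_axioms] by (simp add: free_alg_simps)
    next
      case (gen r u v)
      then have "u \<otimes>\<^bsub>free_alg\<^esub> r \<otimes>\<^bsub>free_alg\<^esub> v \<in> N"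
        using \<open>R \<subseteq> N\<close> by (intro N.I_r_closed N.I_l_closed) (auto simp: free_alg_simps)
      then show ?case by (simp add: free_alg_simps)
    next
      case (add x y)
      then show ?case using additive_subgroup.a_closed[OF N.additive_subgroup_axioms, of x y] by (simp add: free_alg_simps)
    qed
  qed
qed

definition cq :: "('g list \<Rightarrow>\<^sub>0 'k::field) set \<Rightarrow> ('g list \<Rightarrow>\<^sub>0 'k) \<Rightarrow> ('g list \<Rightarrow>\<^sub>0 'k) set" where
  "cq R x = Idl\<^bsub>free_alg\<^esub> R +>\<^bsub>free_alg\<^esub> x"

lemma quot_alg_free: "quot_alg wmon (Idl\<^bsub>free_alg\<^esub> R :: ('g list \<Rightarrow>\<^sub>0 'k::field) set)"
proof (intro quot_alg.intro quot_alg_axioms.intro wmon_monoid)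
  show "ideal (Idl\<^bsub>free_alg\<^esub> R) (monoid_alg wmon :: ('k, 'g list \<Rightarrow>\<^sub>0 'k) module)"
    unfolding genideal_eq using ideal_ideal_of[of R] by (simp add: free_alg_def)
qed (simp add: genideal_eq ideal_of_sc)

lemma cq_cls: "cq R = quot_alg.cls wmon (Idl\<^bsub>free_alg\<^esub> R)"
  by (rule ext) (unfold cq_def quot_alg.cls_def[OF quot_alg_free], simp only: free_alg_def)

lemma cq_image: "alg_image sc (alg_quot free_alg (Idl\<^bsub>free_alg\<^esub> R)) UNIV (cq R) (*) (1 :: 'g list \<Rightarrow>\<^sub>0 'k::field)"
proof -
  have "mmul wmon = ((*) :: ('g list \<Rightarrow>\<^sub>0 'k) \<Rightarrow> _)"
    by (intro ext) (rule mmul_wmon)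
  then show ?thesis
    using quot_alg.quot_image[OF quot_alg_free[of R]] by (simp add: cq_cls[symmetric] free_alg_def[symmetric])
qed

lemma cq_eq_iff: "cq R x = cq R y \<longleftrightarrow> x - y \<in> ideal_of (R :: ('g list \<Rightarrow>\<^sub>0 'k::field) set)"
  using quot_alg.cls_eq_iff[OF quot_alg_free[of R], of x y] by (simp add: cq_cls genideal_eq)

lemma cq_induced:
  "(\<And>y. y - x \<in> ideal_of R \<Longrightarrow> f y = f x) \<Longrightarrow> induced f (cq (R :: ('g list \<Rightarrow>\<^sub>0 'k::field) set) x) = f x"
  using quot_alg.induced_cls[OF quot_alg_free[of R], of x f] by (simp add: cq_cls genideal_eq)

lemma qgroup_alg_cq: "qgroup_alg A q = alg_quot free_alg (Idl\<^bsub>free_alg\<^esub> (qgroup_rels A q))"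
  and word_class_cq: "word_class A q w = cq (qgroup_rels A q) (wrd w)"
  by (simp_all add: qgroup_alg_def word_class_def cq_def)

lemma anti_one: "anti 1 = 1"
  unfolding sgl_Nil[symmetric] by (simp del: sgl_Nil) simp

section \<open>The coproduct of the free algebra\<close>

text \<open>Pairs of words form a monoid under componentwise concatenation, so the tensor square of
  the free algebra is again a monoid algebra and inherits its ring structure.\<close>

type_synonym ('i, 'k) ff = "('i qgen list \<times> 'i qgen list) \<Rightarrow>\<^sub>0 'k"

definition dl :: "('i qgen list \<Rightarrow>\<^sub>0 'k::field) \<Rightarrow> ('i, 'k) ff" where
  "dl = pm.lext (\<lambda>w. spl w (\<lambda>u v. sgl (u, v) 1))"

definition tns :: "('i qgen list \<Rightarrow>\<^sub>0 'k::field) \<Rightarrow> ('i qgen list \<Rightarrow>\<^sub>0 'k) \<Rightarrow> ('i, 'k) ff" where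
  "tns x y = pm.lext (\<lambda>u. pm.lext (\<lambda>v. sgl (u, v) 1) y) x"

lemma tns_add: "tns (x + y) z = tns x z + tns y z" "tns z (x + y) = tns z x + tns z y"
  and tns_sc: "tns (sc a x) y = sc a (tns x y)" "tns x (sc a y) = sc a (tns x y)"
  and tns_diff: "tns (x - y) z = tns x z - tns y z" "tns z (x - y) = tns z x - tns z y"
  and tns_zero [simp]: "tns 0 z = 0" "tns z 0 = 0"
proof -
  show a: "tns (x + y) z = tns x z + tns y z" "tns z (x + y) = tns z x + tns z y" for x y z :: "'a qgen list \<Rightarrow>\<^sub>0 'b"
    by (simp_all add: tns_def pm.lext_add pm.lext_fun_add)
  show "tns (sc a x) y = sc a (tns x y)" "tns x (sc a y) = sc a (tns x y)"
    by (simp_all add: tns_def pm.lext_sc pm.lext_fun_scl)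
  show "tns (x - y) z = tns x z - tns y z" "tns z (x - y) = tns z x - tns z y"
    using a(1)[of "x - y" y z] a(2)[of z "x - y" y] by simp_all
  show "tns 0 z = 0" "tns z 0 = 0"
    using a(1)[of 0 0 z] a(2)[of z 0 0] by simp_all
qed

lemma tns_wrd: "tns (wrd u) (wrd v) = sgl (u, v) 1"
  by (simp add: tns_def)

lemma tns_mult: "tns x y * tns x' y' = tns (x * x') (y * y')"
proof (induction x rule: word_induct)
  case (single u)
  show ?case
  proof (induction y rule: word_induct)
    case (single v)
    show ?case
    proof (induction x' rule: word_induct)
      case (single u')
      show ?case
        by (induction y' rule: word_induct)
          (simp_all add: tns_wrd wrd_mult mult_single tns_add tns_sc distrib_left)
    qed (simp_all add: tns_add tns_sc distrib_left)
  qed (simp_all add: tns_add tns_sc distrib_left distrib_right)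
qed (simp_all add: tns_add tns_sc distrib_left distrib_right)

lemma sgl_pair_Nil: "sgl ([], []) (1::'k::field) = 1"
  using single_one by (metis zero_list_def zero_prod_def)

lemma tns_one: "tns 1 1 = 1"
  using tns_wrd[of "[]" "[]"] by (simp add: sgl_pair_Nil)

lemma dl_add: "dl (x + y) = dl x + dl y" and dl_diff: "dl (x - y) = dl x - dl y" and dl_sc: "dl (sc a x) = sc a (dl x)"
  by (simp_all add: dl_def pm.lext_add pm.lext_diff pm.lext_sc)

lemma dl_zero [simp]: "dl 0 = 0"
  by (simp add: dl_def)

lemma dl_mult: "dl (x * y) = dl x * dl y"
  unfolding dl_def
proof (rule pm_lext_mult)
  fix u v :: "'a qgen list"
  have "spl u (\<lambda>a b. sgl (a, b) (1::'b)) * spl v (\<lambda>a b. sgl (a, b) 1) =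
      spl u (\<lambda>a b. spl v (\<lambda>a' b'. sgl (a, b) 1 * sgl (a', b') 1))"
    by (subst spl_hom[of "\<lambda>x. x * _"], simp add: distrib_right, subst spl_hom[of "\<lambda>x. _ * x"]) (simp_all add: distrib_left)
  then show "spl (u + v) (\<lambda>a b. sgl (a, b) (1::'b)) = spl u (\<lambda>a b. sgl (a, b) 1) * spl v (\<lambda>a b. sgl (a, b) 1)"
    by (simp add: spl_append mult_single)
qed

lemma dl_gens:
  "dl (wrd [Egen i]) = tns (wrd [Egen i]) 1 + tns (wrd [Om i]) (wrd [Egen i])"
  "dl (wrd [Fgen i]) = tns 1 (wrd [Fgen i]) + tns (wrd [Fgen i]) (wrd [Om' i])"
  "g \<in> torus_gens \<Longrightarrow> dl (wrd [g]) = tns (wrd [g]) (wrd [g])"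
  by (simp_all add: dl_def tns_wrd tns_wrd[of "[]", simplified] tns_wrd[of _ "[]", simplified])
    (cases g; simp)

lemma dl_one: "dl 1 = 1"
  unfolding sgl_Nil[symmetric] by (simp add: dl_def sgl_pair_Nil del: sgl_Nil)

text \<open>If \<open>R\<close> generates the ideal \<open>I\<close> of the free algebra
  \<open>F\<close>, this is \<open>I \<otimes> F + F \<otimes> I\<close>, the kernel of passing to
  the quotient in both legs.\<close>

definition tideal :: "('i qgen list \<Rightarrow>\<^sub>0 'k::field) set \<Rightarrow> ('i, 'k) ff set" where
  "tideal R = ideal_of ((\<lambda>r. tns r 1) ` R \<union> tns 1 ` R)"

lemma tns_tideal:
  assumes "x \<in> ideal_of R"
  shows "tns x y \<in> tideal R" "tns y x \<in> tideal R"
proof -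
  have "tns x y \<in> tideal R \<and> tns y x \<in> tideal R"
    using assms
  proof (induction rule: ideal_of.induct)
    case zero
    show ?case by (simp add: tideal_def ideal_of.zero)
  next
    case (gen r u v)
    have "tns (u * r * v) y = tns u y * tns r 1 * tns v 1" "tns y (u * r * v) = tns y u * tns 1 r * tns 1 v"
      by (simp_all add: tns_mult)
    then show ?case using gen by (auto simp: tideal_def intro!: ideal_of.gen)
  next
    case (add x y)
    then show ?case by (auto simp: tns_add tideal_def intro: ideal_of.add)
  qed
  then show "tns x y \<in> tideal R" "tns y x \<in> tideal R" by auto
qed

lemma qcom_hom:
  assumes "cong_alg s1 m1 I1" "cong_alg s2 m2 I2"
    and "\<And>x y. h (x - y) = h x - h y" "\<And>a x. h (s1 a x) = s2 a (h x)" "\<And>x y. h (m1 x y) = m2 (h x) (h y)"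
  shows "h (cong_alg.qcom s1 m1 q p x y n) = cong_alg.qcom s2 m2 q p (h x) (h y) n"
proof -
  interpret A: cong_alg s1 m1 I1 by fact
  interpret B: cong_alg s2 m2 I2 by fact
  show ?thesis by (induction n) (simp_all add: assms)
qed

section \<open>Coproduct and antipode on the relations other than Serre\<close>

context qparam
begin

sublocale G: cong_alg sc "(*)" "tideal (rels0 q)"
  unfolding tideal_def by (rule cong_alg_ideal_of)

sublocale Gop: cong_alg sc "\<lambda>x y. y * x" "tideal (rels0 q)"
  unfolding tideal_def by (rule cong_alg_ideal_of_op)

lemma tns_cong: "x \<doteq> x' \<Longrightarrow> y \<doteq> y' \<Longrightarrow> G.cg (tns x y) (tns x' y')"
proof -
  assume "x \<doteq> x'" "y \<doteq> y'"
  then have "tns (x - x') y + tns x' (y - y') \<in> tideal (rels0 q)"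
    by (intro G.I_add tns_tideal) (simp_all add: F.cg_def)
  then show ?thesis by (simp add: G.cg_def tns_diff)
qed

text \<open>Both tensors in the coproduct of the letter have its weight, since torus letters carry
  none.\<close>

lemma dl_letter_torus:
  assumes g: "g \<in> torus_gens" and x: "x = Egen j \<or> x = Fgen j"
  shows "G.cg (tns (wrd [g]) (wrd [g]) * dl (wrd [x])) (sc (tw q g x) (dl (wrd [x]) * tns (wrd [g]) (wrd [g])))"
proof -
  note c = torus_comm[OF g]
  have 1: "G.cg (tns (wrd [g]) (wrd [g]) * tns (wrd [a]) 1) (sc (tw q g a) (tns (wrd [a]) 1 * tns (wrd [g]) (wrd [g])))" for a
    using tns_cong[OF c[of a] F.cg_refl[of "wrd [g]"]] by (simp add: tns_mult tns_sc)
  have 2: "G.cg (tns (wrd [g]) (wrd [g]) * tns 1 (wrd [a])) (sc (tw q g a) (tns 1 (wrd [a]) * tns (wrd [g]) (wrd [g])))" for a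
    using tns_cong[OF F.cg_refl[of "wrd [g]"] c[of a]] by (simp add: tns_mult tns_sc)
  have 3: "G.cg (tns (wrd [g]) (wrd [g]) * tns (wrd [a]) (wrd [b])) (sc (tw q g a * tw q g b) (tns (wrd [a]) (wrd [b]) * tns (wrd [g]) (wrd [g])))" for a b
    using tns_cong[OF c[of a] c[of b]] by (simp add: tns_mult tns_sc mult.commute flip: pm.scl_mult)
  have t: "tw q g h = 1" if "h \<in> torus_gens" for h using g that by (cases g; cases h) auto
  from x show ?thesis
    using G.cg_add[OF 1[of "Egen j"] 3[of "Om j" "Egen j"]] G.cg_add[OF 2[of "Fgen j"] 3[of "Fgen j" "Om' j"]]
    by (auto simp: dl_gens t distrib_left distrib_right pm.scl_right)
qed

lemma tns_torus_inv: "g \<in> torus_gens \<Longrightarrow> G.cg (tns (wrd [g]) (wrd [g]) * tns (wrd [tinv g]) (wrd [tinv g])) 1"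
  using tns_cong[OF torus_inv_mult torus_inv_mult, of g g] by (simp add: tns_mult tns_one)

lemma dl_conj:
  assumes g: "g \<in> torus_gens" and x: "x = Egen j \<or> x = Fgen j"
  shows "G.cg (dl (wrd [g, x, tinv g])) (dl (sgl [x] (tw q g x)))"
proof -
  have "dl (wrd [g, x, tinv g]) = dl (wrd [g] * wrd [x] * wrd [tinv g])"
    by (simp add: wrd_mult)
  also have "\<dots> = tns (wrd [g]) (wrd [g]) * dl (wrd [x]) * tns (wrd [tinv g]) (wrd [tinv g])"
    using g by (simp add: dl_mult dl_gens)
  also have "G.cg \<dots> (sc (tw q g x) (dl (wrd [x]) * tns (wrd [g]) (wrd [g])) * tns (wrd [tinv g]) (wrd [tinv g]))"
    by (rule G.cg_mul_right, rule dl_letter_torus) fact+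
  also have "\<dots> = sc (tw q g x) (dl (wrd [x]) * (tns (wrd [g]) (wrd [g]) * tns (wrd [tinv g]) (wrd [tinv g])))"
    by (simp add: mult.assoc)
  also have "G.cg \<dots> (sc (tw q g x) (dl (wrd [x]) * 1))"
    by (rule G.cg_scl, rule G.cg_mul_left, rule tns_torus_inv) fact
  also have "\<dots> = dl (sgl [x] (tw q g x))"
    by (simp flip: dl_sc)
  finally show ?thesis .
qed

lemma dl_rels0:
  assumes "r \<in> rels0 q"
  shows "dl r \<in> tideal (rels0 q)"
  using assms
proof cases
  case (torus g h)
  have "G.cg (dl (wrd [g] * wrd [h])) (dl (wrd [h] * wrd [g]))"
    using torus by (simp add: dl_mult dl_gens tns_mult tns_cong torus_comm0)
  then show ?thesis using torus by (simp add: G.cg_def dl_diff wrd_mult)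
next
  case (om_inv i)
  then show ?thesis
    using tns_torus_inv[of "Om i"] by (simp add: G.cg_def dl_diff dl_one dl_mult dl_gens flip: wrd_mult[of "[_]" "[_]", simplified])
next
  case (om'_inv i)
  then show ?thesis
    using tns_torus_inv[of "Om' i"] by (simp add: G.cg_def dl_diff dl_one dl_mult dl_gens flip: wrd_mult[of "[_]" "[_]", simplified])
next
  case (om_e i j)
  then show ?thesis using dl_conj[of "Om i" "Egen j" j] by (simp add: G.cg_def dl_diff)
next
  case (om'_e i j)
  then show ?thesis using dl_conj[of "Om' i" "Egen j" j] by (simp add: G.cg_def dl_diff)
next
  case (om_f i j)
  then show ?thesis using dl_conj[of "Om i" "Fgen j" j] by (simp add: G.cg_def dl_diff)
next
  case (om'_f i j)
  then show ?thesis using dl_conj[of "Om' i" "Fgen j" j] by (simp add: G.cg_def dl_diff)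
next
  case (ef i j)
  let ?E = "wrd [Egen i]" and ?F = "wrd [Fgen j]" and ?d = "if i = j then sc (kap i) (wrd [Om i] - wrd [Om' i]) else 0"
  have r: "r = ?E * ?F - ?F * ?E - ?d"
    using ef by (simp add: wrd_mult kap_def F.scl_diff)
  \<comment> \<open>Moving \<open>\<omega>\<^sub>i\<close> past \<open>f\<^sub>j\<close> and
    \<open>e\<^sub>i\<close> past \<open>\<omega>'\<^sub>j\<close> produces inverse scalars, so the
    mixed term of \<open>e\<^sub>i f\<^sub>j\<close> matches that of
    \<open>f\<^sub>j e\<^sub>i\<close>.\<close>
  have x: "G.cg (tns (wrd [Om i] * ?F) (?E * wrd [Om' j])) (tns (?F * wrd [Om i]) (wrd [Om' j] * ?E))"
    using tns_cong[OF torus_comm[of "Om i" "Fgen j"] torus_comm'[of "Om' j" "Egen i"]] by (simp add: tns_sc flip: pm.scl_mult)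
  have y: "G.cg (tns (?E * ?F) (wrd [Om' j])) (tns (?F * ?E + ?d) (wrd [Om' j]))"
    "G.cg (tns (wrd [Om i]) (?E * ?F)) (tns (wrd [Om i]) (?F * ?E + ?d))"
    by (intro tns_cong ef_comm F.cg_refl)+
  have "dl (?E * ?F) = tns ?E ?F + tns (?E * ?F) (wrd [Om' j]) + (tns (wrd [Om i]) (?E * ?F) + tns (wrd [Om i] * ?F) (?E * wrd [Om' j]))"
    by (simp add: dl_mult dl_gens distrib_left distrib_right tns_mult add_ac)
  also have "G.cg \<dots> (tns ?E ?F + tns (?F * ?E + ?d) (wrd [Om' j]) + (tns (wrd [Om i]) (?F * ?E + ?d) + tns (?F * wrd [Om i]) (wrd [Om' j] * ?E)))"
    by (intro G.cg_add x y G.cg_refl)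
  also have "\<dots> = dl (?F * ?E + ?d)"
    by (auto simp: dl_mult dl_gens distrib_left distrib_right tns_mult add_ac dl_add dl_sc dl_diff tns_add tns_diff tns_sc G.scl_diff)
  finally have "dl (?E * ?F) - dl (?F * ?E + ?d) \<in> tideal (rels0 q)" by (simp add: G.cg_def)
  then show ?thesis by (simp only: r dl_diff dl_add diff_diff_eq)
qed

lemma anti_conj:
  assumes g: "g \<in> torus_gens" and x: "x = Egen j \<or> x = Fgen j"
  shows "anti (wrd [g, x, tinv g]) \<doteq> anti (sgl [x] (tw q g x))"
proof -
  have ag: "ag g = wrd [tinv g]" "ag (tinv g) = wrd [g]" using g by (cases g; simp)+
  have t: "tw q g h = 1" if "h \<in> torus_gens" for h using g that by (cases g; cases h) auto
  have c2: "wrd [g] * (wrd [a] * wrd [b]) \<doteq> sc (tw q g a * tw q g b) (wrd [a] * wrd [b] * wrd [g])" for a b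
  proof -
    have "wrd [g] * (wrd [a] * wrd [b]) = wrd [g] * wrd [a] * wrd [b]" by (simp only: mult.assoc)
    also have "\<dots> \<doteq> sc (tw q g a) (wrd [a] * wrd [g]) * wrd [b]" by (rule F.cg_mul_right) (rule torus_comm[OF g])
    also have "\<dots> = sc (tw q g a) (wrd [a] * (wrd [g] * wrd [b]))" by (simp only: mult.assoc sc_mult_left)
    also have "\<dots> \<doteq> sc (tw q g a) (wrd [a] * sc (tw q g b) (wrd [b] * wrd [g]))"
      by (rule F.cg_scl, rule F.cg_mul_left) (rule torus_comm[OF g])
    also have "\<dots> = sc (tw q g a * tw q g b) (wrd [a] * wrd [b] * wrd [g])" by (simp only: mult.assoc sc_mult_right pm.scl_mult)
    finally show ?thesis .
  qed
  have x2: "wrd [g] * ag x \<doteq> sc (tw q g x) (ag x * wrd [g])"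
    using x F.cg_minus[OF c2[of "OmInv j" "Egen j"]] F.cg_minus[OF c2[of "Fgen j" "OmInv' j"]]
    by (auto simp: t wrd_mult pm.scl_minus)
  have "anti (wrd [g, x, tinv g]) = wrd [g] * ag x * wrd [tinv g]"
    by (simp add: ag)
  also have "\<dots> \<doteq> sc (tw q g x) (ag x * wrd [g]) * wrd [tinv g]"
    by (rule F.cg_mul_right) (rule x2)
  also have "\<dots> = sc (tw q g x) (ag x * (wrd [g] * wrd [tinv g]))" by (simp add: mult.assoc)
  also have "\<dots> \<doteq> sc (tw q g x) (ag x * 1)"
    by (rule F.cg_scl, rule F.cg_mul_left, rule torus_inv_mult) fact
  finally show ?thesis by simp
qed

lemma anti_rels0:
  assumes "r \<in> rels0 q"
  shows "anti r \<in> ideal_of (rels0 q)"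
  using assms
proof cases
  case (torus g h)
  have ag: "ag g = wrd [tinv g]" if "g \<in> torus_gens" for g :: "'i qgen" using that by (cases g; simp)
  show ?thesis
    using torus_comm0[of "tinv h" "tinv g"] torus by (simp add: F.cg_def pm.lext_diff ag)
next
  case (om_inv i)
  then show ?thesis using torus_inv_mult[of "Om i"] by (simp add: F.cg_def pm.lext_diff anti_one)
next
  case (om'_inv i)
  then show ?thesis using torus_inv_mult[of "Om' i"] by (simp add: F.cg_def pm.lext_diff anti_one)
next
  case (om_e i j)
  then show ?thesis using anti_conj[of "Om i" "Egen j" j] by (simp add: F.cg_def pm.lext_diff)
next
  case (om'_e i j)
  then show ?thesis using anti_conj[of "Om' i" "Egen j" j] by (simp add: F.cg_def pm.lext_diff)
next
  case (om_f i j)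
  then show ?thesis using anti_conj[of "Om i" "Fgen j" j] by (simp add: F.cg_def pm.lext_diff)
next
  case (om'_f i j)
  then show ?thesis using anti_conj[of "Om' i" "Fgen j" j] by (simp add: F.cg_def pm.lext_diff)
next
  case (ef i j)
  let ?E = "wrd [Egen i]" and ?F = "wrd [Fgen j]" and ?d = "if i = j then sc (kap i) (wrd [Om i] - wrd [Om' i]) else 0"
  let ?o = "wrd [OmInv i]" and ?o' = "wrd [OmInv' j]"
  have r: "r = ?E * ?F - (?F * ?E + ?d)"
    using ef by (simp add: wrd_mult kap_def F.scl_diff diff_diff_eq)
  have "anti (?E * ?F) = ?F * (?o' * ?o) * ?E"
    by (simp add: anti_mult wrd_mult)
  also have "\<dots> \<doteq> ?F * (?o * ?o') * ?E"
    by (rule F.cg_mul_right, rule F.cg_mul_left, rule torus_comm0) simp_all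
  also have "\<dots> = (?F * ?o) * (?o' * ?E)" by (simp only: mult.assoc)
  \<comment> \<open>The two scalars are \<open>inverse (q i j)\<close> and \<open>q i j\<close>,
    hence cancel.\<close>
  also have "\<dots> \<doteq> sc (inverse (tw q (OmInv i) (Fgen j))) (?o * ?F) * sc (tw q (OmInv' j) (Egen i)) (?E * ?o')"
    by (rule F.cg_mul, rule torus_comm', simp, rule torus_comm, simp)
  also have "\<dots> = ?o * (?F * ?E) * ?o'"
    by (simp add: mult.assoc flip: pm.scl_mult)
  finally have 1: "anti (?E * ?F) \<doteq> ?o * (?F * ?E) * ?o'" .
  have 2: "anti (?F * ?E) = ?o * (?E * ?F) * ?o'"
    by (simp add: anti_mult wrd_mult)
  have 3: "?o * (?E * ?F) * ?o' \<doteq> ?o * (?F * ?E + ?d) * ?o'"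
    by (rule F.cg_mul_right, rule F.cg_mul_left, rule ef_comm)
  \<comment> \<open>Multiplying by both torus inverses turns
    \<open>\<omega>\<^sub>i - \<omega>'\<^sub>i\<close> into the difference of the inverses with the
    opposite sign, which makes up for the reversed order of \<open>e\<close> and
    \<open>f\<close>.\<close>
  have 4: "?o * ?d * ?o' \<doteq> - anti ?d"
  proof (cases "i = j")
    case True
    have "?o * wrd [Om i] * ?o' \<doteq> 1 * ?o'"
      by (rule F.cg_mul_right) (use torus_inv_mult[of "OmInv i"] in simp)
    moreover have "?o * (wrd [Om' i] * ?o') \<doteq> ?o * 1"
      by (rule F.cg_mul_left) (use torus_inv_mult[of "Om' i"] True in simp)
    ultimately have "sc (kap i) (?o * wrd [Om i] * ?o' - ?o * (wrd [Om' i] * ?o')) \<doteq> sc (kap i) (1 * ?o' - ?o * 1)"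
      by (intro F.cg_scl F.cg_diff)
    moreover have "?o * ?d * ?o' = sc (kap i) (?o * wrd [Om i] * ?o' - ?o * (wrd [Om' i] * ?o'))"
      using True by (simp add: left_diff_distrib right_diff_distrib mult.assoc del: map_single)
    moreover have "- anti ?d = sc (kap i) (1 * ?o' - ?o * 1)"
      using True by (simp add: pm.lext_sc pm.lext_diff F.scl_diff)
    ultimately show ?thesis by metis
  qed simp
  have "anti (?E * ?F) - (anti (?F * ?E) + anti ?d) \<doteq> ?o * (?F * ?E) * ?o' - (?o * (?F * ?E + ?d) * ?o' + anti ?d)"
    unfolding 2 by (intro F.cg_diff F.cg_add 1 3 F.cg_refl)
  also have "\<dots> = - (?o * ?d * ?o') - anti ?d"
    by (simp only: distrib_left distrib_right) simp
  also have "\<dots> \<doteq> - (- anti ?d) - anti ?d"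
    by (rule F.cg_diff[OF F.cg_minus[OF 4] F.cg_refl])
  finally show ?thesis
    unfolding r pm.lext_diff pm.lext_add by (simp add: F.cg_def)
qed

end


lemma (in cong_alg) I_diff: "x \<in> I \<Longrightarrow> y \<in> I \<Longrightarrow> x - y \<in> I"
  using I_add[OF _ I_uminus, of x y] by simp

section \<open>From the tensor square of the free algebra to the tensor power of an algebra\<close>

context word_algebra
begin

definition tm :: "('i, 'k) ff \<Rightarrow> 'b list \<Rightarrow>\<^sub>0 'k" where
  "tm = pm.lext (\<lambda>(u, v). sgl [c (wrd u), c (wrd v)] 1)"

lemma dt_tm: "dt x = tm (dl x)"
proof -
  have "tm (dl x) = pm.lext (\<lambda>w. tm (spl w (\<lambda>u v. sgl (u, v) 1))) x"
    unfolding dl_def by (rule lext_comp[OF pm.scaling_axioms pm.scaling_axioms]) (simp_all add: tm_def pm.lext_add pm.lext_sc)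
  also have "\<dots> = dt x"
    unfolding dt_def by (subst spl_hom[of tm]) (simp_all add: tm_def pm.lext_add)
  finally show ?thesis by simp
qed

lemma tm_closed: "tm z \<in> tuples H 2"
  unfolding tm_def by (intro CollectI keys_lext) (auto simp: carrier_c)

lemma tm_add: "tm (x + y) = tm x + tm y" and tm_sc: "tm (sc a x) = sc a (tm x)"
  by (simp_all add: tm_def pm.lext_add pm.lext_sc)

lemma tm_zero [simp]: "tm 0 = 0"
  by (simp add: tm_def)

lemma c_append: "c (wrd (u @ v)) = c (wrd u) \<otimes> c (wrd v)"
  by (simp flip: wrd_mult c_mult)

lemma tm_mult: "tm (x * y) = mmul (tuple_monoid H 2) (tm x) (tm y)"
proof (induction x rule: pm_induct)
  case (single u a)
  show ?case
  proof (induction y rule: pm_induct)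
    case (single v b)
    show ?case
      by (cases u; cases v) (simp add: tm_def mult_single mmul_sgl mmul_sc c_append)
  qed (simp_all add: tm_add distrib_left mmul_add)
qed (simp_all add: tm_add distrib_right mmul_add)

lemma tp_pair:
  "tp H 2 (sgl [c (x + y), c z] 1) = tp H 2 (sgl [c x, c z] 1) \<oplus>\<^bsub>tensor_power H 2\<^esub> tp H 2 (sgl [c y, c z] 1)"
  "tp H 2 (sgl [c z, c (x + y)] 1) = tp H 2 (sgl [c z, c x] 1) \<oplus>\<^bsub>tensor_power H 2\<^esub> tp H 2 (sgl [c z, c y] 1)"
  "tp H 2 (sgl [c (sc a x), c z] 1) = a \<odot>\<^bsub>tensor_power H 2\<^esub> tp H 2 (sgl [c x, c z] 1)"
  "tp H 2 (sgl [c z, c (sc a x)] 1) = a \<odot>\<^bsub>tensor_power H 2\<^esub> tp H 2 (sgl [c z, c x] 1)"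
proof -
  interpret T: alg_image sc "tensor_power H 2" "tuples H 2" "tp H 2" "mmul (tuple_monoid H 2)" "sgl (replicate 2 \<one>) 1"
    by (rule tensor_image_H)
  have [simp]: "sgl [c x, c y] a \<in> tuples H 2" for x y a
    by (auto simp: carrier_c)
  show "tp H 2 (sgl [c (x + y), c z] 1) = tp H 2 (sgl [c x, c z] 1) \<oplus>\<^bsub>tensor_power H 2\<^esub> tp H 2 (sgl [c y, c z] 1)"
    using alg.tp_slot_add[of "[]" "[c z]" 2 "c x" "c y" 1] by (subst T.p_add[symmetric]) (auto simp: c_add)
  show "tp H 2 (sgl [c z, c (x + y)] 1) = tp H 2 (sgl [c z, c x] 1) \<oplus>\<^bsub>tensor_power H 2\<^esub> tp H 2 (sgl [c z, c y] 1)"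
    using alg.tp_slot_add[of "[c z]" "[]" 2 "c x" "c y" 1] by (subst T.p_add[symmetric]) (auto simp: c_add)
  show "tp H 2 (sgl [c (sc a x), c z] 1) = a \<odot>\<^bsub>tensor_power H 2\<^esub> tp H 2 (sgl [c x, c z] 1)"
    using alg.tp_slot_smult[of "[]" "[c z]" 2 "c x" a 1] by (subst T.p_scl[symmetric]) (auto simp: c_sc)
  show "tp H 2 (sgl [c z, c (sc a x)] 1) = a \<odot>\<^bsub>tensor_power H 2\<^esub> tp H 2 (sgl [c z, c x] 1)"
    using alg.tp_slot_smult[of "[c z]" "[]" 2 "c x" a 1] by (subst T.p_scl[symmetric]) (auto simp: c_sc)
qed

lemma tp_tm_tns: "tp H 2 (tm (tns x y)) = tp H 2 (sgl [c x, c y] 1)"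
proof -
  interpret T: alg_image sc "tensor_power H 2" "tuples H 2" "tp H 2" "mmul (tuple_monoid H 2)" "sgl (replicate 2 \<one>) 1"
    by (rule tensor_image_H)
  have a: "tp H 2 (tm (z + z')) = tp H 2 (tm z) \<oplus>\<^bsub>tensor_power H 2\<^esub> tp H 2 (tm z')"
    "tp H 2 (tm (sc r z)) = r \<odot>\<^bsub>tensor_power H 2\<^esub> tp H 2 (tm z)" for z z' r
    unfolding tm_add tm_sc by (rule T.p_add T.p_scl; rule tm_closed)+
  show ?thesis
  proof (induction x rule: word_induct)
    case (single u)
    show ?case
      by (induction y rule: word_induct) (simp_all add: tns_add tns_sc a tp_pair tns_wrd, simp add: tm_def)
  qed (simp_all add: tns_add tns_sc a tp_pair)
qed

text \<open>On each generator one leg becomes zero in \<open>H\<close>, and a pure tensor with a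
  zero leg vanishes; multiplicativity of \<open>tm\<close> then handles the two-sided
  multiples.\<close>

lemma tp_tm_tideal:
  assumes "z \<in> tideal R" "\<And>r. r \<in> R \<Longrightarrow> c r = \<zero>"
  shows "tp H 2 (tm z) = \<zero>\<^bsub>tensor_power H 2\<^esub>"
  using assms(1) unfolding tideal_def
proof (induction rule: ideal_of.induct)
  interpret T: alg_image sc "tensor_power H 2" "tuples H 2" "tp H 2" "mmul (tuple_monoid H 2)" "sgl (replicate 2 \<one>) 1"
    by (rule tensor_image_H)
  interpret TR: ring "tensor_power H 2" by (rule T.alg.ring_H)
  {
    case zero
    show ?case by (simp add: tm_def T.p_zero)
  next
    case (gen g u v)
    have z: "tp H 2 (sgl [c x, c y] 1) = \<zero>\<^bsub>tensor_power H 2\<^esub>" if "c x = \<zero> \<or> c y = \<zero>" for x y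
    proof -
      have z0: "0 \<odot>\<^bsub>tensor_power H 2\<^esub> tp H 2 (sgl [c z, c w] 1) = \<zero>\<^bsub>tensor_power H 2\<^esub>" for z w
      proof -
        have "0 \<odot>\<^bsub>tensor_power H 2\<^esub> tp H 2 (sgl [c z, c w] 1) = tp H 2 (sc 0 (sgl [c z, c w] 1))"
          by (rule T.p_scl[symmetric]) (auto simp: carrier_c)
        then show ?thesis by (simp add: T.p_zero)
      qed
      have "tp H 2 (sgl [c 0, c y] 1) = \<zero>\<^bsub>tensor_power H 2\<^esub>" "tp H 2 (sgl [c x, c 0] 1) = \<zero>\<^bsub>tensor_power H 2\<^esub>"
        using tp_pair(3)[of 0 0 y] tp_pair(4)[of x 0 0] z0 by simp_all
      then show ?thesis using that unfolding c_zero by auto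
    qed
    have "tp H 2 (tm g) = \<zero>\<^bsub>tensor_power H 2\<^esub>"
    proof -
      obtain r where "r \<in> R" "g = tns r 1 \<or> g = tns 1 r" using gen by auto
      then show ?thesis
        using z[of r 1] z[of 1 r] assms(2)[of r] by (auto simp: tp_tm_tns)
    qed
    then have "tp H 2 (tm (u * g * v)) = tp H 2 (tm u) \<otimes>\<^bsub>tensor_power H 2\<^esub> \<zero>\<^bsub>tensor_power H 2\<^esub> \<otimes>\<^bsub>tensor_power H 2\<^esub> tp H 2 (tm v)"
      unfolding tm_mult using tm_closed T.mu_closed[OF tm_closed tm_closed] by (simp only: T.p_mu tm_closed)
    also have "\<dots> = \<zero>\<^bsub>tensor_power H 2\<^esub>"
      by (simp add: T.p_closed[OF tm_closed])
    finally show ?case .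
  next
    case (add x y)
    then show ?case
      unfolding tm_add by (subst T.p_add[OF tm_closed tm_closed]) (simp add: T.p_zero[symmetric] T.p_add[OF T.S_zero T.S_zero, symmetric])
  }
qed

end

section \<open>Quantum groups are Hopf algebras\<close>

locale cartan_param = qparam q for q :: "'i \<Rightarrow> 'i \<Rightarrow> 'k::field" +
  fixes A :: "'i \<Rightarrow> 'i \<Rightarrow> int"
  assumes A_nonpos: "i \<noteq> j \<Longrightarrow> A i j \<le> 0" and q_cartan: "q i j * q j i = q i i powi A i j"
begin

abbreviation "sdeg i j \<equiv> nat (1 - A i j)"
abbreviation "RR \<equiv> qgroup_rels A q"

text \<open>The Cartan condition in the form used by \<open>qcom_add\<close> and by the commutator
  lemmas, with \<open>n = 1 - A i j\<close>.\<close>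

lemma sdeg_param:
  assumes "i \<noteq> j"
  shows "sdeg i j > 0" "q i i ^ (sdeg i j - 1) * (q i j * q j i) = 1"
proof -
  show "sdeg i j > 0" using A_nonpos[OF assms] by simp
  have "sdeg i j - 1 = nat (- A i j)" using A_nonpos[OF assms] by simp
  then show "q i i ^ (sdeg i j - 1) * (q i j * q j i) = 1"
    using A_nonpos[OF assms] by (cases "A i j = 0") (auto simp: q_cartan power_int_def power_inverse)
qed

section \<open>The coproduct of the Serre elements\<close>

lemma lp_wrd: "((*) (wrd [x]) ^^ k) (wrd w) = wrd (replicate k x @ w)"
  by (induction k) (simp_all add: wrd_mult)

lemma rp_wrd: "((\<lambda>y. y * wrd [x]) ^^ k) (wrd w) = wrd (w @ replicate k x)"
  by (induction k) (simp_all add: wrd_mult replicate_append_same)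

lemma serre_coeff_gb: "k \<le> sdeg i j \<Longrightarrow>
    serre_coeff A q i j k = (-1) ^ k * gb (q i i) (sdeg i j) k * q i i ^ (k * (k - 1) div 2) * q i j ^ k"
  by (simp add: serre_coeff_def gauss_binomial_gb)

lemma serreE_qcom: "serreE A q i j = F.qcom (q i i) (q i j) (wrd [Egen i]) (wrd [Egen j]) (sdeg i j)"
  unfolding F.qcom_expand serreE_def
  by (intro sum.cong refl) (simp add: lp_wrd rp_wrd serre_coeff_gb)

lemma serreF_qcom: "serreF A q i j = Fop.qcom (q i i) (q i j) (wrd [Fgen i]) (wrd [Fgen j]) (sdeg i j)"
  unfolding Fop.qcom_expand serreF_def
  by (intro sum.cong refl) (simp add: lp_wrd rp_wrd serre_coeff_gb)

text \<open>Modulo the other relations a Serre element is skew-primitive: \<open>qcom_add\<close>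
  separates the iterated commutator of
  \<open>e\<^sub>i \<otimes> 1 + \<omega>\<^sub>i \<otimes> e\<^sub>i\<close> on
  \<open>e\<^sub>j \<otimes> 1 + \<omega>\<^sub>j \<otimes> e\<^sub>j\<close> into two parts, and
  \<open>qcom_torus_factor\<close> collects the torus legs of the second.\<close>

lemma dl_serreE:
  assumes "i \<noteq> j"
  shows "G.cg (dl (serreE A q i j))
    (tns (serreE A q i j) 1 + tns (((*) (wrd [Om i]) ^^ sdeg i j) (wrd [Om j])) (serreE A q i j))"
proof -
  let ?n = "sdeg i j" and ?q = "q i i" and ?p = "q i j"
  let ?Ei = "wrd [Egen i]" and ?Ej = "wrd [Egen j]" and ?oi = "wrd [Om i]" and ?oj = "wrd [Om j]"
  have 0: "dl (serreE A q i j) = G.qcom ?q ?p (tns ?Ei 1 + tns ?oi ?Ei) (tns ?Ej 1 + tns ?oj ?Ej) ?n"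
    unfolding serreE_qcom
    by (subst qcom_hom[OF F.cong_alg_axioms G.cong_alg_axioms]) (simp_all add: dl_diff dl_sc dl_mult dl_gens)
  have 1: "G.cg (dl (serreE A q i j)) (G.qcom ?q ?p (tns ?Ei 1) (tns ?Ej 1) ?n + G.qcom ?q ?p (tns ?oi ?Ei) (tns ?oj ?Ej) ?n)"
    unfolding 0
  proof (rule G.qcom_add[where s = "q j i"])
    show "G.cg (tns ?oi ?Ei * tns ?Ei 1) (sc ?q (tns ?Ei 1 * tns ?oi ?Ei))"
      using tns_cong[OF torus_comm[of "Om i" "Egen i"] F.cg_refl[of ?Ei]] by (simp add: tns_mult tns_sc)
    show "G.cg (tns ?oi ?Ei * tns ?Ej 1) (sc ?p (tns ?Ej 1 * tns ?oi ?Ei))"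
      using tns_cong[OF torus_comm[of "Om i" "Egen j"] F.cg_refl[of ?Ei]] by (simp add: tns_mult tns_sc)
    show "G.cg (tns ?oj ?Ej * tns ?Ei 1) (sc (q j i) (tns ?Ei 1 * tns ?oj ?Ej))"
      using tns_cong[OF torus_comm[of "Om j" "Egen i"] F.cg_refl[of ?Ej]] by (simp add: tns_mult tns_sc)
  qed (use sdeg_param[OF assms] in auto)
  have 2: "G.qcom ?q ?p (tns ?Ei 1) (tns ?Ej 1) ?n = tns (serreE A q i j) 1"
    unfolding serreE_qcom
    by (subst qcom_hom[OF F.cong_alg_axioms G.cong_alg_axioms, where h = "\<lambda>x. tns x 1"])
      (simp_all add: tns_diff tns_sc tns_mult)
  have 3: "G.qcom ?q ?p (tns 1 ?Ei) (tns 1 ?Ej) ?n = tns 1 (serreE A q i j)"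
    unfolding serreE_qcom
    by (subst qcom_hom[OF F.cong_alg_axioms G.cong_alg_axioms, where h = "\<lambda>x. tns 1 x"])
      (simp_all add: tns_diff tns_sc tns_mult)
  have 4: "((*) (tns ?oi 1) ^^ m) (tns ?oj 1) = tns (((*) ?oi ^^ m) ?oj) 1" for m
    by (induction m) (simp_all add: tns_mult)
  have "G.cg (G.qcom ?q ?p (tns ?oi 1 * tns 1 ?Ei) (tns ?oj 1 * tns 1 ?Ej) ?n)
     (((*) (tns ?oi 1) ^^ ?n) (tns ?oj 1) * G.qcom ?q ?p (tns 1 ?Ei) (tns 1 ?Ej) ?n)"
    by (rule G.qcom_torus_factor) (simp_all add: tns_mult tns_cong torus_comm0)
  then have "G.cg (G.qcom ?q ?p (tns ?oi ?Ei) (tns ?oj ?Ej) ?n) (tns (((*) ?oi ^^ ?n) ?oj) (serreE A q i j))"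
    unfolding 3 4 by (simp add: tns_mult)
  from G.cg_trans[OF 1 G.cg_add[OF G.cg_refl this]] show ?thesis unfolding 2 .
qed

text \<open>The same argument for the reversed product; the summand
  \<open>f \<otimes> \<omega>'\<close> now takes the part of \<open>a\<close>, and
  \<open>1 \<otimes> f\<close> that of \<open>b\<close>.\<close>

lemma dl_serreF:
  assumes "i \<noteq> j"
  shows "G.cg (dl (serreF A q i j))
    (tns (serreF A q i j) (((\<lambda>y. y * wrd [Om' i]) ^^ sdeg i j) (wrd [Om' j])) + tns 1 (serreF A q i j))"
proof -
  let ?n = "sdeg i j" and ?q = "q i i" and ?p = "q i j"
  let ?Fi = "wrd [Fgen i]" and ?Fj = "wrd [Fgen j]" and ?oi = "wrd [Om' i]" and ?oj = "wrd [Om' j]"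
  have 0: "dl (serreF A q i j) = Gop.qcom ?q ?p (tns ?Fi ?oi + tns 1 ?Fi) (tns ?Fj ?oj + tns 1 ?Fj) ?n"
    unfolding serreF_qcom
    by (subst qcom_hom[OF Fop.cong_alg_axioms Gop.cong_alg_axioms]) (simp_all add: dl_diff dl_sc dl_mult dl_gens add.commute)
  have 1: "G.cg (dl (serreF A q i j)) (Gop.qcom ?q ?p (tns ?Fi ?oi) (tns ?Fj ?oj) ?n + Gop.qcom ?q ?p (tns 1 ?Fi) (tns 1 ?Fj) ?n)"
    unfolding 0
  proof (rule Gop.qcom_add[where s = "q j i"])
    show "G.cg (tns ?Fi ?oi * tns 1 ?Fi) (sc ?q (tns 1 ?Fi * tns ?Fi ?oi))"
      using tns_cong[OF F.cg_refl[of ?Fi] torus_comm[of "Om' i" "Fgen i"]] by (simp add: tns_mult tns_sc)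
    show "G.cg (tns ?Fj ?oj * tns 1 ?Fi) (sc ?p (tns 1 ?Fi * tns ?Fj ?oj))"
      using tns_cong[OF F.cg_refl[of ?Fj] torus_comm[of "Om' j" "Fgen i"]] by (simp add: tns_mult tns_sc)
    show "G.cg (tns ?Fi ?oi * tns 1 ?Fj) (sc (q j i) (tns 1 ?Fj * tns ?Fi ?oi))"
      using tns_cong[OF F.cg_refl[of ?Fi] torus_comm[of "Om' i" "Fgen j"]] by (simp add: tns_mult tns_sc)
  qed (use sdeg_param[OF assms] in auto)
  have 2: "Gop.qcom ?q ?p (tns ?Fi 1) (tns ?Fj 1) ?n = tns (serreF A q i j) 1"
    unfolding serreF_qcom
    by (subst qcom_hom[OF Fop.cong_alg_axioms Gop.cong_alg_axioms, where h = "\<lambda>x. tns x 1"])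
      (simp_all add: tns_diff tns_sc tns_mult)
  have 3: "Gop.qcom ?q ?p (tns 1 ?Fi) (tns 1 ?Fj) ?n = tns 1 (serreF A q i j)"
    unfolding serreF_qcom
    by (subst qcom_hom[OF Fop.cong_alg_axioms Gop.cong_alg_axioms, where h = "\<lambda>x. tns 1 x"])
      (simp_all add: tns_diff tns_sc tns_mult)
  have 4: "((\<lambda>y. y * tns 1 ?oi) ^^ m) (tns 1 ?oj) = tns 1 (((\<lambda>y. y * ?oi) ^^ m) ?oj)" for m
    by (induction m) (simp_all add: tns_mult)
  have "G.cg (Gop.qcom ?q ?p (tns ?Fi 1 * tns 1 ?oi) (tns ?Fj 1 * tns 1 ?oj) ?n)
     (Gop.qcom ?q ?p (tns ?Fi 1) (tns ?Fj 1) ?n * ((\<lambda>y. y * tns 1 ?oi) ^^ ?n) (tns 1 ?oj))"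
    by (rule Gop.qcom_torus_factor) (simp_all add: tns_mult tns_cong torus_comm0)
  then have "G.cg (Gop.qcom ?q ?p (tns ?Fi ?oi) (tns ?Fj ?oj) ?n) (tns (serreF A q i j) (((\<lambda>y. y * ?oi) ^^ ?n) ?oj))"
    unfolding 2 4 by (simp add: tns_mult)
  from G.cg_trans[OF 1 G.cg_add[OF this G.cg_refl]] show ?thesis unfolding 3 .
qed

lemma rels0_subset: "rels0 q \<subseteq> RR"
  by (auto simp: qgroup_rels_eq)

lemma tideal_mono: "R \<subseteq> S \<Longrightarrow> tideal R \<subseteq> tideal S"
  unfolding tideal_def by (rule ideal_of_mono) auto

lemma rels_cases:
  assumes "r \<in> RR"
  obtains "r \<in> rels0 q" | i j where "i \<noteq> j" "r = serreE A q i j" | i j where "i \<noteq> j" "r = serreF A q i j"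
  using assms unfolding qgroup_rels_eq by blast

lemma serre_in: "i \<noteq> j \<Longrightarrow> serreE A q i j \<in> ideal_of RR" "i \<noteq> j \<Longrightarrow> serreF A q i j \<in> ideal_of RR"
  by (auto simp: qgroup_rels_eq intro!: ideal_of_base)

lemma dl_rels:
  assumes "r \<in> RR"
  shows "dl r \<in> tideal RR"
  using assms
proof (cases rule: rels_cases)
  case 1
  then show ?thesis using dl_rels0 tideal_mono[OF rels0_subset] by blast
next
  case (2 i j)
  from dl_serreE[OF 2(1)] have "dl r - (tns r 1 + tns (((*) (wrd [Om i]) ^^ sdeg i j) (wrd [Om j])) r) \<in> tideal RR"
    using tideal_mono[OF rels0_subset] by (auto simp: G.cg_def 2)
  moreover have "tns r 1 + tns (((*) (wrd [Om i]) ^^ sdeg i j) (wrd [Om j])) r \<in> tideal RR"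
    unfolding 2(2) tideal_def
    by (intro ideal_of.add tns_tideal[unfolded tideal_def] serre_in 2)
  ultimately show ?thesis
    unfolding tideal_def using ideal_of.add by fastforce
next
  case (3 i j)
  from dl_serreF[OF 3(1)] have "dl r - (tns r (((\<lambda>y. y * wrd [Om' i]) ^^ sdeg i j) (wrd [Om' j])) + tns 1 r) \<in> tideal RR"
    using tideal_mono[OF rels0_subset] by (auto simp: G.cg_def 3)
  moreover have "tns r (((\<lambda>y. y * wrd [Om' i]) ^^ sdeg i j) (wrd [Om' j])) + tns 1 r \<in> tideal RR"
    unfolding 3(2) tideal_def
    by (intro ideal_of.add tns_tideal[unfolded tideal_def] serre_in 3)
  ultimately show ?thesis
    unfolding tideal_def using ideal_of.add by fastforce
qed

lemma dl_ideal: "x \<in> ideal_of RR \<Longrightarrow> dl x \<in> tideal RR"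
  unfolding tideal_def
  by (rule ideal_of_hom) (use dl_rels in \<open>auto simp: dl_add dl_mult tideal_def\<close>)

text \<open>Stated for any larger set of relations, because the antipode identities are used in the
  quotient by \<open>rels0 q\<close> as well as in the quantum group.\<close>

lemma word_algebra_cq:
  assumes "rels0 q \<subseteq> R"
  shows "word_algebra (alg_quot free_alg (Idl\<^bsub>free_alg\<^esub> R)) (cq R)"
proof -
  interpret Q: alg_image sc "alg_quot free_alg (Idl\<^bsub>free_alg\<^esub> R)" UNIV "cq R" "(*)" 1
    by (rule cq_image)
  have "cq R (wrd [g, tinv g]) = cq R 1" if "g \<in> torus_gens" for g :: "'i qgen"
    using torus_inv_mult[OF that] ideal_of_mono[OF assms] by (auto simp: cq_eq_iff F.cg_def wrd_mult)
  from this[of "Om _"] this[of "OmInv _"] this[of "Om' _"] this[of "OmInv' _"] show ?thesis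
    by unfold_locales (simp_all add: Q.carrier_eq Q.p_add Q.p_scl Q.p_zero Q.p_mu Q.p_u)
qed

text \<open>With \<open>mu2\<close>, the maps \<open>m (S \<otimes> id)\<close> and
  \<open>m (id \<otimes> S)\<close> on the tensor square of the free algebra; they extract the
  antipode of a skew-primitive element from its coproduct.\<close>

definition mu1 :: "('i, 'k) ff \<Rightarrow> 'i qgen list \<Rightarrow>\<^sub>0 'k" where
  "mu1 = pm.lext (\<lambda>(u, v). antw u * wrd v)"

definition mu2 :: "('i, 'k) ff \<Rightarrow> 'i qgen list \<Rightarrow>\<^sub>0 'k" where
  "mu2 = pm.lext (\<lambda>(u, v). wrd u * antw v)"

lemma mu_add: "mu1 (x + y) = mu1 x + mu1 y" "mu2 (x + y) = mu2 x + mu2 y"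
  and mu_diff: "mu1 (x - y) = mu1 x - mu1 y" "mu2 (x - y) = mu2 x - mu2 y"
  and mu_zero [simp]: "mu1 0 = 0" "mu2 0 = 0"
  and mu_sc: "mu1 (sc a x) = sc a (mu1 x)" "mu2 (sc a x) = sc a (mu2 x)"
  by (simp_all add: mu1_def mu2_def pm.lext_add pm.lext_diff pm.lext_sc)

lemma mu_tns: "mu1 (tns x y) = anti x * y" "mu2 (tns x y) = x * anti y"
proof -
  show "mu1 (tns x y) = anti x * y"
  proof (induction x rule: word_induct)
    case (single u)
    show ?case
      by (induction y rule: word_induct)
        (simp_all add: tns_wrd mu_add mu_sc tns_add tns_sc distrib_left, simp add: mu1_def)
  qed (simp_all add: mu_add mu_sc tns_add tns_sc pm.lext_add pm.lext_sc distrib_right)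
  show "mu2 (tns x y) = x * anti y"
  proof (induction x rule: word_induct)
    case (single u)
    show ?case
      by (induction y rule: word_induct)
        (simp_all add: tns_wrd mu_add mu_sc tns_add tns_sc distrib_left pm.lext_add pm.lext_sc, simp add: mu2_def)
  qed (simp_all add: mu_add mu_sc tns_add tns_sc pm.lext_add pm.lext_sc distrib_right)
qed

text \<open>The two maps are not multiplicative, but between tensors of words a generator of the
  ideal stays a single tensor, on which they can be evaluated.\<close>

lemma mu_tideal:
  assumes "z \<in> tideal (rels0 q)"
  shows "mu1 z \<in> ideal_of (rels0 q) \<and> mu2 z \<in> ideal_of (rels0 q)"
  using assms unfolding tideal_def
proof (induction rule: ideal_of.induct)
  case zero
  show ?case by (simp add: ideal_of.zero)
next
  case (gen g u v)
  show ?case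
  proof (induction u rule: pm_induct)
    case (single ab s)
    show ?case
    proof (induction v rule: pm_induct)
      case (single ab' s')
      obtain a b a' b' where ab: "ab = (a, b)" "ab' = (a', b')" by (cases ab; cases ab')
      have s: "sgl ab s = sc s (tns (wrd a) (wrd b))" "sgl ab' s' = sc s' (tns (wrd a') (wrd b'))"
        by (simp_all add: ab tns_wrd)
      obtain r where r: "r \<in> rels0 q" "g = tns r 1 \<or> g = tns 1 r" using gen by auto
      have m: "tns (wrd a) (wrd b) * tns r 1 * tns (wrd a') (wrd b') = tns (wrd a * r * wrd a') (wrd b * wrd b')"
        "tns (wrd a) (wrd b) * tns 1 r * tns (wrd a') (wrd b') = tns (wrd a * wrd a') (wrd b * r * wrd b')"
        by (simp_all add: tns_mult)
      have i: "x * (y * r * z) * w \<in> ideal_of (rels0 q)" "x * (y * anti r * z) * w \<in> ideal_of (rels0 q)" for x y z w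
        by (intro ideal_of_mult ideal_of_base r anti_rels0)+
      have "mu1 (tns (wrd a) (wrd b) * g * tns (wrd a') (wrd b')) \<in> ideal_of (rels0 q) \<and>
          mu2 (tns (wrd a) (wrd b) * g * tns (wrd a') (wrd b')) \<in> ideal_of (rels0 q)"
        using r(2)
      proof
        assume "g = tns r 1"
        then show ?thesis
          using i(2)[of 1 "anti (wrd a')" "anti (wrd a)" "wrd b * wrd b'"] i(1)[of 1 "wrd a" "wrd a'" "anti (wrd b * wrd b')"]
          unfolding m \<open>g = _\<close> by (simp only: mu_tns anti_mult mult_1_left mult.assoc)
      next
        assume "g = tns 1 r"
        then show ?thesis
          using i(1)[of "anti (wrd a * wrd a')" "wrd b" "wrd b'" 1] i(2)[of "wrd a * wrd a'" "anti (wrd b')" "anti (wrd b)" 1]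
          unfolding m \<open>g = _\<close> by (simp only: mu_tns anti_mult mult_1_right mult.assoc)
      qed
      then show ?case
        unfolding s by (simp add: mu_sc ideal_of_sc del: map_single)
    qed (auto simp: distrib_left mu_add intro: ideal_of.intros)
  qed (auto simp: distrib_left distrib_right mu_add intro: ideal_of.intros)
next
  case (add x y)
  then show ?case by (auto simp: mu_add intro: ideal_of.add)
qed

lemma mu_dl: "mu1 (dl x) \<doteq> sc (fd.lext eps x) 1" "mu2 (dl x) \<doteq> sc (fd.lext eps x) 1"
proof -
  interpret W: word_algebra "alg_quot free_alg (Idl\<^bsub>free_alg\<^esub> (rels0 q))" "cq (rels0 q)"
    by (rule word_algebra_cq) simp
  have d1: "mu1 (dl (wrd w)) = spl w (\<lambda>u v. antw u * wrd v)" for w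
    unfolding dl_def pm.lext_single pm.scl_one
    by (subst spl_hom[of mu1], rule mu_add) (simp add: mu1_def)
  have d2: "mu2 (dl (wrd w)) = spl w (\<lambda>u v. wrd u * antw v)" for w
    unfolding dl_def pm.lext_single pm.scl_one
    by (subst spl_hom[of mu2], rule mu_add) (simp add: mu2_def)
  have "mu1 (dl x) \<doteq> sc (fd.lext eps x) 1 \<and> mu2 (dl x) \<doteq> sc (fd.lext eps x) 1"
  proof (induction x rule: word_induct)
    case (single w)
    show ?case
      using W.anti_inverse_wrd[of w] by (simp add: d1 d2 F.cg_def flip: cq_eq_iff)
  next
    case (add s t)
    then show ?case by (auto simp: dl_add mu_add fd.lext_add pm.scl_left intro: F.cg_add simp del: map_single)
  next
    case (sc a s)
    then show ?case by (auto simp: dl_sc mu_sc fd.lext_sc pm.scl_mult intro: F.cg_scl simp del: map_single)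
  qed
  then show "mu1 (dl x) \<doteq> sc (fd.lext eps x) 1" "mu2 (dl x) \<doteq> sc (fd.lext eps x) 1" by auto
qed

lemma eps_serre: "fd.lext eps (serreE A q i j) = 0" "fd.lext eps (serreF A q i j) = 0"
  by (simp_all add: serreE_def serreF_def fd.lext_sum)

lemma eps_one: "fd.lext eps 1 = 1"
  unfolding sgl_Nil[symmetric] by (simp del: sgl_Nil)

lemma eps_rels:
  assumes "r \<in> RR"
  shows "fd.lext eps r = 0"
  using assms
proof (cases rule: rels_cases)
  case 1
  then show ?thesis
  proof cases
    case (torus g h)
    then show ?thesis by (simp add: fd.lext_diff mult.commute)
  qed (auto simp: fd.lext_diff eps_one)
qed (auto simp: eps_serre)

text \<open>A Serre element \<open>r\<close> in the \<open>e\<close> has coproduct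
  \<open>r \<otimes> 1 + g \<otimes> r\<close> and zero counit, so the antipode identity gives
  \<open>S r + S g * r = 0\<close> modulo the other relations, and \<open>S r\<close> lies in the
  ideal. For the \<open>f\<close> the other antipode identity is used.\<close>

lemma anti_rels:
  assumes "r \<in> RR"
  shows "anti r \<in> ideal_of RR"
  using assms
proof (cases rule: rels_cases)
  case 1
  then show ?thesis using anti_rels0 ideal_of_mono[OF rels0_subset] by blast
next
  case (2 i j)
  let ?g = "((*) (wrd [Om i]) ^^ sdeg i j) (wrd [Om j])"
  have "mu1 (dl r - (tns r 1 + tns ?g r)) \<in> ideal_of (rels0 q)"
    using mu_tideal dl_serreE[OF 2(1)] by (simp add: G.cg_def 2(2))
  moreover have "mu1 (dl r) \<in> ideal_of (rels0 q)"
    using mu_dl(1)[of r] by (simp add: 2(2) eps_serre F.cg_def)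
  ultimately have "mu1 (dl r) - mu1 (dl r - (tns r 1 + tns ?g r)) \<in> ideal_of (rels0 q)"
    by (rule F.I_diff[rotated])
  then have "mu1 (tns r 1 + tns ?g r) \<in> ideal_of RR"
    using subsetD[OF ideal_of_mono[OF rels0_subset]] by (simp add: mu_diff)
  then have "anti r + anti ?g * r \<in> ideal_of RR"
    by (simp add: mu_add mu_tns)
  moreover have "sc (-1) (anti ?g * r) \<in> ideal_of RR"
    by (intro ideal_of_sc ideal_of_mult_left) (simp add: 2 serre_in)
  ultimately show ?thesis
    using ideal_of.add[of "anti r + anti ?g * r" RR "sc (-1) (anti ?g * r)"] by (simp add: pm.scl_minus)
next
  case (3 i j)
  let ?g = "((\<lambda>y. y * wrd [Om' i]) ^^ sdeg i j) (wrd [Om' j])"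
  have "mu2 (dl r - (tns r ?g + tns 1 r)) \<in> ideal_of (rels0 q)"
    using mu_tideal dl_serreF[OF 3(1)] by (simp add: G.cg_def 3(2))
  moreover have "mu2 (dl r) \<in> ideal_of (rels0 q)"
    using mu_dl(2)[of r] by (simp add: 3(2) eps_serre F.cg_def)
  ultimately have "mu2 (dl r) - mu2 (dl r - (tns r ?g + tns 1 r)) \<in> ideal_of (rels0 q)"
    by (rule F.I_diff[rotated])
  then have "mu2 (tns r ?g + tns 1 r) \<in> ideal_of RR"
    using subsetD[OF ideal_of_mono[OF rels0_subset]] by (simp add: mu_diff)
  then have "r * anti ?g + anti r \<in> ideal_of RR"
    by (simp add: mu_add mu_tns)
  moreover have "sc (-1) (r * anti ?g) \<in> ideal_of RR"
    by (intro ideal_of_sc ideal_of_mult_right) (simp add: 3 serre_in)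
  ultimately show ?thesis
    using ideal_of.add[of "r * anti ?g + anti r" RR "sc (-1) (r * anti ?g)"] by (simp add: pm.scl_minus)
qed

lemma anti_ideal: "x \<in> ideal_of RR \<Longrightarrow> anti x \<in> ideal_of RR"
proof (induction rule: ideal_of.induct)
  case (gen r u v)
  then show ?case
    using anti_rels by (simp add: anti_mult mult.assoc ideal_of_mult_left ideal_of_mult_right)
qed (auto simp: pm.lext_add intro: ideal_of.intros)

lemma eps_mult: "fd.lext eps (x * y) = fd.lext eps x * (fd.lext eps y :: 'k)"
proof (induction x rule: word_induct)
  case (single w)
  show ?case
    by (induction y rule: word_induct)
      (simp_all add: wrd_mult distrib_left fd.lext_add fd.lext_sc mult.left_commute)
qed (simp_all add: distrib_right fd.lext_add fd.lext_sc)

lemma eps_ideal: "x \<in> ideal_of RR \<Longrightarrow> fd.lext eps x = 0"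
proof (induction rule: ideal_of.induct)
  case (gen r u v)
  then show ?case by (simp add: eps_mult eps_rels)
qed (auto simp: fd.lext_add)

end


section \<open>The quantum group as a Hopf algebra presented by words\<close>

lemma mspan_monoid_alg_cong:
  assumes "carrier G = carrier G'"
  shows "mspan (monoid_alg G) Y = mspan (monoid_alg G' :: ('k::field, _) module) Y"
proof -
  have "add_monoid (monoid_alg G) = add_monoid (monoid_alg G' :: ('k, _) module)"
    by (simp add: monoid_alg_def assms)
  then have "submodule N field_alg (monoid_alg G) = submodule N field_alg (monoid_alg G' :: ('k, _) module)" for N
    by (simp add: submodule_def submodule_axioms_def)
  then show ?thesis by (simp add: mspan_def)
qed

text \<open>Relations and cosets involve only addition and scalars, so a change of multiplication or
  an added coalgebra structure leaves tensor classes unchanged; this covers the deformation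
  too.\<close>

lemma tp_cong:
  fixes H :: "('k::field, 'b, 'm) module_scheme" and H' :: "('k, 'b, 'n) module_scheme"
  assumes "carrier H = carrier H'" "ring.add H = ring.add H'" "module.smult H = module.smult H'"
  shows "tp H n = tp H' n"
proof
  fix t
  have "carrier (tuple_monoid H n) = carrier (tuple_monoid H' n)"
    by (simp add: assms)
  then have 1: "mspan (monoid_alg (tuple_monoid H n)) Y = mspan (monoid_alg (tuple_monoid H' n) :: ('k, _) module) Y" for Y
    by (rule mspan_monoid_alg_cong)
  have 2: "multilinear_rels H n = multilinear_rels H' n"
    by (simp add: multilinear_rels_def assms)
  show "tp H n t = tp H' n t"
    by (simp add: tp_def multilinear_ideal_def 1 2 a_r_coset_def r_coset_def)
qed

lemma qgroup_simps [simp]: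
  "carrier (qgroup A q) = carrier (qgroup_alg A q)"
  "monoid.mult (qgroup A q) = monoid.mult (qgroup_alg A q)"
  "one (qgroup A q) = one (qgroup_alg A q)"
  "ring.zero (qgroup A q) = ring.zero (qgroup_alg A q)"
  "ring.add (qgroup A q) = ring.add (qgroup_alg A q)"
  "module.smult (qgroup A q) = module.smult (qgroup_alg A q)"
  "comult (qgroup A q) = induced (free_ext (tensor_power (qgroup_alg A q) 2) (comult_gen A q))"
  "counit (qgroup A q) = induced (free_ext field_alg counit_gen)"
  "antipode (qgroup A q) = induced (free_ext (opposite_alg (qgroup_alg A q)) (antipode_gen A q))"
  by (simp_all add: qgroup_def module.defs hopf.defs)

context cartan_param
begin

abbreviation "cU \<equiv> cq RR"

sublocale U: word_algebra "qgroup_alg A q" cU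
  unfolding qgroup_alg_cq by (rule word_algebra_cq) (rule rels0_subset)

lemma cU_eq_iff: "cU x = cU y \<longleftrightarrow> x - y \<in> ideal_of RR"
  by (rule cq_eq_iff)

lemma cU_zero_iff: "cU x = \<zero>\<^bsub>qgroup_alg A q\<^esub> \<longleftrightarrow> x \<in> ideal_of RR"
  using cU_eq_iff[of x 0] by (simp add: U.c_zero)

lemma cU_eqv: "x \<doteq> y \<Longrightarrow> cU x = cU y"
  using ideal_of_mono[OF rels0_subset] by (auto simp: cU_eq_iff F.cg_def)

lemma tp_dt_ideal: "x \<in> ideal_of RR \<Longrightarrow> tp (qgroup_alg A q) 2 (U.dt x) = \<zero>\<^bsub>tensor_power (qgroup_alg A q) 2\<^esub>"
  unfolding U.dt_tm
  by (rule U.tp_tm_tideal[OF dl_ideal]) (auto simp: cU_zero_iff ideal_of_base)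

lemma comult_gen_dt: "comult_gen A q x = tp (qgroup_alg A q) 2 (U.dt (wrd [x]))"
proof -
  interpret T: alg_image sc "tensor_power (qgroup_alg A q) 2" "tuples (qgroup_alg A q) 2" "tp (qgroup_alg A q) 2"
      "mmul (tuple_monoid (qgroup_alg A q) 2)" "sgl (replicate 2 \<one>\<^bsub>qgroup_alg A q\<^esub>) 1"
    by (rule U.tensor_image_H)
  have [simp]: "sgl [cU u, cU v] a \<in> tuples (qgroup_alg A q) 2" for u v a
    by (auto simp: U.carrier_c)
  have p: "pure_tensor (qgroup_alg A q) [cU u, cU v] = tp (qgroup_alg A q) 2 (sgl [cU u, cU v] 1)" for u v
    by (simp add: pure_tensor_tp numeral_2_eq_2)
  show ?thesis
    unfolding U.dt_wrd
    by (cases x; simp add: word_class_cq p; subst T.p_add; simp)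
qed

lemma free_ext_comult: "free_ext (tensor_power (qgroup_alg A q) 2) (comult_gen A q) x = tp (qgroup_alg A q) 2 (U.dt x)"
proof -
  interpret T: alg_image sc "tensor_power (qgroup_alg A q) 2" "tuples (qgroup_alg A q) 2" "tp (qgroup_alg A q) 2"
      "mmul (tuple_monoid (qgroup_alg A q) 2)" "sgl (replicate 2 \<one>\<^bsub>qgroup_alg A q\<^esub>) 1"
    by (rule U.tensor_image_H)
  have *: "foldr (\<lambda>x y. comult_gen A q x \<otimes>\<^bsub>tensor_power (qgroup_alg A q) 2\<^esub> y) w \<one>\<^bsub>tensor_power (qgroup_alg A q) 2\<^esub> =
      tp (qgroup_alg A q) 2 (U.dt (wrd w))" for w
  proof (induction w)
    case Nil
    have "U.dt (wrd []) = sgl (replicate 2 \<one>\<^bsub>qgroup_alg A q\<^esub>) 1"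
      unfolding U.dt_wrd by (simp add: U.c_one numeral_2_eq_2)
    then show ?case by (simp only: foldr.simps id_apply T.p_u)
  next
    case (Cons a w)
    have "U.dt (wrd (a # w)) = mmul (tuple_monoid (qgroup_alg A q) 2) (U.dt (wrd [a])) (U.dt (wrd w))"
      by (simp add: wrd_mult flip: U.dt_mult)
    then show ?case
      using Cons T.p_mu[OF U.dt_closed U.dt_closed] by (simp add: comult_gen_dt)
  qed
  have "free_ext (tensor_power (qgroup_alg A q) 2) (comult_gen A q) x = tp (qgroup_alg A q) 2 (pm.lext (\<lambda>w. U.dt (wrd w)) x)"
    unfolding free_ext_def by (rule T.linear_ext_image) (rule U.dt_closed, rule *)
  also have "pm.lext (\<lambda>w. U.dt (wrd w)) x = U.dt x"
    by (simp add: U.dt_def)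
  finally show ?thesis .
qed

lemma comult_cU: "comult (qgroup A q) (cU x) = tp (qgroup_alg A q) 2 (U.dt x)"
proof -
  interpret T: alg_image sc "tensor_power (qgroup_alg A q) 2" "tuples (qgroup_alg A q) 2" "tp (qgroup_alg A q) 2"
      "mmul (tuple_monoid (qgroup_alg A q) 2)" "sgl (replicate 2 \<one>\<^bsub>qgroup_alg A q\<^esub>) 1"
    by (rule U.tensor_image_H)
  have "induced (free_ext (tensor_power (qgroup_alg A q) 2) (comult_gen A q)) (cU x) =
      free_ext (tensor_power (qgroup_alg A q) 2) (comult_gen A q) x"
  proof (rule cq_induced)
    fix y assume "y - x \<in> ideal_of RR"
    then have "tp (qgroup_alg A q) 2 (U.dt y - U.dt x) = \<zero>\<^bsub>tensor_power (qgroup_alg A q) 2\<^esub>"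
      using tp_dt_ideal[of "y - x"] by (simp add: U.dt_def pm.lext_diff)
    then show "free_ext (tensor_power (qgroup_alg A q) 2) (comult_gen A q) y = free_ext (tensor_power (qgroup_alg A q) 2) (comult_gen A q) x"
      unfolding free_ext_comult by (rule T.p_eqI[OF U.dt_closed U.dt_closed])
  qed
  then show ?thesis by (simp add: free_ext_comult)
qed

lemma counit_cU: "counit (qgroup A q) (cU x) = fd.lext eps x"
proof -
  have *: "foldr (\<lambda>x y. counit_gen x \<otimes>\<^bsub>field_alg\<^esub> y) w \<one>\<^bsub>field_alg\<^esub> = (eps w :: 'k)" for w :: "'i qgen list"
    by (induction w) auto
  have e: "free_ext field_alg counit_gen x = fd.lext eps x" for x :: "'i qgen list \<Rightarrow>\<^sub>0 'k"
    unfolding free_ext_def * by (rule trans[OF lin_image.linear_ext_image[OF lin_image_field]]) simp_all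
  have "induced (free_ext field_alg counit_gen) (cU x) = free_ext field_alg counit_gen x"
  proof (rule cq_induced)
    fix y assume "y - x \<in> ideal_of RR"
    then have "fd.lext eps (y - x) = 0" by (rule eps_ideal)
    then show "free_ext field_alg counit_gen y = free_ext field_alg counit_gen x" by (simp add: e fd.lext_diff)
  qed
  then show ?thesis by (simp add: e)
qed

lemma antipode_cU: "antipode (qgroup A q) (cU x) = cU (anti x)"
proof -
  interpret O: lin_image sc "opposite_alg (qgroup_alg A q)" UNIV cU
    by unfold_locales (simp_all add: opposite_alg_def U.carrier_c U.c_add U.c_sc U.c_zero)
  have g: "antipode_gen A q x = cU (ag x)" for x
    by (cases x) (simp_all add: word_class_cq U.p_uminus)
  have *: "foldr (\<lambda>x y. antipode_gen A q x \<otimes>\<^bsub>opposite_alg (qgroup_alg A q)\<^esub> y) w \<one>\<^bsub>opposite_alg (qgroup_alg A q)\<^esub> = cU (antw w)" for w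
    by (induction w) (simp_all add: opposite_alg_def g U.c_mult U.c_one)
  have e: "free_ext (opposite_alg (qgroup_alg A q)) (antipode_gen A q) x = cU (anti x)" for x
    unfolding free_ext_def by (rule O.linear_ext_image) (simp_all add: *)
  have "induced (free_ext (opposite_alg (qgroup_alg A q)) (antipode_gen A q)) (cU x) =
      free_ext (opposite_alg (qgroup_alg A q)) (antipode_gen A q) x"
  proof (rule cq_induced)
    fix y assume "y - x \<in> ideal_of RR"
    then have "anti (y - x) \<in> ideal_of RR" by (rule anti_ideal)
    then show "free_ext (opposite_alg (qgroup_alg A q)) (antipode_gen A q) y =
        free_ext (opposite_alg (qgroup_alg A q)) (antipode_gen A q) x"
      by (simp add: e cU_eq_iff pm.lext_diff)
  qed
  then show ?thesis by (simp add: e)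
qed

lemma tp_qgroup: "tp (qgroup A q) n = tp (qgroup_alg A q) n"
  by (rule tp_cong) simp_all

sublocale Q: word_hopf "qgroup A q" cU
proof -
  interpret Q: word_bialgebra "qgroup A q" cU
    by unfold_locales
      (simp_all only: qgroup_simps(1-6) U.carrier_c U.c_add U.c_sc U.c_zero U.c_mult U.c_one U.c_inv
        comult_cU counit_cU tp_qgroup U.dt_def cU_zero_iff anti_ideal)
  show "word_hopf (qgroup A q) cU"
    by unfold_locales (rule Q.is_antipode_anti, rule antipode_cU)
qed

end


section \<open>The Harish-Chandra projection\<close>

lemma sc_diff: "sc a (x - y) = sc a x - sc a y"
  by (rule poly_mapping_eqI) (simp add: lookup_minus right_diff_distrib)

lemma sc_left_commute: "sc a (sc b x) = sc b (sc a x)"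
  by (rule poly_mapping_eqI) simp

text \<open>
  The universal Verma module of the algebra without Serre relations has the basis \<open>f\<^sub>u \<otimes> \<gamma>\<close>, for
  words \<open>u\<close> in the index set and exponents \<open>\<gamma>\<close> of torus elements (\<open>Inl i\<close> for \<open>\<omega>\<^sub>i\<close>, \<open>Inr i\<close> for \<open>\<omega>'\<^sub>i\<close>).
  Projecting the action on its highest weight vector to the degree 0 part gives a map which kills the
  Serre relations, because these commute with all \<open>e\<^sub>k\<close> (resp. all \<open>f\<^sub>k\<close>).
\<close>

type_synonym ('i, 'k) verma = "('i list \<times> ('i + 'i \<Rightarrow>\<^sub>0 int)) \<Rightarrow>\<^sub>0 'k"

fun dg :: "'i qgen \<Rightarrow> ('i + 'i) \<Rightarrow>\<^sub>0 int" where
  "dg (Om i) = sgl (Inl i) 1" | "dg (OmInv i) = sgl (Inl i) (-1)"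
| "dg (Om' i) = sgl (Inr i) 1" | "dg (OmInv' i) = sgl (Inr i) (-1)" | "dg g = 0"

definition "dgw w = sum_list (map dg w)"

lemma dgw_simps [simp]: "dgw [] = 0" "dgw (x # w) = dg x + dgw w" "dgw (u @ v) = dgw u + dgw v"
  by (simp_all add: dgw_def)

lemma dg_tinv: "g \<in> torus_gens \<Longrightarrow> dg (tinv g) = - dg g"
  by (cases g; simp add: single_uminus)

context cartan_param
begin

definition twf :: "'i qgen \<Rightarrow> 'i list \<Rightarrow> 'k" where
  "twf g u = prod_list (map (\<lambda>j. tw q g (Fgen j)) u)"

lemma twf_simps [simp]: "twf g [] = 1" "twf g (j # u) = tw q g (Fgen j) * twf g u"
  by (simp_all add: twf_def)

definition fop :: "'i \<Rightarrow> ('i, 'k) verma \<Rightarrow> ('i, 'k) verma" where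
  "fop j = pm.lext (\<lambda>(u, \<gamma>). sgl (j # u, \<gamma>) 1)"

definition top :: "'i qgen \<Rightarrow> ('i, 'k) verma \<Rightarrow> ('i, 'k) verma" where
  "top g = pm.lext (\<lambda>(u, \<gamma>). sgl (u, \<gamma> + dg g) (twf g u))"

text \<open>Obtained by moving \<open>e\<^sub>i\<close> to the right through the \<open>f\<close>
  with the commutation relation until it annihilates the highest weight vector.\<close>

primrec ebas :: "'i \<Rightarrow> 'i list \<Rightarrow> ('i + 'i \<Rightarrow>\<^sub>0 int) \<Rightarrow> ('i, 'k) verma" where
  "ebas i [] \<gamma> = 0"
| "ebas i (j # u) \<gamma> = fop j (ebas i u \<gamma>) +
    (if i = j then sc (kap i) (top (Om i) (sgl (u, \<gamma>) 1) - top (Om' i) (sgl (u, \<gamma>) 1)) else 0)"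

definition eop :: "'i \<Rightarrow> ('i, 'k) verma \<Rightarrow> ('i, 'k) verma" where
  "eop i = pm.lext (\<lambda>(u, \<gamma>). ebas i u \<gamma>)"

fun act :: "'i qgen \<Rightarrow> ('i, 'k) verma \<Rightarrow> ('i, 'k) verma" where
  "act (Egen i) = eop i" | "act (Fgen i) = fop i" | "act g = top g"

lemma act_add: "act g (x + y) = act g x + act g y" and act_sc: "act g (sc a x) = sc a (act g x)"
  and act_zero [simp]: "act g 0 = 0" and act_diff: "act g (x - y) = act g x - act g y"
  by (cases g; simp add: eop_def fop_def top_def pm.lext_add pm.lext_sc pm.lext_diff)+

lemmas fop_lin = act_add[of "Fgen j" for j, simplified] act_sc[of "Fgen j" for j, simplified]
  act_diff[of "Fgen j" for j, simplified] act_zero[of "Fgen j" for j, simplified]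
lemmas eop_lin = act_add[of "Egen j" for j, simplified] act_sc[of "Egen j" for j, simplified]
  act_diff[of "Egen j" for j, simplified] act_zero[of "Egen j" for j, simplified]
lemma top_lin: "top g (x + y) = top g x + top g y" "top g (sc a x) = sc a (top g x)" "top g 0 = 0" "top g (x - y) = top g x - top g y"
  by (simp_all add: top_def pm.lext_add pm.lext_sc pm.lext_diff)

lemma fop_sgl: "fop j (sgl (u, \<gamma>) a) = sgl (j # u, \<gamma>) a"
  and top_sgl: "top g (sgl (u, \<gamma>) a) = sgl (u, \<gamma> + dg g) (a * twf g u)"
  and eop_sgl: "eop i (sgl (u, \<gamma>) a) = sc a (ebas i u \<gamma>)"
  by (simp_all add: fop_def top_def eop_def)

lemma act_torus: "g \<in> torus_gens \<Longrightarrow> act g = top g"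
  by (cases g) auto

lemma verma_induct [case_names basis add sc]:
  assumes "\<And>u \<gamma>. P (sgl (u, \<gamma>) 1)" "\<And>s t. P s \<Longrightarrow> P t \<Longrightarrow> P (s + t)" "\<And>a s. P s \<Longrightarrow> P (sc a s)"
  shows "P (m :: ('i, 'k) verma)"
proof (induction m rule: pm_induct)
  case zero
  show ?case using assms(3)[OF assms(1), of 0] by simp
next
  case (single w a)
  show ?case using assms(3)[OF assms(1), of a "fst w" "snd w"] by simp
qed (rule assms(2))

primrec actw :: "'i qgen list \<Rightarrow> ('i, 'k) verma \<Rightarrow> ('i, 'k) verma" where
  "actw [] m = m" | "actw (x # w) m = act x (actw w m)"

lemma actw_append [simp]: "actw (u @ v) m = actw u (actw v m)"
  by (induction u) auto

lemma actw_add: "actw w (x + y) = actw w x + actw w y" and actw_sc: "actw w (sc a x) = sc a (actw w x)"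
  and actw_zero [simp]: "actw w 0 = 0"
  by (induction w) (auto simp: act_add act_sc)

definition rep :: "('i qgen list \<Rightarrow>\<^sub>0 'k) \<Rightarrow> ('i, 'k) verma \<Rightarrow> ('i, 'k) verma" where
  "rep x m = pm.lext (\<lambda>w. actw w m) x"

lemma rep_wrd [simp]: "rep (sgl w a) m = sc a (actw w m)"
  by (simp add: rep_def)

lemma rep_add: "rep (x + y) m = rep x m + rep y m" "rep x (m + m') = rep x m + rep x m'"
  and rep_sc: "rep (sc a x) m = sc a (rep x m)" "rep x (sc a m) = sc a (rep x m)"
  and rep_diff: "rep (x - y) m = rep x m - rep y m" and rep_zero [simp]: "rep 0 m = 0" "rep x 0 = 0"
  by (simp_all add: rep_def pm.lext_add pm.lext_sc pm.lext_diff actw_add actw_sc pm.lext_fun_add pm.lext_fun_scl)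
    (simp add: pm.lext_def)

lemma rep_one [simp]: "rep 1 m = m"
  unfolding sgl_Nil[symmetric] by (simp del: sgl_Nil)

lemma rep_mult: "rep (x * y) m = rep x (rep y m)"
proof (induction x rule: word_induct)
  case (single u)
  show ?case
    by (induction y rule: word_induct) (simp_all add: wrd_mult rep_add rep_sc distrib_left actw_add actw_sc)
qed (simp_all add: rep_add rep_sc distrib_right)

lemma top_fop: "top g (fop j m) = sc (tw q g (Fgen j)) (fop j (top g m))"
proof (induction m rule: verma_induct)
  case (basis u \<gamma>)
  show ?case by (simp add: fop_sgl top_sgl)
qed (simp_all add: fop_lin top_lin pm.scl_right sc_left_commute)

lemma top_top: "top g (top h m) = top h (top g m)"
  by (induction m rule: verma_induct) (simp_all add: top_lin top_sgl add_ac mult.commute)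

lemma top_inv: "g \<in> torus_gens \<Longrightarrow> top g (top (tinv g) m) = m"
proof (induction m rule: verma_induct)
  case (basis u \<gamma>)
  have "twf (tinv g) u * twf g u = 1"
    by (induction u) (simp_all add: tw_tinv[OF basis] field_simps)
  then show ?case by (simp add: top_sgl dg_tinv basis add_ac)
qed (simp_all add: top_lin)

lemma eop_shift: "eop i (top g (sgl (u, \<gamma>) 1)) = sc (inverse (tw q g (Egen i))) (top g (eop i (sgl (u, \<gamma>) 1)))"
  if "g \<in> torus_gens"
proof -
  have ef: "tw q g (Fgen i) = inverse (tw q g (Egen i))" for i
    using that by (cases g) auto
  have *: "sc (twf g u) (ebas i u (\<gamma> + dg g)) = sc (inverse (tw q g (Egen i))) (top g (ebas i u \<gamma>))"
  proof (induction u)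
    case (Cons j u)
    let ?e = "tw q g (Fgen j)"
    have 1: "sc (twf g (j # u)) (fop j (ebas i u (\<gamma> + dg g))) = sc (inverse (tw q g (Egen i))) (top g (fop j (ebas i u \<gamma>)))"
    proof -
      have "sc (twf g (j # u)) (fop j (ebas i u (\<gamma> + dg g))) = sc ?e (fop j (sc (twf g u) (ebas i u (\<gamma> + dg g))))"
        by (simp add: fop_lin pm.scl_mult)
      also have "\<dots> = sc (inverse (tw q g (Egen i))) (top g (fop j (ebas i u \<gamma>)))"
        unfolding Cons top_fop by (simp add: fop_lin mult.commute flip: pm.scl_mult)
      finally show ?thesis .
    qed
    have 2: "sc (twf g (i # u)) (top h (sgl (u, \<gamma> + dg g) 1)) = sc (inverse (tw q g (Egen i))) (top g (top h (sgl (u, \<gamma>) 1)))" for h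
      by (simp add: top_sgl ef add_ac mult_ac)
    show ?case
      using 1 2[of "Om i"] 2[of "Om' i"]
      by (cases "i = j") (simp_all add: pm.scl_right top_lin sc_diff sc_left_commute[of "twf g (j # u)" "kap j"]
        sc_left_commute[of "inverse (tw q g (Egen j))" "kap j"] del: map_single twf_simps)
  qed (simp add: top_lin del: twf_simps)
  show ?thesis
    using * by (simp add: top_sgl eop_sgl)
qed

lemma eop_top: "g \<in> torus_gens \<Longrightarrow> top g (eop i m) = sc (tw q g (Egen i)) (eop i (top g m))"
proof (induction m rule: verma_induct)
  case (basis u \<gamma>)
  then show ?case by (simp add: eop_shift flip: pm.scl_mult)
qed (simp_all add: eop_lin top_lin pm.scl_right sc_left_commute)

lemma eop_fop: "eop i (fop j m) = fop j (eop i m) + (if i = j then sc (kap i) (top (Om i) m - top (Om' i) m) else 0)"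
proof (induction m rule: verma_induct)
  case (basis u \<gamma>)
  show ?case by (simp add: fop_sgl eop_sgl)
next
  case (add s t)
  then show ?case by (auto simp: eop_lin fop_lin top_lin sc_diff pm.scl_right)
next
  case (sc a s)
  then show ?case by (auto simp: eop_lin fop_lin top_lin sc_diff pm.scl_right sc_left_commute[of a])
qed

lemma rep_rels0:
  assumes "r \<in> rels0 q"
  shows "rep r m = 0"
  using assms
proof cases
  case (torus g h)
  then show ?thesis by (simp add: rep_diff act_torus top_top)
next
  case (om_inv i)
  then show ?thesis using top_inv[of "Om i"] by (simp add: rep_diff)
next
  case (om'_inv i)
  then show ?thesis using top_inv[of "Om' i"] by (simp add: rep_diff)
next
  case (om_e i j)
  then show ?thesis using top_inv[of "Om i"] by (simp add: rep_diff eop_top)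
next
  case (om'_e i j)
  then show ?thesis using top_inv[of "Om' i"] by (simp add: rep_diff eop_top)
next
  case (om_f i j)
  then show ?thesis using top_inv[of "Om i"] by (simp add: rep_diff top_fop)
next
  case (om'_f i j)
  then show ?thesis using top_inv[of "Om' i"] by (simp add: rep_diff top_fop)
next
  case (ef i j)
  then show ?thesis by (simp add: rep_diff eop_fop kap_def sc_diff)
qed

lemma rep_eqv: "x \<doteq> y \<Longrightarrow> rep x m = rep y m"
proof -
  assume "x \<doteq> y"
  then have "x - y \<in> ideal_of (rels0 q)" by (simp add: F.cg_def)
  then have "rep (x - y) m = 0"
    by (induction arbitrary: m rule: ideal_of.induct) (simp_all add: rep_mult rep_rels0 rep_add)
  then show ?thesis by (simp add: rep_diff)
qed

section \<open>Serre elements acting on the universal Verma module\<close>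

lemma fe_comm: "wrd [Fgen k] * wrd [Egen i] \<doteq> wrd [Egen i] * wrd [Fgen k] +
    (if i = k then sc (kap i) (wrd [Om' i] - wrd [Om i]) else 0)"
proof -
  have "wrd [Egen i] * wrd [Fgen k] + (if i = k then sc (kap i) (wrd [Om' i] - wrd [Om i]) else 0) \<doteq>
      wrd [Fgen k] * wrd [Egen i] + (if i = k then sc (kap i) (wrd [Om i] - wrd [Om' i]) else 0) +
      (if i = k then sc (kap i) (wrd [Om' i] - wrd [Om i]) else 0)"
    by (intro F.cg_add ef_comm F.cg_refl)
  also have "\<dots> = wrd [Fgen k] * wrd [Egen i]"
    by (simp add: F.scl_diff del: map_single)
  finally show ?thesis by (rule F.cg_sym)
qed

text \<open>For \<open>k = i\<close> this is the diagonal commutator computation, for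
  \<open>k = j\<close> the off-diagonal one, and for other \<open>k\<close> the letter commutes with
  both entries.\<close>

lemma f_serreE: 
  assumes "i \<noteq> j"
  shows "wrd [Fgen k] * serreE A q i j \<doteq> serreE A q i j * wrd [Fgen k]"
  unfolding serreE_qcom
proof -
  note n = sdeg_param[OF assms]
  consider "k = i" | "k = j" "k \<noteq> i" | "k \<noteq> i" "k \<noteq> j" by blast
  then show "wrd [Fgen k] * F.qcom (q i i) (q i j) (wrd [Egen i]) (wrd [Egen j]) (sdeg i j) \<doteq>
      F.qcom (q i i) (q i j) (wrd [Egen i]) (wrd [Egen j]) (sdeg i j) * wrd [Fgen k]"
  proof cases
    case 1
    show ?thesis
    proof (rule F.qcom_commutator_diag[where u = "wrd [Om i]" and u' = "wrd [Om' i]" and \<kappa> = "kap i" and s = "q j i"])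
      show "wrd [Fgen k] * wrd [Egen i] \<doteq> wrd [Egen i] * wrd [Fgen k] + sc (kap i) (wrd [Om' i] - wrd [Om i])"
        using fe_comm[of k i] 1 by simp
      show "wrd [Fgen k] * wrd [Egen j] \<doteq> wrd [Egen j] * wrd [Fgen k]"
        using fe_comm[of k j] 1 assms by simp
    qed (use n q_diag torus_comm[of "Om i"] torus_comm'[of "Om' i"] in
        \<open>auto dest: spec[of _ "Egen i"] spec[of _ "Egen j"] simp: torus_comm[of "Om i" "Egen _", simplified] torus_comm'[of "Om' i", simplified]
          intro: torus_comm[of "Om i" "Egen _", simplified] torus_comm'[of "Om' i" "Egen _", simplified]\<close>)
  next
    case 2
    show ?thesis
    proof (rule F.qcom_commutator_off[where w = "wrd [Om j]" and w' = "wrd [Om' j]" and \<kappa> = "kap j" and s = "q j i"])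
      show "wrd [Fgen k] * wrd [Egen i] \<doteq> wrd [Egen i] * wrd [Fgen k]"
        using fe_comm[of k i] 2 by simp
      show "wrd [Fgen k] * wrd [Egen j] \<doteq> wrd [Egen j] * wrd [Fgen k] + sc (kap j) (wrd [Om' j] - wrd [Om j])"
        using fe_comm[of k j] 2 by simp
      show "wrd [Om j] * wrd [Egen i] \<doteq> sc (q j i) (wrd [Egen i] * wrd [Om j])"
        using torus_comm[of "Om j" "Egen i"] by simp
      show "wrd [Egen i] * wrd [Om' j] \<doteq> sc (q i j) (wrd [Om' j] * wrd [Egen i])"
        using torus_comm'[of "Om' j" "Egen i"] by simp
    qed (use n in auto)
  next
    case 3
    then show ?thesis
      using fe_comm[of k i] fe_comm[of k j] by (intro F.qcom_commute) auto
  qed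
qed

text \<open>The same three cases, read in the opposite algebra; \<open>\<omega>\<^sub>i\<close> and
  \<open>\<omega>'\<^sub>i\<close> keep their roles as \<open>u\<close> and
  \<open>u'\<close>.\<close>

lemma e_serreF:
  assumes "i \<noteq> j"
  shows "serreF A q i j * wrd [Egen k] \<doteq> wrd [Egen k] * serreF A q i j"
  unfolding serreF_qcom
proof -
  note n = sdeg_param[OF assms]
  consider "k = i" | "k = j" "k \<noteq> i" | "k \<noteq> i" "k \<noteq> j" by blast
  then show "Fop.qcom (q i i) (q i j) (wrd [Fgen i]) (wrd [Fgen j]) (sdeg i j) * wrd [Egen k] \<doteq>
      wrd [Egen k] * Fop.qcom (q i i) (q i j) (wrd [Fgen i]) (wrd [Fgen j]) (sdeg i j)"
  proof cases
    case 1
    show ?thesis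
    proof (rule Fop.qcom_commutator_diag[where u = "wrd [Om i]" and u' = "wrd [Om' i]" and \<kappa> = "kap i" and s = "q j i"])
      show "wrd [Fgen i] * wrd [Egen k] \<doteq> wrd [Egen k] * wrd [Fgen i] + sc (kap i) (wrd [Om' i] - wrd [Om i])"
        using fe_comm[of i k] 1 by simp
      show "wrd [Fgen j] * wrd [Egen k] \<doteq> wrd [Egen k] * wrd [Fgen j]"
        using fe_comm[of j k] 1 assms by simp
      show "wrd [Fgen i] * wrd [Om i] \<doteq> sc (q i i) (wrd [Om i] * wrd [Fgen i])"
        using torus_comm'[of "Om i" "Fgen i"] by simp
      show "wrd [Fgen j] * wrd [Om i] \<doteq> sc (q i j) (wrd [Om i] * wrd [Fgen j])"
        using torus_comm'[of "Om i" "Fgen j"] by simp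
      show "wrd [Om' i] * wrd [Fgen i] \<doteq> sc (q i i) (wrd [Fgen i] * wrd [Om' i])"
        using torus_comm[of "Om' i" "Fgen i"] by simp
      show "wrd [Om' i] * wrd [Fgen j] \<doteq> sc (q j i) (wrd [Fgen j] * wrd [Om' i])"
        using torus_comm[of "Om' i" "Fgen j"] by simp
    qed (use n q_diag in auto)
  next
    case 2
    show ?thesis
    proof (rule Fop.qcom_commutator_off[where w = "wrd [Om j]" and w' = "wrd [Om' j]" and \<kappa> = "kap j" and s = "q j i"])
      show "wrd [Fgen i] * wrd [Egen k] \<doteq> wrd [Egen k] * wrd [Fgen i]"
        using fe_comm[of i k] 2 by simp
      show "wrd [Fgen j] * wrd [Egen k] \<doteq> wrd [Egen k] * wrd [Fgen j] + sc (kap j) (wrd [Om' j] - wrd [Om j])"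
        using fe_comm[of j k] 2 by simp
      show "wrd [Fgen i] * wrd [Om j] \<doteq> sc (q j i) (wrd [Om j] * wrd [Fgen i])"
        using torus_comm'[of "Om j" "Fgen i"] by simp
      show "wrd [Om' j] * wrd [Fgen i] \<doteq> sc (q i j) (wrd [Fgen i] * wrd [Om' j])"
        using torus_comm[of "Om' j" "Fgen i"] by simp
    qed (use n in auto)
  next
    case 3
    then show ?thesis
      using fe_comm[of i k] fe_comm[of j k] by (intro Fop.qcom_commute) auto
  qed
qed

definition tww :: "'i qgen \<Rightarrow> 'i qgen list \<Rightarrow> 'k" where
  "tww g w = prod_list (map (tw q g) w)"

lemma tww_simps [simp]: "tww g [] = 1" "tww g (x # w) = tw q g x * tww g w" "tww g (u @ v) = tww g u * tww g v"
  "tww g (replicate k x) = tw q g x ^ k"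
  by (simp_all add: tww_def prod_list_replicate)

lemma torus_comm_word: "g \<in> torus_gens \<Longrightarrow> wrd [g] * wrd w \<doteq> sc (tww g w) (wrd w * wrd [g])"
proof (induction w)
  case (Cons x w)
  have "wrd [g] * wrd (x # w) = wrd [g] * wrd [x] * wrd w" by (simp add: wrd_mult)
  also have "\<dots> \<doteq> sc (tw q g x) (wrd [x] * wrd [g]) * wrd w"
    by (rule F.cg_mul_right, rule torus_comm) (rule Cons.prems)
  also have "\<dots> = sc (tw q g x) (wrd [x] * (wrd [g] * wrd w))" by (simp add: mult.assoc)
  also have "\<dots> \<doteq> sc (tw q g x) (wrd [x] * sc (tww g w) (wrd w * wrd [g]))"
    by (rule F.cg_scl, rule F.cg_mul_left, rule Cons.IH) (rule Cons.prems)
  also have "\<dots> = sc (tww g (x # w)) (wrd (x # w) * wrd [g])" by (simp add: wrd_mult mult_single)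
  finally show ?case .
qed simp

lemma torus_serreF:
  assumes "g \<in> torus_gens"
  shows "wrd [g] * serreF A q i j \<doteq> sc (tw q g (Fgen i) ^ sdeg i j * tw q g (Fgen j)) (serreF A q i j * wrd [g])"
proof -
  let ?w = "\<lambda>k. replicate k (Fgen i) @ [Fgen j] @ replicate (sdeg i j - k) (Fgen i)" and ?c = "serre_coeff A q i j"
  let ?t = "tw q g (Fgen i) ^ sdeg i j * tw q g (Fgen j)"
  have t: "tww g (?w k) = ?t" if "k \<le> sdeg i j" for k
    using that by (simp add: mult_ac flip: power_add)
  have "wrd [g] * serreF A q i j = (\<Sum>k\<le>sdeg i j. sc (?c k) (wrd [g] * wrd (?w k)))"
    unfolding serreF_def by (simp add: sum_distrib_left flip: sc_mult_right)
  also have "\<dots> \<doteq> (\<Sum>k\<le>sdeg i j. sc (?c k) (sc (tww g (?w k)) (wrd (?w k) * wrd [g])))"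
    by (intro F.cg_sum F.cg_scl torus_comm_word assms)
  also have "\<dots> = (\<Sum>k\<le>sdeg i j. sc ?t (sc (?c k) (wrd (?w k)) * wrd [g]))"
    by (intro sum.cong refl) (simp only: t atMost_iff sc_mult_left mult.commute flip: pm.scl_mult)
  also have "\<dots> = sc ?t (serreF A q i j * wrd [g])"
    unfolding serreF_def by (simp add: sum_distrib_right pm.scl_sum)
  finally show ?thesis .
qed

text \<open>Each monomial of the Serre element ends in an \<open>e\<close>, so the highest weight
  vector is killed; commuting with all \<open>f\<close> extends this to the whole module.\<close>

lemma rep_serreE:
  assumes "i \<noteq> j"
  shows "rep (serreE A q i j) m = 0"
proof (induction m rule: verma_induct)
  case (basis u \<gamma>)
  show ?case
  proof (induction u)
    case Nil
    have e: "actw (w @ [Egen l]) (sgl ([], \<gamma>) 1) = 0" for w l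
      by (simp add: eop_sgl)
    have "actw (replicate a (Egen i) @ [Egen j] @ replicate k (Egen i)) (sgl ([], \<gamma>) 1) = 0" for a k
    proof (cases k)
      case 0
      then show ?thesis using e[of "replicate a (Egen i)" j] by simp
    next
      case (Suc l)
      have "replicate a (Egen i) @ [Egen j] @ replicate k (Egen i) = (replicate a (Egen i) @ [Egen j] @ replicate l (Egen i)) @ [Egen i]"
        using replicate_append_same[of l "Egen i"] by (simp add: Suc)
      then show ?thesis by (simp only: e)
    qed
    then show ?case
      unfolding serreE_def rep_def by (simp only: pm.lext_sum pm.lext_single) simp
  next
    case (Cons l u)
    have "rep (serreE A q i j) (sgl (l # u, \<gamma>) 1) = rep (serreE A q i j) (rep (wrd [Fgen l]) (sgl (u, \<gamma>) 1))"
      by (simp add: fop_sgl)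
    also have "\<dots> = rep (wrd [Fgen l] * serreE A q i j) (sgl (u, \<gamma>) 1)"
      unfolding rep_mult[symmetric] by (rule rep_eqv, rule F.cg_sym, rule f_serreE) (rule assms)
    also have "\<dots> = 0" by (simp only: rep_mult Cons rep_zero)
    finally show ?case .
  qed
qed (simp_all add: rep_add rep_sc)

definition pr0 :: "('i, 'k) verma \<Rightarrow> ('i + 'i \<Rightarrow>\<^sub>0 int) \<Rightarrow>\<^sub>0 'k" where
  "pr0 = pm.lext (\<lambda>(u, \<gamma>). if u = [] then sgl \<gamma> 1 else 0)"

lemma pr0_lin: "pr0 (x + y) = pr0 x + pr0 y" "pr0 (sc a x) = sc a (pr0 x)" "pr0 0 = 0" "pr0 (x - y) = pr0 x - pr0 y"
  by (simp_all add: pr0_def pm.lext_add pm.lext_sc pm.lext_diff)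

lemma pr0_fop: "pr0 (fop j m) = 0"
  by (induction m rule: verma_induct) (simp_all add: fop_lin pr0_lin fop_sgl, simp add: pr0_def)

lemma pr0_top: "pr0 (top g m) = pm.lext (\<lambda>\<gamma>. sgl (\<gamma> + dg g) 1) (pr0 m)"
  by (induction m rule: verma_induct)
    (simp_all add: top_lin pr0_lin top_sgl pm.lext_add pm.lext_sc, simp add: pr0_def)

text \<open>Unlike those in the \<open>e\<close>, the Serre elements in the \<open>f\<close> do not
  act by zero. For \<open>i \<noteq> j\<close> the subspace generated here is stable under all
  letters, and it has no degree 0 part since each monomial starts with an \<open>f\<close>.\<close>

inductive_set sub_serreF :: "'i \<Rightarrow> 'i \<Rightarrow> ('i, 'k) verma set" for i j where
  base: "rep (serreF A q i j) m \<in> sub_serreF i j"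
| fop: "z \<in> sub_serreF i j \<Longrightarrow> fop k z \<in> sub_serreF i j"
| add: "z \<in> sub_serreF i j \<Longrightarrow> z' \<in> sub_serreF i j \<Longrightarrow> z + z' \<in> sub_serreF i j"
| sc: "z \<in> sub_serreF i j \<Longrightarrow> sc a z \<in> sub_serreF i j"

lemma sub_serreF_top:
  assumes "z \<in> sub_serreF i j" "g \<in> torus_gens"
  shows "top g z \<in> sub_serreF i j"
  using assms(1)
proof (induction rule: sub_serreF.induct)
  case (base m)
  have "top g (rep (serreF A q i j) m) = rep (wrd [g] * serreF A q i j) m"
    using assms(2) by (simp add: rep_mult act_torus)
  also have "\<dots> = rep (sc (tw q g (Fgen i) ^ sdeg i j * tw q g (Fgen j)) (serreF A q i j * wrd [g])) m"
    by (rule rep_eqv, rule torus_serreF) (rule assms)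
  finally show ?case
    by (simp only: rep_sc rep_mult) (intro sub_serreF.intros)
qed (auto simp: top_lin top_fop intro: sub_serreF.intros)

lemma sub_serreF_eop:
  assumes "z \<in> sub_serreF i j" "i \<noteq> j"
  shows "eop k z \<in> sub_serreF i j"
  using assms(1)
proof (induction rule: sub_serreF.induct)
  case (base m)
  have "eop k (rep (serreF A q i j) m) = rep (wrd [Egen k] * serreF A q i j) m"
    by (simp add: rep_mult)
  also have "\<dots> = rep (serreF A q i j * wrd [Egen k]) m"
    by (rule rep_eqv, rule F.cg_sym, rule e_serreF) (rule assms)
  finally show ?case by (simp only: rep_mult) (intro sub_serreF.intros)
next
  case (fop z l)
  have "top (Om k) z + sc (-1) (top (Om' k) z) \<in> sub_serreF i j"
    by (intro sub_serreF.intros sub_serreF_top fop) auto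
  then show ?case
    using fop by (auto simp: eop_fop pm.scl_minus intro!: sub_serreF.intros)
qed (auto simp: eop_lin intro: sub_serreF.intros)

lemma sub_serreF_actw:
  assumes "z \<in> sub_serreF i j" "i \<noteq> j"
  shows "actw w z \<in> sub_serreF i j"
proof (induction w)
  case (Cons x w)
  then show ?case
    using assms by (cases x) (auto intro: sub_serreF_top sub_serreF_eop sub_serreF.fop)
qed (use assms in auto)

lemma pr0_sub_serreF: "z \<in> sub_serreF i j \<Longrightarrow> pr0 z = 0"
proof (induction rule: sub_serreF.induct)
  case (base m)
  have "pr0 (actw (replicate k (Fgen i) @ [Fgen j] @ w) m) = 0" for k w
    by (cases k) (simp_all add: pr0_fop)
  moreover have "pr0 (sum f K) = (\<Sum>k\<in>K. pr0 (f k))" for f :: "nat \<Rightarrow> _" and K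
    unfolding pr0_def by (rule pm.lext_sum)
  ultimately show ?case
    unfolding serreF_def rep_def by (simp only: pm.lext_sum pm.lext_single pr0_lin) simp
qed (simp_all add: pr0_fop pr0_lin)

definition hcp :: "('i qgen list \<Rightarrow>\<^sub>0 'k) \<Rightarrow> ('i + 'i \<Rightarrow>\<^sub>0 int) \<Rightarrow>\<^sub>0 'k" where
  "hcp x = pr0 (rep x (sgl ([], 0) 1))"

lemma hcp_lin: "hcp (x + y) = hcp x + hcp y" "hcp (sc a x) = sc a (hcp x)" "hcp (x - y) = hcp x - hcp y" "hcp 0 = 0"
  by (simp_all add: hcp_def rep_add rep_sc rep_diff pr0_lin)

lemma hcp_rel:
  assumes "r \<in> RR"
  shows "hcp (u * r * v) = 0"
  using assms
proof (cases rule: rels_cases)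
  case 1
  then show ?thesis by (simp add: hcp_def rep_mult rep_rels0 pr0_lin)
next
  case (2 i j)
  then show ?thesis by (simp add: hcp_def rep_mult rep_serreE pr0_lin)
next
  case (3 i j)
  show ?thesis
  proof (induction u rule: word_induct)
    case (single w)
    show ?case
      by (simp add: hcp_def rep_mult 3(2)) (rule pr0_sub_serreF, rule sub_serreF_actw, rule sub_serreF.base, rule 3)
  qed (simp_all add: hcp_lin distrib_right)
qed

lemma hcp_ideal: "x \<in> ideal_of RR \<Longrightarrow> hcp x = 0"
  by (induction rule: ideal_of.induct) (simp_all add: hcp_lin hcp_rel)

lemma actw_torus: "set w \<subseteq> torus_gens \<Longrightarrow> actw w (sgl ([], \<gamma>) 1) = sgl ([], \<gamma> + dgw w) 1"
  by (induction w arbitrary: \<gamma>) (simp_all add: act_torus top_sgl add_ac)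

lemma hcp_torus: "set w \<subseteq> torus_gens \<Longrightarrow> hcp (wrd w) = sgl (dgw w) 1"
  by (simp add: hcp_def actw_torus) (simp add: pr0_def)

text \<open>The last \<open>Egen\<close> of the word meets a vector that torus letters have only
  shifted in weight, hence one annihilated by every \<open>e\<close>.\<close>

lemma hcp_pos:
  assumes "set w \<subseteq> torus_gens \<union> range Egen" "Egen i \<in> set w"
  shows "rep (wrd w) (sgl ([], 0) 1) = 0"
proof -
  obtain u k v where w: "w = u @ Egen k # v" "set v \<subseteq> torus_gens"
  proof -
    have "\<exists>u x v. w = u @ x # v \<and> x \<in> range Egen \<and> (\<forall>y\<in>set v. y \<notin> range Egen)"
      using split_list_last_prop[of w "\<lambda>x. x \<in> range Egen"] assms(2) by blast
    then show thesis using that assms(1) by fastforce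
  qed
  then show ?thesis by (simp add: actw_torus eop_sgl)
qed

text \<open>Once the leftmost \<open>Fgen\<close> has been applied the vector lies in the image of
  \<open>fop\<close>, and torus letters cannot create a degree 0 part.\<close>

lemma hcp_neg:
  assumes "set w \<subseteq> torus_gens \<union> range Fgen" "Fgen i \<in> set w"
  shows "pr0 (actw w m) = 0"
proof -
  obtain u k v where w: "w = u @ Fgen k # v" "set u \<subseteq> torus_gens"
  proof -
    have "\<exists>u x v. w = u @ x # v \<and> x \<in> range Fgen \<and> (\<forall>y\<in>set u. y \<notin> range Fgen)"
      using split_list_first_prop[of w "\<lambda>x. x \<in> range Fgen"] assms(2) by blast
    then show thesis using that assms(1) by fastforce
  qed
  have "pr0 (actw u z) = 0" if "pr0 z = 0" "set u \<subseteq> torus_gens" for u z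
    using that by (induction u) (simp_all add: act_torus pr0_top)
  then show ?thesis using w by (simp add: pr0_fop)
qed

end


section \<open>The torus\<close>

lemma (in lin_image) mspan_induct:
  assumes "x \<in> mspan M Y" "Y \<subseteq> carrier M" "P \<zero>" "\<And>y. y \<in> Y \<Longrightarrow> P y"
    and "\<And>x y. x \<in> carrier M \<Longrightarrow> y \<in> carrier M \<Longrightarrow> P x \<Longrightarrow> P y \<Longrightarrow> P (x \<oplus> y)"
    and "\<And>a x. x \<in> carrier M \<Longrightarrow> P x \<Longrightarrow> P (a \<odot> x)"
  shows "x \<in> carrier M" "P x"
proof -
  have "submodule {x \<in> carrier M. P x} field_alg M"
    by (rule submoduleI) (use assms in \<open>auto simp: carrier_eq simp flip: p_add p_scl p_zero\<close>)
  then have "mspan M Y \<subseteq> {x \<in> carrier M. P x}"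
    by (rule mspan_minimal) (use assms in auto)
  then show "x \<in> carrier M" "P x" using assms(1) by auto
qed

lemma dgw_surj: "\<exists>w. set w \<subseteq> torus_gens \<and> dgw w = \<gamma>"
proof (induction \<gamma> rule: pm_induct)
  case zero
  show ?case by (intro exI[of _ "[]"]) simp
next
  case (single b n)
  have r: "dgw (replicate k x) = sgl b (int k * m)" if "dg x = sgl b m" for k x m
    using that by (induction k) (simp_all add: algebra_simps flip: single_add)
  obtain x where x: "x \<in> torus_gens" "dg x = sgl b 1"
    by (cases b) (auto intro: that[of "Om _"] that[of "Om' _"])
  show ?case
  proof (cases "n \<ge> 0")
    case True
    then show ?thesis using x r[of x 1 "nat n"] by (intro exI[of _ "replicate (nat n) x"]) auto
  next
    case False
    then show ?thesis
      using x r[of "tinv x" "-1" "nat (- n)"] dg_tinv[of x]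
      by (intro exI[of _ "replicate (nat (- n)) (tinv x)"]) (auto simp: single_uminus split: if_splits, (cases x; simp)+)
  qed
next
  case (add s t)
  then obtain u v where "set u \<subseteq> torus_gens \<and> dgw u = s" "set v \<subseteq> torus_gens \<and> dgw v = t" by blast
  then show ?case by (intro exI[of _ "u @ v"]) auto
qed

locale cartan_fin = cartan_param q A for q :: "'i::finite \<Rightarrow> 'i \<Rightarrow> 'k::field" and A
begin

abbreviation "UA \<equiv> qgroup_alg A q"
abbreviation "TT \<equiv> torus_group A q"

lemma torus_words_comm:
  assumes "set u \<subseteq> torus_gens" "set v \<subseteq> torus_gens"
  shows "wrd u * wrd v \<doteq> wrd v * wrd u"
  using assms(1)
proof (induction u)
  case (Cons g u)
  have t: "tww g v = 1"
  proof -
    have "tw q g h = 1" if "h \<in> torus_gens" for h using Cons that by (cases g; cases h) auto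
    then show ?thesis using assms(2) by (induction v) auto
  qed
  have "wrd (g # u) * wrd v = wrd [g] * (wrd u * wrd v)" by (simp add: wrd_mult)
  also have "\<dots> \<doteq> wrd [g] * (wrd v * wrd u)" by (rule F.cg_mul_left) (use Cons in simp)
  also have "\<dots> = wrd [g] * wrd v * wrd u" by (simp only: mult.assoc)
  also have "\<dots> \<doteq> wrd v * wrd [g] * wrd u"
    by (rule F.cg_mul_right) (use torus_comm_word[of g v] Cons t in simp)
  finally show ?case by (simp add: wrd_mult)
qed simp

definition winv :: "'i qgen list \<Rightarrow> 'i qgen list" where "winv w = map tinv (rev w)"

lemma winv_simps [simp]: "set w \<subseteq> torus_gens \<Longrightarrow> set (winv w) \<subseteq> torus_gens" "winv (winv w) = w"
proof -
  have "tinv \<circ> tinv = (id :: 'i qgen \<Rightarrow> _)" by (rule ext) simp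
  then show "winv (winv w) = w" by (simp add: winv_def rev_map)
qed (auto simp: winv_def)

lemma wrd_winv: "set w \<subseteq> torus_gens \<Longrightarrow> wrd w * wrd (winv w) \<doteq> 1"
proof (induction w)
  case (Cons g w)
  have "wrd (g # w) * wrd (winv (g # w)) = wrd [g] * (wrd w * wrd (winv w)) * wrd [tinv g]"
    by (simp add: winv_def wrd_mult)
  also have "\<dots> \<doteq> wrd [g] * 1 * wrd [tinv g]"
    by (rule F.cg_mul_right, rule F.cg_mul_left) (use Cons in simp)
  also have "\<dots> = wrd [g] * wrd [tinv g]" by simp
  also have "\<dots> \<doteq> 1" by (rule torus_inv_mult) (use Cons in simp)
  finally show ?case .
qed (simp add: winv_def)

lemma cU_winv:
  assumes "set w \<subseteq> torus_gens"
  shows "cU (wrd w) \<otimes>\<^bsub>UA\<^esub> cU (wrd (winv w)) = \<one>\<^bsub>UA\<^esub>" "cU (wrd (winv w)) \<otimes>\<^bsub>UA\<^esub> cU (wrd w) = \<one>\<^bsub>UA\<^esub>"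
  using cU_eqv[OF wrd_winv[OF assms]] cU_eqv[OF wrd_winv[of "winv w"]] assms by (simp_all add: U.c_mult U.c_one)

lemma monoid_UA: "Group.monoid UA"
  by (rule U.alg.monoid_H)

lemma group_units: "group (units_of UA)"
  by (rule Group.monoid.units_group) (rule monoid_UA)

lemma cU_unit: "set w \<subseteq> torus_gens \<Longrightarrow> cU (wrd w) \<in> carrier (units_of UA)"
  using cU_winv[of w] by (auto simp: units_of_def Units_def U.carrier_c)

lemma units_of_simps: "x \<otimes>\<^bsub>units_of UA\<^esub> y = x \<otimes>\<^bsub>UA\<^esub> y" "\<one>\<^bsub>units_of UA\<^esub> = \<one>\<^bsub>UA\<^esub>"
  by (simp_all add: units_of_def)

lemma inv_units: "set w \<subseteq> torus_gens \<Longrightarrow> inv\<^bsub>units_of UA\<^esub> (cU (wrd w)) = cU (wrd (winv w))"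
  by (rule group.inv_equality[OF group_units]) (auto simp: units_of_simps cU_winv cU_unit)

lemma carrier_TT: "carrier TT = {cU (wrd w) |w. set w \<subseteq> torus_gens}"
proof -
  let ?S = "range (\<lambda>i. word_class A q [Om i]) \<union> range (\<lambda>i. word_class A q [Om' i])"
  have S: "?S \<subseteq> carrier (units_of UA)"
    using cU_unit[of "[Om _]"] cU_unit[of "[Om' _]"] by (auto simp: word_class_cq)
  have c: "carrier TT = generate (units_of UA) ?S"
    unfolding torus_group_def carrier_subgroup_generated using S by (simp add: Int_absorb1)
  have "generate (units_of UA) ?S \<subseteq> {cU (wrd w) |w. set w \<subseteq> torus_gens}"
  proof
    fix x assume "x \<in> generate (units_of UA) ?S"
    then show "x \<in> {cU (wrd w) |w. set w \<subseteq> torus_gens}"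
    proof induction
      case one
      show ?case unfolding units_of_simps U.c_one[symmetric] sgl_Nil[symmetric] by (auto simp del: sgl_Nil)
    next
      case (incl h)
      then show ?case by (force simp: word_class_cq)
    next
      case (inv h)
      then obtain g where g: "g \<in> torus_gens" "h = cU (wrd [g])"
        by (auto simp: word_class_cq intro: that[of "Om _"] that[of "Om' _"])
      have "inv\<^bsub>units_of UA\<^esub> h = cU (wrd [tinv g])"
        unfolding g(2) using inv_units[of "[g]"] g(1) by (simp add: winv_def)
      moreover have "set [tinv g] \<subseteq> torus_gens" using g(1) by simp
      ultimately show ?case by blast
    next
      case (eng h1 h2)
      then obtain u v where "h1 = cU (wrd u)" "h2 = cU (wrd v)" "set u \<subseteq> torus_gens" "set v \<subseteq> torus_gens" by auto
      then show ?case by (auto simp: units_of_simps wrd_mult simp flip: U.c_mult intro!: exI[of _ "u @ v"])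
    qed
  qed
  moreover have "cU (wrd w) \<in> generate (units_of UA) ?S" if "set w \<subseteq> torus_gens" for w
    using that
  proof (induction w)
    case Nil
    have "cU (wrd []) = \<one>\<^bsub>units_of UA\<^esub>" by (simp add: units_of_simps U.c_one)
    then show ?case by (metis generate.one)
  next
    case (Cons g w)
    have inv: "cU (wrd [tinv g]) = inv\<^bsub>units_of UA\<^esub> (cU (wrd [g]))" if "g \<in> torus_gens" for g
      using inv_units[of "[g]"] that by (simp add: winv_def)
    have i: "inv\<^bsub>units_of UA\<^esub> (cU (wrd [Om i])) \<in> generate (units_of UA) ?S"
      "inv\<^bsub>units_of UA\<^esub> (cU (wrd [Om' i])) \<in> generate (units_of UA) ?S"
      "cU (wrd [Om i]) \<in> generate (units_of UA) ?S" "cU (wrd [Om' i]) \<in> generate (units_of UA) ?S" for i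
      by (rule generate.inv generate.incl; auto simp: word_class_cq)+
    have "cU (wrd [g]) \<in> generate (units_of UA) ?S"
      using Cons.prems i inv[of "Om _"] inv[of "Om' _"] by (cases g) auto
    then have "cU (wrd [g]) \<otimes>\<^bsub>units_of UA\<^esub> cU (wrd w) \<in> generate (units_of UA) ?S"
      using Cons by (intro generate.eng) auto
    then show ?case by (simp add: units_of_simps wrd_mult flip: U.c_mult)
  qed
  ultimately show ?thesis unfolding c by blast
qed

lemma TT_simps: "x \<otimes>\<^bsub>TT\<^esub> y = x \<otimes>\<^bsub>UA\<^esub> y" "\<one>\<^bsub>TT\<^esub> = \<one>\<^bsub>UA\<^esub>"
  by (simp_all add: torus_group_def units_of_simps)

lemma TT_mult: "cU (wrd u) \<otimes>\<^bsub>TT\<^esub> cU (wrd v) = cU (wrd (u @ v))"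
  by (simp add: TT_simps wrd_mult flip: U.c_mult)

lemma TT_in: "set w \<subseteq> torus_gens \<Longrightarrow> cU (wrd w) \<in> carrier TT"
  by (auto simp: carrier_TT)

lemma comm_group_TT: "comm_group TT"
proof (rule group.group_comm_groupI)
  show "group TT"
    unfolding torus_group_def by (rule group.group_subgroup_generated) (rule group_units)
  fix x y assume "x \<in> carrier TT" "y \<in> carrier TT"
  then obtain u v where "x = cU (wrd u)" "y = cU (wrd v)" "set u \<subseteq> torus_gens" "set v \<subseteq> torus_gens"
    by (auto simp: carrier_TT)
  then show "x \<otimes>\<^bsub>TT\<^esub> y = y \<otimes>\<^bsub>TT\<^esub> x"
    using cU_eqv[OF torus_words_comm[of u v]] by (simp add: TT_simps U.c_mult)
qed

sublocale TG: comm_group TT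
  by (rule comm_group_TT)

definition tgen :: "'i + 'i \<Rightarrow> ('i qgen list \<Rightarrow>\<^sub>0 'k) set" where
  "tgen b = (case b of Inl i \<Rightarrow> cU (wrd [Om i]) | Inr i \<Rightarrow> cU (wrd [Om' i]))"

lemma tgen_closed [simp]: "tgen b \<in> carrier TT"
  by (cases b) (simp_all add: tgen_def TT_in)

definition texp :: "('i + 'i \<Rightarrow>\<^sub>0 int) \<Rightarrow> ('i qgen list \<Rightarrow>\<^sub>0 'k) set" where
  "texp \<gamma> = finprod TT (\<lambda>b. tgen b [^]\<^bsub>TT\<^esub> Poly_Mapping.lookup \<gamma> b) UNIV"

lemma texp_add: "texp (\<gamma> + \<delta>) = texp \<gamma> \<otimes>\<^bsub>TT\<^esub> texp \<delta>"
  unfolding texp_def by (subst TG.finprod_multf[symmetric]) (auto simp: lookup_add TG.int_pow_mult)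

lemma texp_single: "texp (sgl b n) = tgen b [^]\<^bsub>TT\<^esub> n"
proof -
  have "texp (sgl b n) = finprod TT (\<lambda>c. if b = c then tgen c [^]\<^bsub>TT\<^esub> n else \<one>\<^bsub>TT\<^esub>) UNIV"
    unfolding texp_def by (rule TG.finprod_cong') (auto simp: lookup_single when_def)
  also have "\<dots> = tgen b [^]\<^bsub>TT\<^esub> n"
    by (rule TG.finprod_singleton) auto
  finally show ?thesis .
qed

lemma inv_TT: "set w \<subseteq> torus_gens \<Longrightarrow> inv\<^bsub>TT\<^esub> (cU (wrd w)) = cU (wrd (winv w))"
  by (rule TG.inv_equality) (auto simp: TT_simps cU_winv TT_in)

lemma texp_dg: "g \<in> torus_gens \<Longrightarrow> texp (dg g) = cU (wrd [g])"
  using inv_TT[of "[Om _]"] inv_TT[of "[Om' _]"]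
  by (cases g) (auto simp: texp_single TG.int_pow_neg winv_def, simp_all add: tgen_def)

lemma texp_dgw: "set w \<subseteq> torus_gens \<Longrightarrow> texp (dgw w) = cU (wrd w)"
proof (induction w)
  case Nil
  have "texp (sgl undefined 0) = \<one>\<^bsub>TT\<^esub>" unfolding texp_single by simp
  then show ?case by (simp add: TT_simps U.c_one)
next
  case (Cons g w)
  then show ?case by (simp add: texp_add texp_dg TT_mult)
qed

definition hcU :: "('i qgen list \<Rightarrow>\<^sub>0 'k) set \<Rightarrow> ('i + 'i \<Rightarrow>\<^sub>0 int) \<Rightarrow>\<^sub>0 'k" where
  "hcU C = hcp (U.pre C)"

lemma hcU_cU [simp]: "hcU (cU x) = hcp x"
proof -
  have "cU (U.pre (cU x)) = cU x" using U.pre by simp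
  then have "hcp (U.pre (cU x) - x) = 0" by (intro hcp_ideal) (simp add: cU_eq_iff)
  then show ?thesis by (simp add: hcU_def hcp_lin)
qed

text \<open>Well defined on the torus because the Harish-Chandra image of a torus word is the single
  exponent \<open>dgw w\<close>.\<close>

definition tdeg :: "('i qgen list \<Rightarrow>\<^sub>0 'k) set \<Rightarrow> 'i + 'i \<Rightarrow>\<^sub>0 int" where
  "tdeg C = (THE \<gamma>. hcU C = sgl \<gamma> 1)"

lemma tdeg_wrd: "set w \<subseteq> torus_gens \<Longrightarrow> tdeg (cU (wrd w)) = dgw w"
proof -
  assume w: "set w \<subseteq> torus_gens"
  have "sgl a (1::'k) = sgl b 1 \<longleftrightarrow> a = b" for a b :: "'i + 'i \<Rightarrow>\<^sub>0 int"
    by (metis lookup_single_eq lookup_single_not_eq zero_neq_one)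
  then show ?thesis by (simp add: tdeg_def hcp_torus w)
qed

lemma tdeg_texp: "g \<in> carrier TT \<Longrightarrow> texp (tdeg g) = g"
  by (auto simp: carrier_TT tdeg_wrd texp_dgw)

lemma texp_tdeg: "tdeg (texp \<gamma>) = \<gamma>" and texp_closed: "texp \<gamma> \<in> carrier TT"
proof -
  obtain w where w: "set w \<subseteq> torus_gens" "dgw w = \<gamma>" using dgw_surj by blast
  then show "tdeg (texp \<gamma>) = \<gamma>" "texp \<gamma> \<in> carrier TT"
    using texp_dgw[of w] tdeg_wrd[of w] TT_in[of w] by auto
qed

text \<open>\<open>tdeg\<close> separates torus words with different exponents, which is the
  independence of the \<open>\<omega>\<^sub>i\<close> and \<open>\<omega>'\<^sub>i\<close>;
  \<open>texp\<close> provides the inverse.\<close>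

lemma torus_iso: "TT \<cong> free_Abelian_group (UNIV :: ('i + 'i) set)"
proof -
  have "tdeg \<in> hom TT (free_Abelian_group UNIV)"
    by (rule homI) (auto simp: carrier_TT TT_mult tdeg_wrd)
  moreover have "bij_betw tdeg (carrier TT) (carrier (free_Abelian_group UNIV))"
    by (rule bij_betwI[of _ _ _ texp]) (auto simp: tdeg_texp texp_tdeg texp_closed)
  ultimately show ?thesis by (auto simp: is_iso_def iso_def)
qed

section \<open>Inflations\<close>

lemma hcU_lin:
  assumes "x \<in> carrier UA" "y \<in> carrier UA"
  shows "hcU (x \<oplus>\<^bsub>UA\<^esub> y) = hcU x + hcU y" "hcU (a \<odot>\<^bsub>UA\<^esub> x) = sc a (hcU x)"
  using assms by (auto simp: U.carrier_c hcp_lin simp flip: U.c_add U.c_sc)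

lemma hcU_zero: "hcU \<zero>\<^bsub>UA\<^esub> = 0"
  by (simp add: hcp_lin flip: U.c_zero)

abbreviation "pos_words \<beta> \<equiv> {word_class A q w | w. w \<in> lists (range Egen \<union> range Om \<union> range OmInv) \<and> (\<forall>i. count_list w (Egen i) = \<beta> i)}"
abbreviation "neg_words \<alpha> \<equiv> {word_class A q w | w. w \<in> lists (range Fgen \<union> range Om' \<union> range OmInv') \<and> (\<forall>i. count_list w (Fgen i) = \<alpha> i)}"

lemma words_subset: "pos_words \<beta> \<subseteq> carrier UA" "neg_words \<alpha> \<subseteq> carrier UA"
  by (auto simp: word_class_cq U.carrier_c)

lemma hcU_neg_pos:
  assumes x: "x \<in> neg_part A q \<alpha>" and y: "y \<in> pos_part A q \<beta>" and k: "(\<Sum>i\<in>UNIV. \<alpha> i) + (\<Sum>i\<in>UNIV. \<beta> i) \<ge> 1"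
  shows "x \<in> carrier UA" "y \<in> carrier UA" "hcU (x \<otimes>\<^bsub>UA\<^esub> y) = 0"
proof -
  have words: "hcU (w \<otimes>\<^bsub>UA\<^esub> w') = 0" if ww: "w \<in> neg_words \<alpha>" "w' \<in> pos_words \<beta>" for w w'
  proof -
    obtain u v where u: "w = cU (wrd u)" "u \<in> lists (range Fgen \<union> range Om' \<union> range OmInv')" "\<And>i. count_list u (Fgen i) = \<alpha> i"
      and v: "w' = cU (wrd v)" "v \<in> lists (range Egen \<union> range Om \<union> range OmInv)" "\<And>i. count_list v (Egen i) = \<beta> i"
      using ww by (auto simp: word_class_cq)
    have "hcp (wrd u * wrd v) = 0"
    proof (cases "\<exists>i. \<beta> i > 0")
      case True
      then obtain i where "Egen i \<in> set v" using v(3) by (metis count_notin less_not_refl)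
      moreover have "set v \<subseteq> torus_gens \<union> range Egen" using v(2) by auto
      ultimately show ?thesis using hcp_pos[of v i] by (simp add: hcp_def rep_mult pr0_lin)
    next
      case False
      then have "\<exists>i. \<alpha> i > 0" using k by (metis (no_types, lifting) Suc_n_not_le_n add_eq_0_iff_both_eq_0 gr0I less_one not_le sum.neutral)
      then obtain i where "Fgen i \<in> set u" using u(3) by (metis count_notin less_not_refl)
      moreover have "set u \<subseteq> torus_gens \<union> range Fgen" using u(2) by auto
      ultimately show ?thesis using hcp_neg[of u i] by (simp add: hcp_def rep_mult)
    qed
    then show ?thesis by (simp add: u(1) v(1) flip: U.c_mult)
  qed
  note mul = U.alg.monoid_H[THEN Group.monoid.m_closed]
  have 1: "y \<in> carrier UA \<and> hcU (w \<otimes>\<^bsub>UA\<^esub> y) = 0" if w: "w \<in> neg_words \<alpha>" for w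
  proof -
    have wc: "w \<in> carrier UA" using w words_subset(2)[of \<alpha>] by blast
    have "y \<in> carrier UA" "hcU (w \<otimes>\<^bsub>UA\<^esub> y) = 0"
      using y unfolding pos_part_def
      by (rule U.mspan_induct[where P = "\<lambda>y. hcU (w \<otimes>\<^bsub>UA\<^esub> y) = 0"];
        use words_subset words[OF w] wc in \<open>auto simp: U.carrier_c hcp_lin distrib_left simp flip: U.c_mult U.c_add U.c_sc U.c_zero\<close>)+
    then show ?thesis by blast
  qed
  have yc: "y \<in> carrier UA"
    using y unfolding pos_part_def
    by (rule U.mspan_induct(1)[where P = "\<lambda>_. True"]) (use words_subset in auto)
  show "y \<in> carrier UA" by (rule yc)
  show "x \<in> carrier UA" "hcU (x \<otimes>\<^bsub>UA\<^esub> y) = 0"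
    using x unfolding neg_part_def
    by (rule U.mspan_induct[where P = "\<lambda>x. hcU (x \<otimes>\<^bsub>UA\<^esub> y) = 0"];
      use words_subset 1 yc in \<open>auto simp: U.carrier_c hcp_lin distrib_right simp flip: U.c_mult U.c_add U.c_sc U.c_zero\<close>)+
qed

lemma hcU_graded:
  assumes "x \<in> graded_part A q k" "k \<ge> 1"
  shows "x \<in> carrier UA" "hcU x = 0"
  using assms(1) unfolding graded_part_def
  by (rule U.mspan_induct[where P = "\<lambda>x. hcU x = 0"];
    use hcU_neg_pos assms(2) hcU_lin hcU_zero U.alg.monoid_H[THEN Group.monoid.m_closed] in fastforce)+

text \<open>The bilinear extension of \<sigma> is pulled back along the Harish-Chandra projection,
  which restricts to the identity on the torus and kills all components of positive degree.\<close>

lemma inflation_exists: "\<exists>s. is_inflation A q \<sigma> s"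
proof
  define s where "s = (\<lambda>x y. fd.lext (\<lambda>\<gamma>. fd.lext (\<lambda>\<delta>. \<sigma> (texp \<gamma>) (texp \<delta>)) (hcU y)) (hcU x))"
  have "bilinear_form (qgroup A q) s"
    unfolding bilinear_form_def s_def
    by (auto simp: hcU_lin fd.lext_add fd.lext_sc fd.lext_fun_add fd.lext_fun_scl)
  moreover have "s g h = \<sigma> g h" if "g \<in> carrier TT" "h \<in> carrier TT" for g h
    using that by (auto simp: carrier_TT s_def hcp_torus texp_dgw)
  moreover have "s x y = 0 \<and> s y x = 0" if "k \<ge> 1" "x \<in> graded_part A q k" for k x y
    using hcU_graded[OF that(2,1)] by (simp add: s_def fd.lext_def)
  ultimately show "is_inflation A q \<sigma> s"
    unfolding is_inflation_def by blast
qed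

end


section \<open>Twisting by a bicharacter\<close>

text \<open>The bicharacter of the root lattice with matrix \<open>z\<close> on the simple
  roots.\<close>

definition bic :: "('i::finite \<Rightarrow> 'i \<Rightarrow> 'k::field) \<Rightarrow> ('i \<Rightarrow>\<^sub>0 int) \<Rightarrow> ('i \<Rightarrow>\<^sub>0 int) \<Rightarrow> 'k" where
  "bic z a b = (\<Prod>i\<in>UNIV. (\<Prod>j\<in>UNIV. z i j powi Poly_Mapping.lookup b j) powi Poly_Mapping.lookup a i)"

lemma prod_powi_single:
  "(\<Prod>i\<in>UNIV. x i powi Poly_Mapping.lookup (sgl k n) i) = (x k powi n :: 'k::field)" for k :: "'i::finite"
proof -
  have "(\<Prod>i\<in>UNIV. x i powi Poly_Mapping.lookup (sgl k n) i) = (\<Prod>i\<in>UNIV. if i = k then x i powi n else 1)"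
    by (intro prod.cong) (auto simp: lookup_single when_def)
  then show ?thesis by simp
qed

lemma bic_single: "bic z (sgl i m) (sgl j n) = (z i j powi n) powi m"
  by (simp add: bic_def prod_powi_single)

lemma bic_zero [simp]: "bic z 0 b = 1" "bic z a 0 = 1"
  by (simp_all add: bic_def)

lemma bic_inverse: "bic (\<lambda>i j. inverse (z i j)) a b = inverse (bic z a b)"
  by (simp add: bic_def power_int_inverse prod_inversef[unfolded o_def])

locale bichar =
  fixes z :: "'i::finite \<Rightarrow> 'i \<Rightarrow> 'k::field"
  assumes z_nonzero [simp]: "z i j \<noteq> 0"
begin

lemma bic_nonzero [simp]: "bic z a b \<noteq> 0"
  by (simp add: bic_def)

lemma bic_add: "bic z (a + a') b = bic z a b * bic z a' b" "bic z a (b + b') = bic z a b * bic z a b'"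
  by (simp_all add: bic_def lookup_add power_int_add prod.distrib power_int_mult_distrib)

text \<open>\<open>bq w w'\<close> is the scalar by which the deformed product of the words \<open>w\<close> and \<open>w'\<close> differs from their product.\<close>

definition bq :: "'i qgen list \<Rightarrow> 'i qgen list \<Rightarrow> 'k" where
  "bq w w' = bic z (ld w) (ld w') * inverse (bic z (rd w) (rd w'))"

lemma bq_simps [simp]: "bq [] w = 1" "bq w [] = 1"
  by (simp_all add: bq_def)

lemma bq_append: "bq (u @ v) w = bq u w * bq v w" "bq w (u @ v) = bq w u * bq w v"
  by (simp_all add: bq_def bic_add)

lemma bq_nonzero [simp]: "bq w w' \<noteq> 0"
  by (simp add: bq_def)

primrec chi :: "'i qgen list \<Rightarrow> 'k" where
  "chi [] = 1" | "chi (x # w) = bq [x] w * chi w"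

text \<open>On the free monoid the bimultiplicative \<open>bq\<close> is a coboundary:
  \<open>chi\<close>, the product of \<open>bq\<close> over all pairs of letters in order,
  trivialises it. Hence rescaling words by \<open>chi\<close> absorbs the deformed product.\<close>

lemma chi_append: "chi (u @ v) = chi u * chi v * bq u v"
proof (induction u)
  case (Cons x u)
  have "bq (x # u) v = bq [x] v * bq u v" using bq_append(1)[of "[x]" u v] by simp
  then show ?case by (simp add: Cons bq_append mult_ac)
qed simp

lemma chi_nonzero [simp]: "chi w \<noteq> 0"
  by (induction w) auto

definition twi :: "('i qgen list \<Rightarrow>\<^sub>0 'k) \<Rightarrow> 'i qgen list \<Rightarrow>\<^sub>0 'k" where
  "twi = pm.lext (\<lambda>w. sgl w (chi w))"

lemma twi_lin: "twi (x + y) = twi x + twi y" "twi (sc a x) = sc a (twi x)" "twi (x - y) = twi x - twi y" "twi 0 = 0"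
  and twi_single [simp]: "twi (sgl w a) = sgl w (a * chi w)"
  and twi_sum: "twi (sum f K) = (\<Sum>k\<in>K. twi (f k))"
  by (simp_all add: twi_def pm.lext_add pm.lext_sc pm.lext_diff pm.lext_sum)

definition homog :: "('i qgen list \<Rightarrow>\<^sub>0 'k) \<Rightarrow> ('i \<Rightarrow>\<^sub>0 int) \<Rightarrow> ('i \<Rightarrow>\<^sub>0 int) \<Rightarrow> bool" where
  "homog r d d' \<longleftrightarrow> (\<forall>w\<in>Poly_Mapping.keys r. ld w = d \<and> rd w = d')"

lemma homog_diff: "homog r d d' \<Longrightarrow> homog s d d' \<Longrightarrow> homog (r - s) d d'"
  and homog_sum: "(\<And>k. k \<in> K \<Longrightarrow> homog (f k) d d') \<Longrightarrow> homog (sum f K) d d'"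
  and homog_single: "ld w = d \<Longrightarrow> rd w = d' \<Longrightarrow> homog (sgl w a) d d'"
proof -
  show "homog r d d' \<Longrightarrow> homog s d d' \<Longrightarrow> homog (r - s) d d'"
    using keys_diff[of r s] by (auto simp: homog_def)
  show "ld w = d \<Longrightarrow> rd w = d' \<Longrightarrow> homog (sgl w a) d d'" by (auto simp: homog_def)
  show "(\<And>k. k \<in> K \<Longrightarrow> homog (f k) d d') \<Longrightarrow> homog (sum f K) d d'"
    using keys_sum[of f K] by (fastforce simp: homog_def)
qed

lemma ld_rd_torus: "set w \<subseteq> torus_gens \<Longrightarrow> ld w = rd w"
proof (induction w)
  case (Cons x w)
  then show ?case by (cases x) auto
qed simp

text \<open>In the commutator relation \<open>e\<^sub>i f\<^sub>i\<close> has both degrees equal to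
  the i-th simple root, as do \<open>\<omega>\<^sub>i\<close> and \<open>\<omega>'\<^sub>i\<close>;
  this is why the two torus letters have to share a degree.\<close>

lemma homog_rels0: "r \<in> rels0 q \<Longrightarrow> \<exists>d d'. homog r d d'"
proof (induction rule: rels0.induct)
  case (torus g h)
  show ?case
    by (rule exI[of _ "ld [g, h]"], rule exI[of _ "rd [g, h]"], intro homog_diff homog_single) (simp_all add: add_ac)
next
  case (om_inv i)
  show ?case by (intro exI homog_diff homog_single refl) (simp_all flip: single_add)
next
  case (om'_inv i)
  show ?case by (intro exI homog_diff homog_single refl) (simp_all flip: single_add)
next
  case (om_e i j)
  show ?case by (intro exI homog_diff homog_single refl) (simp_all add: single_uminus)
next
  case (om'_e i j)
  show ?case by (intro exI homog_diff homog_single refl) (simp_all add: single_uminus)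
next
  case (om_f i j)
  show ?case by (intro exI homog_diff homog_single refl) (simp_all add: single_uminus)
next
  case (om'_f i j)
  show ?case by (intro exI homog_diff homog_single refl) (simp_all add: single_uminus)
next
  case (ef i j)
  show ?case
    by (rule exI[of _ "ld [Egen i, Fgen j]"], rule exI[of _ "rd [Egen i, Fgen j]"])
      (auto intro!: homog_diff homog_single)
qed

lemma ld_replicate_split: "k \<le> n \<Longrightarrow> ld (replicate (n - k) x) + ld (replicate k x) = ld (replicate n x)"
  "k \<le> n \<Longrightarrow> rd (replicate (n - k) x) + rd (replicate k x) = rd (replicate n x)"
  by (simp_all flip: ld_simps(3) rd_simps(3) replicate_add)

lemma homog_serre: "\<exists>d d'. homog (serreE A q i j) d d'" "\<exists>d d'. homog (serreF A q i j) d d'"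
proof -
  let ?n = "nat (1 - A i j)"
  show "\<exists>d d'. homog (serreE A q i j) d d'"
    unfolding serreE_def
    by (rule exI[of _ "ld (replicate ?n (Egen i)) + ld [Egen j]"], rule exI[of _ "rd (replicate ?n (Egen i)) + rd [Egen j]"],
        intro homog_sum homog_single)
      (simp_all add: ld_replicate_split[symmetric] add_ac)
  show "\<exists>d d'. homog (serreF A q i j) d d'"
    unfolding serreF_def
    by (rule exI[of _ "ld (replicate ?n (Fgen i)) + ld [Fgen j]"], rule exI[of _ "rd (replicate ?n (Fgen i)) + rd [Fgen j]"],
        intro homog_sum homog_single)
      (simp_all add: ld_replicate_split[symmetric] add_ac)
qed

lemma homog_rels: "r \<in> qgroup_rels A q \<Longrightarrow> \<exists>d d'. homog r d d'"
  unfolding qgroup_rels_eq using homog_rels0 homog_serre by blast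

text \<open>Between words \<open>a\<close> and \<open>b\<close> every monomial of a homogeneous
  \<open>r\<close> receives the same extra scalar, so \<open>twi\<close> maps \<open>a r b\<close>
  to a multiple of \<open>a (twi r) b\<close>.\<close>

lemma twi_ideal:
  assumes R: "\<And>r. r \<in> R \<Longrightarrow> (\<exists>d d'. homog r d d') \<and> twi r \<in> ideal_of R'" and x: "x \<in> ideal_of R"
  shows "twi x \<in> ideal_of R'"
  using x
proof (induction rule: ideal_of.induct)
  case (gen r u v)
  obtain d d' where h: "homog r d d'" and r: "twi r \<in> ideal_of R'" using R[OF gen] by blast
  show ?case
  proof (induction u rule: word_induct)
    case (single a)
    show ?case
    proof (induction v rule: word_induct)
      case (single b)
      let ?c = "chi a * chi b * bq a b * (bic z (ld a) d * inverse (bic z (rd a) d')) * (bic z d (ld b) * inverse (bic z d' (rd b)))"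
      have "twi (wrd a * s * wrd b) = sc ?c (wrd a * twi s * wrd b)" if "Poly_Mapping.keys s \<subseteq> Poly_Mapping.keys r" for s
      proof (induction s rule: pm_induct)
        case (single w t)
        have w: "ld w = d" "rd w = d'" using h single that by (auto simp: homog_def)
        have "chi (a @ w @ b) = ?c * chi w"
          by (simp add: chi_append bq_append) (simp add: bq_def w)
        then show ?case by (simp add: mult_single mult_ac)
      qed (simp_all add: twi_lin distrib_left distrib_right pm.scl_right)
      from this[of r] show ?case
        using r by (auto intro!: ideal_of_sc ideal_of_mult)
    qed (auto simp: twi_lin distrib_left intro: ideal_of.add ideal_of_sc)
  qed (auto simp: twi_lin distrib_right intro: ideal_of.add ideal_of_sc)
qed (auto simp: twi_lin intro: ideal_of.intros)

lemma bq_torus: "set u \<subseteq> torus_gens \<Longrightarrow> set v \<subseteq> torus_gens \<Longrightarrow> bq u v = 1"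
  by (simp add: bq_def ld_rd_torus)

lemma bq_replicate: "bq (replicate k x) w = bq [x] w ^ k" "bq w (replicate k x) = bq w [x] ^ k"
proof -
  show "bq (replicate k x) w = bq [x] w ^ k"
  proof (induction k)
    case (Suc k)
    then show ?case using bq_append(1)[of "[x]" "replicate k x" w] by simp
  qed simp
  show "bq w (replicate k x) = bq w [x] ^ k"
  proof (induction k)
    case (Suc k)
    then show ?case using bq_append(2)[of w "[x]" "replicate k x"] by simp
  qed simp
qed

text \<open>The letter \<open>y\<close> has \<open>a\<close> letters \<open>x\<close> before it and
  \<open>k\<close> after it; the pairs among the \<open>x\<close> contribute a factor that does not
  depend on its position.\<close>

lemma chi_serre_word:
  assumes "a + k = n"
  shows "chi (replicate a x @ [y] @ replicate k x) = chi (replicate n x) * bq [x] [y] ^ a * bq [y] [x] ^ k"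
proof -
  have "chi (replicate n x) = chi (replicate a x) * chi (replicate k x) * bq (replicate a x) (replicate k x)"
    by (simp add: assms[symmetric] replicate_add chi_append)
  moreover have "chi ([y] @ replicate k x) = chi (replicate k x) * bq [y] [x] ^ k"
    by (simp add: bq_replicate mult.commute)
  moreover have "bq (replicate a x) ([y] @ replicate k x) = bq [x] [y] ^ a * bq (replicate a x) (replicate k x)"
    using bq_append(2)[of "replicate a x" "[y]" "replicate k x"] by (simp add: bq_replicate)
  ultimately show ?thesis by (simp only: chi_append mult_ac)
qed

end

section \<open>Rescaling carries the relations for one parameter matrix to those for the
  other\<close>

locale twist = bichar z for z :: "'i::finite \<Rightarrow> 'i \<Rightarrow> 'k::field" +
  fixes q qhat :: "'i \<Rightarrow> 'i \<Rightarrow> 'k" and A :: "'i \<Rightarrow> 'i \<Rightarrow> int"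
  assumes qn [simp]: "q i j \<noteq> 0" and qhn [simp]: "qhat i j \<noteq> 0"
    and diag: "qhat i i = q i i" and sym: "qhat i j * qhat j i = q i j * q j i"
    and ratio: "z i j * inverse (z j i) = qhat i j * inverse (q i j)"
begin

lemma ratio_cancel: "qhat i j * inverse (q i j) * q i j = qhat i j" "q i j * (qhat i j * inverse (q i j)) = qhat i j"
  "inverse (qhat i j) * q i j * inverse (q i j) = inverse (qhat i j)"
  by (simp_all add: field_simps)

lemma bq_gens: "bq [Egen i] [Egen j] = z i j" "bq [Fgen i] [Fgen j] = inverse (z i j)"
  by (simp_all add: bq_def bic_single)

text \<open>The factor is \<open>z i j / z j i\<close> or its inverse, as prescribed by
  \<open>ratio\<close>: exactly what changes \<open>q i j\<close> to \<open>qhat i j\<close> in the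
  conjugation relations.\<close>

lemma chi_conj:
  assumes "g = Om i \<or> g = Om' i"
  shows "chi [g, Egen j, tinv g] = qhat i j * inverse (q i j)" "chi [g, Fgen j, tinv g] = inverse (qhat i j * inverse (q i j))"
proof -
  have "q i j * z i j = qhat i j * z j i" using ratio[of i j] by (simp add: field_simps)
  then show "chi [g, Egen j, tinv g] = qhat i j * inverse (q i j)" "chi [g, Fgen j, tinv g] = inverse (qhat i j * inverse (q i j))"
    using assms by (auto simp: bq_def bic_add bic_single power_int_minus field_simps)
qed

lemma hat_flip: "inverse (qhat j i) = qhat i j * inverse (q i j) * inverse (q j i)"
  using sym[of i j] by (simp add: field_simps)

lemma serre_coeff_hat: "serre_coeff A qhat i j k = serre_coeff A q i j k * (z i j * inverse (z j i)) ^ k"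
proof -
  have "qhat i j ^ k = q i j ^ k * (z i j * inverse (z j i)) ^ k"
    by (simp add: ratio ratio_cancel flip: power_mult_distrib)
  then show ?thesis by (simp only: serre_coeff_def diag mult.assoc)
qed

lemma twi_rels0:
  assumes "r \<in> rels0 qhat"
  shows "twi r \<in> ideal_of (rels0 q)"
  using assms
proof cases
  case (torus g h)
  then have "twi r = r" by (simp add: twi_lin bq_torus)
  then show ?thesis using torus by (auto intro: ideal_of_base rels0.intros)
next
  case (om_inv i)
  have "twi r = r" unfolding om_inv twi_lin twi_single by (simp add: bq_torus)
  moreover have "r \<in> rels0 q" using om_inv rels0.om_inv[of i q] by simp
  ultimately show ?thesis by (simp add: ideal_of_base)
next
  case (om'_inv i)
  have "twi r = r" unfolding om'_inv twi_lin twi_single by (simp add: bq_torus)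
  moreover have "r \<in> rels0 q" using om'_inv rels0.om'_inv[of i q] by simp
  ultimately show ?thesis by (simp add: ideal_of_base)
next
  case (om_e i j)
  let ?c = "qhat i j * inverse (q i j)"
  have "twi r = sc ?c (wrd [Om i, Egen j, OmInv i] - sgl [Egen j] (q i j))"
    unfolding om_e twi_lin twi_single using chi_conj(1)[of "Om i" i j] by (simp add: sc_diff del: chi.simps) (simp add: ratio_cancel)
  then show ?thesis by (simp only:) (intro ideal_of_sc ideal_of_base rels0.intros)
next
  case (om'_e i j)
  let ?c = "qhat i j * inverse (q i j)"
  have "twi r = sc ?c (wrd [Om' i, Egen j, OmInv' i] - sgl [Egen j] (inverse (q j i)))"
    unfolding om'_e twi_lin twi_single hat_flip using chi_conj(1)[of "Om' i" i j] by (simp add: sc_diff del: chi.simps) simp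
  then show ?thesis by (simp only:) (intro ideal_of_sc ideal_of_base rels0.intros)
next
  case (om_f i j)
  let ?c = "inverse (qhat i j * inverse (q i j))"
  have "twi r = sc ?c (wrd [Om i, Fgen j, OmInv i] - sgl [Fgen j] (inverse (q i j)))"
    unfolding om_f twi_lin twi_single using chi_conj(2)[of "Om i" i j] by (simp add: sc_diff del: chi.simps) (simp add: ratio_cancel)
  then show ?thesis by (simp only:) (intro ideal_of_sc ideal_of_base rels0.intros)
next
  case (om'_f i j)
  let ?c = "inverse (qhat i j * inverse (q i j))"
  have "qhat j i = ?c * q j i" using hat_flip[of j i] by (simp add: field_simps)
  then have "twi r = sc ?c (wrd [Om' i, Fgen j, OmInv' i] - sgl [Fgen j] (q j i))"
    unfolding om'_f twi_lin twi_single using chi_conj(2)[of "Om' i" i j] by (simp add: sc_diff del: chi.simps) simp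
  then show ?thesis by (simp only:) (intro ideal_of_sc ideal_of_base rels0.intros)
next
  case (ef i j)
  have "twi r = r"
    unfolding ef by (auto simp: twi_lin bq_def)
  moreover have "r \<in> rels0 q"
    unfolding ef diag by (rule rels0.ef)
  ultimately show ?thesis by (simp add: ideal_of_base)
qed

text \<open>Up to a common factor, the word with \<open>k\<close> letters behind
  \<open>e\<^sub>j\<close> is rescaled by \<open>z i j ^ (n - k) * z j i ^ k\<close> and its
  coefficient by \<open>(z i j / z j i) ^ k\<close>; together this is \<open>z i j ^ n\<close> for
  every \<open>k\<close>.\<close>

lemma twi_serreE: "twi (serreE A qhat i j) = sc (chi (replicate (nat (1 - A i j)) (Egen i)) * z i j ^ nat (1 - A i j)) (serreE A q i j)"
proof -
  let ?n = "nat (1 - A i j)"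
  have "serre_coeff A qhat i j k * chi (replicate (?n - k) (Egen i) @ [Egen j] @ replicate k (Egen i)) =
      chi (replicate ?n (Egen i)) * z i j ^ ?n * serre_coeff A q i j k" if "k \<le> ?n" for k
  proof -
    have "z i j ^ ?n = z i j ^ (?n - k) * z i j ^ k" using that by (simp flip: power_add)
    moreover have "z j i ^ k * (inverse (z j i)) ^ k = 1" by (simp flip: power_mult_distrib)
    ultimately show ?thesis
      using that by (subst chi_serre_word[of _ _ ?n]) (simp_all add: serre_coeff_hat bq_gens power_mult_distrib mult_ac)
  qed
  then show ?thesis
    unfolding serreE_def twi_sum pm.scl_sum by (intro sum.cong refl) (simp del: append.simps)
qed

text \<open>For the \<open>f\<close> the values of \<open>bq\<close> are inverted and the two sides
  of the middle letter exchanged, which leaves \<open>inverse (z j i) ^ n\<close> for every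
  \<open>k\<close>.\<close>

lemma twi_serreF: "twi (serreF A qhat i j) = sc (chi (replicate (nat (1 - A i j)) (Fgen i)) * inverse (z j i) ^ nat (1 - A i j)) (serreF A q i j)"
proof -
  let ?n = "nat (1 - A i j)"
  have "serre_coeff A qhat i j k * chi (replicate k (Fgen i) @ [Fgen j] @ replicate (?n - k) (Fgen i)) =
      chi (replicate ?n (Fgen i)) * inverse (z j i) ^ ?n * serre_coeff A q i j k" if "k \<le> ?n" for k
  proof -
    have "inverse (z j i) ^ ?n = inverse (z j i) ^ (?n - k) * inverse (z j i) ^ k" using that by (simp flip: power_add)
    moreover have "z i j ^ k * (inverse (z i j)) ^ k = 1" by (simp flip: power_mult_distrib)
    ultimately show ?thesis
      using that by (subst chi_serre_word[of _ _ ?n]) (simp_all add: serre_coeff_hat bq_gens power_mult_distrib mult_ac)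
  qed
  then show ?thesis
    unfolding serreF_def twi_sum pm.scl_sum by (intro sum.cong refl) (simp del: append.simps)
qed

lemma twi_rels: "x \<in> ideal_of (qgroup_rels A qhat) \<Longrightarrow> twi x \<in> ideal_of (qgroup_rels A q)"
proof (rule twi_ideal[where R = "qgroup_rels A qhat"])
  fix r assume r: "r \<in> qgroup_rels A qhat"
  have rels: "rels0 q \<subseteq> qgroup_rels A q" by (auto simp: qgroup_rels_eq)
  consider "r \<in> rels0 qhat" | i j where "i \<noteq> j" "r = serreE A qhat i j" | i j where "i \<noteq> j" "r = serreF A qhat i j"
    using r unfolding qgroup_rels_eq by blast
  then have "twi r \<in> ideal_of (qgroup_rels A q)"
  proof cases
    case 1
    then show ?thesis using twi_rels0 ideal_of_mono[OF rels] by blast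
  next
    case 2
    then have "serreE A q i j \<in> qgroup_rels A q" by (auto simp: qgroup_rels_eq)
    then show ?thesis unfolding 2 twi_serreE by (intro ideal_of_sc ideal_of_base)
  next
    case 3
    then have "serreF A q i j \<in> qgroup_rels A q" by (auto simp: qgroup_rels_eq)
    then show ?thesis unfolding 3 twi_serreF by (intro ideal_of_sc ideal_of_base)
  qed
  then show "(\<exists>d d'. homog r d d') \<and> twi r \<in> ideal_of (qgroup_rels A q)"
    using homog_rels[OF r] by simp
qed

lemma twist_inverse: "twist (\<lambda>i j. inverse (z i j)) qhat q"
proof
  show "inverse (z i j) * inverse (inverse (z j i)) = q i j * inverse (qhat i j)" for i j
    using arg_cong[OF ratio[of i j], of inverse] by (simp add: mult.commute)
qed (simp_all add: diag sym)

text \<open>Rescaling with the inverse bicharacter undoes \<open>twi\<close> and exchanges the two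
  parameter matrices.\<close>

lemma twi_rels_iff: "twi x \<in> ideal_of (qgroup_rels A q) \<longleftrightarrow> x \<in> ideal_of (qgroup_rels A qhat)"
proof
  interpret I: twist "\<lambda>i j. inverse (z i j)" qhat q A by (rule twist_inverse)
  have b: "I.bq u v = inverse (bq u v)" for u v
    by (simp add: I.bq_def bq_def bic_inverse)
  have c: "I.chi w = inverse (chi w)" for w
    by (induction w) (simp_all add: b)
  have "I.twi (twi x) = x"
    by (induction x rule: word_induct) (simp_all add: twi_lin I.twi_lin c)
  then show "twi x \<in> ideal_of (qgroup_rels A q) \<Longrightarrow> x \<in> ideal_of (qgroup_rels A qhat)"
    using I.twi_rels[of "twi x"] by simp
qed (rule twi_rels)

end


section \<open>Inflated bicharacters are cocycles\<close>

lemma fd_lext_swap: "fd.lext (\<lambda>u. fd.lext (\<lambda>v. f u v) y) x = fd.lext (\<lambda>v. fd.lext (\<lambda>u. f u v) x) y"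
  unfolding fd.lext_def sum_distrib_left
  by (subst sum.swap) (intro sum.cong refl mult.left_commute)

lemma (in scaling) spl_lext: "spl w (\<lambda>a b. lext (\<lambda>v. g a b v) y) = lext (\<lambda>v. spl w (\<lambda>a b. g a b v)) y"
proof (induction w arbitrary: g)
  case (Cons x w)
  then show ?case by (cases x) (simp_all add: lext_fun_add)
qed simp

context word_bialgebra
begin

lemma bilin_field:
  assumes "\<And>x y. f (c x) (c y) = F x y" "\<And>x y z. F (x + y) z = F x z + F y z" "\<And>x y z. F z (x + y) = F z x + F z y"
    "\<And>a x y. F (sc a x) y = a * F x y" "\<And>a x y. F x (sc a y) = a * F x y"
  shows "bilin H field_alg f"
  unfolding bilin_def using assms by (auto simp: carrier_c simp flip: c_add c_sc)

lemma bilinear_formI: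
  assumes "\<And>x y. f (c x) (c y) = F x y" "\<And>x y z. F (x + y) z = F x z + F y z" "\<And>x y z. F z (x + y) = F z x + F z y"
    "\<And>a x y. F (sc a x) y = a * F x y" "\<And>a x y. F x (sc a y) = a * F x y"
  shows "bilinear_form H f"
  unfolding bilinear_form_def using assms by (auto simp: carrier_c simp flip: c_add c_sc)

lemma bilinear_formD:
  assumes "bilinear_form H f"
  shows "f (c (x + y)) (c z) = f (c x) (c z) + f (c y) (c z)" "f (c z) (c (x + y)) = f (c z) (c x) + f (c z) (c y)"
    "f (c (sc a x)) (c y) = a * f (c x) (c y)" "f (c x) (c (sc a y)) = a * f (c x) (c y)"
  using assms by (simp_all add: bilinear_form_def carrier_c c_add c_sc)

lemma trilin_H:
  assumes "\<And>x y z. f (c x) (c y) (c z) = c (F x y z)"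
    "\<And>x x' y z. F (x + x') y z = F x y z + F x' y z" "\<And>a x y z. F (sc a x) y z = sc a (F x y z)"
    "\<And>x y y' z. F x (y + y') z = F x y z + F x y' z" "\<And>a x y z. F x (sc a y) z = sc a (F x y z)"
    "\<And>x y z z'. F x y (z + z') = F x y z + F x y z'" "\<And>a x y z. F x y (sc a z) = sc a (F x y z)"
  shows "trilin H H f"
proof -
  have "bilin H H (f (c x))" "bilin H H (\<lambda>y z. f y z (c x))" for x
    by (rule bilin_H[where F = "F x"] bilin_H[where F = "\<lambda>y z. F y z x"]; simp add: assms)+
  then show ?thesis by (auto simp: trilin_def carrier_c)
qed

text \<open>Convolutions and both sides of the cocycle identity are nested Sweedler sums of a
  product of two forms, so one evaluation on words serves them all.\<close>

lemma sweedler_forms: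
  assumes S: "bilinear_form H S" and T: "bilinear_form H T"
  shows "sweedler H field_alg (\<lambda>a1 a2. sweedler H field_alg (\<lambda>b1 b2. S a1 b1 * T a2 b2) (c y)) (c x) =
    fd.lext (\<lambda>u. fd.lext (\<lambda>v. spl u (\<lambda>u1 u2. spl v (\<lambda>v1 v2.
      S (c (wrd u1)) (c (wrd v1)) * T (c (wrd u2)) (c (wrd v2))))) y) x"
proof -
  note l = bilinear_formD[OF S] bilinear_formD[OF T]
  let ?I = "\<lambda>x1 x2. fd.lext (\<lambda>v. spl v (\<lambda>v1 v2. S (c x1) (c (wrd v1)) * T (c x2) (c (wrd v2)))) y"
  have "bilin H field_alg (\<lambda>b1 b2. S (c x1) b1 * T (c x2) b2)" for x1 x2
    by (rule bilin_field[where F = "\<lambda>y1 y2. S (c x1) (c y1) * T (c x2) (c y2)"])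
      (simp_all add: l distrib_left distrib_right)
  note b1 = this
  have i: "sweedler H field_alg (\<lambda>b1 b2. S (c x1) b1 * T (c x2) b2) (c y) = ?I x1 x2" for x1 x2
    by (subst sweedler_c[OF lin_image_field b1, where F = "\<lambda>v1 v2. S (c x1) (c (wrd v1)) * T (c x2) (c (wrd v2))"]) simp_all
  have "S p r * T (c (sc a x2)) (c z) = a * (S p r * T (c x2) (c z))" for p r a x2 z
    by (simp add: l)
  then have "?I x1 (sc a x2) = a * ?I x1 x2" for a x1 x2
    by (simp only: fd.spl_scl fd.lext_fun_scl)
  then have "bilin H field_alg (\<lambda>a1 a2. sweedler H field_alg (\<lambda>b1 b2. S a1 b1 * T a2 b2) (c y))"
    by (intro bilin_field[where F = ?I])
      (simp_all add: i l distrib_left distrib_right spl_add fd.lext_fun_add fd.spl_scl fd.lext_fun_scl mult.assoc)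
  note b2 = this
  show ?thesis
    by (subst sweedler_c[OF lin_image_field b2, where F = "\<lambda>u1 u2. ?I (wrd u1) (wrd u2)"])
      (simp_all add: i fd.spl_lext)
qed

end

lemma eps_torus: "eps w = (if set w \<subseteq> torus_gens then 1 else 0)"
proof (induction w)
  case (Cons x w)
  then show ?case by (cases x) auto
qed simp

locale deform = cartan_fin q A + bichar z for q :: "'i::finite \<Rightarrow> 'i \<Rightarrow> 'k::field" and A and z :: "'i \<Rightarrow> 'i \<Rightarrow> 'k"
begin

abbreviation "QQ \<equiv> qgroup A q"

text \<open>The pullback of \<open>bic z\<close> along the projection to the group algebra of the
  root lattice. It is nonzero only on torus words, where left and right degrees agree.\<close>

definition sb :: "'i qgen list \<Rightarrow> 'i qgen list \<Rightarrow> 'k" where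
  "sb u v = eps u * eps v * bic z (ld u) (ld v)"

definition SB :: "('i qgen list \<Rightarrow>\<^sub>0 'k) \<Rightarrow> ('i qgen list \<Rightarrow>\<^sub>0 'k) \<Rightarrow> 'k" where
  "SB x y = fd.lext (\<lambda>u. fd.lext (sb u) y) x"

lemma sb_rd: "sb u v = eps u * eps v * bic z (rd u) (rd v)"
  by (auto simp: sb_def eps_torus ld_rd_torus)

lemma SB_lin: "SB (x + y) w = SB x w + SB y w" "SB (x - y) w = SB x w - SB y w" "SB (sc a x) w = a * SB x w"
  "SB w (x + y) = SB w x + SB w y" "SB w (x - y) = SB w x - SB w y" "SB w (sc a x) = a * SB w x"
  and SB_wrd: "SB (wrd u) y = fd.lext (sb u) y" "SB x (wrd v) = fd.lext (\<lambda>u. sb u v) x"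
proof -
  have r: "SB x y = fd.lext (\<lambda>v. fd.lext (\<lambda>u. sb u v) x) y" for x y
    unfolding SB_def by (rule fd_lext_swap)
  show "SB w (x + y) = SB w x + SB w y" "SB w (x - y) = SB w x - SB w y" "SB w (sc a x) = a * SB w x"
    "SB x (wrd v) = fd.lext (\<lambda>u. sb u v) x"
    by (simp_all add: r fd.lext_add fd.lext_diff fd.lext_sc)
qed (simp_all add: SB_def fd.lext_add fd.lext_diff fd.lext_sc)

text \<open>The counit weighted by a character of the degree is still multiplicative, and on a
  homogeneous relation the weight is a constant factor, so it vanishes there because the counit
  does. Used in each argument, this makes \<open>SB\<close> descend to the quotient.\<close>

lemma degree_character_ideal:
  assumes h: "\<And>a b. h (a + b) = h a * h b" and x: "x \<in> ideal_of RR"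
  shows "fd.lext (\<lambda>w. eps w * h (ld w)) x = (0 :: 'k)"
proof -
  let ?f = "\<lambda>w. eps w * h (ld w)"
  have m: "fd.lext ?f (x * y) = fd.lext ?f x * fd.lext ?f y" for x y
  proof (induction x rule: word_induct)
    case (single w)
    show ?case
      by (induction y rule: word_induct)
        (simp_all add: wrd_mult distrib_left fd.lext_add fd.lext_sc h mult_ac)
  qed (simp_all add: distrib_right fd.lext_add fd.lext_sc)
  have r: "fd.lext ?f r = 0" if "r \<in> RR" for r
  proof -
    obtain d d' where "homog r d d'" using homog_rels[OF \<open>r \<in> RR\<close>] by blast
    then have "fd.lext ?f r = fd.lext (\<lambda>w. h d * eps w) r"
      by (intro fd.lext_cong) (auto simp: homog_def)
    also have "\<dots> = 0" by (simp add: fd.lext_fun_scl eps_rels that)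
    finally show ?thesis .
  qed
  show ?thesis
    using x by (induction rule: ideal_of.induct) (simp_all add: m r fd.lext_add)
qed

lemma SB_ideal: assumes "x \<in> ideal_of RR" shows "SB x y = 0" "SB y x = 0"
proof -
  have "fd.lext (\<lambda>u. sb u v) x = 0" for v
    using degree_character_ideal[OF _ assms, of "\<lambda>d. bic z d (ld v)"]
      fd.lext_fun_scl[of "eps v" "\<lambda>u. eps u * bic z (ld u) (ld v)" x]
    by (simp add: bic_add sb_def mult_ac)
  then show "SB x y = 0"
    unfolding SB_def by (subst fd_lext_swap) (simp add: fd.lext_def)
  have "fd.lext (sb u) x = 0" for u
    using degree_character_ideal[OF _ assms, of "bic z (ld u)"]
      fd.lext_fun_scl[of "eps u" "\<lambda>v. eps v * bic z (ld u) (ld v)" x]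
    by (simp add: bic_add sb_def[abs_def] mult_ac)
  then show "SB y x = 0"
    unfolding SB_def by (simp add: fd.lext_def)
qed

definition sU :: "('i qgen list \<Rightarrow>\<^sub>0 'k) set \<Rightarrow> ('i qgen list \<Rightarrow>\<^sub>0 'k) set \<Rightarrow> 'k" where
  "sU a b = SB (U.pre a) (U.pre b)"

lemma sU_c: "sU (cU x) (cU y) = SB x y"
proof -
  have "U.pre (cU x) - x \<in> ideal_of RR" for x
    using U.pre[of "cU x"] by (simp flip: cU_eq_iff)
  then have "SB (U.pre (cU x) - x) w = 0" "SB w (U.pre (cU x) - x) = 0" for x w
    by (rule SB_ideal)+
  then show ?thesis by (simp add: sU_def SB_lin)
qed

text \<open>Convolving with the form from the left only multiplies by its value on left degrees, by
  \<open>spl_eps_left\<close> in either argument; from the right, \<open>sb_right\<close> gives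
  right degrees.\<close>

lemma sb_left: "spl u (\<lambda>u1 u2. spl v (\<lambda>v1 v2. sb u1 v1 * f u2 v2)) = bic z (ld u) (ld v) * f u v"
proof -
  have "spl v (\<lambda>v1 v2. sb u1 v1 * f u2 v2) = eps u1 * bic z (ld u1) (ld v) * f u2 v" for u1 u2
    using fd.spl_eps_left[of v "\<lambda>d. eps u1 * bic z (ld u1) d" "\<lambda>v2. f u2 v2"] by (simp add: sb_def mult_ac)
  then show ?thesis
    using fd.spl_eps_left[of u "\<lambda>d. bic z d (ld v)" "\<lambda>u2. f u2 v"] by simp
qed

lemma sb_right: "spl u (\<lambda>u1 u2. spl v (\<lambda>v1 v2. f u1 v1 * sb u2 v2)) = bic z (rd u) (rd v) * f u v"
proof -
  have "spl v (\<lambda>v1 v2. f u1 v1 * sb u2 v2) = eps u2 * bic z (rd u2) (rd v) * f u1 v" for u1 u2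
    using fd.spl_eps_right[of v "\<lambda>d. eps u2 * bic z (rd u2) d" "\<lambda>v1. f u1 v1"] by (simp add: sb_rd mult_ac)
  then show ?thesis
    using fd.spl_eps_right[of u "\<lambda>d. bic z d (rd v)" "\<lambda>u1. f u1 v"] by simp
qed

lemma bilinear_SB: "(\<And>x y. s (cU x) (cU y) = SB x y) \<Longrightarrow> bilinear_form QQ s"
  by (rule Q.bilinear_formI[where F = SB]) (simp_all add: SB_lin)

lemma deform_inverse: "deform q A (\<lambda>i j. inverse (z i j))"
  by unfold_locales simp

lemma convolution_inverse_SB:
  assumes s: "\<And>x y. s (cU x) (cU y) = SB x y"
  shows "\<exists>t. convolution_inverse QQ s t"
proof -
  interpret I: deform q A "\<lambda>i j. inverse (z i j)" by (rule deform_inverse)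
  have Isb: "I.sb u v = eps u * eps v * inverse (bic z (ld u) (ld v))" for u v
    by (simp add: I.sb_def bic_inverse)
  have cancel: "bic z a b * (k * inverse (bic z a b)) = k" "inverse (bic z a b) * (k * bic z a b) = k" for a b k
    by simp_all
  note b = bilinear_SB[OF s] I.bilinear_SB[OF I.sU_c]
  have e: "fd.lext (\<lambda>u. fd.lext (\<lambda>v. eps u * eps v) y) x = counit QQ (cU x) * counit QQ (cU y)" for x y
    unfolding Q.counit_c fd.lext_fun_scl using fd.lext_fun_scl[of "fd.lext eps y" eps x] by (simp add: mult.commute)
  have "convolution QQ s I.sU (cU x) (cU y) = counit QQ (cU x) * counit QQ (cU y)" for x y
    unfolding convolution_def Q.sweedler_forms[OF b] e[symmetric]
    by (simp add: s I.sU_c SB_wrd I.SB_wrd sb_left) (simp only: Isb cancel)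
  moreover have "convolution QQ I.sU s (cU x) (cU y) = counit QQ (cU x) * counit QQ (cU y)" for x y
    unfolding convolution_def Q.sweedler_forms[OF b(2,1)] e[symmetric]
    by (simp add: s I.sU_c SB_wrd I.SB_wrd I.sb_left) (simp only: sb_def bic_inverse cancel)
  ultimately have "convolution_inverse QQ s I.sU"
    unfolding convolution_inverse_def using b(2) by (auto simp: U.carrier_c)
  then show ?thesis by blast
qed

text \<open>The deformed product refers to an arbitrarily chosen convolution inverse;
  \<open>sb_right\<close> turns the identity \<open>t * s = \<epsilon> \<otimes> \<epsilon>\<close>
  into an equation that can be solved for \<open>t\<close> on words.\<close>

lemma convolution_inverse_wrd:
  assumes s: "\<And>x y. s (cU x) (cU y) = SB x y" and t: "convolution_inverse QQ s t"
  shows "t (cU (wrd u)) (cU (wrd v)) = eps u * eps v * inverse (bic z (rd u) (rd v))"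
proof -
  have b: "bilinear_form QQ t" and c: "convolution QQ t s (cU (wrd u)) (cU (wrd v)) = counit QQ (cU (wrd u)) * counit QQ (cU (wrd v))"
    using t by (auto simp: convolution_inverse_def U.carrier_c)
  have "bic z (rd u) (rd v) * t (cU (wrd u)) (cU (wrd v)) = eps u * eps v"
    using c unfolding convolution_def Q.sweedler_forms[OF b bilinear_SB[OF s]]
    by (simp add: s SB_wrd sb_right Q.counit_c del: qgroup_simps)
  then show ?thesis by (simp add: field_simps)
qed

lemma cocycle_SB:
  assumes s: "\<And>x y. s (cU x) (cU y) = SB x y"
  shows "hopf_2_cocycle QQ s"
proof (intro hopf_2_cocycle.intro hopf_2_cocycle_axioms.intro)
  show "hopf_algebra QQ" by (rule Q.hopf_algebra_H)
  note b = bilinear_SB[OF s]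
  show "bilinear_form QQ s" by (rule b)
  show "\<exists>t. convolution_inverse QQ s t" using s by (rule convolution_inverse_SB)
  fix a b' c' assume "a \<in> carrier QQ"
  then obtain x where a: "a = cU x" by (auto simp: U.carrier_c)
  show "s a \<one>\<^bsub>QQ\<^esub> = counit QQ a \<and> s \<one>\<^bsub>QQ\<^esub> a = counit QQ a"
    unfolding a Q.c_one[symmetric] s sgl_Nil[symmetric] SB_wrd by (simp add: Q.counit_c sb_def[abs_def] del: qgroup_simps)
  assume "b' \<in> carrier QQ" "c' \<in> carrier QQ"
  then obtain y w where b': "b' = cU y" and c': "c' = cU w" by (auto simp: U.carrier_c)
  have 1: "bilinear_form QQ (\<lambda>a2 b2. s (a2 \<otimes>\<^bsub>QQ\<^esub> b2) (cU w))"
    by (rule Q.bilinear_formI[where F = "\<lambda>x y. SB (x * y) w"])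
      (simp_all only: Q.c_mult[symmetric] s distrib_left distrib_right SB_lin sc_mult_left sc_mult_right)
  have 2: "bilinear_form QQ (\<lambda>b2 c2. s (cU x) (b2 \<otimes>\<^bsub>QQ\<^esub> c2))"
    by (rule Q.bilinear_formI[where F = "\<lambda>y w. SB x (y * w)"])
      (simp_all only: Q.c_mult[symmetric] s distrib_left distrib_right SB_lin sc_mult_left sc_mult_right)
  have "sweedler QQ field_alg (\<lambda>a1 a2. sweedler QQ field_alg (\<lambda>b1 b2. s a1 b1 * s (a2 \<otimes>\<^bsub>QQ\<^esub> b2) c') b') a =
      fd.lext (\<lambda>u. fd.lext (\<lambda>v. bic z (ld u) (ld v) * SB (wrd u * wrd v) w) y) x"
    unfolding a b' c' Q.sweedler_forms[OF b 1] Q.c_mult[symmetric] s by (simp add: SB_wrd(1) sb_left)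
  also have "\<dots> = fd.lext (\<lambda>u. fd.lext (\<lambda>v. fd.lext (\<lambda>k. bic z (ld u) (ld v) * sb (u @ v) k) w) y) x"
    by (simp add: wrd_mult SB_wrd(1) fd.lext_fun_scl)
  \<comment> \<open>The bicharacter identity
    \<open>z(u, v) z(u + v, k) = z(v, k) z(u, v + k)\<close> on degrees; what follows reorders the
    sums and folds them back.\<close>
  also have "\<dots> = fd.lext (\<lambda>u. fd.lext (\<lambda>v. fd.lext (\<lambda>k. bic z (ld v) (ld k) * sb u (v @ k)) w) y) x"
    by (simp add: sb_def bic_add mult_ac)
  also have "\<dots> = fd.lext (\<lambda>v. fd.lext (\<lambda>u. fd.lext (\<lambda>k. bic z (ld v) (ld k) * sb u (v @ k)) w) x) y"
    by (rule fd_lext_swap)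
  also have "\<dots> = fd.lext (\<lambda>v. fd.lext (\<lambda>k. fd.lext (\<lambda>u. bic z (ld v) (ld k) * sb u (v @ k)) x) w) y"
    by (subst fd_lext_swap) (rule refl)
  also have "\<dots> = fd.lext (\<lambda>v. fd.lext (\<lambda>k. bic z (ld v) (ld k) * SB x (wrd v * wrd k)) w) y"
    by (simp add: wrd_mult SB_wrd(2) fd.lext_fun_scl)
  also have "\<dots> = sweedler QQ field_alg (\<lambda>b1 b2. sweedler QQ field_alg (\<lambda>c1 c2. s b1 c1 * s a (b2 \<otimes>\<^bsub>QQ\<^esub> c2)) c') b'"
    unfolding a b' c' Q.sweedler_forms[OF b 2] Q.c_mult[symmetric] s by (simp add: SB_wrd(1) sb_left)
  finally show "sweedler QQ field_alg (\<lambda>a1 a2. sweedler QQ field_alg (\<lambda>b1 b2. s a1 b1 * s (a2 \<otimes>\<^bsub>QQ\<^esub> b2) c') b') a =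
      sweedler QQ field_alg (\<lambda>b1 b2. sweedler QQ field_alg (\<lambda>c1 c2. s b1 c1 * s a (b2 \<otimes>\<^bsub>QQ\<^esub> c2)) c') b'" .
qed

section \<open>The deformed product\<close>

lemma deformed_mult_c:
  assumes s: "\<And>x y. s (cU x) (cU y) = SB x y"
  shows "deformed_mult QQ s (cU x) (cU y) = cU (pm.lext (\<lambda>u. pm.lext (\<lambda>v. sc (bq u v) (wrd (u @ v))) y) x)"
proof -
  define t where "t = (SOME t. convolution_inverse QQ s t)"
  have t: "convolution_inverse QQ s t"
    unfolding t_def by (rule someI_ex[OF convolution_inverse_SB[OF s]])
  define tb where "tb u v = eps u * eps v * inverse (bic z (rd u) (rd v))" for u v :: "'i qgen list"
  have tw: "t (cU (wrd u)) (cU (wrd v)) = tb u v" for u v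
    unfolding tb_def by (rule convolution_inverse_wrd[OF s t])
  have bt: "bilinear_form QQ t" using t by (simp add: convolution_inverse_def)
  note tl = Q.bilinear_formD[OF bt]
  \<comment> \<open>A lift of the summand that is linear in all six arguments; this multilinearity
    licenses the nested evaluations below.\<close>
  define F where "F x1 x2 x3 v1 v2 v3 = sc (SB x1 v1 * t (cU x3) (cU v3)) (x2 * v2)"
    for x1 x2 x3 v1 v2 v3 :: "'i qgen list \<Rightarrow>\<^sub>0 'k"
  have Fl: "F (x1 + x1') x2 x3 v1 v2 v3 = F x1 x2 x3 v1 v2 v3 + F x1' x2 x3 v1 v2 v3"
    "F x1 (x2 + x2') x3 v1 v2 v3 = F x1 x2 x3 v1 v2 v3 + F x1 x2' x3 v1 v2 v3"
    "F x1 x2 (x3 + x3') v1 v2 v3 = F x1 x2 x3 v1 v2 v3 + F x1 x2 x3' v1 v2 v3"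
    "F x1 x2 x3 (v1 + v1') v2 v3 = F x1 x2 x3 v1 v2 v3 + F x1 x2 x3 v1' v2 v3"
    "F x1 x2 x3 v1 (v2 + v2') v3 = F x1 x2 x3 v1 v2 v3 + F x1 x2 x3 v1 v2' v3"
    "F x1 x2 x3 v1 v2 (v3 + v3') = F x1 x2 x3 v1 v2 v3 + F x1 x2 x3 v1 v2 v3'"
    for x1 x2 x3 v1 v2 v3 x1' x2' x3' v1' v2' v3'
    by (simp_all add: F_def SB_lin tl distrib_left distrib_right pm.scl_left pm.scl_right)
  have Fs: "F (sc a x1) x2 x3 v1 v2 v3 = sc a (F x1 x2 x3 v1 v2 v3)"
    "F x1 (sc a x2) x3 v1 v2 v3 = sc a (F x1 x2 x3 v1 v2 v3)"
    "F x1 x2 (sc a x3) v1 v2 v3 = sc a (F x1 x2 x3 v1 v2 v3)"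
    "F x1 x2 x3 (sc a v1) v2 v3 = sc a (F x1 x2 x3 v1 v2 v3)"
    "F x1 x2 x3 v1 (sc a v2) v3 = sc a (F x1 x2 x3 v1 v2 v3)"
    "F x1 x2 x3 v1 v2 (sc a v3) = sc a (F x1 x2 x3 v1 v2 v3)" for x1 x2 x3 v1 v2 v3 a
    by (simp_all add: F_def SB_lin tl mult_ac flip: pm.scl_mult)
  have F: "(s (cU x1) (cU v1) * t (cU x3) (cU v3)) \<odot>\<^bsub>QQ\<^esub> (cU x2 \<otimes>\<^bsub>QQ\<^esub> cU v2) = cU (F x1 x2 x3 v1 v2 v3)"
    for x1 x2 x3 v1 v2 v3
    by (simp only: F_def s Q.c_sc Q.c_mult)
  have 1: "trilin QQ QQ (\<lambda>b1 b2 b3. (s (cU x1) b1 * t (cU x3) b3) \<odot>\<^bsub>QQ\<^esub> (cU x2 \<otimes>\<^bsub>QQ\<^esub> b2))" for x1 x2 x3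
    by (rule Q.trilin_H[where F = "F x1 x2 x3"]) (simp_all only: F Fl Fs)
  define G where "G x1 x2 x3 = pm.lext (\<lambda>v. spl v (\<lambda>v' v3. spl v' (\<lambda>v1 v2. F x1 x2 x3 (wrd v1) (wrd v2) (wrd v3)))) y" for x1 x2 x3
  have G: "sweedler3 QQ QQ (\<lambda>b1 b2 b3. (s (cU x1) b1 * t (cU x3) b3) \<odot>\<^bsub>QQ\<^esub> (cU x2 \<otimes>\<^bsub>QQ\<^esub> b2)) (cU y) = cU (G x1 x2 x3)"
    for x1 x2 x3
    unfolding sweedler3_def G_def
    by (rule Q.sweedler3_c(1)[OF Q.lin_image_H 1]) (simp only: F UNIV_I simp_thms)
  have 2: "trilin QQ QQ (\<lambda>a1 a2 a3. sweedler3 QQ QQ (\<lambda>b1 b2 b3. (s a1 b1 * t a3 b3) \<odot>\<^bsub>QQ\<^esub> (a2 \<otimes>\<^bsub>QQ\<^esub> b2)) (cU y))"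
    by (rule Q.trilin_H[where F = G])
      (simp_all only: G, simp_all only: G_def Fl Fs spl_add pm.lext_fun_add pm.spl_scl pm.lext_fun_scl)
  have D: "deformed_mult QQ s (cU x) (cU y) =
      cU (pm.lext (\<lambda>u. spl u (\<lambda>u' u3. spl u' (\<lambda>u1 u2. G (wrd u1) (wrd u2) (wrd u3)))) x)"
    unfolding deformed_mult_def t_def[symmetric] Let_def
    by (subst sweedler3_def, rule Q.sweedler3_c(1)[OF Q.lin_image_H 2]) (simp only: G UNIV_I simp_thms)
  \<comment> \<open>The first of four collapses, two for each argument: the form \<open>s\<close>
    removes the first leg and leaves \<open>bic z\<close> on left degrees, its inverse removes the
    third leg and leaves the inverse value on right degrees.\<close>
  have v1: "spl v' (\<lambda>v1 v2. F (wrd u1) (wrd u2) (wrd u3) (wrd v1) (wrd v2) (wrd v3)) =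
      sc (eps v3 * (eps u3 * inverse (bic z (rd u3) (rd v3)))) (sc (eps u1 * bic z (ld u1) (ld v')) (wrd (u2 @ v')))"
    for u1 u2 u3 v' v3
    using pm.spl_eps_left[of v' "\<lambda>d. eps u1 * bic z (ld u1) d * tb u3 v3" "\<lambda>v2. wrd (u2 @ v2)"]
    by (simp add: F_def SB_wrd(1) tw sb_def tb_def mult_ac wrd_mult del: map_single flip: pm.scl_mult)
  have v2: "G (wrd u1) (wrd u2) (wrd u3) =
      pm.lext (\<lambda>v. sc (eps u3 * inverse (bic z (rd u3) (rd v))) (sc (eps u1 * bic z (ld u1) (ld v)) (wrd (u2 @ v)))) y" for u1 u2 u3
    unfolding G_def v1
    by (simp only: pm.spl_eps_right[of _ "\<lambda>d. eps u3 * inverse (bic z (rd u3) d)" "\<lambda>v. sc (eps u1 * bic z (ld u1) (ld v)) (wrd (u2 @ v))"])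
  have u1: "spl u' (\<lambda>u1 u2. G (wrd u1) (wrd u2) (wrd u3)) =
     pm.lext (\<lambda>v. sc (eps u3 * inverse (bic z (rd u3) (rd v))) (sc (bic z (ld u') (ld v)) (wrd (u' @ v)))) y" for u' u3
    unfolding v2 pm.spl_lext pm.spl_scl
    by (simp only: pm.spl_eps_left[of u' "\<lambda>d. bic z d (ld v)" "\<lambda>u2. wrd (u2 @ v)" for v])
  have "spl u (\<lambda>u' u3. spl u' (\<lambda>u1 u2. G (wrd u1) (wrd u2) (wrd u3))) =
     pm.lext (\<lambda>v. sc (inverse (bic z (rd u) (rd v))) (sc (bic z (ld u) (ld v)) (wrd (u @ v)))) y" for u
    unfolding u1 pm.spl_lext
    by (simp only: pm.spl_eps_right[of u "\<lambda>d. inverse (bic z d (rd v))" "\<lambda>u'. sc (bic z (ld u') (ld v)) (wrd (u' @ v))" for v])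
  then show ?thesis
    unfolding D by (simp add: bq_def mult.commute del: map_single flip: pm.scl_mult)
qed

end


section \<open>Rescaling and the coproduct; the deformed Hopf algebra\<close>

context bichar
begin

lemma gspl_split_cong:
  assumes "\<And>a b. ld a = gl x \<Longrightarrow> rd b = gr x \<Longrightarrow> rd a = ld b \<Longrightarrow> chi a = 1 \<Longrightarrow> chi b = 1 \<Longrightarrow> f a b = g a b"
  shows "gspl x f = gspl x g"
  by (cases x) (simp_all add: assms)

text \<open>In each splitting the right degree of the left leg equals the left degree of the right
  leg. The middle contributions therefore cancel in \<open>chi u * chi v\<close>, and rescaling is
  compatible with the coproduct.\<close>

lemma spl_split_cong:
  assumes "\<And>u v. ld u = ld w \<Longrightarrow> rd v = rd w \<Longrightarrow> rd u = ld v \<Longrightarrow> chi u * chi v = chi w \<Longrightarrow> f u v = g u v"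
  shows "spl w f = spl w g"
  using assms
proof (induction w arbitrary: f g)
  case (Cons x w)
  show ?case
    unfolding spl.simps
  proof (intro gspl_split_cong Cons.IH Cons.prems)
    fix a b u v
    assume h: "ld a = gl x" "rd b = gr x" "rd a = ld b" "chi a = 1" "chi b = 1"
      "ld u = ld w" "rd v = rd w" "rd u = ld v" "chi u * chi v = chi w"
    show "ld (a @ u) = ld (x # w)" "rd (b @ v) = rd (x # w)" "rd (a @ u) = ld (b @ v)"
      using h by simp_all
    have "chi (a @ u) * chi (b @ v) = (bq a u * bq b v) * (chi u * chi v)"
      by (simp add: chi_append h mult_ac)
    also have "bq a u * bq b v = bq [x] w"
      by (simp add: bq_def h mult.commute)
    finally show "chi (a @ u) * chi (b @ v) = chi (x # w)"
      by (simp add: h)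
  qed
qed simp

lemma chi_torus: "set w \<subseteq> torus_gens \<Longrightarrow> chi w = 1"
  by (induction w) (simp_all add: bq_torus)

lemma twi_surj: "\<exists>y. twi y = x"
proof
  show "twi (pm.lext (\<lambda>w. sgl w (inverse (chi w))) x) = x"
    by (induction x rule: word_induct) (simp_all add: twi_lin pm.lext_add pm.lext_sc)
qed

lemma lext_twi: "pm.lext f (twi x) = pm.lext (\<lambda>w. sc (chi w) (f w)) x" "fd.lext g (twi x) = fd.lext (\<lambda>w. chi w * g w) x"
  by (induction x rule: word_induct) (simp_all add: twi_lin pm.lext_add pm.lext_sc fd.lext_add fd.lext_sc)

lemma twi_mult: "pm.lext (\<lambda>u. pm.lext (\<lambda>v. sc (bq u v) (wrd (u @ v))) (twi y)) (twi x) = twi (x * y)"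
proof (induction x rule: word_induct)
  case (single w)
  show ?case
    by (induction y rule: word_induct)
      (simp_all add: twi_lin pm.lext_add pm.lext_sc distrib_left pm.scl_right wrd_mult chi_append mult_ac sc_left_commute)
qed (simp_all add: twi_lin pm.lext_add pm.lext_sc distrib_right)

end

locale deform_twist = deform q A z + twist z q qhat A
  for q :: "'i::finite \<Rightarrow> 'i \<Rightarrow> 'k::field" and A and z qhat :: "'i \<Rightarrow> 'i \<Rightarrow> 'k"
begin

sublocale Hat: cartan_fin qhat A
  by unfold_locales (use A_nonpos q_diag q_cartan in \<open>auto simp: diag sym\<close>)

lemma tp_slots:
  "tp UA 2 (sgl [cU (twi (wrd u)), cU (twi (wrd v))] 1) = tp UA 2 (sgl [cU (wrd u), cU (wrd v)] (chi u * chi v))"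
proof -
  have t: "twi (wrd u) = sc (chi u) (wrd u)" for u by simp
  have "tp UA 2 (sgl ([] @ cU (sc (chi u) (wrd u)) # [b]) r) = tp UA 2 (sgl ([] @ cU (wrd u) # [b]) (r * chi u))"
    if "b \<in> carrier UA" for b r
    unfolding U.c_sc by (rule U.alg.tp_slot_smult) (use that in \<open>auto simp: U.carrier_c\<close>)
  moreover have "tp UA 2 (sgl ([a] @ cU (sc (chi v) (wrd v)) # []) r) = tp UA 2 (sgl ([a] @ cU (wrd v) # []) (r * chi v))"
    if "a \<in> carrier UA" for a r
    unfolding U.c_sc by (rule U.alg.tp_slot_smult) (use that in \<open>auto simp: U.carrier_c\<close>)
  ultimately show ?thesis
    unfolding t by (simp add: U.carrier_c mult.commute[of "chi v" "chi u"] del: map_single)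
qed

lemma comult_twist:
  "tp UA 2 (pm.lext (\<lambda>w. spl w (\<lambda>u v. sgl [cU (wrd u), cU (wrd v)] 1)) (twi x)) =
   tp UA 2 (pm.lext (\<lambda>w. spl w (\<lambda>u v. sgl [cU (twi (wrd u)), cU (twi (wrd v))] 1)) x)"
proof -
  interpret T: alg_image sc "tensor_power UA 2" "tuples UA 2" "tp UA 2" "mmul (tuple_monoid UA 2)" "sgl (replicate 2 \<one>\<^bsub>UA\<^esub>) 1"
    by (rule U.tensor_image_H)
  let ?F = "\<lambda>w. spl w (\<lambda>u v. sgl [cU (wrd u), cU (wrd v)] (chi u * chi v))"
  let ?G = "\<lambda>w. spl w (\<lambda>u v. sgl [cU (twi (wrd u)), cU (twi (wrd v))] 1)"
  have 1: "sc (chi w) (spl w (\<lambda>u v. sgl [cU (wrd u), cU (wrd v)] 1)) = ?F w" for w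
    unfolding pm.spl_scl[symmetric] by (rule spl_split_cong) simp
  have 2: "?F w \<in> tuples UA 2 \<and> ?G w \<in> tuples UA 2 \<and> tp UA 2 (?F w) = tp UA 2 (?G w)" for w
    by (rule T.p_spl_cong) (auto simp: U.carrier_c tp_slots simp del: twi_single)
  show ?thesis
    unfolding lext_twi 1 by (rule T.p_lext_cong) (rule 2)
qed

text \<open>\<open>B\<close> is constrained only outside its antipode, so this applies both before
  and after the antipode of the deformation has been chosen.\<close>

lemma word_bialgebra_deformed:
  fixes B :: "('k, _, 'm) hopf_scheme"
  assumes s: "\<And>x y. s (cU x) (cU y) = SB x y"
    and B: "carrier B = carrier UA" "ring.add B = ring.add UA" "module.smult B = module.smult UA"
      "ring.zero B = ring.zero UA" "one B = one UA"
      "monoid.mult B = deformed_mult QQ s" "comult B = comult QQ" "counit B = counit QQ"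
  shows "word_bialgebra B (\<lambda>x. cU (twi x))"
proof
  have tp: "tp B 2 = tp UA 2" by (rule tp_cong) (simp_all add: B)
  show "carrier B = range (\<lambda>x. cU (twi x))"
    unfolding B U.carrier_c using twi_surj by (metis (no_types, lifting) rangeI subsetI subset_antisym image_subset_iff)
  show "cU (twi (x + y)) = cU (twi x) \<oplus>\<^bsub>B\<^esub> cU (twi y)" "cU (twi (sc a x)) = a \<odot>\<^bsub>B\<^esub> cU (twi x)" "cU (twi 0) = \<zero>\<^bsub>B\<^esub>" for x y a
    by (simp_all only: B twi_lin U.c_add U.c_sc U.c_zero)
  show "cU (twi (x * y)) = cU (twi x) \<otimes>\<^bsub>B\<^esub> cU (twi y)" for x y
    unfolding B deformed_mult_c[OF s] twi_mult ..
  have t: "twi (wrd w) = wrd w" if "set w \<subseteq> torus_gens" for w using that by (simp add: chi_torus)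
  have t1: "twi 1 = 1" using t[of "[]"] by simp
  show "cU (twi 1) = \<one>\<^bsub>B\<^esub>" by (simp add: t1 B U.c_one)
  show "cU (twi (wrd [Om i, OmInv i])) = cU (twi 1)" "cU (twi (wrd [OmInv i, Om i])) = cU (twi 1)"
    "cU (twi (wrd [Om' i, OmInv' i])) = cU (twi 1)" "cU (twi (wrd [OmInv' i, Om' i])) = cU (twi 1)" for i
    by (subst t; simp add: t1 U.c_inv)+
  show "comult B (cU (twi x)) = tp B 2 (pm.lext (\<lambda>w. spl w (\<lambda>u v. sgl [cU (twi (wrd u)), cU (twi (wrd v))] 1)) x)" for x
    unfolding B tp Q.comult_c tp_qgroup by (rule comult_twist)
  show "counit B (cU (twi x)) = fd.lext eps x" for x
  proof -
    have "(\<lambda>w. chi w * eps w) = (eps :: _ \<Rightarrow> 'k)" by (rule ext) (simp add: eps_torus chi_torus)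
    then show ?thesis unfolding B Q.counit_c lext_twi by simp
  qed
  \<comment> \<open>The kernel of the map is the ideal of the relations for \<open>qhat\<close>,
    which the antipode of the free algebra preserves.\<close>
  show "cU (twi (anti x)) = \<zero>\<^bsub>B\<^esub>" if "cU (twi x) = \<zero>\<^bsub>B\<^esub>" for x
    using that Hat.anti_ideal[of x] by (simp add: B cU_zero_iff twi_rels_iff)
qed

lemma deformation_iso:
  assumes s: "\<And>x y. s (cU x) (cU y) = SB x y"
  shows "hopf_isomorphic (qgroup A qhat) (cocycle_deformation QQ s)"
proof -
  define B0 where "B0 = QQ\<lparr>monoid.mult := deformed_mult QQ s\<rparr>"
  define B where "B = B0\<lparr>antipode := (SOME S. is_antipode B0 S)\<rparr>"
  have B: "cocycle_deformation QQ s = B" by (simp add: cocycle_deformation_def B_def B0_def Let_def)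
  interpret B0: word_bialgebra B0 "\<lambda>x. cU (twi x)"
    by (rule word_bialgebra_deformed[OF s]) (simp_all add: B0_def)
  interpret B: word_bialgebra B "\<lambda>x. cU (twi x)"
    by (rule word_bialgebra_deformed[OF s]) (simp_all add: B_def B0_def)
  \<comment> \<open>The antipode is chosen for the record \<open>B0\<close>; both records are
    presented by the same words, so uniqueness carries it over to \<open>B\<close>.\<close>
  have "is_antipode B0 (antipode B)"
    using someI_ex[OF B0.ex_antipode] by (simp add: B_def)
  then have "is_antipode B (antipode B)"
    by (intro B.is_antipode_anti B0.antipode_unique)
  then have "word_hopf B (\<lambda>x. cU (twi x))"
    by unfold_locales
  then show ?thesis
    unfolding B
    by (rule word_hopf_iso[OF Hat.Q.word_hopf_axioms])
      (simp add: B_def B0_def Hat.cU_zero_iff cU_zero_iff twi_rels_iff)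
qed

end


section \<open>Inflations and balanced bicharacters\<close>

abbreviation "neg_gens \<equiv> range Fgen \<union> range Om' \<union> range OmInv'"
abbreviation "pos_gens \<equiv> range Egen \<union> range Om \<union> range OmInv"

lemma Units_field: "Units (field_alg :: ('k::field, 'k) module) = - {0}"
proof -
  have "\<exists>y. y * x = 1 \<and> x * y = 1" if "x \<noteq> 0" for x :: 'k using that by (intro exI[of _ "inverse x"]) simp
  then show ?thesis by (auto simp: Units_def)
qed

section \<open>Spanning by triangular words\<close>

context cartan_fin
begin

text \<open>Elements congruent to combinations of products of a negative and a positive word.
  Closure under \<open>equiv\<close> lets the inductions work with representatives; that this is
  everything allows bilinear forms to be compared on triangular words.\<close>

inductive_set tri :: "('i qgen list \<Rightarrow>\<^sub>0 'k) set" where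
  word: "set u \<subseteq> neg_gens \<Longrightarrow> set v \<subseteq> pos_gens \<Longrightarrow> wrd (u @ v) \<in> tri"
| add: "x \<in> tri \<Longrightarrow> y \<in> tri \<Longrightarrow> x + y \<in> tri"
| scale: "x \<in> tri \<Longrightarrow> sc a x \<in> tri"
| equiv: "x \<in> tri \<Longrightarrow> cU x = cU y \<Longrightarrow> y \<in> tri"

lemma tri_mult:
  assumes "\<And>u v. set u \<subseteq> neg_gens \<Longrightarrow> set v \<subseteq> pos_gens \<Longrightarrow> wrd [g] * wrd (u @ v) \<in> tri" and "x \<in> tri"
  shows "wrd [g] * x \<in> tri"
  using assms(2)
proof induction
  case (word u v)
  then show ?case by (rule assms(1))
next
  case (equiv x y)
  then show ?case by (intro tri.equiv[OF equiv.IH]) (simp add: U.c_mult)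
qed (auto simp: distrib_left intro: tri.add tri.scale)

lemma tri_neg:
  assumes "g \<in> neg_gens" "x \<in> tri"
  shows "wrd [g] * x \<in> tri"
proof (rule tri_mult)
  show "wrd [g] * wrd (u @ v) \<in> tri" if "set u \<subseteq> neg_gens" "set v \<subseteq> pos_gens" for u v
    using tri.word[of "g # u" v] assms that by (simp add: wrd_mult)
qed fact

lemma tri_torus_pos:
  assumes "g = Om i \<or> g = OmInv i" "x \<in> tri"
  shows "wrd [g] * x \<in> tri"
proof (rule tri_mult)
  fix u v :: "'i qgen list"
  assume uv: "set u \<subseteq> neg_gens" "set v \<subseteq> pos_gens"
  have g: "g \<in> torus_gens" "g \<in> pos_gens" using assms by (auto simp: torus_gens_def)
  have "wrd [g] * wrd (u @ v) = wrd [g] * wrd u * wrd v" by (simp add: wrd_mult)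
  also have "\<dots> \<doteq> sc (tww g u) (wrd u * wrd [g]) * wrd v"
    by (rule F.cg_mul_right, rule torus_comm_word) (rule g)
  also have "\<dots> = sc (tww g u) (wrd (u @ (g # v)))" by (simp add: wrd_mult del: map_single)
  finally have "cU (wrd [g] * wrd (u @ v)) = cU (sc (tww g u) (wrd (u @ (g # v))))" by (rule cU_eqv)
  moreover have "sc (tww g u) (wrd (u @ (g # v))) \<in> tri"
    using uv g by (intro tri.scale tri.word) auto
  ultimately show "wrd [g] * wrd (u @ v) \<in> tri" by (metis tri.equiv)
qed fact

lemma tri_diff: "x \<in> tri \<Longrightarrow> y \<in> tri \<Longrightarrow> x - y \<in> tri"
  using tri.add[of x "sc (-1) y"] tri.scale[of y "-1"] by (simp add: pm.scl_minus)

text \<open>Moving \<open>e\<^sub>i\<close> past a leading \<open>f\<^sub>i\<close> leaves an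
  \<open>\<omega>\<^sub>i\<close> that has to be pushed through the negative word to the positive
  side, and an \<open>\<omega>'\<^sub>i\<close> that is already negative.\<close>

lemma tri_E:
  assumes "x \<in> tri"
  shows "wrd [Egen i] * x \<in> tri"
proof (rule tri_mult)
  fix u v :: "'i qgen list"
  assume "set u \<subseteq> neg_gens" and v: "set v \<subseteq> pos_gens"
  then show "wrd [Egen i] * wrd (u @ v) \<in> tri"
  proof (induction u)
    case Nil
    then show ?case using tri.word[of "[]" "Egen i # v"] by (simp add: wrd_mult)
  next
    case (Cons g u)
    have gn: "g \<in> neg_gens" and un: "set u \<subseteq> neg_gens" using Cons.prems(1) by (simp_all only: list.set insert_subset)
    have IH: "wrd [Egen i] * wrd (u @ v) \<in> tri" by (rule Cons.IH[OF un v])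
    have w: "wrd (u @ v) \<in> tri" by (rule tri.word[OF un v])
    have e: "wrd [Egen i] * wrd ((g # u) @ v) = wrd [Egen i] * wrd [g] * wrd (u @ v)" by (simp add: wrd_mult)
    have g: "wrd [g] * (wrd [Egen i] * wrd (u @ v)) \<in> tri" by (rule tri_neg[OF gn IH])
    consider j where "g = Fgen j" | "g \<in> torus_gens" using Cons.prems by (auto simp: torus_gens_def)
    then show ?case
    proof cases
      case 1
      let ?k = "if i = j then sc (kap i) (wrd [Om i] - wrd [Om' i]) else 0"
      have "cU (wrd [Egen i] * wrd [g] * wrd (u @ v)) = cU ((wrd [g] * wrd [Egen i] + ?k) * wrd (u @ v))"
        unfolding 1 by (rule cU_eqv, rule F.cg_mul_right, rule ef_comm)
      moreover have "?k * wrd (u @ v) \<in> tri"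
        using tri.scale[OF w, of 0] tri_torus_pos[of "Om i" i, OF _ w] tri_neg[of "Om' i", OF _ w]
        by (auto simp: left_diff_distrib intro!: tri.scale tri_diff)
      then have "(wrd [g] * wrd [Egen i] + ?k) * wrd (u @ v) \<in> tri"
        using g by (simp only: distrib_right mult.assoc) (rule tri.add)
      ultimately show ?thesis unfolding e by (metis tri.equiv)
    next
      case 2
      have "cU (wrd [Egen i] * wrd [g] * wrd (u @ v)) = cU (sc (inverse (tw q g (Egen i))) (wrd [g] * wrd [Egen i]) * wrd (u @ v))"
        by (rule cU_eqv, rule F.cg_mul_right, rule torus_comm') (rule 2)
      moreover have "sc (inverse (tw q g (Egen i))) (wrd [g] * wrd [Egen i]) * wrd (u @ v) \<in> tri"
        using tri.scale[OF g] by (simp add: mult.assoc del: map_single)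
      ultimately show ?thesis unfolding e by (metis tri.equiv)
    qed
  qed
qed fact

lemma tri_all: "x \<in> tri"
proof (induction x rule: word_induct)
  case (single w)
  show ?case
  proof (induction w)
    case Nil
    show ?case using tri.word[of "[]" "[]"] by simp
  next
    case (Cons g w)
    have "wrd (g # w) = (wrd [g] * wrd w :: _ \<Rightarrow>\<^sub>0 'k)" by (simp add: wrd_mult)
    moreover have "wrd [g] * wrd w \<in> tri"
      using tri_E[OF Cons] tri_torus_pos[OF _ Cons] tri_neg[OF _ Cons] by (cases g) auto
    ultimately show ?case by (simp only:)
  qed
qed (auto intro: tri.add tri.scale)

lemma triangular_word_graded:
  assumes u: "set u \<subseteq> neg_gens" and v: "set v \<subseteq> pos_gens" and uv: "\<not> set (u @ v) \<subseteq> torus_gens"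
  shows "\<exists>k\<ge>1. cU (wrd (u @ v)) \<in> graded_part A q k"
proof (intro exI conjI)
  let ?\<alpha> = "\<lambda>i. count_list u (Fgen i)" and ?\<beta> = "\<lambda>i. count_list v (Egen i)"
  have "(\<exists>i. Fgen i \<in> set u) \<or> (\<exists>i. Egen i \<in> set v)"
    using u v uv by (auto simp: torus_gens_def)
  then obtain i where "?\<alpha> i + ?\<beta> i \<noteq> 0" by (auto simp: count_list_0_iff)
  moreover have "?\<alpha> i \<le> (\<Sum>i\<in>UNIV. ?\<alpha> i)" "?\<beta> i \<le> (\<Sum>i\<in>UNIV. ?\<beta> i)"
    by (rule member_le_sum; simp)+
  ultimately show "1 \<le> (\<Sum>i\<in>UNIV. ?\<alpha> i) + (\<Sum>i\<in>UNIV. ?\<beta> i)" by linarith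
  have "cU (wrd u) \<in> neg_part A q ?\<alpha>" "cU (wrd v) \<in> pos_part A q ?\<beta>"
    unfolding neg_part_def pos_part_def using u v
    by (auto intro!: subsetD[OF mspan_superset] exI simp: word_class_cq)
  then show "cU (wrd (u @ v)) \<in> graded_part A q ((\<Sum>i\<in>UNIV. ?\<alpha> i) + (\<Sum>i\<in>UNIV. ?\<beta> i))"
    unfolding graded_part_def wrd_mult[symmetric] U.c_mult
    by (intro subsetD[OF mspan_superset]) blast
qed

text \<open>A character of the torus that does not separate \<open>\<omega>\<^sub>i\<close> from
  \<open>\<omega>'\<^sub>i\<close> factors through the root lattice, so the degree of the word
  determines its value.\<close>

lemma torus_hom:
  assumes f: "f \<in> hom TT (units_of field_alg)" and b: "\<And>i. f (cU (wrd [Om' i])) = f (cU (wrd [Om i]))"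
    and w: "set w \<subseteq> torus_gens"
  shows "f (cU (wrd w)) = (\<Prod>i\<in>UNIV. f (cU (wrd [Om i])) powi Poly_Mapping.lookup (ld w) i)"
proof -
  have nz: "f (cU (wrd u)) \<noteq> 0" if "set u \<subseteq> torus_gens" for u
    using hom_in_carrier[OF f TT_in[OF that]] by (simp add: units_of_carrier Units_field)
  have m: "f (cU (wrd (u @ v))) = f (cU (wrd u)) * f (cU (wrd v))" if "set u \<subseteq> torus_gens" "set v \<subseteq> torus_gens" for u v
    using hom_mult[OF f TT_in[OF that(1)] TT_in[OF that(2)]] by (simp add: TT_mult units_of_def)
  have one: "f (cU (wrd [])) = 1" using m[of "[]" "[]"] nz[of "[]"] by simp
  have i: "f (cU (wrd [OmInv i])) = inverse (f (cU (wrd [Om i])))" "f (cU (wrd [OmInv' i])) = inverse (f (cU (wrd [Om i])))" for i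
    using m[of "[Om i]" "[OmInv i]"] m[of "[Om' i]" "[OmInv' i]"] one b U.c_inv(1,3)[of i]
    by (auto intro!: inverse_unique[symmetric])
  have g: "f (cU (wrd [g])) = (\<Prod>i\<in>UNIV. f (cU (wrd [Om i])) powi Poly_Mapping.lookup (gl g) i)" if "g \<in> torus_gens" for g
    using that by (cases g) (simp_all add: prod_powi_single prod_powi_single[where n = 1, simplified] i b power_int_minus)
  show ?thesis
    using w
  proof (induction w)
    case Nil
    show ?case using one by simp
  next
    case (Cons g w)
    then have "f (cU (wrd (g # w))) = f (cU (wrd [g])) * f (cU (wrd w))" using m[of "[g]" w] by simp
    then show ?case using Cons g[of g] nz[of "[Om _]"] by (simp add: lookup_add power_int_add prod.distrib)
  qed
qed

end

section \<open>Inflations and the role of balance\<close>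

locale inflation = cartan_fin q A for q :: "'i::finite \<Rightarrow> 'i \<Rightarrow> 'k::field" and A +
  fixes \<sigma> s
  assumes bicharacter: "bicharacter TT \<sigma>" and inflation: "is_inflation A q \<sigma> s"
begin

abbreviation "sw u v \<equiv> s (cU (wrd u)) (cU (wrd v))"

lemma bilinear_s: "bilinear_form (qgroup A q) s"
  using inflation by (simp add: is_inflation_def)

lemmas s_lin = Q.bilinear_formD[OF bilinear_s]

lemma sw_torus: "set u \<subseteq> torus_gens \<Longrightarrow> set v \<subseteq> torus_gens \<Longrightarrow> sw u v = \<sigma> (cU (wrd u)) (cU (wrd v))"
  using inflation TT_in by (simp add: is_inflation_def)

lemma s_graded:
  assumes "set u \<subseteq> neg_gens" "set v \<subseteq> pos_gens" "\<not> set (u @ v) \<subseteq> torus_gens"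
  shows "s (cU (wrd (u @ v))) (cU y) = 0" "s (cU y) (cU (wrd (u @ v))) = 0"
  using triangular_word_graded[OF assms] inflation
  by (auto simp: is_inflation_def U.carrier_c)

lemma cocycle_imp_balanced:
  assumes "hopf_2_cocycle (qgroup A q) s"
  shows "balanced A q \<sigma>"
proof -
  interpret C: hopf_2_cocycle "qgroup A q" s by fact
  have 1: "bilinear_form (qgroup A q) (\<lambda>a2 b2. s (a2 \<otimes>\<^bsub>qgroup A q\<^esub> b2) (cU w))" for w
    by (rule Q.bilinear_formI[where F = "\<lambda>x y. s (cU (x * y)) (cU w)"])
      (simp_all only: Q.c_mult[symmetric] distrib_left distrib_right s_lin sc_mult_left sc_mult_right)
  have 2: "bilinear_form (qgroup A q) (\<lambda>b2 c2. s (cU x) (b2 \<otimes>\<^bsub>qgroup A q\<^esub> c2))" for x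
    by (rule Q.bilinear_formI[where F = "\<lambda>y w. s (cU x) (cU (y * w))"])
      (simp_all only: Q.c_mult[symmetric] distrib_left distrib_right s_lin sc_mult_left sc_mult_right)
  have cocycle: "spl u (\<lambda>u1 u2. spl v (\<lambda>v1 v2. sw u1 v1 * sw (u2 @ v2) w)) =
      spl v (\<lambda>v1 v2. spl w (\<lambda>w1 w2. sw v1 w1 * sw u (v2 @ w2)))" for u v w
    using C.cocycle[of "cU (wrd u)" "cU (wrd v)" "cU (wrd w)"]
    unfolding Q.sweedler_forms[OF bilinear_s 1] Q.sweedler_forms[OF bilinear_s 2]
    by (simp add: U.carrier_c wrd_mult flip: U.c_mult)
  have E: "sw [Egen i] v = 0" "sw v [Egen i] = 0" for i v
    using s_graded[of "[]" "[Egen i]"] by (auto simp: torus_gens_def)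
  have F: "sw [Fgen i] v = 0" "sw v [Fgen i] = 0" for i v
    using s_graded[of "[Fgen i]" "[]"] by (auto simp: torus_gens_def)
  have FE: "sw [Fgen i, Egen i] v = 0" "sw v [Fgen i, Egen i] = 0" for i v
    using s_graded[of "[Fgen i]" "[Egen i]"] by (auto simp: torus_gens_def)
  have one: "s (cU (wrd [Om i])) (cU 1) = 1" for i
    using C.normalized[of "cU (wrd [Om i])"] by (simp add: Q.carrier_c Q.c_one Q.counit_c del: qgroup_simps)
  have EF: "cU (wrd [Egen i, Fgen i]) = cU (wrd [Fgen i, Egen i] + sc (kap i) (wrd [Om i] + sc (-1) (wrd [Om' i])))" for i
    using cU_eqv[OF ef_comm[of i i]] by (simp add: wrd_mult pm.scl_minus del: map_single)
  have kap: "kap i \<noteq> 0" for i using q_diag[of i] by (simp add: kap_def)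
  have "sw [Om i] w = sw [Om' i] w" "sw w [Om i] = sw w [Om' i]" if w: "set w \<subseteq> torus_gens" for i w
  proof -
    \<comment> \<open>On the left only \<open>\<sigma>(\<omega>\<^sub>i, 1) = 1\<close> times this
      value survives, while every term on the right has a factor with an argument of positive
      degree. As \<open>f\<^sub>i e\<^sub>i\<close> has positive degree too, the relation for
      \<open>e\<^sub>i f\<^sub>i\<close> leaves the difference of the two torus letters.\<close>
    have "sw [Egen i, Fgen i] w = 0"
      using cocycle[of "[Egen i]" "[Fgen i]" w] by (simp add: E F one)
    then show "sw [Om i] w = sw [Om' i] w"
      unfolding EF s_lin using kap FE by simp
    have "sw w [Egen i, Fgen i] = 0"
      using cocycle[of w "[Egen i]" "[Fgen i]"] by (simp add: E F one)
    then show "sw w [Om i] = sw w [Om' i]"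
      unfolding EF s_lin using kap FE by simp
  qed
  then show ?thesis
    by (auto simp: balanced_def carrier_TT word_class_cq sw_torus)
qed

definition zs :: "'i \<Rightarrow> 'i \<Rightarrow> 'k" where
  "zs i j = \<sigma> (cU (wrd [Om i])) (cU (wrd [Om j]))"

lemma zs_nonzero: "zs i j \<noteq> 0"
  using bicharacter hom_in_carrier[of "\<sigma> (cU (wrd [Om i]))" TT "units_of field_alg" "cU (wrd [Om j])"]
  by (auto simp: bicharacter_def zs_def TT_in units_of_carrier Units_field)

lemma deform_zs: "deform q A zs"
  by unfold_locales (rule zs_nonzero)

text \<open>Both sides are bilinear and vanish on triangular words of positive degree; on the torus,
  balance forces \<sigma> to be the bicharacter with matrix \<open>zs\<close>. Triangular words
  span.\<close>

lemma balanced_form: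
  assumes bal: "balanced A q \<sigma>"
  shows "s (cU x) (cU y) = deform.SB zs x y"
proof -
  interpret deform q A zs by (rule deform_zs)
  have \<sigma>: "\<sigma> (cU (wrd u)) (cU (wrd v)) = bic zs (ld u) (ld v)" if u: "set u \<subseteq> torus_gens" and v: "set v \<subseteq> torus_gens" for u v
  proof -
    have "\<sigma> (cU (wrd [Om i])) (cU (wrd v)) = (\<Prod>j\<in>UNIV. zs i j powi Poly_Mapping.lookup (ld v) j)" for i
      unfolding zs_def
      by (rule torus_hom[OF _ _ v]) (use bicharacter bal in \<open>auto simp: bicharacter_def balanced_def word_class_cq TT_in\<close>)
    moreover have "\<sigma> (cU (wrd u)) (cU (wrd v)) = (\<Prod>i\<in>UNIV. \<sigma> (cU (wrd [Om i])) (cU (wrd v)) powi Poly_Mapping.lookup (ld u) i)"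
      by (rule torus_hom[OF _ _ u, of "\<lambda>g. \<sigma> g (cU (wrd v))"])
        (use bicharacter bal v in \<open>auto simp: bicharacter_def balanced_def word_class_cq TT_in\<close>)
    ultimately show ?thesis by (simp add: bic_def)
  qed
  note l = s_lin Q.bilinear_formD[OF bilinear_SB[OF sU_c]]
  have sU_wrd: "sU (cU (wrd u)) (cU (wrd v)) = sb u v" for u v
    by (simp add: sU_c SB_wrd)
  have "s (cU x) (cU y) = sU (cU x) (cU y)"
    using tri_all[of x]
  proof (induction arbitrary: y)
    case (word u v)
    show ?case
    proof (cases "set (u @ v) \<subseteq> torus_gens")
      case True
      show ?thesis
        using tri_all[of y]
      proof induction
        case (word u' v')
        show ?case
        proof (cases "set (u' @ v') \<subseteq> torus_gens")
          case t: True
          show ?thesis unfolding sU_wrd sw_torus[OF True t] \<sigma>[OF True t] sb_def using True t by (simp only: eps_torus) simp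
        next
          case False
          then show ?thesis using s_graded(2)[OF word False] unfolding sU_wrd sb_def by (simp only: eps_torus) simp
        qed
      qed (simp_all only: l)
    next
      case False
      have "sU (cU (wrd (u @ v))) (cU y) = 0"
        using False unfolding sU_c SB_wrd sb_def[abs_def] by (simp only: eps_torus) (simp add: fd.lext_def)
      then show ?thesis using s_graded(1)[OF word False] by simp
    qed
  qed (simp_all only: l)
  then show ?thesis by (simp only: sU_c)
qed

lemma cocycle_iff_balanced: "hopf_2_cocycle (qgroup A q) s \<longleftrightarrow> balanced A q \<sigma>"
  using deform.cocycle_SB[OF deform_zs balanced_form] cocycle_imp_balanced by blast

lemma deformation_isomorphic:
  assumes tw: "twisting_bicharacter A q qhat \<sigma>" and bal: "balanced A q \<sigma>"
    and diag: "\<And>i. qhat i i = q i i" and sym: "\<And>i j. qhat i j * qhat j i = q i j * q j i"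
  shows "hopf_isomorphic (qgroup A qhat) (cocycle_deformation (qgroup A q) s)"
proof -
  have "qhat i j \<noteq> 0" for i j using sym[of i j] q_nonzero[of i j] q_nonzero[of j i] by (metis mult_eq_0_iff)
  then interpret deform_twist q A zs qhat
    using tw by unfold_locales (auto simp: zs_nonzero[unfolded zs_def] diag sym twisting_bicharacter_def zs_def word_class_cq)
  show ?thesis by (rule deformation_iso) (rule balanced_form[OF bal])
qed

end

lemma (in cartan_fin) twisting_exists:
  assumes diag: "\<And>i. qhat i i = q i i" and sym: "\<And>i j. qhat i j * qhat j i = q i j * q j i"
  shows "\<exists>\<sigma>. twisting_bicharacter A q qhat \<sigma> \<and> balanced A q \<sigma>"
proof -
  have qh: "qhat i j \<noteq> 0" for i j using sym[of i j] q_nonzero[of i j] q_nonzero[of j i] by (metis mult_eq_0_iff)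
  \<comment> \<open>An auxiliary total order on the index set. Putting the whole ratio on one side
    of it prescribes the antisymmetric part of \<open>z\<close>; the opposite pair is consistent
    because \<open>qhat\<close> and \<open>q\<close> have the same products.\<close>
  obtain idx :: "'i \<Rightarrow> nat" where idx: "inj idx"
    using finite_imp_inj_to_nat_seg[of "UNIV :: 'i set"] by auto
  define z where "z i j = (if idx i < idx j then qhat i j * inverse (q i j) else 1)" for i j
  have ratio: "z i j * inverse (z j i) = qhat i j * inverse (q i j)" for i j
  proof (cases "i = j")
    case False
    then have "idx i \<noteq> idx j" using idx by (auto dest: injD)
    then show ?thesis using sym[of i j] qh q_nonzero by (auto simp: z_def field_simps)
  qed (simp add: z_def diag q_nonzero)
  \<comment> \<open>The form to be built does not separate \<open>\<omega>\<close> from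
    \<open>\<omega>'\<close>, so the third twisting condition has to coincide with the first two;
    this identity shows that it does.\<close>
  have ratio': "qhat i j * inverse (q i j) = inverse (qhat j i) * q j i" for i j
    using sym[of i j] qh q_nonzero by (simp add: field_simps)
  interpret deform q A z by unfold_locales (simp add: z_def qh q_nonzero)
  have t: "sU (cU (wrd u)) (cU (wrd v)) = bic z (ld u) (ld v)" if "set u \<subseteq> torus_gens" "set v \<subseteq> torus_gens" for u v
    using that by (simp add: sU_c SB_wrd sb_def eps_torus)
  have h: "sU (cU (wrd w)) \<in> hom TT (units_of field_alg)" "(\<lambda>g. sU g (cU (wrd w))) \<in> hom TT (units_of field_alg)"
    if w: "set w \<subseteq> torus_gens" for w
  proof -
    have "sU x (cU (wrd w)) \<in> carrier (units_of field_alg) \<and> sU (cU (wrd w)) x \<in> carrier (units_of field_alg)"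
      if "x \<in> carrier TT" for x
      using that w by (auto simp: carrier_TT t units_of_carrier Units_field)
    moreover have "sU (x \<otimes>\<^bsub>TT\<^esub> y) (cU (wrd w)) = sU x (cU (wrd w)) * sU y (cU (wrd w)) \<and>
        sU (cU (wrd w)) (x \<otimes>\<^bsub>TT\<^esub> y) = sU (cU (wrd w)) x * sU (cU (wrd w)) y"
      if xy: "x \<in> carrier TT" "y \<in> carrier TT" for x y
    proof -
      obtain u v where uv: "set u \<subseteq> torus_gens" "set v \<subseteq> torus_gens" "x = cU (wrd u)" "y = cU (wrd v)"
        using xy by (auto simp: carrier_TT)
      then have "set (u @ v) \<subseteq> torus_gens" by simp
      then show ?thesis unfolding uv(3,4) TT_mult using uv(1,2) w by (simp only: t ld_simps bic_add simp_thms)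
    qed
    ultimately show "sU (cU (wrd w)) \<in> hom TT (units_of field_alg)" "(\<lambda>g. sU g (cU (wrd w))) \<in> hom TT (units_of field_alg)"
      by (auto simp: units_of_mult intro!: homI)
  qed
  have "bicharacter TT sU"
    unfolding bicharacter_def carrier_TT using h by blast
  moreover have gens: "set [Om i] \<subseteq> torus_gens" "set [Om' i] \<subseteq> torus_gens" for i
    by simp_all
  then have "sU (cU (wrd [x i])) (cU (wrd [y j])) = z i j"
    if "x \<in> {Om, Om'}" "y \<in> {Om, Om'}" for x y i j
    using that by (auto simp: t bic_single)
  then have "twisting_bicharacter A q qhat sU" if "bicharacter TT sU"
    using that by (simp add: twisting_bicharacter_def word_class_cq ratio ratio' del: map_single)
  moreover have "balanced A q sU"
    unfolding balanced_def word_class_cq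
  proof (intro allI ballI)
    fix i g assume "g \<in> carrier TT"
    then obtain w where "set w \<subseteq> torus_gens" "g = cU (wrd w)" by (auto simp: carrier_TT)
    then show "sU (cU (wrd [Om i])) g = sU (cU (wrd [Om' i])) g \<and> sU g (cU (wrd [Om i])) = sU g (cU (wrd [Om' i]))"
      using gens by (simp add: t)
  qed
  ultimately show ?thesis by blast
qed

theorem theorem4p5:
  fixes A :: "'i::finite \<Rightarrow> 'i \<Rightarrow> int" and d :: "'i \<Rightarrow> nat"
    and q qhat :: "'i \<Rightarrow> 'i \<Rightarrow> 'k::{alg_closed_field, field_char_0}"
  assumes "symmetrizable_GCM A d"
    and "\<And>i j. q i j \<noteq> 0" and "\<And>i. q i i \<noteq> 1"
    and "\<And>i j. q i j * q j i = q i i powi A i j"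
    and "\<And>i. qhat i i = q i i" and "\<And>i j. qhat i j * qhat j i = q i j * q j i"
  shows
    "torus_group A q \<cong> free_Abelian_group (UNIV :: ('i + 'i) set) \<and>
     (\<forall>\<sigma>. twisting_bicharacter A q qhat \<sigma> \<longrightarrow>
        (\<exists>s. is_inflation A q \<sigma> s) \<and>
        (\<forall>s. is_inflation A q \<sigma> s \<longrightarrow>
           (hopf_2_cocycle (qgroup A q) s \<longleftrightarrow> balanced A q \<sigma>) \<and>
           (hopf_2_cocycle (qgroup A q) s \<longrightarrow>
              hopf_isomorphic (qgroup A qhat) (cocycle_deformation (qgroup A q) s)))) \<and>
     (\<exists>\<sigma>. twisting_bicharacter A q qhat \<sigma> \<and> balanced A q \<sigma>) \<and>
     (\<forall>v. v \<noteq> 0 \<and> (\<forall>i. q i i = v ^ (2 * d i)) \<longrightarrow>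
        (\<forall>i. one_param A d v i i = q i i) \<and>
        (\<forall>i j. one_param A d v i j * one_param A d v j i = q i j * q j i) \<and>
        (\<forall>\<sigma> s. twisting_bicharacter A q (one_param A d v) \<sigma> \<and> is_inflation A q \<sigma> s \<and>
             hopf_2_cocycle (qgroup A q) s \<longrightarrow>
           hopf_isomorphic (qgroup A (one_param A d v)) (cocycle_deformation (qgroup A q) s)))"
proof -
  interpret cartan_fin q A
    by unfold_locales (use assms in \<open>auto simp: symmetrizable_GCM_def\<close>)
  have main: "(hopf_2_cocycle (qgroup A q) s \<longleftrightarrow> balanced A q \<sigma>) \<and>
      (hopf_2_cocycle (qgroup A q) s \<longrightarrow> hopf_isomorphic (qgroup A p) (cocycle_deformation (qgroup A q) s))"
    if "twisting_bicharacter A q p \<sigma>" "is_inflation A q \<sigma> s"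
      "\<And>i. p i i = q i i" "\<And>i j. p i j * p j i = q i j * q j i" for p \<sigma> s
  proof -
    interpret inflation q A \<sigma> s
      by unfold_locales (use that in \<open>auto simp: twisting_bicharacter_def\<close>)
    show ?thesis using cocycle_iff_balanced deformation_isomorphic[of p] that by blast
  qed
  have one: "one_param A d v i i = q i i" "one_param A d v i j * one_param A d v j i = q i j * q j i"
    if v: "v \<noteq> 0 \<and> (\<forall>i. q i i = v ^ (2 * d i))" for v i j
  proof -
    have p: "q i i = v powi (2 * int (d i))" for i
      using v power_int_of_nat[of v "2 * d i"] by simp
    have A: "A i i = 2" "int (d j) * A j i = int (d i) * A i j"
      using assms(1) by (auto simp: symmetrizable_GCM_def)
    show "one_param A d v i i = q i i" by (simp add: one_param_def A p mult.commute)
    \<comment> \<open>Symmetry of \<open>d i * A i j\<close> doubles the exponent, which gives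
      \<open>q i i powi A i j\<close>.\<close>
    have "one_param A d v i j * one_param A d v j i = v powi (int (d i) * A i j + int (d j) * A j i)"
      using v by (simp add: one_param_def power_int_add)
    also have "int (d i) * A i j + int (d j) * A j i = 2 * int (d i) * A i j"
      using A(2) by simp
    also have "v powi (2 * int (d i) * A i j) = (v powi (2 * int (d i))) powi A i j"
      by (rule power_int_mult)
    also have "\<dots> = q i j * q j i" by (simp add: assms(4) p)
    finally show "one_param A d v i j * one_param A d v j i = q i j * q j i" .
  qed
  show ?thesis
  proof (intro conjI allI impI)
    show "TT \<cong> free_Abelian_group (UNIV :: ('i + 'i) set)" by (rule torus_iso)
    show "\<exists>s. is_inflation A q \<sigma> s" for \<sigma> by (rule inflation_exists)
    show "\<exists>\<sigma>. twisting_bicharacter A q qhat \<sigma> \<and> balanced A q \<sigma>"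
      by (rule twisting_exists) (rule assms)+
    fix \<sigma> s
    show "hopf_2_cocycle (qgroup A q) s \<longleftrightarrow> balanced A q \<sigma>"
      and "hopf_2_cocycle (qgroup A q) s \<Longrightarrow> hopf_isomorphic (qgroup A qhat) (cocycle_deformation (qgroup A q) s)"
      if "twisting_bicharacter A q qhat \<sigma>" "is_inflation A q \<sigma> s"
      using main[OF that assms(5,6)] by blast+
    fix v
    assume v: "v \<noteq> 0 \<and> (\<forall>i. q i i = v ^ (2 * d i))"
    show "one_param A d v i i = q i i" "one_param A d v i j * one_param A d v j i = q i j * q j i" for i j
      by (rule one[OF v])+
    show "hopf_isomorphic (qgroup A (one_param A d v)) (cocycle_deformation (qgroup A q) s)"
      if "twisting_bicharacter A q (one_param A d v) \<sigma> \<and> is_inflation A q \<sigma> s \<and> hopf_2_cocycle (qgroup A q) s"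
      using main[of "one_param A d v" \<sigma> s] one[OF v] that by blast
  qed
qed

end
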